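(* Let $K$ be an imaginary quadratic field in which the prime $p=\mathfrak{p}\overline{\mathfrak{p}}$ is split, let $\mathfrak{g}$ be a modulus of $K$ coprime to $p$, let $E$ be a finite extension of $\mathbf{Q}_p$ and $V$ a finite-dimensional $E$-vector space, and let $\Theta$ be a ray class distribution modulo $p^\infty\mathfrak{g}$ with values in $V$ and growth parameter $(\alpha_{\mathfrak{p}},\alpha_{\overline{\mathfrak{p}}})$. Let $r=v_p(\alpha_{\mathfrak{p}})$ and $s=v_p(\alpha_{\overline{\mathfrak{p}}})$, and write $G=G_{p^\infty\mathfrak{g}}$. If $r,s<1$, then there is a unique distribution \[ \widetilde\Theta\in D^{(r,s)}(G,E)\otimes_E V \] whose restriction to locally constant functions on $G$ is $\Theta$. If moreover $r+s<1$, then $\widetilde\Theta$ lies in $D^{r+s}(G,E)\otimes_E V$ and agrees with the unique element of $D^{r+s}(G,E)\otimes_E V$ whose restriction to locally constant functions is $\Theta$.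
   Context: $v_p$ is the valuation with $v_p(p)=1$. A modulus of $K$ is here a non-zero ideal of $\mathcal{O}_K$; $G_{\mathfrak{f}}$ is the ray class group modulo $\mathfrak{f}$, and $G_{p^\infty\mathfrak{g}}=\varprojlim G_{\mathfrak{f}}$ over moduli $\mathfrak{f}\mid p^\infty\mathfrak{g}$ (i.e. $\mathfrak f$ dividing $p^n\mathfrak g$ for some $n$); it is a compact abelian $p$-adic analytic group of dimension 2. A ray class distribution modulo $p^\infty\mathfrak{g}$ with values in $V$ and growth parameter $(\alpha_{\mathfrak{p}},\alpha_{\overline{\mathfrak{p}}})$ (non-zero elements of $\mathcal{O}_E$) is a family $\Phi_{\mathfrak{f}}\in E[G_{\mathfrak{f}}]\otimes_E V$, for all moduli $\mathfrak{f}\mid p^\infty\mathfrak{g}$, compatible under the maps induced by the natural surjections $G_{\mathfrak{f}'}\to G_{\mathfrak{f}}$ for $\mathfrak{f}\mid\mathfrak{f}'$, such that for some $\mathcal{O}_E$-lattice $\Lambda\subseteq V$ one has $\Phi_{\mathfrak{f}}\in\mathcal{O}_E[G_{\mathfrak{f}}]\otimes_{\mathcal{O}_E}\alpha_{\mathfrak{f}}^{-1}\Lambda$ for every $\mathfrak{f}$, where $\alpha_{\mathfrak{f}}=\alpha_{\mathfrak{p}}^{v_{\mathfrak{p}}(\mathfrak{f})}\alpha_{\overline{\mathfrak{p}}}^{v_{\overline{\mathfrak{p}}}(\mathfrak{f})}$. It is viewed as a $V$-valued linear functional on the space $LC(G,E)$ of locally constant functions: its value on the indicator function of the preimage of $c\in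 G_{\mathfrak{f}}$ is the coefficient of $c$ in $\Phi_{\mathfrak{f}}$. Spaces of functions. For $0\le r<1$ and $H\cong\mathbf{Z}_p^d$ (additive notation), let $\varepsilon_m(f)=\inf_{x\in H,\,y\in p^mH}v_p(f(x+y)-f(x))$; $C^r(H,E)$ is the Banach space of continuous $f:H\to E$ with $\varepsilon_m(f)-rm\to\infty$, with valuation $\inf(\inf_xv_p(f(x)),\inf_{m\ge0}(\varepsilon_m(f)-rm))$. For a compact abelian $p$-adic analytic group $G$ with an open subgroup $H\cong\mathbf{Z}_p^d$, $C^r(G,E)$ is the space of functions whose pullback to $H$ via $h\mapsto a+h$ lies in $C^r(H,E)$ for each $a\in G/H$, with the resulting topology; $D^r(G,E)$ is its continuous dual. The images of $\operatorname{Lie}\mathcal{O}_{K,\mathfrak{p}}^\times$ and $\operatorname{Lie}\mathcal{O}_{K,\overline{\mathfrak{p}}}^\times$ in $\operatorname{Lie}G_{p^\infty\mathfrak{g}}$ give a direct sum decomposition. Choose closed subgroups $H_1,H_2\cong\mathbf{Z}_p$ of $G=G_{p^\infty\mathfrak{g}}$ having these images as Lie algebras, with $H_1\times H_2$ an open subgroup of $G$. For $r,s\in[0,1)$, $C^{(r,s)}(H_1\times H_2,E)$ is the completed tensor product $C^r(H_1,E)\,\widehat\otimes\,C^s(H_2,E)$, viewed as a space of functions on $H_1\times H_2$; $C^{(r,s)}(G,E)$ is the space of functions on $G$ whose pullback to $H_1\times H_2$ via $h\mapsto a+h$ lies in $C^{(r,s)}(H_1\times H_2,E)$ for each coset $a$,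 with the resulting topology (independent of choices). $D^{(r,s)}(G,E)$ is its continuous dual. One has continuous inclusions $C^{r+s}(G,E)\subseteq C^{(r,s)}(G,E)$ when $r+s<1$, through which $D^{(r,s)}(G,E)$ is regarded as a subspace of $D^{r+s}(G,E)$. *)

theory Defs
  imports
    "HOL-Analysis.Analysis"
    "HOL-Computational_Algebra.Polynomial"
    "HOL-Computational_Algebra.Primes"
    "HOL-Algebra.Ideal_Product"
    "HOL-Algebra.QuotRing"
    "HOL-Algebra.Product_Groups"
    "HOL-Algebra.Elementary_Groups"
begin

text \<open>The field \<open>K\<close> is the whole type \<open>'k\<close>.\<close>

definition imaginary_quadratic :: "'k::field_char_0 itself \<Rightarrow> bool" where
  "imaginary_quadratic _ \<longleftrightarrow>
     vector_space.dim (\<lambda>(q::rat) (x::'k). of_rat q * x) UNIV = 2 \<and>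
     \<not> (\<exists>\<sigma>::'k \<Rightarrow> real. \<sigma> 1 = 1 \<and>
          (\<forall>x y. \<sigma> (x + y) = \<sigma> x + \<sigma> y) \<and> (\<forall>x y. \<sigma> (x * y) = \<sigma> x * \<sigma> y))"

definition OK :: "'k::field_char_0 ring" where
  "OK = \<lparr>carrier = {x. algebraic_int x}, mult = (*), one = 1, zero = 0, add = (+)\<rparr>"

definition modulus :: "'k::field_char_0 set \<Rightarrow> bool" where
  "modulus I \<longleftrightarrow> ideal I OK \<and> I \<noteq> {0}"

definition ideal_dvd :: "'k::field_char_0 set \<Rightarrow> 'k set \<Rightarrow> bool" where
  "ideal_dvd I J \<longleftrightarrow> (\<exists>L. ideal L OK \<and> J = ideal_prod OK I L)"

definition ideal_coprime :: "'k::field_char_0 set \<Rightarrow> 'k set \<Rightarrow> bool" where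
  "ideal_coprime I J \<longleftrightarrow> I <+>\<^bsub>OK\<^esub> J = carrier OK"

definition ideal_power :: "'k::field_char_0 set \<Rightarrow> nat \<Rightarrow> 'k set" where
  "ideal_power I n = I [^]\<^bsub>ideals_set OK\<^esub> n"

definition ideal_val :: "'k::field_char_0 set \<Rightarrow> 'k set \<Rightarrow> nat" where
  "ideal_val P I = (GREATEST n. ideal_dvd (ideal_power P n) I)"

definition split_prime :: "nat \<Rightarrow> 'k::field_char_0 set \<Rightarrow> 'k set \<Rightarrow> bool" where
  "split_prime p P Pb \<longleftrightarrow> primeideal P OK \<and> primeideal Pb OK \<and> P \<noteq> Pb \<and>
     PIdl\<^bsub>OK\<^esub> (of_nat p) = ideal_prod OK P Pb"

text \<open>
  Fractional ideals are multiplied with \<^const>\<open>ideal_prod\<close> of \<^const>\<open>OK\<close>, whose inductive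
  definition does not mention the carrier; likewise \<open>PIdl\<^bsub>OK\<^esub> \<alpha>\<close> is the principal fractional ideal
  \<open>\<alpha>\<O>\<^sub>K\<close> for every \<open>\<alpha>\<close> in \<open>K\<close>.
\<close>

definition fractional_ideals :: "'k::field_char_0 set monoid" where
  "fractional_ideals = \<lparr>
     carrier = {M. M \<noteq> {0} \<and> 0 \<in> M \<and> (\<forall>x\<in>M. \<forall>y\<in>M. x + y \<in> M) \<and>
                   (\<forall>a\<in>carrier OK. \<forall>x\<in>M. a * x \<in> M) \<and>
                   (\<exists>d\<in>carrier OK. d \<noteq> 0 \<and> (\<forall>x\<in>M. d * x \<in> carrier OK))},
     mult = ideal_prod OK, one = carrier OK\<rparr>"

text \<open>A fractional ideal is prime to \<open>f\<close> if it is a quotient of integral ideals prime to \<open>f\<close>.\<close>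

definition ray_ideals :: "'k::field_char_0 set \<Rightarrow> 'k set monoid" where
  "ray_ideals f = fractional_ideals
     \<lparr>carrier := {M \<in> carrier fractional_ideals.
        \<exists>I J. modulus I \<and> modulus J \<and> ideal_coprime I f \<and> ideal_coprime J f \<and>
              ideal_prod OK M J = I}\<rparr>"

text \<open>Principal fractional ideals with a generator that is multiplicatively congruent to 1
  modulo \<open>f\<close>; there is no sign condition because \<open>K\<close> has no real place.\<close>

definition ray_principal :: "'k::field_char_0 set \<Rightarrow> 'k set set" where
  "ray_principal f = {PIdl\<^bsub>OK\<^esub> (a / b) | a b.
     a \<in> carrier OK \<and> b \<in> carrier OK \<and> a \<noteq> 0 \<and> b \<noteq> 0 \<and>
     ideal_coprime (PIdl\<^bsub>OK\<^esub> a) f \<and> ideal_coprime (PIdl\<^bsub>OK\<^esub> b) f \<and> a - b \<in> f}"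

definition ray_class_group :: "'k::field_char_0 set \<Rightarrow> 'k set set monoid" where
  "ray_class_group f = ray_ideals f Mod ray_principal f"

text \<open>The natural surjection from level \<open>f'\<close> to level \<open>f\<close>, for \<open>f\<close> dividing \<open>f'\<close>: the class \<open>C\<close>
  modulo \<open>f'\<close> is sent to the class modulo \<open>f\<close> containing it.\<close>

definition ray_proj :: "'k::field_char_0 set \<Rightarrow> 'k set set \<Rightarrow> 'k set set" where
  "ray_proj f C = ray_principal f <#>\<^bsub>fractional_ideals\<^esub> C"

definition moduli :: "nat \<Rightarrow> 'k::field_char_0 set \<Rightarrow> 'k set set" where
  "moduli p g = {f. modulus f \<and>
     (\<exists>n. ideal_dvd f (ideal_prod OK (ideal_power (PIdl\<^bsub>OK\<^esub> (of_nat p)) n) g))}"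

definition ray_limit :: "nat \<Rightarrow> 'k::field_char_0 set \<Rightarrow> ('k set \<Rightarrow> 'k set set) monoid" where
  "ray_limit p g = product_group (moduli p g) ray_class_group
     \<lparr>carrier := {x \<in> (\<Pi>\<^sub>E f\<in>moduli p g. carrier (ray_class_group f)).
        \<forall>f\<in>moduli p g. \<forall>f'\<in>moduli p g. ideal_dvd f f' \<longrightarrow> ray_proj f (x f') = x f}\<rparr>"

definition ray_limit_top :: "nat \<Rightarrow> 'k::field_char_0 set \<Rightarrow> ('k set \<Rightarrow> 'k set set) topology" where
  "ray_limit_top p g = subtopology
     (product_topology (\<lambda>f. discrete_topology (carrier (ray_class_group f))) (moduli p g))
     (carrier (ray_limit p g))"

text \<open>The topology on \<open>S\<close> for which the sets \<open>{g \<in> S. w (g - f) \<ge> B}\<close> are a neighbourhood base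
  at \<open>f\<close>.\<close>

definition val_topology :: "'a::minus set \<Rightarrow> ('a \<Rightarrow> ereal) \<Rightarrow> 'a topology" where
  "val_topology S w = topology (\<lambda>U. U \<subseteq> S \<and>
     (\<forall>f\<in>U. \<exists>B::real. \<forall>g\<in>S. w (g - f) \<ge> ereal B \<longrightarrow> g \<in> U))"

lemma openin_val_topology:
  "openin (val_topology S w) U \<longleftrightarrow> U \<subseteq> S \<and>
     (\<forall>f\<in>U. \<exists>B::real. \<forall>g\<in>S. w (g - f) \<ge> ereal B \<longrightarrow> g \<in> U)"
proof -
  let ?P = "\<lambda>U. U \<subseteq> S \<and> (\<forall>f\<in>U. \<exists>B::real. \<forall>g\<in>S. w (g - f) \<ge> ereal B \<longrightarrow> g \<in> U)"
  have "istopology ?P"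
    unfolding istopology_def
  proof (intro conjI allI impI)
    fix U V assume U: "?P U" and V: "?P V"
    show "U \<inter> V \<subseteq> S" using U by blast
    show "\<forall>f\<in>U \<inter> V. \<exists>B::real. \<forall>g\<in>S. w (g - f) \<ge> ereal B \<longrightarrow> g \<in> U \<inter> V"
    proof
      fix f assume "f \<in> U \<inter> V"
      with U V obtain B C :: real where
        "\<forall>g\<in>S. w (g - f) \<ge> ereal B \<longrightarrow> g \<in> U" "\<forall>g\<in>S. w (g - f) \<ge> ereal C \<longrightarrow> g \<in> V"
        by (meson IntD1 IntD2)
      then show "\<exists>B::real. \<forall>g\<in>S. w (g - f) \<ge> ereal B \<longrightarrow> g \<in> U \<inter> V"
        by (intro exI[of _ "max B C"]) (metis IntI ereal_less_eq(3) max.bounded_iff order.refl order_trans)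
    qed
  next
    fix \<K> assume K: "\<forall>U\<in>\<K>. ?P U"
    show "\<Union>\<K> \<subseteq> S" using K by blast
    show "\<forall>f\<in>\<Union>\<K>. \<exists>B::real. \<forall>g\<in>S. w (g - f) \<ge> ereal B \<longrightarrow> g \<in> \<Union>\<K>"
      using K by (meson Union_iff)
  qed
  then show ?thesis
    unfolding val_topology_def by (simp add: topology_inverse')
qed

definition field_valuation :: "('e::field \<Rightarrow> ereal) \<Rightarrow> bool" where
  "field_valuation v \<longleftrightarrow> (\<forall>x. v x = \<infinity> \<longleftrightarrow> x = 0) \<and> (\<forall>x. v x \<noteq> -\<infinity>) \<and>
     (\<forall>x y. v (x * y) = v x + v y) \<and> (\<forall>x y. v (x + y) \<ge> min (v x) (v y))"

text \<open>The closure of \<open>\<rat>\<close> in the valued field \<open>E\<close>. If \<open>v p = 1\<close>, then \<open>v\<close> induces the \<open>p\<close>-adic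
  valuation on \<open>\<rat>\<close>, so this closure, when complete, is the completion \<open>\<rat>\<^sub>p\<close>.\<close>

definition Qp_in :: "('e::field_char_0 \<Rightarrow> ereal) \<Rightarrow> 'e set" where
  "Qp_in v = val_topology UNIV v closure_of \<rat>"

definition finite_ext_Qp :: "nat \<Rightarrow> ('e::field_char_0 \<Rightarrow> ereal) \<Rightarrow> bool" where
  "finite_ext_Qp p v \<longleftrightarrow> field_valuation v \<and> v (of_nat p) = 1 \<and>
     (\<forall>X::nat \<Rightarrow> 'e. (\<forall>n. X n \<in> Qp_in v) \<longrightarrow>
        (\<forall>B::real. \<exists>N. \<forall>m\<ge>N. \<forall>n\<ge>N. v (X m - X n) \<ge> ereal B) \<longrightarrow>
        (\<exists>l\<in>Qp_in v. (\<lambda>n. v (X n - l)) \<longlonglongrightarrow> \<infinity>)) \<and>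
     (\<exists>B. finite B \<and> (\<forall>x. \<exists>c. (\<forall>b\<in>B. c b \<in> Qp_in v) \<and> x = (\<Sum>b\<in>B. c b * b)))"

definition OE :: "('e::field_char_0 \<Rightarrow> ereal) \<Rightarrow> 'e set" where
  "OE v = {x. v x \<ge> 0}"

definition OE_lattice ::
    "('e::field_char_0 \<Rightarrow> ereal) \<Rightarrow> ('e \<Rightarrow> 'v::ab_group_add \<Rightarrow> 'v) \<Rightarrow> 'v set \<Rightarrow> bool" where
  "OE_lattice v smul \<Lambda> \<longleftrightarrow> (\<exists>S. finite S \<and> module.span smul S = UNIV \<and>
     \<Lambda> = {\<Sum>b\<in>S. smul (c b) b | c. \<forall>b\<in>S. c b \<in> OE v})"

text \<open>An element of \<open>E[G\<^sub>f] \<otimes> V\<close> is a function from the finite group \<open>G\<^sub>f\<close> to \<open>V\<close> (its family of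
  coefficients); values of \<open>\<Phi> f\<close> outside \<open>G\<^sub>f\<close> play no role.\<close>

definition ray_class_distribution ::
    "nat \<Rightarrow> 'k::field_char_0 set \<Rightarrow> 'k set \<Rightarrow> 'k set \<Rightarrow> ('e::field_char_0 \<Rightarrow> ereal) \<Rightarrow>
     ('e \<Rightarrow> 'v::ab_group_add \<Rightarrow> 'v) \<Rightarrow> 'e \<Rightarrow> 'e \<Rightarrow> ('k set \<Rightarrow> 'k set set \<Rightarrow> 'v) \<Rightarrow> bool" where
  "ray_class_distribution p P Pb g v smul \<alpha> \<alpha>b \<Phi> \<longleftrightarrow>
     \<alpha> \<in> OE v \<and> \<alpha> \<noteq> 0 \<and> \<alpha>b \<in> OE v \<and> \<alpha>b \<noteq> 0 \<and>
     (\<forall>f\<in>moduli p g. \<forall>f'\<in>moduli p g. ideal_dvd f f' \<longrightarrow>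
        (\<forall>c\<in>carrier (ray_class_group f).
           \<Phi> f c = (\<Sum>c'\<in>{c' \<in> carrier (ray_class_group f'). ray_proj f c' = c}. \<Phi> f' c'))) \<and>
     (\<exists>\<Lambda>. OE_lattice v smul \<Lambda> \<and>
        (\<forall>f\<in>moduli p g. \<forall>c\<in>carrier (ray_class_group f).
           \<exists>y\<in>\<Lambda>. \<Phi> f c = smul (inverse (\<alpha> ^ ideal_val P f * \<alpha>b ^ ideal_val Pb f)) y))"

definition linear_on :: "('x \<Rightarrow> 'e::field) set \<Rightarrow> ('e \<Rightarrow> 'v::ab_group_add \<Rightarrow> 'v) \<Rightarrow>
    (('x \<Rightarrow> 'e) \<Rightarrow> 'v) \<Rightarrow> bool" where
  "linear_on C smul L \<longleftrightarrow>
     (\<forall>f\<in>C. \<forall>g\<in>C. L (\<lambda>x. f x + g x) = L f + L g) \<and>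
     (\<forall>c. \<forall>f\<in>C. L (\<lambda>x. c * f x) = smul c (L f))"

text \<open>In all function spaces below, a function on a subset \<open>X\<close> of a type is represented by its
  extension by zero, and a functional on a space \<open>C\<close> by its extension by zero outside \<open>C\<close>.\<close>

definition LC :: "'g topology \<Rightarrow> ('g \<Rightarrow> 'e::zero) set" where
  "LC T = {\<phi>. (\<forall>x. x \<notin> topspace T \<longrightarrow> \<phi> x = 0) \<and>
     (\<forall>x\<in>topspace T. \<exists>U. openin T U \<and> x \<in> U \<and> (\<forall>y\<in>U. \<phi> y = \<phi> x))}"

definition lc_functional ::
    "nat \<Rightarrow> 'k::field_char_0 set \<Rightarrow> ('e::field_char_0 \<Rightarrow> 'v::ab_group_add \<Rightarrow> 'v) \<Rightarrow>
     ('k set \<Rightarrow> 'k set set \<Rightarrow> 'v) \<Rightarrow> (('k set \<Rightarrow> 'k set set) \<Rightarrow> 'e) \<Rightarrow> 'v" where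
  "lc_functional p g smul \<Phi> = (THE L.
     linear_on (LC (ray_limit_top p g)) smul L \<and>
     (\<forall>\<phi>. \<phi> \<notin> LC (ray_limit_top p g) \<longrightarrow> L \<phi> = 0) \<and>
     (\<forall>f\<in>moduli p g. \<forall>c\<in>carrier (ray_class_group f).
        L (indicator {x \<in> carrier (ray_limit p g). x f = c}) = \<Phi> f c))"

definition restricts_to ::
    "nat \<Rightarrow> 'k::field_char_0 set \<Rightarrow> ('e::field_char_0 \<Rightarrow> 'v::ab_group_add \<Rightarrow> 'v) \<Rightarrow>
     ((('k set \<Rightarrow> 'k set set) \<Rightarrow> 'e) \<Rightarrow> 'v) \<Rightarrow> ('k set \<Rightarrow> 'k set set \<Rightarrow> 'v) \<Rightarrow> bool" where
  "restricts_to p g smul \<Psi> \<Phi> \<longleftrightarrow>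
     (\<forall>\<phi>\<in>LC (ray_limit_top p g). \<Psi> \<phi> = lc_functional p g smul \<Phi> \<phi>)"

text \<open>The subgroup \<open>p\<^sup>mH\<close>, for a group in multiplicative notation.\<close>

definition ppow :: "nat \<Rightarrow> ('h, 'm) monoid_scheme \<Rightarrow> nat \<Rightarrow> 'h set" where
  "ppow p H m = (\<lambda>h. h [^]\<^bsub>H\<^esub> (p ^ m)) ` carrier H"

definition eps :: "nat \<Rightarrow> ('e::field \<Rightarrow> ereal) \<Rightarrow> ('h, 'm) monoid_scheme \<Rightarrow> nat \<Rightarrow> ('h \<Rightarrow> 'e) \<Rightarrow> ereal"
  where
  "eps p v H m f = (INF x\<in>carrier H. INF y\<in>ppow p H m. v (f (x \<otimes>\<^bsub>H\<^esub> y) - f x))"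

definition Cr_val ::
    "nat \<Rightarrow> ('e::field \<Rightarrow> ereal) \<Rightarrow> ('h, 'm) monoid_scheme \<Rightarrow> real \<Rightarrow> ('h \<Rightarrow> 'e) \<Rightarrow> ereal" where
  "Cr_val p v H r f =
     inf (INF x\<in>carrier H. v (f x)) (INF m. eps p v H m f - ereal (r * real m))"

definition Cr ::
    "nat \<Rightarrow> ('e::field \<Rightarrow> ereal) \<Rightarrow> ('h, 'm) monoid_scheme \<Rightarrow> 'h topology \<Rightarrow> real \<Rightarrow> ('h \<Rightarrow> 'e) set"
  where
  "Cr p v H T r = {f. (\<forall>x. x \<notin> carrier H \<longrightarrow> f x = 0) \<and>
     continuous_map T (val_topology UNIV v) f \<and>
     (\<lambda>m. eps p v H m f - ereal (r * real m)) \<longlonglongrightarrow> \<infinity>}"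

text \<open>The algebraic tensor product of two spaces of functions, realised as a space of functions of
  two variables, with its tensor product valuation.\<close>

definition tensor_sum :: "nat \<Rightarrow> (nat \<Rightarrow> 'x \<Rightarrow> 'e::field) \<Rightarrow> (nat \<Rightarrow> 'y \<Rightarrow> 'e) \<Rightarrow> 'x \<times> 'y \<Rightarrow> 'e" where
  "tensor_sum n f g = (\<lambda>(x, y). \<Sum>i<n. f i x * g i y)"

definition alg_tensor :: "('x \<Rightarrow> 'e::field) set \<Rightarrow> ('y \<Rightarrow> 'e) set \<Rightarrow> ('x \<times> 'y \<Rightarrow> 'e) set" where
  "alg_tensor C1 C2 = {tensor_sum n f g | n f g. \<forall>i<n. f i \<in> C1 \<and> g i \<in> C2}"

definition tensor_val ::
    "('x \<Rightarrow> 'e::field) set \<Rightarrow> (('x \<Rightarrow> 'e) \<Rightarrow> ereal) \<Rightarrow> ('y \<Rightarrow> 'e) set \<Rightarrow> (('y \<Rightarrow> 'e) \<Rightarrow> ereal) \<Rightarrow>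
     ('x \<times> 'y \<Rightarrow> 'e) \<Rightarrow> ereal" where
  "tensor_val C1 w1 C2 w2 F = Sup {INF i\<in>{..<n}. w1 (f i) + w2 (g i) | n f g.
     (\<forall>i<n. f i \<in> C1 \<and> g i \<in> C2) \<and> F = tensor_sum n f g}"

text \<open>\<open>tensor_approx \<dots> T F\<close>: the sequence \<open>T\<close> in the algebraic tensor product is Cauchy for the
  tensor product valuation, and \<open>F\<close> is the function represented by its limit in the completion.\<close>

definition tensor_approx ::
    "('e::field \<Rightarrow> ereal) \<Rightarrow> ('x \<Rightarrow> 'e) set \<Rightarrow> (('x \<Rightarrow> 'e) \<Rightarrow> ereal) \<Rightarrow>
     ('y \<Rightarrow> 'e) set \<Rightarrow> (('y \<Rightarrow> 'e) \<Rightarrow> ereal) \<Rightarrow>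
     (nat \<Rightarrow> 'x \<times> 'y \<Rightarrow> 'e) \<Rightarrow> ('x \<times> 'y \<Rightarrow> 'e) \<Rightarrow> bool" where
  "tensor_approx v C1 w1 C2 w2 T F \<longleftrightarrow>
     (\<forall>n. T n \<in> alg_tensor C1 C2) \<and>
     (\<forall>B::real. \<exists>N. \<forall>m\<ge>N. \<forall>n\<ge>N. tensor_val C1 w1 C2 w2 (T m - T n) \<ge> ereal B) \<and>
     (\<forall>z. (\<lambda>n. v (T n z - F z)) \<longlonglongrightarrow> \<infinity>)"

definition completed_tensor ::
    "('e::field \<Rightarrow> ereal) \<Rightarrow> ('x \<Rightarrow> 'e) set \<Rightarrow> (('x \<Rightarrow> 'e) \<Rightarrow> ereal) \<Rightarrow>
     ('y \<Rightarrow> 'e) set \<Rightarrow> (('y \<Rightarrow> 'e) \<Rightarrow> ereal) \<Rightarrow> ('x \<times> 'y \<Rightarrow> 'e) set" where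
  "completed_tensor v C1 w1 C2 w2 = {F. \<exists>T. tensor_approx v C1 w1 C2 w2 T F}"

definition completed_tensor_val ::
    "('e::field \<Rightarrow> ereal) \<Rightarrow> ('x \<Rightarrow> 'e) set \<Rightarrow> (('x \<Rightarrow> 'e) \<Rightarrow> ereal) \<Rightarrow>
     ('y \<Rightarrow> 'e) set \<Rightarrow> (('y \<Rightarrow> 'e) \<Rightarrow> ereal) \<Rightarrow> ('x \<times> 'y \<Rightarrow> 'e) \<Rightarrow> ereal" where
  "completed_tensor_val v C1 w1 C2 w2 F = (THE c. \<exists>T. tensor_approx v C1 w1 C2 w2 T F \<and>
     (\<lambda>n. tensor_val C1 w1 C2 w2 (T n)) \<longlonglongrightarrow> c)"

text \<open>Functions on \<open>G\<close> all of whose pullbacks under \<open>x \<mapsto> a + j x\<close> lie in a space \<open>C\<close> of functions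
  on \<open>X\<close>. Here \<open>a\<close> runs over all of \<open>G\<close> rather than over coset representatives: the spaces in
  question and their valuations are invariant under translation, so the condition and the
  infimum depend only on the coset of \<open>a\<close>.\<close>

definition pullback :: "('g, 'm) monoid_scheme \<Rightarrow> 'x set \<Rightarrow> ('x \<Rightarrow> 'g) \<Rightarrow> 'g \<Rightarrow> ('g \<Rightarrow> 'e::zero) \<Rightarrow> 'x \<Rightarrow> 'e"
  where
  "pullback G X j a f = (\<lambda>x. if x \<in> X then f (a \<otimes>\<^bsub>G\<^esub> j x) else 0)"

definition glued ::
    "('g, 'm) monoid_scheme \<Rightarrow> 'x set \<Rightarrow> ('x \<Rightarrow> 'g) \<Rightarrow> ('x \<Rightarrow> 'e::zero) set \<Rightarrow> ('g \<Rightarrow> 'e) set" where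
  "glued G X j C = {f. (\<forall>x. x \<notin> carrier G \<longrightarrow> f x = 0) \<and>
     (\<forall>a\<in>carrier G. pullback G X j a f \<in> C)}"

definition glued_val ::
    "('g, 'm) monoid_scheme \<Rightarrow> 'x set \<Rightarrow> ('x \<Rightarrow> 'g) \<Rightarrow> (('x \<Rightarrow> 'e::zero) \<Rightarrow> ereal) \<Rightarrow>
     ('g \<Rightarrow> 'e) \<Rightarrow> ereal" where
  "glued_val G X j w f = (INF a\<in>carrier G. w (pullback G X j a f))"

definition CrG ::
    "nat \<Rightarrow> ('e::field \<Rightarrow> ereal) \<Rightarrow> 'g monoid \<Rightarrow> 'g topology \<Rightarrow> 'g set \<Rightarrow> real \<Rightarrow> ('g \<Rightarrow> 'e) set" where
  "CrG p v G T H r = glued G H (\<lambda>h. h) (Cr p v (G\<lparr>carrier := H\<rparr>) (subtopology T H) r)"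

definition CrG_val ::
    "nat \<Rightarrow> ('e::field \<Rightarrow> ereal) \<Rightarrow> 'g monoid \<Rightarrow> 'g set \<Rightarrow> real \<Rightarrow> ('g \<Rightarrow> 'e) \<Rightarrow> ereal" where
  "CrG_val p v G H r = glued_val G H (\<lambda>h. h) (Cr_val p v (G\<lparr>carrier := H\<rparr>) r)"

definition CrsG ::
    "nat \<Rightarrow> ('e::field \<Rightarrow> ereal) \<Rightarrow> 'g monoid \<Rightarrow> 'g topology \<Rightarrow> 'g set \<Rightarrow> 'g set \<Rightarrow> real \<Rightarrow> real \<Rightarrow>
     ('g \<Rightarrow> 'e) set" where
  "CrsG p v G T H1 H2 r s = glued G (H1 \<times> H2) (\<lambda>(h1, h2). h1 \<otimes>\<^bsub>G\<^esub> h2)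
     (completed_tensor v
        (Cr p v (G\<lparr>carrier := H1\<rparr>) (subtopology T H1) r) (Cr_val p v (G\<lparr>carrier := H1\<rparr>) r)
        (Cr p v (G\<lparr>carrier := H2\<rparr>) (subtopology T H2) s) (Cr_val p v (G\<lparr>carrier := H2\<rparr>) s))"

definition CrsG_val ::
    "nat \<Rightarrow> ('e::field \<Rightarrow> ereal) \<Rightarrow> 'g monoid \<Rightarrow> 'g topology \<Rightarrow> 'g set \<Rightarrow> 'g set \<Rightarrow> real \<Rightarrow> real \<Rightarrow>
     ('g \<Rightarrow> 'e) \<Rightarrow> ereal" where
  "CrsG_val p v G T H1 H2 r s = glued_val G (H1 \<times> H2) (\<lambda>(h1, h2). h1 \<otimes>\<^bsub>G\<^esub> h2)
     (completed_tensor_val v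
        (Cr p v (G\<lparr>carrier := H1\<rparr>) (subtopology T H1) r) (Cr_val p v (G\<lparr>carrier := H1\<rparr>) r)
        (Cr p v (G\<lparr>carrier := H2\<rparr>) (subtopology T H2) s) (Cr_val p v (G\<lparr>carrier := H2\<rparr>) s))"

definition cont_dual ::
    "('e::field \<Rightarrow> ereal) \<Rightarrow> ('x \<Rightarrow> 'e) set \<Rightarrow> (('x \<Rightarrow> 'e) \<Rightarrow> ereal) \<Rightarrow> (('x \<Rightarrow> 'e) \<Rightarrow> 'e) set" where
  "cont_dual v C w = {\<mu>. linear_on C (*) \<mu> \<and> (\<forall>f. f \<notin> C \<longrightarrow> \<mu> f = 0) \<and>
     continuous_map (val_topology C w) (val_topology UNIV v) \<mu>}"

definition DrG ::
    "nat \<Rightarrow> ('e::field \<Rightarrow> ereal) \<Rightarrow> 'g monoid \<Rightarrow> 'g topology \<Rightarrow> 'g set \<Rightarrow> real \<Rightarrow>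
     (('g \<Rightarrow> 'e) \<Rightarrow> 'e) set" where
  "DrG p v G T H r = cont_dual v (CrG p v G T H r) (CrG_val p v G H r)"

definition DrsG ::
    "nat \<Rightarrow> ('e::field \<Rightarrow> ereal) \<Rightarrow> 'g monoid \<Rightarrow> 'g topology \<Rightarrow> 'g set \<Rightarrow> 'g set \<Rightarrow> real \<Rightarrow> real \<Rightarrow>
     (('g \<Rightarrow> 'e) \<Rightarrow> 'e) set" where
  "DrsG p v G T H1 H2 r s = cont_dual v (CrsG p v G T H1 H2 r s) (CrsG_val p v G T H1 H2 r s)"

text \<open>\<open>D \<otimes> V\<close> for a space \<open>D\<close> of functionals: the finite sums of tensors \<open>\<mu> \<otimes> w\<close>, realised as
  \<open>V\<close>-valued functionals.\<close>

definition dual_tensor ::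
    "(('x \<Rightarrow> 'e) \<Rightarrow> 'e) set \<Rightarrow> ('e \<Rightarrow> 'v::ab_group_add \<Rightarrow> 'v) \<Rightarrow> (('x \<Rightarrow> 'e) \<Rightarrow> 'v) set" where
  "dual_tensor D smul = {\<lambda>\<phi>. \<Sum>i<n. smul (\<mu> i \<phi>) (w i) | (n::nat) \<mu> w. \<forall>i<n. \<mu> i \<in> D}"

definition restrict_functional :: "'f set \<Rightarrow> ('f \<Rightarrow> 'v::zero) \<Rightarrow> 'f \<Rightarrow> 'v" where
  "restrict_functional C \<Psi> = (\<lambda>\<phi>. if \<phi> \<in> C then \<Psi> \<phi> else 0)"

definition Zp :: "nat \<Rightarrow> (nat \<Rightarrow> int) monoid" where
  "Zp p = product_group UNIV (\<lambda>n. integer_mod_group (p ^ n))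
     \<lparr>carrier := {x. \<forall>n. x n \<in> carrier (integer_mod_group (p ^ n)) \<and>
                         x (Suc n) mod int (p ^ n) = x n}\<rparr>"

definition Zp_top :: "nat \<Rightarrow> (nat \<Rightarrow> int) topology" where
  "Zp_top p = subtopology
     (product_topology (\<lambda>n. discrete_topology (carrier (integer_mod_group (p ^ n)))) UNIV)
     (carrier (Zp p))"

definition iso_Zp_power :: "nat \<Rightarrow> nat \<Rightarrow> 'g monoid \<Rightarrow> 'g topology \<Rightarrow> bool" where
  "iso_Zp_power p d A T \<longleftrightarrow> (\<exists>h. h \<in> iso (product_group {..<d} (\<lambda>_. Zp p)) A \<and>
     homeomorphic_map (product_topology (\<lambda>_. Zp_top p) {..<d}) T h)"

definition open_Zp_subgroup :: "nat \<Rightarrow> 'g monoid \<Rightarrow> 'g topology \<Rightarrow> 'g set \<Rightarrow> bool" where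
  "open_Zp_subgroup p G T H \<longleftrightarrow> subgroup H G \<and> openin T H \<and>
     (\<exists>d. iso_Zp_power p d (G\<lparr>carrier := H\<rparr>) (subtopology T H))"

text \<open>The Lie algebra of a \<open>p\<close>-adic analytic group is identified, via \<open>X \<mapsto> (t \<mapsto> exp (t X))\<close>, with
  the set of germs at 0 of continuous homomorphisms from an open subgroup \<open>p\<^sup>n\<int>\<^sub>p\<close> of \<open>\<int>\<^sub>p\<close> to the
  group; only the Lie algebra as a set is needed. A germ is the set of all functions agreeing
  with a representative near 0.\<close>

definition local_one_param :: "nat \<Rightarrow> 'g monoid \<Rightarrow> 'g topology \<Rightarrow> ((nat \<Rightarrow> int) \<Rightarrow> 'g) set" where
  "local_one_param p A T = {\<gamma>. \<exists>n. \<gamma> \<in> hom (Zp p\<lparr>carrier := ppow p (Zp p) n\<rparr>) A \<and>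
     continuous_map (subtopology (Zp_top p) (ppow p (Zp p) n)) T \<gamma>}"

definition germ :: "nat \<Rightarrow> ((nat \<Rightarrow> int) \<Rightarrow> 'g) \<Rightarrow> ((nat \<Rightarrow> int) \<Rightarrow> 'g) set" where
  "germ p \<gamma> = {\<delta>. \<exists>n. \<forall>x\<in>ppow p (Zp p) n. \<delta> x = \<gamma> x}"

definition lie_algebra :: "nat \<Rightarrow> 'g monoid \<Rightarrow> 'g topology \<Rightarrow> ((nat \<Rightarrow> int) \<Rightarrow> 'g) set set" where
  "lie_algebra p A T = germ p ` local_one_param p A T"

text \<open>The image of \<open>Lie A\<close> under the differential of a homomorphism \<open>\<rho>\<close>.\<close>

definition lie_image ::
    "nat \<Rightarrow> 'a monoid \<Rightarrow> 'a topology \<Rightarrow> ('a \<Rightarrow> 'g) \<Rightarrow> ((nat \<Rightarrow> int) \<Rightarrow> 'g) set set" where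
  "lie_image p A T \<rho> = (\<lambda>\<gamma>. germ p (\<rho> \<circ> \<gamma>)) ` local_one_param p A T"

text \<open>\<open>\<O>\<^bsub>K,P\<^esub>\<^sup>\<times>\<close> as the inverse limit of the groups \<open>(\<O>\<^sub>K / P\<^sup>n)\<^sup>\<times>\<close>; a residue class is a coset, and
  compatibility of residue classes is inclusion of cosets.\<close>

definition local_units :: "'k::field_char_0 set \<Rightarrow> (nat \<Rightarrow> 'k set) monoid" where
  "local_units P = product_group UNIV (\<lambda>n. units_of (OK Quot ideal_power P n))
     \<lparr>carrier := {u. \<forall>n. u n \<in> Units (OK Quot ideal_power P n) \<and> u (Suc n) \<subseteq> u n}\<rparr>"

definition local_units_top :: "'k::field_char_0 set \<Rightarrow> (nat \<Rightarrow> 'k set) topology" where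
  "local_units_top P = subtopology
     (product_topology (\<lambda>n. discrete_topology (Units (OK Quot ideal_power P n))) UNIV)
     (carrier (local_units P))"

text \<open>The natural map from \<open>\<O>\<^bsub>K,P\<^esub>\<^sup>\<times>\<close> to the ray class group of level \<open>p\<^sup>\<infinity>g\<close>: in \<open>G\<^sub>f\<close>, with
  \<open>f = P\<^sup>n L\<close> and \<open>n = v\<^sub>P(f)\<close>, it sends \<open>u\<close> to the class of \<open>\<alpha>\<O>\<^sub>K\<close> for any non-zero integral \<open>\<alpha>\<close>
  congruent to \<open>u\<close> modulo \<open>P\<^sup>n\<close> and to 1 modulo \<open>L\<close>. The opposite normalisation of the
  idelic class map gives the inverse of this map, which has the same image on Lie algebras.\<close>

definition local_unit_map ::
    "nat \<Rightarrow> 'k::field_char_0 set \<Rightarrow> 'k set \<Rightarrow> (nat \<Rightarrow> 'k set) \<Rightarrow> ('k set \<Rightarrow> 'k set set)" where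
  "local_unit_map p g P u = (\<lambda>f\<in>moduli p g. THE c. \<exists>L \<alpha>. ideal L OK \<and>
     f = ideal_prod OK (ideal_power P (ideal_val P f)) L \<and>
     \<alpha> \<in> carrier OK \<and> \<alpha> \<noteq> 0 \<and> \<alpha> \<in> u (ideal_val P f) \<and> \<alpha> - 1 \<in> L \<and>
     c = ray_principal f #>\<^bsub>ray_ideals f\<^esub> (PIdl\<^bsub>OK\<^esub> \<alpha>))"

definition adapted_Zp_subgroup :: "nat \<Rightarrow> 'k::field_char_0 set \<Rightarrow> 'k set \<Rightarrow> ('k set \<Rightarrow> 'k set set) set \<Rightarrow> bool"
  where
  "adapted_Zp_subgroup p g P H \<longleftrightarrow>
     subgroup H (ray_limit p g) \<and> closedin (ray_limit_top p g) H \<and>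
     iso_Zp_power p 1 (ray_limit p g\<lparr>carrier := H\<rparr>) (subtopology (ray_limit_top p g) H) \<and>
     lie_algebra p (ray_limit p g\<lparr>carrier := H\<rparr>) (subtopology (ray_limit_top p g) H) =
       lie_image p (local_units P) (local_units_top P) (local_unit_map p g P)"

text \<open>By compactness, the last two conditions say that multiplication identifies \<open>H\<^sub>1 \<times> H\<^sub>2\<close>
  with an open subgroup of \<open>G\<close>.\<close>

definition adapted_pair ::
    "nat \<Rightarrow> 'k::field_char_0 set \<Rightarrow> 'k set \<Rightarrow> 'k set \<Rightarrow>
     ('k set \<Rightarrow> 'k set set) set \<Rightarrow> ('k set \<Rightarrow> 'k set set) set \<Rightarrow> bool" where
  "adapted_pair p g P Pb H1 H2 \<longleftrightarrow>
     adapted_Zp_subgroup p g P H1 \<and> adapted_Zp_subgroup p g Pb H2 \<and>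
     H1 \<inter> H2 = {\<one>\<^bsub>ray_limit p g\<^esub>} \<and>
     openin (ray_limit_top p g) (H1 <#>\<^bsub>ray_limit p g\<^esub> H2)"

end

(*
The coset of x under p^m H1 x p^n H2 is a union of fibres of G -> G_f with f = P^(m+c) Pb^(n+c) g, for a
constant c: the Lie algebra condition puts the images of (1 + p^2)^(p^(m+c) e) at P into p^m H1, an integer
logarithm approximates any local unit close to 1 by such powers, and compactness passes to the limit. So the
growth condition bounds the value of the distribution on the indicator of that coset by -k - r m - s n.
A locally constant function is a telescoping sum, in both variables, of indicators of such cosets weighted by
double differences, which are precisely what the valuation of the completed tensor product controls; hence
the functional is bounded for that valuation and extends uniquely from the dense subspace of locally
constant functions to C^(r,s), because E is complete. The comparison with C^(r+s) follows
from density as well, because both restrictions agree on locally constant functions.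
*)
theory Submission
 imports Defs
begin

section \<open>Complete valued fields and extension of functionals\<close>

text \<open>The tensor valuation is a supremum over all presentations of a function, so a bound on
  it cannot be read off from values directly. The device is a dual description: the same number is
  an infimum over pairs of test functionals, a point value or a weighted difference in each
  variable. Expanding in one variable attains the bound with no loss, and the dual description
  survives pointwise limits; this makes the completion a concrete space of functions with a
  computable valuation. On the arithmetic side the obstacle is that H1 and H2 are known only through
  germs of one-parameter subgroups. The single curve of powers of 1 + p^2 suffices, because P has
  residue degree one and rational integers are dense in the completion at P. The square, in place of
  1 + p, keeps p = 2 in line with odd p. Compactness of G rests on finiteness of ray class groups.
  It is derived from Hurwitz' pigeonhole argument in place of a Minkowski bound, with ideals handled
  as modules in K and integrality expressed by trace and norm.\<close>

lemma ereal_le_if_smaller: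
 fixes x :: ereal
 assumes "!!B'. B' < B ==> ereal B' <= x"
 shows "ereal B <= x"
proof (rule dense_le)
 fix y :: ereal assume "y < ereal B"
 then show "y <= x"
  by (metis assms ereal_dense2 ereal_less(2) ereal_less_eq(3) le_less_trans less_ereal.simps(1) less_imp_le not_le order_trans)
qed

section \<open>Valued fields and completeness of finite extensions\<close>

locale valued_field =
 fixes v :: "'e::field => ereal"
 assumes fv: "field_valuation v"
begin

text \<open>Estimates are phrased with real lower bounds, so that arithmetic on bounds takes place
  in the reals and an infinite valuation means satisfying every bound.\<close>

definition vge :: "real => 'e => bool" where "vge B x \<longleftrightarrow> ereal B <= v x"

lemma v_zero: "v 0 = \<infinity>" and v_eq_infty: "v x = \<infinity> \<longleftrightarrow> x = 0"
 and v_neq: "v x ~= -\<infinity>" and v_mult: "v (x * y) = v x + v y" using fv unfolding field_valuation_def by auto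

lemma v_add: "min (v x) (v y) <= v (x + y)" using fv unfolding field_valuation_def by auto

lemma v_one: "v 1 = 0"
proof -
 have "v 1 = v 1 + v 1" using v_mult[of 1 1] by simp
 moreover have "v 1 ~= \<infinity>" by (simp add: v_eq_infty)
 ultimately show ?thesis using v_neq[of 1] by (cases "v 1") auto
qed

lemma v_minus: "v (- x) = v x"
proof -
 have "v (-1) + v (-1) = 0" using v_mult[of "-1" "-1"] v_one by simp
 then have "v (-1) = 0" using v_neq[of "-1"] by (cases "v (-1)") (auto simp: zero_ereal_def)
 then show ?thesis using v_mult[of "-1" x] by simp
qed

lemma v_real: "x ~= 0 ==> \<exists>b. v x = ereal b" using v_neq[of x] v_eq_infty[of x] by (cases "v x") auto

lemma v_inverse: "v x = ereal b ==> v (inverse x) = ereal (- b)"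
proof -
 assume a: "v x = ereal b"
 then have x: "x ~= 0" using v_zero by auto
 then obtain c where c: "v (inverse x) = ereal c" using v_real[of "inverse x"] by auto
 have "v x + v (inverse x) = 0" using v_mult[of x "inverse x"] x v_one by simp
 then show ?thesis using a c by (simp add: zero_ereal_def)
qed

lemma v_power: "v x = ereal b ==> v (x ^ n) = ereal (b * real n)"
 by (induction n) (auto simp: v_one v_mult algebra_simps zero_ereal_def)

lemma vge_0 [simp]: "vge B 0" by (simp add: vge_def v_zero)

lemma vge_add: "vge B x ==> vge B y ==> vge B (x + y)"
 unfolding vge_def using v_add[of x y] by (metis min_def order_trans)

lemma vge_minus [simp]: "vge B (- x) = vge B x" by (simp add: vge_def v_minus)

lemma vge_diff: "vge B x ==> vge B y ==> vge B (x - y)" using vge_add[of B x "- y"] by simp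

lemma vge_diff_commute: "vge B (x - y) \<longleftrightarrow> vge B (y - x)" using vge_minus[of B "x - y"] by simp

lemma vge_mono: "vge B x ==> B' <= B ==> vge B' x" unfolding vge_def by (meson ereal_less_eq(3) order_trans)

lemma vge_mult: "vge B x ==> vge C y ==> vge (B + C) (x * y)"
 unfolding vge_def v_mult by (metis add_mono plus_ereal.simps(1))

lemma vge_sum: "(!!i. i : A ==> vge B (f i)) ==> vge B (sum f A)"
 by (induction A rule: infinite_finite_induct) (auto intro: vge_add)

lemma vge_all: "(!!B. vge B x) ==> x = 0" unfolding vge_def using v_eq_infty[of x] by (metis ereal_top)

lemma vge_ex: "\<exists>B. vge B x"
proof (cases "x = 0")
 case False
 then show ?thesis using v_real[of x] by (auto simp: vge_def)
qed auto

lemma vge_ex_finite: "finite A ==> \<exists>B. \<forall>x\<in>A. vge B (f x)"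
proof (induction A rule: finite_induct)
 case (insert a A)
 then obtain B where "\<forall>x\<in>A. vge B (f x)" by auto
 moreover obtain C where "vge C (f a)" using vge_ex by blast
 ultimately have "\<forall>x\<in>insert a A. vge (min B C) (f x)" by (auto intro: vge_mono)
 then show ?case by blast
qed auto

lemma vge_trans: "vge B (x - y) ==> vge B (y - z) ==> vge B (x - z)" using vge_add[of B "x - y" "y - z"] by simp

lemma vge_one_0: "vge 0 1" by (simp add: vge_def v_one)

lemma vge_less: "(!!B'. B' < B ==> vge B' x) ==> vge B x" unfolding vge_def using ereal_le_if_smaller by blast

lemma tendsto_v_iff:
 "((%n. v (X n)) \<longlonglongrightarrow> \<infinity>) \<longleftrightarrow> (\<forall>B. \<exists>N. \<forall>n\<ge>N. vge B (X n))"
proof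
 assume "(%n. v (X n)) \<longlonglongrightarrow> \<infinity>"
 then have "\<forall>B. eventually (%n. ereal B < v (X n)) sequentially" by (simp add: tendsto_PInfty)
 then show "\<forall>B. \<exists>N. \<forall>n\<ge>N. vge B (X n)"
  unfolding eventually_sequentially vge_def by (meson less_imp_le)
next
 assume *: "\<forall>B. \<exists>N. \<forall>n\<ge>N. vge B (X n)"
 show "(%n. v (X n)) \<longlonglongrightarrow> \<infinity>" unfolding tendsto_PInfty eventually_sequentially
 proof
  fix B :: real
  obtain N where "\<forall>n\<ge>N. vge (B + 1) (X n)" using * by blast
  then show "\<exists>N. \<forall>n\<ge>N. ereal B < v (X n)"
   unfolding vge_def by (metis ereal_less_eq(3) less_add_one linorder_not_le order_trans)
 qed
qed

lemma topspace_val [simp]: "topspace (val_topology S w) = S"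
proof (rule antisym)
 show "topspace (val_topology S w) \<subseteq> S"
  using openin_topspace[of "val_topology S w"] unfolding openin_val_topology by (rule conjunct1)
 have "openin (val_topology S w) S" unfolding openin_val_topology by auto
 then show "S \<subseteq> topspace (val_topology S w)" by (rule openin_subset)
qed

lemma openin_v_ball: "openin (val_topology UNIV v) {y. vge B (y - x)}" unfolding openin_val_topology
proof (intro conjI ballI)
 fix f assume "f : {y. vge B (y - x)}"
 then show "\<exists>B'. \<forall>g\<in>UNIV. ereal B' <= v (g - f) --> g : {y. vge B (y - x)}"
  by (intro exI[of _ B]) (auto simp: vge_def[symmetric] intro: vge_trans)
qed auto

text \<open>Completeness is a property of subsets, because it is propagated from the closure of
  \<open>\<rat>\<close> through a growing chain of subspaces of E.\<close>

definition vcomplete :: "'e set => bool" where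
 "vcomplete S \<longleftrightarrow> (\<forall>X::nat => 'e. (\<forall>n. X n : S) -->
  (\<forall>B. \<exists>N. \<forall>m\<ge>N. \<forall>n\<ge>N. vge B (X m - X n)) -->
  (\<exists>l\<in>S. \<forall>B. \<exists>N. \<forall>n\<ge>N. vge B (X n - l)))"

text \<open>Two elements closer than the valuation of x have the same valuation by the ultrametric
  inequality. The loss 2 b is the valuation of x y in the denominator of 1/x - 1/y.\<close>

lemma vge_inverse_diff:
 assumes "v x = ereal b" "vge B (x - y)" "B > b"
 shows "vge (B - 2 * b) (inverse x - inverse y)"
proof -
 have x: "x ~= 0" using assms v_zero by auto
 have vy: "v y = ereal b"
 proof (rule antisym)
  have "vge b y" using vge_diff[of b x "x - y"] assms vge_mono[of B "x - y" b] by (simp add: vge_def)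
  then show "ereal b <= v y" by (simp add: vge_def)
  show "v y <= ereal b"
  proof (rule ccontr)
   assume "~ v y <= ereal b"
   then obtain b' where b': "ereal b < ereal b'" "ereal b' < v y"
    by (metis ereal_dense2 less_imp_le linorder_not_le)
   define c where "c = min b' B"
   have "vge b' y" using b' by (simp add: vge_def)
   then have "vge c y" "vge c (x - y)" "c > b"
    using b' assms vge_mono[of b' y c] vge_mono[of B "x - y" c] by (auto simp: c_def)
   then have "vge c x" using vge_add[of c "x - y" y] by simp
   then show False using assms(1) \<open>c > b\<close> by (simp add: vge_def)
  qed
 qed
 then have y: "y ~= 0" using v_zero by auto
 have "inverse x - inverse y = - ((x - y) * (inverse x * inverse y))" using x y by (simp add: field_simps)
 moreover have "vge (- b + - b) (inverse x * inverse y)"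
  using v_inverse[OF assms(1)] v_inverse[OF vy] by (intro vge_mult) (auto simp: vge_def)
 ultimately show ?thesis using vge_mult[OF assms(2), of "- b + - b" "inverse x * inverse y"] by simp
qed

text \<open>Completeness of W keeps b at positive distance from it, so the coefficient of b is
  controlled by the whole vector. Cauchy sequences then split into a Cauchy sequence of coefficients
  and one in W.\<close>

lemma vcomplete_extend:
 assumes F: "0 : F" "1 : F" "!!x y. x : F ==> y : F ==> x + y : F" "!!x y. x : F ==> y : F ==> x * y : F"
  "!!x. x : F ==> - x : F" "!!x. x : F ==> inverse x : F"
  and cF: "vcomplete F" and cW: "vcomplete W"
  and W: "!!x y. x : W ==> y : W ==> x + y : W" "!!c x. c : F ==> x : W ==> c * x : W"
  and b: "b \<notin> W"
 shows "vcomplete {c * b + w | c w. c : F & w : W}"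
proof -
 have "\<exists>\<delta>. \<forall>w\<in>W. ~ vge \<delta> (b - w)"
 proof (rule ccontr)
  assume "~ ?thesis"
  then have "\<forall>n::nat. \<exists>w\<in>W. vge (real n) (b - w)" by auto
  then obtain X where X: "!!n. X n : W" "!!n. vge (real n) (b - X n)" by metis
  have near: "\<forall>B. \<exists>N. \<forall>n\<ge>N. vge B (X n - b)"
   using X(2) by (metis real_arch_simple vge_diff_commute vge_mono of_nat_le_iff order_trans)
  have "\<forall>B. \<exists>N. \<forall>m\<ge>N. \<forall>n\<ge>N. vge B (X m - X n)"
   using near by (metis vge_diff_commute vge_trans)
  then obtain l where l: "l : W" "\<forall>B. \<exists>N. \<forall>n\<ge>N. vge B (X n - l)"
   using cW X unfolding vcomplete_def by blast
  have "b - l = 0"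
  proof (rule vge_all)
   fix B
   obtain N1 N2 where "\<forall>n\<ge>N1. vge B (X n - l)" "\<forall>n\<ge>N2. vge B (X n - b)" using l near by meson
   then have "vge B (X (max N1 N2) - l)" "vge B (b - X (max N1 N2))" using vge_diff_commute by auto
   then show "vge B (b - l)" using vge_trans by blast
  qed
  then show False using l b by simp
 qed
 then obtain \<delta> where \<delta>: "!!w. w : W ==> ~ vge \<delta> (b - w)" by blast
 \<comment> \<open>Division by c turns c b + w into b minus an element of W, for which the bound
   \<open>\<delta>\<close> fails.\<close>
 have key: "vge (B - \<delta>) c" if "c : F" "w : W" "vge B (c * b + w)" for B c w
 proof (cases "c = 0")
  case False
  then obtain e where e: "v c = ereal e" using v_real by blast
  have "vge (B + - e) ((c * b + w) * inverse c)" using that v_inverse[OF e] by (intro vge_mult) (auto simp: vge_def)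
  moreover have "(c * b + w) * inverse c = b - (- inverse c) * w" using False by (simp add: field_simps)
  moreover have "(- inverse c) * w : W" using that by (intro W(2) F(5,6))
  ultimately have "vge (B - e) (b - (- inverse c) * w)" "~ vge \<delta> (b - (- inverse c) * w)"
   using \<delta>[of "(- inverse c) * w"] by simp_all
  then have "~ \<delta> <= B - e" using vge_mono by blast
  then show ?thesis using e by (simp add: vge_def)
 qed auto
 show ?thesis unfolding vcomplete_def
 proof (intro allI impI)
  fix X :: "nat => 'e"
  assume "\<forall>n. X n : {c * b + w | c w. c : F & w : W}"
   and cX: "\<forall>B. \<exists>N. \<forall>m\<ge>N. \<forall>n\<ge>N. vge B (X m - X n)"
  then have "\<forall>n. \<exists>z. fst z : F & snd z : W & X n = fst z * b + snd z" by fastforce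
  from choice[OF this] obtain z where
   z: "!!n. fst (z n) : F" "!!n. snd (z n) : W" "!!n. X n = fst (z n) * b + snd (z n)" by blast
  define c w where "c n = fst (z n)" and "w n = snd (z n)" for n
  have cw: "!!n. c n : F" "!!n. w n : W" "!!n. X n = c n * b + w n" using z by (auto simp: c_def w_def)
  have Wd: "x - y : W" if "x : W" "y : W" for x y using W(1)[of x "(-1) * y"] W(2)[of "-1" y] F that by simp
  have Fd: "x - y : F" if "x : F" "y : F" for x y using F(3)[of x "- y"] F that by simp
  have "vge (B - \<delta>) (c m - c n)" if "vge B (X m - X n)" for B m n
   by (rule key[where w = "w m - w n"]) (use cw Wd Fd that in \<open>auto simp: algebra_simps\<close>)
  then have cc: "\<forall>B. \<exists>N. \<forall>m\<ge>N. \<forall>n\<ge>N. vge B (c m - c n)"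
   using cX by (metis add_diff_cancel_right')
  then obtain c0 where c0: "c0 : F" "\<forall>B. \<exists>N. \<forall>n\<ge>N. vge B (c n - c0)"
   using cF cw unfolding vcomplete_def by blast
  obtain e where e: "vge e b" using vge_ex by blast
  have cb: "\<exists>N. \<forall>n\<ge>N. vge B ((c n - c0) * b)" for B
  proof -
   obtain N where "\<forall>n\<ge>N. vge (B - e) (c n - c0)" using c0 by blast
   then have "\<forall>n\<ge>N. vge (B - e + e) ((c n - c0) * b)" using vge_mult e by blast
   then show ?thesis by auto
  qed
  have "\<exists>N. \<forall>m\<ge>N. \<forall>n\<ge>N. vge B (w m - w n)" for B
  proof -
   obtain N1 N2 where N: "\<forall>n\<ge>N1. vge B ((c n - c0) * b)" "\<forall>m\<ge>N2. \<forall>n\<ge>N2. vge B (X m - X n)"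
    using cb cX by metis
   have "vge B (w m - w n)" if "m >= max N1 N2" "n >= max N1 N2" for m n
   proof -
    have "w m - w n = (X m - X n) - ((c m - c0) * b - (c n - c0) * b)" by (simp add: cw algebra_simps)
    then show ?thesis using N that by (metis max.bounded_iff vge_diff)
   qed
   then show ?thesis by blast
  qed
  then obtain w0 where w0: "w0 : W" "\<forall>B. \<exists>N. \<forall>n\<ge>N. vge B (w n - w0)"
   using cW cw unfolding vcomplete_def by blast
  have "\<exists>N. \<forall>n\<ge>N. vge B (X n - (c0 * b + w0))" for B
  proof -
   obtain N1 N2 where N: "\<forall>n\<ge>N1. vge B ((c n - c0) * b)" "\<forall>n\<ge>N2. vge B (w n - w0)"
    using cb w0 by metis
   have "vge B (X n - (c0 * b + w0))" if "n >= max N1 N2" for n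
   proof -
    have "X n - (c0 * b + w0) = (c n - c0) * b + (w n - w0)" by (simp add: cw algebra_simps)
    then show ?thesis using N that by (metis max.bounded_iff vge_add)
   qed
   then show ?thesis by blast
  qed
  then show "\<exists>l\<in>{c * b + w | c w. c : F & w : W}. \<forall>B. \<exists>N. \<forall>n\<ge>N. vge B (X n - l)"
   using c0 w0 by blast
 qed
qed

end

text \<open>Generators over the closure F of \<open>\<rat>\<close> are adjoined one at a time. They
  may be dependent: a generator that already lies in the span leaves it unchanged, and otherwise
  \<open>vcomplete_extend\<close> applies.\<close>

lemma finite_ext_complete:
 fixes v :: "'e::field_char_0 => ereal"
 assumes "finite_ext_Qp p v"
 shows "valued_field.vcomplete v UNIV"
proof -
 interpret valued_field v using assms unfolding finite_ext_Qp_def by (intro valued_field.intro) blast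
 define F where "F = Qp_in v"
 \<comment> \<open>With membership stated as approximability by rationals, F inherits the field
   operations from \<open>\<rat>\<close> by continuity.\<close>
 have F_iff: "x : F \<longleftrightarrow> (\<forall>B. \<exists>q\<in>\<rat>. vge B (x - q))" for x
 proof
  assume "x : F"
  then have *: "!!T. x : T ==> openin (val_topology UNIV v) T ==> \<exists>y. y : \<rat> & y : T"
   unfolding F_def Qp_in_def in_closure_of by blast
  show "\<forall>B. \<exists>q\<in>\<rat>. vge B (x - q)"
   using *[OF _ openin_v_ball[of _ x]] by (auto simp: vge_diff_commute)
 next
  assume *: "\<forall>B. \<exists>q\<in>\<rat>. vge B (x - q)"
  show "x : F" unfolding F_def Qp_in_def in_closure_of
  proof (intro conjI allI impI)
   fix T assume T: "x : T & openin (val_topology UNIV v) T"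
   then obtain B where "\<forall>g\<in>UNIV. ereal B <= v (g - x) --> g : T" unfolding openin_val_topology by blast
   then show "\<exists>y. y : \<rat> & y : T" using * by (metis UNIV_I vge_def vge_diff_commute)
  qed simp
 qed
 have F_D: "\<exists>q\<in>\<rat>. vge B (x - q)" if "x : F" for x B using that F_iff by blast
 have FQ: "q : \<rat> ==> q : F" for q unfolding F_iff by (metis diff_self vge_0)
 have F0: "0 : F" "1 : F" by (auto intro: FQ)
 have Fadd: "x + y : F" if xy: "x : F" "y : F" for x y unfolding F_iff
 proof
  fix B
  obtain q where "q : \<rat>" "vge B (x - q)" using F_D[OF xy(1), of "B"] by blast
  moreover obtain r where "r : \<rat>" "vge B (y - r)" using F_D[OF xy(2), of "B"] by blast
  ultimately show "\<exists>q\<in>\<rat>. vge B (x + y - q)"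
   using vge_add[of B "x - q" "y - r"] by (intro bexI[of _ "q + r"]) (auto simp: algebra_simps)
 qed
 have Fm: "- x : F" if xy: "x : F" for x unfolding F_iff
 proof
  fix B
  obtain q where "q : \<rat>" "vge B (x - q)" using F_D[OF xy(1), of "B"] by blast
  then show "\<exists>q\<in>\<rat>. vge B (- x - q)"
   using vge_diff_commute[of B x q] by (intro bexI[of _ "- q"]) (auto simp: algebra_simps)
 qed
 have Fmult: "x * y : F" if xy: "x : F" "y : F" for x y unfolding F_iff
 proof
  fix B
  obtain a b where ab: "vge a x" "vge b y" using vge_ex by meson
  obtain q where q: "q : \<rat>" "vge (B - b) (x - q)" using F_D[OF xy(1), of "(B - b)"] by blast
  \<comment> \<open>The precision required of the second factor depends on q, so y is approximated
    only after q is fixed.\<close>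
  obtain c where c: "vge c q" using vge_ex by meson
  obtain r where r: "r : \<rat>" "vge (B - c) (y - r)" using F_D[OF xy(2), of "(B - c)"] by blast
  have "x * y - q * r = (x - q) * y + q * (y - r)" by (simp add: algebra_simps)
  moreover have "vge B ((x - q) * y)" using vge_mult[OF q(2) ab(2)] by simp
  moreover have "vge B (q * (y - r))" using vge_mult[OF c r(2)] by simp
  ultimately show "\<exists>q\<in>\<rat>. vge B (x * y - q)" using q r vge_add by (metis Rats_mult)
 qed
 have Finv: "inverse x : F" if xy: "x : F" for x
 proof (cases "x = 0")
  case False
  then obtain b where b: "v x = ereal b" using v_real by blast
  show ?thesis unfolding F_iff
  proof
   fix B
   \<comment> \<open>Precision above b places q in the range of \<open>vge_inverse_diff\<close>,
     whose loss 2 b is added in advance.\<close>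
   obtain q where q: "q : \<rat>" "vge (max (B + 2 * b) (b + 1)) (x - q)" using F_D[OF xy(1), of "(max (B + 2 * b) (b + 1))"] by blast
   then have "vge (max (B + 2 * b) (b + 1) - 2 * b) (inverse x - inverse q)"
    using b by (intro vge_inverse_diff) auto
   then have "vge B (inverse x - inverse q)" by (rule vge_mono) auto
   then show "\<exists>q\<in>\<rat>. vge B (inverse x - q)" using q by (meson Rats_inverse)
  qed
 qed (use F0 in auto)
 have cF: "vcomplete F" unfolding vcomplete_def
 proof (intro allI impI)
  fix X :: "nat => 'e"
  assume "\<forall>n. X n : F" "\<forall>B. \<exists>N. \<forall>m\<ge>N. \<forall>n\<ge>N. vge B (X m - X n)"
  then obtain l where "l : F" "(%n. v (X n - l)) \<longlonglongrightarrow> \<infinity>"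
   using assms unfolding finite_ext_Qp_def F_def[symmetric] vge_def by blast
  then show "\<exists>l\<in>F. \<forall>B. \<exists>N. \<forall>n\<ge>N. vge B (X n - l)"
   unfolding tendsto_v_iff by blast
 qed
 define W where "W B = {\<Sum>b\<in>B. c b * b | c. \<forall>b\<in>B. c b : F}" for B :: "'e set"
 have W: "finite B ==> vcomplete (W B)" for B
 proof (induction B rule: finite_induct)
  case empty
  have "W {} = {0}" by (auto simp: W_def)
  then show ?case by (auto simp: vcomplete_def)
 next
  case (insert b B)
  have Wadd: "x + y : W B" if xy: "x : W B" "y : W B" for x y
  proof -
   obtain c d where "\<forall>b\<in>B. c b : F" "x = (\<Sum>b\<in>B. c b * b)" "\<forall>b\<in>B. d b : F" "y = (\<Sum>b\<in>B. d b * b)"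
    using xy unfolding W_def by blast
   then have "x + y = (\<Sum>b\<in>B. (c b + d b) * b) & (\<forall>b\<in>B. c b + d b : F)"
    by (simp add: sum.distrib algebra_simps Fadd)
   then show ?thesis unfolding W_def by (intro CollectI exI[of _ "%b. c b + d b"]) blast
  qed
  have Wmult: "e * x : W B" if xy: "e : F" "x : W B" for e x
  proof -
   obtain c where "\<forall>b\<in>B. c b : F" "x = (\<Sum>b\<in>B. c b * b)" using xy unfolding W_def by blast
   then have "e * x = (\<Sum>b\<in>B. (e * c b) * b) & (\<forall>b\<in>B. e * c b : F)"
    using that by (simp add: sum_distrib_left algebra_simps Fmult)
   then show ?thesis unfolding W_def by (intro CollectI exI[of _ "%b. e * c b"]) blast
  qed
  have eq: "W (insert b B) = {c * b + w | c w. c : F & w : W B}"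
  proof (intro Set.set_eqI iffI)
   fix x assume "x : W (insert b B)"
   then obtain c where "\<forall>b\<in>insert b B. c b : F" "x = (\<Sum>b\<in>insert b B. c b * b)"
    unfolding W_def by blast
   then show "x : {c * b + w | c w. c : F & w : W B}" using insert(1,2) unfolding W_def by auto
  next
   fix x assume "x : {c * b + w | c w. c : F & w : W B}"
   then obtain e c where ec: "e : F" "\<forall>b\<in>B. c b : F" "x = e * b + (\<Sum>b\<in>B. c b * b)"
    unfolding W_def by blast
   have "(\<Sum>b'\<in>B. (c(b := e)) b' * b') = (\<Sum>b\<in>B. c b * b)" using insert(2) by (intro sum.cong) auto
   then have "x = (\<Sum>b'\<in>insert b B. (c(b := e)) b' * b')" using insert(1,2) ec by simp
   then show "x : W (insert b B)" unfolding W_def using ec by (intro CollectI exI[of _ "c(b := e)"]) auto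
  qed
  show ?case
  proof (cases "b : W B")
   case True
   have "x : {c * b + w | c w. c : F & w : W B}" if "x : W B" for x
    using that F0 by (intro CollectI exI[of _ 0] exI[of _ x]) auto
   then have "W (insert b B) = W B" unfolding eq using Wadd Wmult True by blast
   then show ?thesis using insert by simp
  next
   case False
   show ?thesis unfolding eq using F0 Fadd Fmult Fm Finv cF insert.IH Wadd Wmult False
    by (intro vcomplete_extend) auto
  qed
 qed
 obtain B where "finite B" "\<forall>x. \<exists>c. (\<forall>b\<in>B. c b : F) & x = (\<Sum>b\<in>B. c b * b)"
  using assms unfolding finite_ext_Qp_def F_def by blast
 then have "W B = UNIV" unfolding W_def by blast
 then show ?thesis using W[OF \<open>finite B\<close>] by simp
qed

section \<open>Extension of bounded functionals from dense subspaces\<close>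

context valued_field begin

text \<open>Boundedness with a constant loss k makes L uniformly continuous, so its values along
  approximants of f form a Cauchy sequence in the complete field.\<close>

lemma extend_functional:
 fixes C S :: "('g => 'e) set" and w :: "('g => 'e) => ereal"
 assumes complete: "vcomplete UNIV"
  and Cadd: "!!f g. f : C ==> g : C ==> (%x. f x + g x) : C"
  and Cscal: "!!c f. f : C ==> (%x. c * f x) : C"
  and wadd: "!!B f g. f : C ==> g : C ==> ereal B <= w f ==> ereal B <= w g ==> ereal B <= w (%x. f x + g x)"
  and wscal: "!!B D c f. f : C ==> ereal B <= w f ==> vge D c ==> ereal (B + D) <= w (%x. c * f x)"
  and SC: "S \<subseteq> C"
  and Sadd: "!!f g. f : S ==> g : S ==> (%x. f x + g x) : S"
  and Sscal: "!!c f. f : S ==> (%x. c * f x) : S"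
  and dense: "!!f B. f : C ==> \<exists>ph\<in>S. ereal B <= w (%x. f x - ph x)"
  and lin: "linear_on S (*) L"
  and bound: "!!ph B. ph : S ==> ereal B <= w ph ==> vge (B - k) (L ph)"
 shows "\<exists>\<mu>\<in>cont_dual v C w. \<forall>ph\<in>S. \<mu> ph = L ph"
proof -
 have Ladd: "L (%x. f x + g x) = L f + L g" if "f : S" "g : S" for f g
  using lin that unfolding linear_on_def by blast
 have Lscal: "L (%x. c * f x) = c * L f" if "f : S" for c f using lin that unfolding linear_on_def by blast
 have Sdiff: "(%x. f x - g x) : S" if "f : S" "g : S" for f g
  using Sadd[OF that(1) Sscal[OF that(2), of "-1"]] by simp
 have Ldiff: "L (%x. f x - g x) = L f - L g" if "f : S" "g : S" for f g
  using Ladd[OF that(1) Sscal[OF that(2), of "-1"]] Lscal[OF that(2), of "-1"] by simp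
 have Cdiff: "(%x. f x - g x) : C" if "f : C" "g : C" for f g
  using Cadd[OF that(1) Cscal[OF that(2), of "-1"]] by simp
 have wscal1: "ereal B <= w (%x. - f x)" if "f : C" "ereal B <= w f" for B f
  using wscal[OF that, of 0 "-1"] by (simp add: vge_one_0)
 have wdiff: "ereal B <= w (%x. f x - g x)" if "f : C" "g : C" "ereal B <= w f" "ereal B <= w g" for B f g
  using wadd[OF that(1) Cscal[OF that(2), of "-1"] that(3)] wscal1[OF that(2,4)] by simp
 \<comment> \<open>A limit over all approximants at once, in place of one chosen sequence:
   uniqueness, additivity and homogeneity then need no comparison of sequences.\<close>
 define lm where "lm f l \<longleftrightarrow> (\<forall>B. \<forall>ph\<in>S. ereal B <= w (%x. f x - ph x) --> vge (B - k) (L ph - l))" for f l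
 have near: "vge (B - k) (L ph - L \<psi>)" if "f : C" "ph : S" "\<psi> : S"
  "ereal B <= w (%x. f x - ph x)" "ereal B <= w (%x. f x - \<psi> x)" for f ph \<psi> B
 proof -
  have "(%x. ph x - \<psi> x) = (%x. (f x - \<psi> x) - (f x - ph x))" by auto
  moreover have "ereal B <= w (%x. (f x - \<psi> x) - (f x - ph x))" by (rule wdiff) (use Cdiff that SC in auto)
  ultimately have "ereal B <= w (%x. ph x - \<psi> x)" by simp
  then show ?thesis using bound[OF Sdiff[OF that(2,3)]] Ldiff[OF that(2,3)] by simp
 qed
 have ex: "\<exists>l. lm f l" if f: "f : C" for f
 proof -
  have "\<forall>n. \<exists>ph. ph : S & ereal (real n) <= w (%x. f x - ph x)" using dense[OF f] by blast
  from choice[OF this] obtain X where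
   X: "!!n. X n : S" "!!n. ereal (real n) <= w (%x. f x - X n x)" by blast
  have XB: "ereal B <= w (%x. f x - X n x)" if "n >= nat \<lceil>B\<rceil>" for B n
   using X(2)[of n] that by (meson ereal_less_eq(3) le_nat_iff nat_ceiling_le_eq order_trans)
  have "\<exists>N. \<forall>m\<ge>N. \<forall>n\<ge>N. vge B (L (X m) - L (X n))" for B
   by (intro exI[of _ "nat \<lceil>B + k\<rceil>"]) (use near[OF f X(1) X(1) XB XB, of "B + k"] in auto)
  then obtain l where l: "!!B. \<exists>N. \<forall>n\<ge>N. vge B (L (X n) - l)"
   using complete[unfolded vcomplete_def, rule_format, of "%n. L (X n)"] by auto
  have "lm f l" unfolding lm_def
  proof (intro allI ballI impI)
   fix B ph assume a: "ph : S" "ereal B <= w (%x. f x - ph x)"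
   obtain N where N: "\<forall>n\<ge>N. vge (B - k) (L (X n) - l)" using l by blast
   define n where "n = max N (nat \<lceil>B\<rceil>)"
   have "vge (B - k) (L ph - L (X n))" by (rule near[OF f a(1) X(1) a(2) XB]) (simp add: n_def)
   moreover have "vge (B - k) (L (X n) - l)" using N by (simp add: n_def)
   ultimately show "vge (B - k) (L ph - l)" by (rule vge_trans)
  qed
  then show ?thesis by blast
 qed
 have uniq: "l = l'" if f: "f : C" and "lm f l" "lm f l'" for f l l'
 proof -
  have "l - l' = 0"
  proof (rule vge_all)
   fix B
   obtain ph where "ph : S" "ereal (B + k) <= w (%x. f x - ph x)" using dense[OF f] by blast
   then have "vge B (L ph - l)" "vge B (L ph - l')" using that unfolding lm_def by fastforce+
   then show "vge B (l - l')" using vge_diff_commute vge_trans by blast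
  qed
  then show ?thesis by simp
 qed
 have lmadd: "lm (%x. f x + g x) (l + l')" if f: "f : C" "g : C" and l: "lm f l" "lm g l'" for f g l l'
  unfolding lm_def
 proof (intro allI ballI impI)
  fix B \<eta> assume a: "\<eta> : S" "ereal B <= w (%x. f x + g x - \<eta> x)"
  obtain ph where p: "ph : S" "ereal B <= w (%x. f x - ph x)" using dense f by blast
  obtain \<psi> where q: "\<psi> : S" "ereal B <= w (%x. g x - \<psi> x)" using dense f by blast
  have "ereal B <= w (%x. (f x - ph x) + (g x - \<psi> x))" by (rule wadd) (use p q f SC Cdiff in auto)
  then have "ereal B <= w (%x. f x + g x - (ph x + \<psi> x))" by (simp add: algebra_simps)
  then have "vge (B - k) (L \<eta> - L (%x. ph x + \<psi> x))"
   using near[OF Cadd[OF f] a(1) Sadd[OF p(1) q(1)] a(2)] by simp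
  then have "vge (B - k) (L \<eta> - (L ph + L \<psi>))" using Ladd p q by simp
  moreover have "vge (B - k) ((L ph - l) + (L \<psi> - l'))" using p q l unfolding lm_def by (intro vge_add) auto
  ultimately show "vge (B - k) (L \<eta> - (l + l'))"
   using vge_add[of "B - k" "L \<eta> - (L ph + L \<psi>)" "(L ph - l) + (L \<psi> - l')"] by (simp add: algebra_simps)
 qed
 have lmscal: "lm (%x. c * f x) (c * l)" if f: "f : C" and l: "lm f l" for f l c unfolding lm_def
 proof (intro allI ballI impI)
  fix B \<eta> assume a: "\<eta> : S" "ereal B <= w (%x. c * f x - \<eta> x)"
  obtain D where D: "vge D c" using vge_ex by blast
  obtain ph where p: "ph : S" "ereal (B - D) <= w (%x. f x - ph x)" using dense f by blast
  have "ereal (B - D + D) <= w (%x. c * (f x - ph x))" by (rule wscal) (use p f SC Cdiff D in auto)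
  then have "ereal B <= w (%x. c * f x - c * ph x)" by (simp add: algebra_simps)
  then have "vge (B - k) (L \<eta> - L (%x. c * ph x))" using near[OF Cscal[OF f] a(1) Sscal[OF p(1)] a(2)] by simp
  then have "vge (B - k) (L \<eta> - c * L ph)" using Lscal p by simp
  moreover have "vge (D + (B - D - k)) (c * (L ph - l))" using p l D unfolding lm_def by (intro vge_mult) auto
  ultimately show "vge (B - k) (L \<eta> - c * l)"
   using vge_add[of "B - k" "L \<eta> - c * L ph" "c * (L ph - l)"] by (simp add: algebra_simps)
 qed
 define \<mu> where "\<mu> f = (if f : C then SOME l. lm f l else 0)" for f
 have \<mu>: "lm f (\<mu> f)" if "f : C" for f using someI_ex[OF ex[OF that]] that by (simp add: \<mu>_def)
 have \<mu>S: "\<mu> ph = L ph" if "ph : S" for ph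
 proof (rule uniq[OF _ \<mu>])
  show "lm ph (L ph)" unfolding lm_def
  proof (intro allI ballI impI)
   fix B \<psi> assume a: "\<psi> : S" "ereal B <= w (%x. ph x - \<psi> x)"
   show "vge (B - k) (L \<psi> - L ph)"
    using bound[OF Sdiff[OF that a(1)] a(2)] Ldiff[OF that a(1)] vge_diff_commute by simp
  qed
 qed (use that SC in auto)
 have \<mu>add: "\<mu> (%x. f x + g x) = \<mu> f + \<mu> g" if "f : C" "g : C" for f g
  using uniq[OF Cadd[OF that] \<mu>[OF Cadd[OF that]] lmadd[OF that \<mu>[OF that(1)] \<mu>[OF that(2)]]] .
 have \<mu>scal: "\<mu> (%x. c * f x) = c * \<mu> f" if "f : C" for f c
  using uniq[OF Cscal[OF that] \<mu>[OF Cscal[OF that]] lmscal[OF that \<mu>[OF that]]] .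
 have \<mu>bound: "vge (B - k) (\<mu> f)" if f: "f : C" "ereal B <= w f" for f B
 proof -
  obtain ph where p: "ph : S" "ereal B <= w (%x. f x - ph x)" using dense f by blast
  have "ereal B <= w (%x. f x - (f x - ph x))" by (rule wdiff) (use p f Cdiff SC in auto)
  then have "vge (B - k) (L ph)" using bound p by simp
  moreover have "vge (B - k) (L ph - \<mu> f)" using \<mu>[OF f(1)] p unfolding lm_def by blast
  ultimately show ?thesis using vge_diff by fastforce
 qed
 have "\<mu> : cont_dual v C w" unfolding cont_dual_def
 proof (intro CollectI conjI allI impI)
  show "linear_on C (*) \<mu>" unfolding linear_on_def using \<mu>add \<mu>scal by blast
  show "\<mu> f = 0" if "f \<notin> C" for f using that by (simp add: \<mu>_def)
  show "continuous_map (val_topology C w) (val_topology UNIV v) \<mu>" unfolding continuous_map_def topspace_val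
  proof (intro conjI allI impI)
   fix U assume U: "openin (val_topology UNIV v) U"
   show "openin (val_topology C w) {x : C. \<mu> x : U}" unfolding openin_val_topology
   proof (intro conjI ballI)
    fix f assume f: "f : {x : C. \<mu> x : U}"
    then obtain B where B: "!!y. vge B (y - \<mu> f) ==> y : U"
     using U unfolding openin_val_topology vge_def by blast
    show "\<exists>B. \<forall>g\<in>C. ereal B <= w (g - f) --> g : {x : C. \<mu> x : U}"
    proof (intro exI[of _ "B + k"] ballI impI)
     fix g assume g: "g : C" "ereal (B + k) <= w (g - f)"
     have "vge (B + k - k) (\<mu> (%x. g x - f x))"
      by (rule \<mu>bound) (use g f Cdiff in \<open>auto simp: fun_diff_def\<close>)
     moreover have "\<mu> (%x. g x - f x) = \<mu> g - \<mu> f"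
      using \<mu>add[OF g(1) Cscal[of f "-1"]] \<mu>scal[of f "-1"] f by simp
     ultimately show "g : {x : C. \<mu> x : U}" using B g by simp
    qed
   qed auto
  qed auto
 qed
 then show ?thesis using \<mu>S by blast
qed

text \<open>Finite combinations are compared, with possibly different numbers of terms, because one
  coordinate of an element of the tensor product with V has this form. \<open>w_minus\<close>
  reconciles the two orientations of a difference, in density and in the topology.\<close>

lemma cont_dual_dense_eq:
 fixes C S :: "('g => 'e) set" and w :: "('g => 'e) => ereal"
 assumes SC: "S \<subseteq> C"
  and w_minus: "!!B f ph. f : C ==> ph : S ==> ereal B <= w (%x. f x - ph x) ==> ereal B <= w (%x. ph x - f x)"
  and dense: "!!f B. f : C ==> \<exists>ph\<in>S. ereal B <= w (%x. f x - ph x)"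
  and fin: "finite I" "finite J"
  and \<mu>: "!!i. i : I ==> \<mu> i : cont_dual v C w" and \<nu>: "!!j. j : J ==> \<nu> j : cont_dual v C w"
  and eq: "!!ph. ph : S ==> (\<Sum>i\<in>I. c i * \<mu> i ph) = (\<Sum>j\<in>J. d j * \<nu> j ph)"
 shows "(\<Sum>i\<in>I. c i * \<mu> i f) = (\<Sum>j\<in>J. d j * \<nu> j f)"
proof (cases "f : C")
 case False
 then show ?thesis using \<mu> \<nu> by (simp add: cont_dual_def)
next
 case f: True
 have one: "\<exists>M. \<forall>ph\<in>S. ereal M <= w (%x. f x - ph x) --> vge B (e * l ph - e * l f)"
  if l: "l : cont_dual v C w" for l B e
 proof -
  obtain D where D: "vge D e" using vge_ex by blast
  have "openin (val_topology C w) {x : C. l x : {y. vge (B - D) (y - l f)}}"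
   using l openin_v_ball[of "B - D" "l f"] unfolding cont_dual_def continuous_map_def by auto
  then obtain M where M: "!!g. g : C ==> ereal M <= w (g - f) ==> vge (B - D) (l g - l f)"
   unfolding openin_val_topology using f by (smt (verit) diff_self mem_Collect_eq vge_0)
  have "vge B (e * l ph - e * l f)" if "ph : S" "ereal M <= w (%x. f x - ph x)" for ph
  proof -
   have "vge (B - D) (l ph - l f)" using M[of ph] w_minus[OF f that] that SC by (auto simp: fun_diff_def)
   then have "vge (D + (B - D)) (e * (l ph - l f))" using vge_mult D by blast
   then show ?thesis by (simp add: algebra_simps)
  qed
  then show ?thesis by blast
 qed
 have many: "\<exists>M. \<forall>ph\<in>S. ereal M <= w (%x. f x - ph x) --> vge B ((\<Sum>i\<in>K. a i * \<kappa> i ph) - (\<Sum>i\<in>K. a i * \<kappa> i f))"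
  if "finite K" "!!i. i : K ==> \<kappa> i : cont_dual v C w" for K :: "'z set" and a \<kappa> B using that
 proof (induction K rule: finite_induct)
  case (insert i K)
  then obtain M where M: "\<forall>ph\<in>S. ereal M <= w (%x. f x - ph x) --> vge B ((\<Sum>i\<in>K. a i * \<kappa> i ph) - (\<Sum>i\<in>K. a i * \<kappa> i f))"
   by auto
  obtain M' where M': "\<forall>ph\<in>S. ereal M' <= w (%x. f x - ph x) --> vge B (a i * \<kappa> i ph - a i * \<kappa> i f)"
   using one insert by blast
  show ?case
  proof (intro exI[of _ "max M M'"] ballI impI)
   fix ph assume h: "ph : S" "ereal (max M M') <= w (%x. f x - ph x)"
   have "ereal M <= ereal (max M M')" "ereal M' <= ereal (max M M')" by auto
   then have "ereal M <= w (%x. f x - ph x)" "ereal M' <= w (%x. f x - ph x)" using h(2) order_trans by blast+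
   then have "vge B (((\<Sum>i\<in>K. a i * \<kappa> i ph) - (\<Sum>i\<in>K. a i * \<kappa> i f)) + (a i * \<kappa> i ph - a i * \<kappa> i f))"
    by (intro vge_add) (use M M' h in auto)
   then show "vge B ((\<Sum>i\<in>insert i K. a i * \<kappa> i ph) - (\<Sum>i\<in>insert i K. a i * \<kappa> i f))"
    using insert(1,2) by (simp add: algebra_simps)
  qed
 qed auto
 have "(\<Sum>i\<in>I. c i * \<mu> i f) - (\<Sum>j\<in>J. d j * \<nu> j f) = 0"
 proof (rule vge_all)
  fix B
  obtain M where M: "\<forall>ph\<in>S. ereal M <= w (%x. f x - ph x) --> vge B ((\<Sum>i\<in>I. c i * \<mu> i ph) - (\<Sum>i\<in>I. c i * \<mu> i f))"
   using many[of I \<mu> B c] fin \<mu> by blast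
  obtain M' where M': "\<forall>ph\<in>S. ereal M' <= w (%x. f x - ph x) --> vge B ((\<Sum>i\<in>J. d i * \<nu> i ph) - (\<Sum>i\<in>J. d i * \<nu> i f))"
   using many[of J \<nu> B d] fin \<nu> by blast
  obtain ph where p: "ph : S" "ereal (max M M') <= w (%x. f x - ph x)" using dense f by blast
  have "ereal M <= ereal (max M M')" "ereal M' <= ereal (max M M')" by auto
  then have Mw: "ereal M <= w (%x. f x - ph x)" "ereal M' <= w (%x. f x - ph x)" using p(2) order_trans by blast+
  have "vge B (((\<Sum>i\<in>J. d i * \<nu> i ph) - (\<Sum>i\<in>J. d i * \<nu> i f)) - ((\<Sum>i\<in>I. c i * \<mu> i ph) - (\<Sum>i\<in>I. c i * \<mu> i f)))"
   by (rule vge_diff) (use M M' p Mw in auto)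
  then show "vge B ((\<Sum>i\<in>I. c i * \<mu> i f) - (\<Sum>j\<in>J. d j * \<nu> j f))"
   using eq[OF p(1)] by (simp add: algebra_simps)
 qed
 then show ?thesis by simp
qed

end

section \<open>The completed tensor product of two function spaces\<close>

lemma ereal_le_minus_real: "ereal B <= x - ereal c \<longleftrightarrow> ereal (B + c) <= x" by (cases x) auto

text \<open>Both kinds of quantity in the valuation of order r become values of one type, so that a
  bound is a single quantification and the tensor valuation can be tested by pairs.\<close>

datatype 'h test = Point 'h | Diff nat 'h 'h

fun tev :: "'h test => ('h => 'e::ring) => 'e" where
 "tev (Point x) f = f x"
| "tev (Diff m y x) f = f y - f x"

fun twt :: "real => 'h test => real" where
 "twt r (Point x) = 0"
| "twt r (Diff m y x) = r * real m"

definition tests :: "nat => ('h, 'm) monoid_scheme => 'h test set" where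
 "tests p H = Point ` carrier H \<union>
  {Diff m (x \<otimes>\<^bsub>H\<^esub> h) x | m x h. x : carrier H & h : ppow p H m}"

lemma tev_add: "tev s (%x. f x + g x) = tev s f + tev s g" by (cases s) (auto simp: algebra_simps)

lemma tev_diff: "tev s (%x. f x - g x) = tev s f - tev s g" by (cases s) (auto simp: algebra_simps)

lemma tev_zero: "tev s (%x. 0) = 0" by (cases s) auto

lemma tev_mult_left: "tev s (%x. c * f x) = c * tev s f" by (cases s) (auto simp: algebra_simps)

lemma tev_mult_right: "tev s (%x. f x * c) = tev s f * c" by (cases s) (auto simp: algebra_simps)

lemma tev_sum: "tev s (%x. \<Sum>i\<in>I. f i x) = (\<Sum>i\<in>I. tev s (f i))"
 by (cases s) (auto simp: sum_subtractf)

text \<open>In place of an isomorphism with a power of Z_p, the filtration by p^m-th powers is taken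
  with open cosets, finitely many at each level. One development then serves H1, H2 and the open
  subgroup H.\<close>

locale zp_filtered = valued_field v + comm_group H
 for v :: "'e::field => ereal" and H :: "('h, 'm) monoid_scheme" (structure) +
 fixes p :: nat and T :: "'h topology" and r :: real
 assumes r0: "r >= 0"
  and topT: "topspace T = carrier H"
  and openK: "x : carrier H ==> openin T ((%k. x \<otimes> k) ` ppow p H m)"
  and finK: "\<exists>X. finite X & X \<subseteq> carrier H & (\<forall>x\<in>carrier H. \<exists>a\<in>X. \<exists>k\<in>ppow p H m. x = a \<otimes> k)"
begin

abbreviation "K m \<equiv> ppow p H m"

lemma K_sub: "k : K m ==> k : carrier H" by (auto simp: ppow_def)

lemma K_one: "\<one> : K m" unfolding ppow_def by (rule image_eqI[of _ _ \<one>]) auto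

lemma K_mult: "k : K m ==> l : K m ==> k \<otimes> l : K m"
 unfolding ppow_def by (auto simp: nat_pow_distrib[symmetric])

lemma K_inv: "k : K m ==> inv k : K m" unfolding ppow_def by (auto simp: nat_pow_inv[symmetric])

lemma K_zero: "K 0 = carrier H" unfolding ppow_def by auto

lemma K_mono: "m <= n ==> k : K n ==> k : K m"
proof -
 assume "m <= n" "k : K n"
 then obtain h d where h: "h : carrier H" "k = h [^] (p ^ n)" "n = m + d"
  unfolding ppow_def by (auto simp: le_iff_add)
 then have "k = (h [^] (p ^ d)) [^] (p ^ m)" by (simp add: nat_pow_pow power_add mult.commute)
 then show "k : K m" using h unfolding ppow_def by blast
qed

text \<open>The choice depends on x only through its coset as a set, which makes \<open>rep\<close>
  constant on cosets by construction.\<close>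

definition rep :: "nat => 'h => 'h" where
 "rep m x = (SOME y. y : (%k. x \<otimes> k) ` K m)"

lemma rep_ex: assumes "x : carrier H" shows "\<exists>k\<in>K m. rep m x = x \<otimes> k"
proof -
 have "x : (%k. x \<otimes> k) ` K m" by (rule image_eqI[of _ _ \<one>]) (use assms K_one in auto)
 then have "rep m x : (%k. x \<otimes> k) ` K m" unfolding rep_def by (rule someI)
 then show ?thesis by auto
qed

lemma rep_closed [simp]: "x : carrier H ==> rep m x : carrier H" using rep_ex[of x m] K_sub by fastforce

lemma coset_eq:
 assumes "x : carrier H" "k : K m"
 shows "(%l. (x \<otimes> k) \<otimes> l) ` K m = (%l. x \<otimes> l) ` K m"
proof (intro Set.set_eqI iffI)
 fix z assume "z : (%l. (x \<otimes> k) \<otimes> l) ` K m"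
 then obtain l where "l : K m" "z = (x \<otimes> k) \<otimes> l" by auto
 then have "z = x \<otimes> (k \<otimes> l)" using assms K_sub by (simp add: m_assoc)
 then show "z : (%l. x \<otimes> l) ` K m" using K_mult[OF assms(2) \<open>l : K m\<close>] by blast
next
 fix z assume "z : (%l. x \<otimes> l) ` K m"
 then obtain l where l: "l : K m" "z = x \<otimes> l" by auto
 have c: "k : carrier H" "l : carrier H" using assms l K_sub by auto
 then have "k \<otimes> (inv k \<otimes> l) = l" using m_assoc[of k "inv k" l] by simp
 then have "z = (x \<otimes> k) \<otimes> (inv k \<otimes> l)" using l c assms m_assoc[of x k "inv k \<otimes> l"] by simp
 then show "z : (%l. (x \<otimes> k) \<otimes> l) ` K m" using K_mult[OF K_inv[OF assms(2)] l(1)] by blast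
qed

lemma rep_mult: "x : carrier H ==> k : K m ==> rep m (x \<otimes> k) = rep m x"
 unfolding rep_def by (simp add: coset_eq)

lemma rep_rep: assumes "x : carrier H" "m <= n" shows "rep m (rep n x) = rep m x"
proof -
 obtain k where "k : K n" "rep n x = x \<otimes> k" using rep_ex assms by blast
 then show ?thesis using rep_mult[of x k m] K_mono[of m n k] assms by simp
qed

lemma rep_ex': assumes "x : carrier H" shows "\<exists>k\<in>K m. x = rep m x \<otimes> k"
proof -
 obtain k where k: "k : K m" "rep m x = x \<otimes> k" using rep_ex[OF assms] by blast
 then have "x = rep m x \<otimes> inv k" using assms K_sub by (simp add: m_assoc)
 then show ?thesis using K_inv[OF k(1)] by blast
qed

lemma rep_finite: "finite (rep m ` carrier H)"
proof -
 obtain X where X: "finite X" "X \<subseteq> carrier H" "\<forall>x\<in>carrier H. \<exists>a\<in>X. \<exists>k\<in>K m. x = a \<otimes> k"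
  using finK[of m] by (elim exE conjE)
 have "rep m ` carrier H \<subseteq> rep m ` X"
 proof
  fix y assume "y : rep m ` carrier H"
  then obtain x where x: "x : carrier H" "y = rep m x" by auto
  then obtain a k where "a : X" "k : K m" "x = a \<otimes> k" using X by blast
  then show "y : rep m ` X" using rep_mult X x by auto
 qed
 then show ?thesis using X finite_subset by blast
qed

lemma Cr_val_iff: "ereal B <= Cr_val p v H r f \<longleftrightarrow> (\<forall>t\<in>tests p H. vge (B + twt r t) (tev t f))"
proof -
 have "ereal B <= Cr_val p v H r f \<longleftrightarrow> (\<forall>x\<in>carrier H. vge B (f x)) &
  (\<forall>m. \<forall>x\<in>carrier H. \<forall>k\<in>K m. vge (B + r * real m) (f (x \<otimes> k) - f x))"
  unfolding Cr_val_def eps_def le_inf_iff le_INF_iff ereal_le_minus_real vge_def by auto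
 also have "\<dots> \<longleftrightarrow> (\<forall>t\<in>tests p H. vge (B + twt r t) (tev t f))"
  unfolding tests_def ball_Un by (fastforce simp: image_iff)
 finally show ?thesis .
qed

text \<open>Continuity follows from the modulus condition: at a level where it holds with bound B,
  differences of f within a coset have valuation at least B, since r is non-negative.\<close>

lemma Cr_iff: "f : Cr p v H T r \<longleftrightarrow> (\<forall>x. x \<notin> carrier H --> f x = 0) &
  (\<forall>B. \<exists>M. \<forall>m\<ge>M. \<forall>x\<in>carrier H. \<forall>k\<in>K m. vge (B + r * real m) (f (x \<otimes> k) - f x))"
proof -
 have lim: "(%m. eps p v H m f - ereal (r * real m)) \<longlonglongrightarrow> \<infinity> \<longleftrightarrow>
  (\<forall>B. \<exists>M. \<forall>m\<ge>M. \<forall>x\<in>carrier H. \<forall>k\<in>K m. vge (B + r * real m) (f (x \<otimes> k) - f x))" (is "?L \<longleftrightarrow> ?R")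
 proof -
  have "?L \<longleftrightarrow> (\<forall>B. \<exists>M. \<forall>m\<ge>M. ereal B <= eps p v H m f - ereal (r * real m))"
  proof
   assume ?L
   then have "\<forall>B. eventually (%m. ereal B < eps p v H m f - ereal (r * real m)) sequentially"
    by (simp add: tendsto_PInfty)
   then show "\<forall>B. \<exists>M. \<forall>m\<ge>M. ereal B <= eps p v H m f - ereal (r * real m)"
    unfolding eventually_sequentially by (meson less_imp_le)
  next
   assume *: "\<forall>B. \<exists>M. \<forall>m\<ge>M. ereal B <= eps p v H m f - ereal (r * real m)"
   show ?L unfolding tendsto_PInfty eventually_sequentially
   proof
    fix B :: real
    obtain M where M: "\<forall>m\<ge>M. ereal (B + 1) <= eps p v H m f - ereal (r * real m)" using * by blast
    have "ereal B < ereal (B + 1)" by simp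
    then show "\<exists>N. \<forall>n\<ge>N. ereal B < eps p v H n f - ereal (r * real n)"
     using M less_le_trans by blast
   qed
  qed
  also have "\<dots> \<longleftrightarrow> ?R" unfolding eps_def le_INF_iff ereal_le_minus_real vge_def by auto
  finally show ?thesis .
 qed
 have "continuous_map T (val_topology UNIV v) f"
  if *: "\<forall>B. \<exists>M. \<forall>m\<ge>M. \<forall>x\<in>carrier H. \<forall>k\<in>K m. vge (B + r * real m) (f (x \<otimes> k) - f x)"
  unfolding continuous_map_def topspace_val
 proof (intro conjI allI impI)
  fix U assume U: "openin (val_topology UNIV v) U"
  show "openin T {x : topspace T. f x : U}"
  proof (subst openin_subopen, intro ballI)
   fix x assume x: "x : {x : topspace T. f x : U}"
   then obtain B where B: "!!y. vge B (y - f x) ==> y : U" using U unfolding openin_val_topology vge_def by blast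
   obtain M where M: "\<forall>m\<ge>M. \<forall>x\<in>carrier H. \<forall>k\<in>K m. vge (B + r * real m) (f (x \<otimes> k) - f x)"
    using * by blast
   have "f (x \<otimes> k) : U" if "k : K M" for k
   proof (rule B, rule vge_mono)
    show "vge (B + r * real M) (f (x \<otimes> k) - f x)" using M that x topT by auto
    show "B <= B + r * real M" using r0 by simp
   qed
   then show "\<exists>V. openin T V & x : V & V \<subseteq> {x : topspace T. f x : U}" using x topT K_one K_sub
    by (intro exI[of _ "(%k. x \<otimes> k) ` K M"] conjI openK) (auto intro!: image_eqI[of _ _ \<one>])
  qed
 qed auto
 then show ?thesis unfolding Cr_def mem_Collect_eq lim by blast
qed

lemma level_in_Cr:
 assumes "!!x. x \<notin> carrier H ==> f x = 0" "!!x k. x : carrier H ==> k : K M ==> f (x \<otimes> k) = f x"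
 shows "f : Cr p v H T r" unfolding Cr_iff
proof (intro conjI allI impI)
 fix B
 show "\<exists>M. \<forall>m\<ge>M. \<forall>x\<in>carrier H. \<forall>k\<in>K m. vge (B + r * real m) (f (x \<otimes> k) - f x)"
  using assms(2) K_mono by (intro exI[of _ M]) auto
qed (use assms in auto)

lemma Cr_zero: "(%x. 0) : Cr p v H T r" by (rule level_in_Cr) auto

lemma Cr_add: assumes "f : Cr p v H T r" "g : Cr p v H T r" shows "(%x. f x + g x) : Cr p v H T r" unfolding Cr_iff
proof (intro conjI allI impI)
 fix B
 obtain M N where "\<forall>m\<ge>M. \<forall>x\<in>carrier H. \<forall>k\<in>K m. vge (B + r * real m) (f (x \<otimes> k) - f x)"
  "\<forall>m\<ge>N. \<forall>x\<in>carrier H. \<forall>k\<in>K m. vge (B + r * real m) (g (x \<otimes> k) - g x)"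
  using assms unfolding Cr_iff by meson
 then have "vge (B + r * real m) ((f (x \<otimes> k) - f x) + (g (x \<otimes> k) - g x))"
  if "m >= max M N" "x : carrier H" "k : K m" for m x k using that by (intro vge_add) auto
 then show "\<exists>M. \<forall>m\<ge>M. \<forall>x\<in>carrier H. \<forall>k\<in>K m. vge (B + r * real m) (f (x \<otimes> k) + g (x \<otimes> k) - (f x + g x))"
  by (intro exI[of _ "max M N"]) (auto simp: algebra_simps)
qed (use assms in \<open>auto simp: Cr_iff\<close>)

lemma Cr_scale: assumes "f : Cr p v H T r" shows "(%x. c * f x) : Cr p v H T r" unfolding Cr_iff
proof (intro conjI allI impI)
 fix B
 obtain D where D: "vge D c" using vge_ex by blast
 obtain M where M: "\<forall>m\<ge>M. \<forall>x\<in>carrier H. \<forall>k\<in>K m. vge (B - D + r * real m) (f (x \<otimes> k) - f x)"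
  using assms unfolding Cr_iff by blast
 have "vge (B + r * real m) (c * f (x \<otimes> k) - c * f x)"
  if "m >= M" "x : carrier H" "k : K m" for m x k
 proof -
  have "vge (D + (B - D + r * real m)) (c * (f (x \<otimes> k) - f x))" using M that D by (intro vge_mult) auto
  then show ?thesis by (simp add: algebra_simps)
 qed
 then show "\<exists>M. \<forall>m\<ge>M. \<forall>x\<in>carrier H. \<forall>k\<in>K m. vge (B + r * real m) (c * f (x \<otimes> k) - c * f x)"
  by blast
qed (use assms in \<open>auto simp: Cr_iff\<close>)

lemma Cr_diff: "f : Cr p v H T r ==> g : Cr p v H T r ==> (%x. f x - g x) : Cr p v H T r"
 using Cr_add[OF _ Cr_scale[of g "-1"], of f] by simp

definition trunc :: "nat => ('h => 'e) => 'h => 'e" where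
 "trunc L f = (%x. if x : carrier H then f (rep L x) else 0)"

lemma trunc_level: "x : carrier H ==> k : K L ==> trunc L f (x \<otimes> k) = trunc L f x"
 unfolding trunc_def using K_sub by (auto simp: rep_mult)

lemma trunc_Cr: "trunc L f : Cr p v H T r"
 by (rule level_in_Cr[where M = L]) (auto simp: trunc_level, auto simp: trunc_def)

text \<open>Within cosets of level L the truncation is constant and only differences of f remain. A
  coarser difference is a difference of two pointwise errors, each of valuation at least B + r L,
  which pays for the weight r m with m < L.\<close>

lemma Cr_val_diff_trunc:
 assumes "f : Cr p v H T r" shows "\<exists>L. ereal B <= Cr_val p v H r (%x. f x - trunc L f x)"
proof -
 obtain L where L: "\<forall>m\<ge>L. \<forall>x\<in>carrier H. \<forall>k\<in>K m. vge (B + r * real m) (f (x \<otimes> k) - f x)"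
  using assms unfolding Cr_iff by blast
 have pt: "vge (B + r * real L) (f x - trunc L f x)" if x: "x : carrier H" for x
 proof -
  obtain k where "k : K L" "rep L x = x \<otimes> k" using rep_ex[OF x] by blast
  then show ?thesis using L x vge_diff_commute by (auto simp: trunc_def)
 qed
 have "ereal B <= Cr_val p v H r (%x. f x - trunc L f x)" unfolding Cr_val_iff
 proof
  fix t assume "t : tests p H"
  then consider x where "t = Point x" "x : carrier H"
   | m x k where "t = Diff m (x \<otimes> k) x" "x : carrier H" "k : K m" unfolding tests_def by auto
  then show "vge (B + twt r t) (tev t (%x. f x - trunc L f x))"
  proof cases
   case 1
   moreover have "B <= B + r * real L" using r0 by simp
   ultimately show ?thesis using vge_mono[OF pt] by auto
  next
   case 2
   show ?thesis
   proof (cases "m >= L")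
    case True
    then have "k : K L" using 2 K_mono by blast
    then show ?thesis using 2 True L trunc_level by simp
   next
    case False
    then have "r * real m <= r * real L" using r0 by (intro mult_left_mono) auto
    moreover have "vge (B + r * real L) (tev t (%x. f x - trunc L f x))"
     using 2 pt K_sub by (auto intro: vge_diff)
    ultimately show ?thesis using 2 by (auto intro: vge_mono)
   qed
  qed
 qed
 then show ?thesis by blast
qed

lemma Cr_val_add: "ereal B <= Cr_val p v H r f ==> ereal B <= Cr_val p v H r g ==>
  ereal B <= Cr_val p v H r (%x. f x + g x)" unfolding Cr_val_iff by (auto simp: tev_add intro: vge_add)

lemma Cr_val_mono: "ereal B <= Cr_val p v H r f ==> B' <= B ==> ereal B' <= Cr_val p v H r f"
 by (meson ereal_less_eq(3) order_trans)

text \<open>The finitely many values have a common lower bound, and differences vanish from level M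
  on, so the weights cost at most r M.\<close>

lemma level_bounded:
 assumes "!!x k. x : carrier H ==> k : K M ==> f (x \<otimes> k) = f x"
 shows "\<exists>B. ereal B <= Cr_val p v H r f"
proof -
 obtain B where B: "\<forall>x\<in>rep M ` carrier H. vge B (f x)"
  using vge_ex_finite[OF rep_finite[of M], of f] by blast
 have pt: "vge B (f x)" if x: "x : carrier H" for x
 proof -
  obtain k where "k : K M" "rep M x = x \<otimes> k" using rep_ex[OF x] by blast
  then have "f x = f (rep M x)" using assms[OF x] by simp
  then show ?thesis using B x by simp
 qed
 have "ereal (B - r * real M) <= Cr_val p v H r f" unfolding Cr_val_iff
 proof
  fix t assume "t : tests p H"
  then consider x where "t = Point x" "x : carrier H"
   | m x k where "t = Diff m (x \<otimes> k) x" "x : carrier H" "k : K m" unfolding tests_def by auto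
  then show "vge (B - r * real M + twt r t) (tev t f)"
  proof cases
   case 1
   moreover have "B - r * real M <= B" using r0 by simp
   ultimately show ?thesis using vge_mono[OF pt] by auto
  next
   case 2
   show ?thesis
   proof (cases "m >= M")
    case True
    then have "k : K M" using 2 K_mono by blast
    then show ?thesis using 2 assms by simp
   next
    case False
    then have "r * real m <= r * real M" using r0 by (intro mult_left_mono) auto
    moreover have "vge B (tev t f)" using 2 pt K_sub by (auto intro: vge_diff)
    ultimately show ?thesis using 2 by (auto intro: vge_mono)
   qed
  qed
 qed
 then show ?thesis by blast
qed

lemma Cr_bounded: assumes "f : Cr p v H T r" shows "\<exists>B. ereal B <= Cr_val p v H r f"
proof -
 obtain L where L: "ereal 0 <= Cr_val p v H r (%x. f x - trunc L f x)" using Cr_val_diff_trunc[OF assms] by blast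
 obtain B where B: "ereal B <= Cr_val p v H r (trunc L f)" using level_bounded[of L "trunc L f"] trunc_level by blast
 have "ereal (min 0 B) <= Cr_val p v H r (%x. (f x - trunc L f x) + trunc L f x)"
  by (rule Cr_val_add) (rule Cr_val_mono[OF L], simp, rule Cr_val_mono[OF B], simp)
 then have "ereal (min 0 B) <= Cr_val p v H r f" by simp
 then show ?thesis by blast
qed

definition ind :: "nat => 'h => 'h => 'e" where
 "ind m c = (%x. if x : carrier H & rep m x = c then 1 else 0)"

lemma ind_level: "x : carrier H ==> k : K m ==> ind m c (x \<otimes> k) = ind m c x"
 using K_sub by (auto simp: ind_def rep_mult)

lemma ind_Cr: "ind m c : Cr p v H T r" by (rule level_in_Cr[where M = m]) (auto simp: ind_level, auto simp: ind_def)

text \<open>Differences at levels n >= m vanish, so the largest weight that occurs is r (m - 1). At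
  m = 0 the indicator is constant, and natural subtraction gives 0.\<close>

lemma ind_val: "ereal (- (r * real (m - 1))) <= Cr_val p v H r (ind m c)" unfolding Cr_val_iff
proof
 fix t assume "t : tests p H"
 then consider x where "t = Point x" "x : carrier H"
  | n x k where "t = Diff n (x \<otimes> k) x" "x : carrier H" "k : K n" unfolding tests_def by auto
 then show "vge (- (r * real (m - 1)) + twt r t) (tev t (ind m c))"
 proof cases
  case 1
  then show ?thesis using r0 vge_one_0 by (auto simp: ind_def intro: vge_mono)
 next
  case 2
  show ?thesis
  proof (cases "n >= m")
   case True
   then have "k : K m" using 2 K_mono by blast
   then show ?thesis using 2 ind_level by simp
  next
   case False
   then have "r * real n <= r * real (m - 1)" using r0 by (intro mult_left_mono) auto
   moreover have "vge 0 (tev t (ind m c))" using 2 vge_one_0 by (auto simp: ind_def)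
   ultimately show ?thesis using 2 by (auto intro: vge_mono)
  qed
 qed
qed

lemma sum_ind: "x : carrier H ==> (\<Sum>c\<in>rep m ` carrier H. ind m c x * f c) = f (rep m x)"
proof -
 assume x: "x : carrier H"
 have "(\<Sum>c\<in>rep m ` carrier H. ind m c x * f c) = (\<Sum>c\<in>rep m ` carrier H. if rep m x = c then f c else 0)"
  using x by (intro sum.cong) (auto simp: ind_def)
 also have "\<dots> = f (rep m x)" using rep_finite[of m] x by (simp add: sum.delta)
 finally show ?thesis .
qed

definition dif :: "nat => ('h => 'e) => 'h => 'e" where
 "dif m f c = (if m = 0 then f c else f c - f (rep (m - 1) c))"

text \<open>The increment compares two points of one coset of level m - 1, so it has weight r (m -
  1), exactly what \<open>ind m c\<close> loses. Level 0 is a point value of weight 0, again in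
  agreement with natural subtraction.\<close>

lemma dif_tev:
 assumes "c : carrier H"
 obtains t where "t : tests p H" "twt r t = r * real (m - 1)" "!!f. dif m f c = tev t f"
proof (cases "m = 0")
 case True
 then show ?thesis using assms that[of "Point c"] by (auto simp: tests_def dif_def)
next
 case False
 define c' where "c' = rep (m - 1) c"
 obtain k where k: "k : K (m - 1)" "c = c' \<otimes> k"
  using rep_ex'[OF assms, of "m - 1"] unfolding c'_def by (elim bexE)
 have "c' : carrier H" using assms by (simp add: c'_def)
 then have "Diff (m - 1) (c' \<otimes> k) c' : tests p H" using k(1) unfolding tests_def by blast
 then have "Diff (m - 1) c c' : tests p H" using k(2) by simp
 then show ?thesis using False that[of "Diff (m - 1) c c'"] by (auto simp: dif_def c'_def)
qed

text \<open>Telescoping through the levels replaces the wavelet expansion of \<open>f\<close>.\<close>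

lemma telescope:
 assumes x: "x : carrier H"
 shows "f (rep L x) = (\<Sum>m\<le>L. dif m f (rep m x))"
proof (induction L)
 case 0
 show ?case by (simp add: dif_def)
next
 case (Suc L)
 have "dif (Suc L) f (rep (Suc L) x) = f (rep (Suc L) x) - f (rep L x)"
  using rep_rep[OF x, of L "Suc L"] by (simp add: dif_def)
 then have "f (rep (Suc L) x) = f (rep L x) + dif (Suc L) f (rep (Suc L) x)" by simp
 also have "\<dots> = (\<Sum>m\<le>L. dif m f (rep m x)) + dif (Suc L) f (rep (Suc L) x)" by (simp only: Suc)
 also have "\<dots> = (\<Sum>m\<le>Suc L. dif m f (rep m x))" by (rule sum.atMost_Suc[symmetric])
 finally show ?case .
qed

lemma trunc_expand:
 assumes x: "x : carrier H"
 shows "f (rep L x) = (\<Sum>m\<le>L. \<Sum>c\<in>rep m ` carrier H. ind m c x * dif m f c)"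
proof -
 have "f (rep L x) = (\<Sum>m\<le>L. dif m f (rep m x))" by (rule telescope[OF x])
 also have "\<dots> = (\<Sum>m\<le>L. \<Sum>c\<in>rep m ` carrier H. ind m c x * dif m f c)"
  by (rule sum.cong[OF refl], rule sum_ind[OF x, symmetric])
 finally show ?thesis .
qed

end

lemma tensor_sum_diff:
 "(%z. tensor_sum n f g z - tensor_sum m f' g' z) =
  tensor_sum (n + m) (%i. if i < n then f i else (%x. - f' (i - n) x)) (%i. if i < n then g i else g' (i - n))"
proof
 fix z :: "'a \<times> 'b"
 obtain x y where z: "z = (x, y)" by force
 have "(\<Sum>i<n + m. (if i < n then f i else (%x. - f' (i - n) x)) x * (if i < n then g i else g' (i - n)) y) =
   (\<Sum>i<n. f i x * g i y) + (\<Sum>i<m. - f' i x * g' i y)" by (induction m) (auto simp: algebra_simps)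
 then show "tensor_sum n f g z - tensor_sum m f' g' z = tensor_sum (n + m)
  (%i. if i < n then f i else (%x. - f' (i - n) x)) (%i. if i < n then g i else g' (i - n)) z"
  by (simp add: tensor_sum_def z sum_negf)
qed

lemma tensor_sum_add:
 "(%z. tensor_sum n f g z + tensor_sum m f' g' z) =
  tensor_sum (n + m) (%i. if i < n then f i else f' (i - n)) (%i. if i < n then g i else g' (i - n))"
proof
 fix z :: "'a \<times> 'b"
 obtain x y where z: "z = (x, y)" by force
 have "(\<Sum>i<n + m. (if i < n then f i else f' (i - n)) x * (if i < n then g i else g' (i - n)) y) =
   (\<Sum>i<n. f i x * g i y) + (\<Sum>i<m. f' i x * g' i y)" by (induction m) (auto simp: algebra_simps)
 then show "tensor_sum n f g z + tensor_sum m f' g' z = tensor_sum (n + m)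
  (%i. if i < n then f i else f' (i - n)) (%i. if i < n then g i else g' (i - n)) z"
  by (simp add: tensor_sum_def z)
qed

section \<open>The tensor valuation through pairs of tests\<close>

locale zp_filtered_pair =
 A: zp_filtered v H1 p T1 r + B: zp_filtered v H2 p T2 s
 for v :: "'e::field => ereal" and H1 :: "('x, 'm) monoid_scheme" and H2 :: "('y, 'n) monoid_scheme"
  and p :: nat and T1 :: "'x topology" and T2 :: "'y topology" and r s :: real
begin

abbreviation "vge \<equiv> A.vge"
abbreviation "C1 \<equiv> Cr p v H1 T1 r"
abbreviation "C2 \<equiv> Cr p v H2 T2 s"
abbreviation "w1 \<equiv> Cr_val p v H1 r"
abbreviation "w2 \<equiv> Cr_val p v H2 s"

definition tev2 :: "'x test => 'y test => ('x \<times> 'y => 'e) => 'e" where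
 "tev2 a b F = tev a (%x. tev b (%y. F (x, y)))"

text \<open>The candidate for the tensor valuation that is read off from values: two
  \<open>Diff\<close> tests give the weighted double differences.\<close>

definition Nge :: "real => ('x \<times> 'y => 'e) => bool" where
 "Nge B F \<longleftrightarrow> (\<forall>a\<in>tests p H1. \<forall>b\<in>tests p H2. vge (B + twt r a + twt s b) (tev2 a b F))"

lemma tev2_add: "tev2 a b (%z. F z + G z) = tev2 a b F + tev2 a b G" by (simp add: tev2_def tev_add)

lemma tev2_diff: "tev2 a b (%z. F z - G z) = tev2 a b F - tev2 a b G" by (simp add: tev2_def tev_diff)

lemma tev2_scale: "tev2 a b (%z. c * F z) = c * tev2 a b F" by (simp add: tev2_def tev_mult_left)

lemma tev2_tensor: "tev2 a b (tensor_sum n f g) = (\<Sum>i<n. tev a (f i) * tev b (g i))"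
 by (simp add: tev2_def tensor_sum_def tev_sum tev_mult_left tev_mult_right)

lemma Nge_add: "Nge B F ==> Nge B G ==> Nge B (%z. F z + G z)"
 unfolding Nge_def by (auto simp: tev2_add intro: A.vge_add)

lemma Nge_diff: "Nge B F ==> Nge B G ==> Nge B (%z. F z - G z)"
 unfolding Nge_def by (auto simp: tev2_diff intro: A.vge_diff)

lemma Nge_scale: "Nge B F ==> vge D c ==> Nge (B + D) (%z. c * F z)" unfolding Nge_def tev2_scale
proof (intro ballI)
 fix a b assume h: "\<forall>a\<in>tests p H1. \<forall>b\<in>tests p H2. vge (B + twt r a + twt s b) (tev2 a b F)"
  "vge D c" "a : tests p H1" "b : tests p H2"
 then have "vge (D + (B + twt r a + twt s b)) (c * tev2 a b F)" by (intro A.vge_mult) auto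
 then show "vge (B + D + twt r a + twt s b) (c * tev2 a b F)" by (simp add: algebra_simps)
qed

lemma Nge_mono: "Nge B F ==> B' <= B ==> Nge B' F" unfolding Nge_def by (meson A.vge_mono add_right_mono)

lemma Nge_less: assumes "!!B'. B' < B ==> Nge B' F" shows "Nge B F" unfolding Nge_def
proof (intro ballI)
 fix a b assume h: "a : tests p H1" "b : tests p H2"
 show "vge (B + twt r a + twt s b) (tev2 a b F)"
 proof (rule A.vge_less)
  fix B' assume "B' < B + twt r a + twt s b"
  then have "Nge (B' - twt r a - twt s b) F" by (intro assms) simp
  then show "vge B' (tev2 a b F)" using h unfolding Nge_def by fastforce
 qed
qed

text \<open>A presentation that attains the bound. This is a priori stronger than a bound on the
  supremum in \<open>tensor_val\<close>, and the empty sum presents zero at every bound.\<close>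

definition TR :: "real => ('x \<times> 'y => 'e) => bool" where
 "TR B F \<longleftrightarrow> (\<exists>n f g. (\<forall>i<n. f i : C1 & g i : C2 & ereal B <= w1 (f i) + w2 (g i)) & F = tensor_sum n f g)"

lemma TR_tensor_val: assumes "TR B F" shows "ereal B <= tensor_val C1 w1 C2 w2 F"
proof -
 obtain n f g where *: "\<forall>i<n. f i : C1 & g i : C2 & ereal B <= w1 (f i) + w2 (g i)" "F = tensor_sum n f g"
  using assms unfolding TR_def by blast
 have "ereal B <= (INF i\<in>{..<n}. w1 (f i) + w2 (g i))" using * by (intro INF_greatest) auto
 also have "\<dots> <= tensor_val C1 w1 C2 w2 F" unfolding tensor_val_def by (rule Sup_upper) (use * in blast)
 finally show ?thesis .
qed

text \<open>\<open>Cr_val_iff\<close> speaks of real bounds only, so a factor of infinite valuation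
  is treated apart: all its tests vanish.\<close>

lemma vge_tensor_term:
 assumes "ereal B <= w1 f + w2 g" "a : tests p H1" "b : tests p H2"
 shows "vge (B + twt r a + twt s b) (tev a f * tev b g)"
proof -
 have z1: "tev a f = 0" if w: "w1 f = \<infinity>"
 proof (rule A.vge_all)
  fix C
  have "ereal (C - twt r a) <= w1 f" using w by simp
  then show "vge C (tev a f)" using assms(2) unfolding A.Cr_val_iff by fastforce
 qed
 have z2: "tev b g = 0" if w: "w2 g = \<infinity>"
 proof (rule A.vge_all)
  fix C
  have "ereal (C - twt s b) <= w2 g" using w by simp
  then show "vge C (tev b g)" using assms(3) unfolding B.Cr_val_iff by fastforce
 qed
 consider "w1 f = \<infinity>" | "w2 g = \<infinity>" | b1 b2 where "w1 f = ereal b1" "w2 g = ereal b2"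
  using assms(1) by (cases "w1 f"; cases "w2 g") auto
 then show ?thesis
 proof cases
  case 3
  then have "vge (b1 + twt r a) (tev a f)" "vge (b2 + twt s b) (tev b g)"
   using A.Cr_val_iff[of b1 f] B.Cr_val_iff[of b2 g] assms(2,3) by auto
  then have "vge (b1 + twt r a + (b2 + twt s b)) (tev a f * tev b g)" by (rule A.vge_mult)
  moreover have "B + twt r a + twt s b <= b1 + twt r a + (b2 + twt s b)" using 3 assms(1) by simp
  ultimately show ?thesis by (rule A.vge_mono)
 qed (use z1 z2 in auto)
qed

lemma TR_Nge: "TR B F ==> Nge B F"
 unfolding TR_def Nge_def by (auto simp: tev2_tensor intro!: A.vge_sum vge_tensor_term)

lemma tensor_val_Nge: assumes "ereal B <= tensor_val C1 w1 C2 w2 F" shows "Nge B F"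
proof (rule Nge_less)
 fix B' assume "B' < B"
 then have "ereal B' < ereal B" by simp
 then have "ereal B' < tensor_val C1 w1 C2 w2 F" using assms by (rule less_le_trans)
 then obtain a where a: "a : {INF i\<in>{..<n}. w1 (f i) + w2 (g i) | n f g.
  (\<forall>i<n. f i : C1 & g i : C2) & F = tensor_sum n f g}" "ereal B' < a"
  unfolding tensor_val_def less_Sup_iff by (elim bexE)
 from a(1) obtain n f g where "a = (INF i\<in>{..<n}. w1 (f i) + w2 (g i))"
  "\<forall>i<n. f i : C1 & g i : C2" "F = tensor_sum n f g" by (elim CollectE exE conjE)
 then have *: "\<forall>i<n. f i : C1 & g i : C2" "F = tensor_sum n f g"
  "ereal B' < (INF i\<in>{..<n}. w1 (f i) + w2 (g i))" using a(2) by simp_all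
 have "ereal B' <= w1 (f i) + w2 (g i)" if "i < n" for i
 proof -
  have "(INF i\<in>{..<n}. w1 (f i) + w2 (g i)) <= w1 (f i) + w2 (g i)" by (rule INF_lower) (use that in simp)
  then show ?thesis using *(3) by (simp add: order.strict_implies_order less_le_trans)
 qed
 then have "TR B' F" using *(1,2) unfolding TR_def by blast
 then show "Nge B' F" by (rule TR_Nge)
qed

lemma TR_add: assumes "TR B F" "TR B G" shows "TR B (%z. F z + G z)"
proof -
 obtain n f g where 1: "\<forall>i<n. f i : C1 & g i : C2 & ereal B <= w1 (f i) + w2 (g i)" "F = tensor_sum n f g"
  using assms unfolding TR_def by blast
 obtain m f' g' where 2: "\<forall>i<m. f' i : C1 & g' i : C2 & ereal B <= w1 (f' i) + w2 (g' i)" "G = tensor_sum m f' g'"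
  using assms unfolding TR_def by blast
 show ?thesis unfolding TR_def by (intro exI[of _ "n + m"] exI[of _ "%i. if i < n then f i else f' (i - n)"]
    exI[of _ "%i. if i < n then g i else g' (i - n)"] conjI)
   (use 1 2 in \<open>auto simp: tensor_sum_add\<close>)
qed

lemma TR_zero: "TR B (%z. 0)" unfolding TR_def by (intro exI[of _ 0]) (auto simp: tensor_sum_def)

lemma TR_sum: "finite I ==> (!!i. i : I ==> TR B (F i)) ==> TR B (%z. \<Sum>i\<in>I. F i z)"
 by (induction I rule: finite_induct) (auto intro: TR_add TR_zero)

lemma TR_single: "f : C1 ==> g : C2 ==> ereal B <= w1 f + w2 g ==> TR B (%(x, y). f x * g y)"
 unfolding TR_def by (intro exI[of _ 1] exI[of _ "%_. f"] exI[of _ "%_. g"]) (auto simp: tensor_sum_def)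

lemma TR_alg: "TR B F ==> F : alg_tensor C1 C2" unfolding TR_def alg_tensor_def by blast

lemma alg_diff: assumes "F : alg_tensor C1 C2" "G : alg_tensor C1 C2"
 shows "(%z. F z - G z) : alg_tensor C1 C2"
proof -
 obtain n f g where 1: "\<forall>i<n. f i : C1 & g i : C2" "F = tensor_sum n f g"
  using assms unfolding alg_tensor_def by blast
 obtain m f' g' where 2: "\<forall>i<m. f' i : C1 & g' i : C2" "G = tensor_sum m f' g'"
  using assms unfolding alg_tensor_def by blast
 have "\<forall>i<m. (%x. - f' i x) : C1" using 2 A.Cr_scale[of _ "-1"] by fastforce
 then show ?thesis unfolding alg_tensor_def
  by (intro CollectI exI[of _ "n + m"] exI[of _ "%i. if i < n then f i else (%x. - f' (i - n) x)"]
    exI[of _ "%i. if i < n then g i else g' (i - n)"] conjI)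
   (use 1 2 in \<open>auto simp: tensor_sum_diff\<close>)
qed

lemma alg_outside: "F : alg_tensor C1 C2 ==> z \<notin> carrier H1 \<times> carrier H2 ==> F z = 0"
 unfolding alg_tensor_def tensor_sum_def by (cases z) (auto simp: A.Cr_iff B.Cr_iff)

text \<open>Only the first variable is expanded: for \<open>c\<close> a representative modulo \<open>p\<^sup>m\<close>, the second factor
 \<open>dif m F(\<cdot>, y) c\<close> has valuation at least \<open>B + r (m - 1)\<close>, which compensates that of \<open>ind m c\<close>.\<close>

lemma Nge_TR: assumes F: "F : alg_tensor C1 C2" and N: "Nge B F" shows "TR B F"
proof -
 obtain n f g where fg: "\<forall>i<n. f i : C1 & g i : C2" "F = tensor_sum n f g"
  using F unfolding alg_tensor_def by blast
 \<comment> \<open>Truncating a first factor changes the function by a tensor that already meets the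
   bound, because the valuation of the second factor is bounded below.\<close>
 have "\<exists>L. TR B (%(x, y). (f i x - A.trunc L (f i) x) * g i y)" if i: "i < n" for i
 proof -
  obtain b where b: "ereal b <= w2 (g i)" using B.Cr_bounded fg i by blast
  obtain L where L: "ereal (B - b) <= w1 (%x. f i x - A.trunc L (f i) x)" using A.Cr_val_diff_trunc fg i by blast
  have "ereal (B - b) + ereal b <= w1 (%x. f i x - A.trunc L (f i) x) + w2 (g i)" using L b by (rule add_mono)
  then have "TR B (%(x, y). (f i x - A.trunc L (f i) x) * g i y)"
   using fg i by (intro TR_single A.Cr_diff A.trunc_Cr) auto
  then show ?thesis by blast
 qed
 then obtain L where L: "!!i. i < n ==> TR B (%(x, y). (f i x - A.trunc (L i) (f i) x) * g i y)" by metis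
 define R where "R = (%z. \<Sum>i<n. (%(x, y). (f i x - A.trunc (L i) (f i) x) * g i y) z)"
 have R: "TR B R" unfolding R_def by (rule TR_sum) (use L in auto)
 define D where "D = (%(x, y). \<Sum>i<n. A.trunc (L i) (f i) x * g i y)"
 have FRD: "F z = R z + D z" for z
  by (cases z) (simp add: fg R_def D_def tensor_sum_def sum.distrib[symmetric] algebra_simps)
 have ND: "Nge B D"
 proof -
  have "D = (%z. F z - R z)" using FRD by auto
  then show ?thesis using Nge_diff[OF N TR_Nge[OF R]] by simp
 qed
 \<comment> \<open>A common level: at \<open>M\<close> all truncated first factors are constant on
   cosets, so D depends on x only through \<open>A.rep M x\<close>.\<close>
 define M where "M = Max (insert 0 (L ` {..<n}))"
 have LM: "L i <= M" if "i < n" for i unfolding M_def by (rule Max_ge) (use that in auto)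
 have Dc: "D (x, y) = D (A.rep M x, y)" if x: "x : carrier H1" for x y
 proof -
  have "A.trunc (L i) (f i) (A.rep M x) = A.trunc (L i) (f i) x" if "i < n" for i
   using A.rep_rep[OF x LM[OF that]] x by (simp add: A.trunc_def)
  then show ?thesis by (simp add: D_def)
 qed
 have sec: "(%y. A.dif m (%x. D (x, y)) c) : C2" for m c
 proof -
  have 1: "(%y. D (x, y)) : C2" for x
  proof -
   have "(%y. \<Sum>i\<in>I. A.trunc (L i) (f i) x * g i y) : C2" if "I \<subseteq> {..<n}" "finite I" for I
    using that(2,1) by (induction I rule: finite_induct) (auto intro!: B.Cr_add B.Cr_scale B.Cr_zero simp: fg)
   from this[of "{..<n}"] show ?thesis by (simp add: D_def)
  qed
  show ?thesis using 1 B.Cr_diff[OF 1 1] unfolding A.dif_def by (cases "m = 0") auto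
 qed
 have trm: "TR B (%(x, y). A.ind m c x * A.dif m (%x. D (x, y)) c)" if c: "c : carrier H1" for m c
 proof (rule TR_single)
  obtain t where t: "t : tests p H1" "twt r t = r * real (m - 1)" "!!f. A.dif m f c = tev t f"
   using A.dif_tev[OF c] by blast
  have "ereal (B + r * real (m - 1)) <= w2 (%y. A.dif m (%x. D (x, y)) c)" unfolding B.Cr_val_iff
  proof
   fix b assume b: "b : tests p H2"
   have "vge (B + twt r t + twt s b) (tev2 t b D)" using ND t b unfolding Nge_def by blast
   \<comment> \<open>Tests in the two variables commute, so testing the section in y is a pair test
     of D.\<close>
   moreover have "tev b (%y. A.dif m (%x. D (x, y)) c) = tev2 t b D"
    unfolding tev2_def t(3) by (cases t; cases b) (auto simp: algebra_simps)
   ultimately show "vge (B + r * real (m - 1) + twt s b) (tev b (%y. A.dif m (%x. D (x, y)) c))" using t by simp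
  qed
  then have "ereal (- (r * real (m - 1))) + ereal (B + r * real (m - 1)) \<le>
    w1 (A.ind m c) + w2 (%y. A.dif m (%x. D (x, y)) c)" by (intro add_mono A.ind_val)
  then show "ereal B <= w1 (A.ind m c) + w2 (%y. A.dif m (%x. D (x, y)) c)" by simp
 qed (auto simp: A.ind_Cr sec)
 have "D = (%z. \<Sum>m\<in>{..M}. \<Sum>c\<in>A.rep m ` carrier H1. (%(x, y). A.ind m c x * A.dif m (%x. D (x, y)) c) z)"
 proof
  fix z :: "'x \<times> 'y"
  obtain x y where z: "z = (x, y)" by force
  show "D z = (\<Sum>m\<in>{..M}. \<Sum>c\<in>A.rep m ` carrier H1. (%(x, y). A.ind m c x * A.dif m (%x. D (x, y)) c) z)"
  proof (cases "x : carrier H1")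
   case True
   then show ?thesis using Dc[OF True, of y] A.trunc_expand[OF True, of "%x. D (x, y)" M] z by simp
  next
   case False
   then show ?thesis by (simp add: z D_def A.trunc_def A.ind_def)
  qed
 qed
 moreover have "TR B (%z. \<Sum>m\<in>{..M}. \<Sum>c\<in>A.rep m ` carrier H1. (%(x, y). A.ind m c x * A.dif m (%x. D (x, y)) c) z)"
  by (intro TR_sum trm) (auto simp: A.rep_finite)
 ultimately have "TR B D" by simp
 then have "TR B (%z. R z + D z)" by (rule TR_add[OF R])
 then show ?thesis using FRD by (metis (no_types, lifting) ext)
qed

lemma tensor_val_iff: "F : alg_tensor C1 C2 ==> ereal B <= tensor_val C1 w1 C2 w2 F \<longleftrightarrow> Nge B F"
 using tensor_val_Nge Nge_TR TR_tensor_val by blast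

text \<open>A pair of tests involves at most four values, so the Cauchy estimate passes to the
  pointwise limit. The auxiliary index m depends on the pair, the resulting bound does not.\<close>

lemma approx_Nge:
 assumes "tensor_approx v C1 w1 C2 w2 T F"
 shows "\<exists>N. \<forall>n\<ge>N. Nge B (%z. F z - T n z)"
proof -
 have alg: "!!n. T n : alg_tensor C1 C2"
  and cauchy: "\<forall>B::real. \<exists>N. \<forall>m\<ge>N. \<forall>n\<ge>N. ereal B <= tensor_val C1 w1 C2 w2 (T m - T n)"
  and lim: "!!z. (%n. v (T n z - F z)) \<longlonglongrightarrow> \<infinity>"
  using assms unfolding tensor_approx_def by auto
 have ev: "eventually (%m. vge C (F z - T m z)) sequentially" for z C
  using lim[of z] unfolding A.tendsto_v_iff eventually_sequentially by (metis A.vge_diff_commute)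
 have ev2: "eventually (%m. vge C (tev2 a b (%z. F z - T m z))) sequentially" for a b C
 proof (cases a)
  case a: (Point x)
  show ?thesis
  proof (cases b)
   case (Point y)
   then show ?thesis using ev[of C "(x, y)"] a by (simp add: tev2_def)
  next
   case (Diff m y' y)
   then show ?thesis using eventually_conj[OF ev[of C "(x, y)"] ev[of C "(x, y')"]] a
    by (auto simp: tev2_def intro: A.vge_diff elim!: eventually_mono)
  qed
 next
  case a: (Diff k x' x)
  show ?thesis
  proof (cases b)
   case (Point y)
   then show ?thesis using eventually_conj[OF ev[of C "(x, y)"] ev[of C "(x', y)"]] a
    by (auto simp: tev2_def intro: A.vge_diff elim!: eventually_mono)
  next
   case (Diff m y' y)
   then show ?thesis using eventually_conj[OF eventually_conj[OF ev[of C "(x, y)"] ev[of C "(x', y)"]]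
      eventually_conj[OF ev[of C "(x, y')"] ev[of C "(x', y')"]]] a
    by (auto simp: tev2_def intro!: A.vge_diff elim!: eventually_mono)
  qed
 qed
 obtain N where N: "\<forall>m\<ge>N. \<forall>n\<ge>N. ereal B <= tensor_val C1 w1 C2 w2 (T m - T n)"
  using cauchy by blast
 have "Nge B (%z. F z - T n z)" if n: "n >= N" for n unfolding Nge_def
 proof (intro ballI)
  fix a b assume ab: "a : tests p H1" "b : tests p H2"
  let ?C = "B + twt r a + twt s b"
  have "eventually (%m. vge ?C (tev2 a b (%z. F z - T m z)) & m >= N) sequentially"
   using ev2 eventually_ge_at_top by (rule eventually_conj)
  then obtain m where m: "vge ?C (tev2 a b (%z. F z - T m z))" "m >= N"
   by (metis (mono_tags, lifting) eventually_happens sequentially_bot)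
  have "Nge B (T m - T n)" using N m n by (intro tensor_val_Nge) auto
  then have "vge ?C (tev2 a b (%z. T m z - T n z))" using ab unfolding Nge_def fun_diff_def by blast
  then have "vge ?C (tev2 a b (%z. F z - T m z) + tev2 a b (%z. T m z - T n z))" using m by (intro A.vge_add)
  then show "vge ?C (tev2 a b (%z. F z - T n z))" by (simp add: tev2_diff)
 qed
 then show ?thesis by blast
qed

text \<open>Sequences disappear: the completion consists of the functions approximable in the sense
  of \<open>Nge\<close>. This is possible because the valuation is determined by values, so a limit
  is determined by its function.\<close>

lemma completed_iff: "F : completed_tensor v C1 w1 C2 w2 \<longleftrightarrow>
  (\<forall>z. z \<notin> carrier H1 \<times> carrier H2 --> F z = 0) & (\<forall>B. \<exists>D\<in>alg_tensor C1 C2. Nge B (%z. F z - D z))"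
proof
 assume "F : completed_tensor v C1 w1 C2 w2"
 then obtain T where T: "tensor_approx v C1 w1 C2 w2 T F" unfolding completed_tensor_def by blast
 then have alg: "!!n. T n : alg_tensor C1 C2" and lim: "!!z. (%n. v (T n z - F z)) \<longlonglongrightarrow> \<infinity>"
  unfolding tensor_approx_def by auto
 have "F z = 0" if z: "z \<notin> carrier H1 \<times> carrier H2" for z
 proof (rule A.vge_all)
  fix B
  obtain n where "vge B (T n z - F z)" using lim[of z] unfolding A.tendsto_v_iff by blast
  then show "vge B (F z)" using alg_outside[OF alg z] by simp
 qed
 moreover have "\<exists>D\<in>alg_tensor C1 C2. Nge B (%z. F z - D z)" for B
  using approx_Nge[OF T, of B] alg by blast
 ultimately show "(\<forall>z. z \<notin> carrier H1 \<times> carrier H2 --> F z = 0) &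
  (\<forall>B. \<exists>D\<in>alg_tensor C1 C2. Nge B (%z. F z - D z))" by blast
next
 assume *: "(\<forall>z. z \<notin> carrier H1 \<times> carrier H2 --> F z = 0) &
  (\<forall>B. \<exists>D\<in>alg_tensor C1 C2. Nge B (%z. F z - D z))"
 then have "\<forall>n. \<exists>D. D : alg_tensor C1 C2 & Nge (real n) (%z. F z - D z)" by blast
 from choice[OF this] obtain T where T: "!!n. T n : alg_tensor C1 C2"
  "!!n. Nge (real n) (%z. F z - T n z)" by blast
 have TB: "Nge B (%z. F z - T n z)" if "n >= nat \<lceil>B\<rceil>" for B n
  using Nge_mono[OF T(2)[of n], of B] that by (simp add: nat_ceiling_le_eq)
 have "tensor_approx v C1 w1 C2 w2 T F" unfolding tensor_approx_def
 proof (intro conjI allI)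
  fix B :: real
  have "ereal B <= tensor_val C1 w1 C2 w2 (T m - T n)" if "m >= nat \<lceil>B\<rceil>" "n >= nat \<lceil>B\<rceil>" for m n
  proof -
   have "Nge B (%z. (F z - T n z) - (F z - T m z))" using that by (intro Nge_diff[OF TB TB])
   then have "Nge B (%z. T m z - T n z)" by simp
   then show ?thesis using tensor_val_iff[OF alg_diff[OF T(1) T(1)], of B m n] by (simp add: fun_diff_def)
  qed
  then show "\<exists>N. \<forall>m\<ge>N. \<forall>n\<ge>N. ereal B <= tensor_val C1 w1 C2 w2 (T m - T n)" by blast
 next
  fix z
  show "(%n. v (T n z - F z)) \<longlonglongrightarrow> \<infinity>" unfolding A.tendsto_v_iff
  proof
   fix B
   have "vge B (T n z - F z)" if n: "n >= nat \<lceil>B\<rceil>" for n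
   proof (cases "z : carrier H1 \<times> carrier H2")
    case True
    then obtain x y where z: "z = (x, y)" "x : carrier H1" "y : carrier H2" by auto
    have "vge (B + twt r (Point x) + twt s (Point y)) (tev2 (Point x) (Point y) (%z. F z - T n z))"
     using TB[OF n] z unfolding Nge_def tests_def by blast
    then show ?thesis using z A.vge_diff_commute by (simp add: tev2_def)
   next
    case False
    then have "F z = 0" using * by blast
    then show ?thesis using alg_outside[OF T(1) False] by simp
   qed
   then show "\<exists>N. \<forall>n\<ge>N. vge B (T n z - F z)" by blast
  qed
 qed (rule T)
 then show "F : completed_tensor v C1 w1 C2 w2" unfolding completed_tensor_def by blast
qed

text \<open>The tensor product valuation of an approximating sequence converges to the supremum of the
 \<open>B\<close> with \<open>Nge B F\<close>; so the definite description in the valuation denotes that supremum.\<close>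

lemma completed_val_iff:
 assumes F: "F : completed_tensor v C1 w1 C2 w2"
 shows "ereal B <= completed_tensor_val v C1 w1 C2 w2 F \<longleftrightarrow> Nge B F"
proof -
 define N where "N = Sup {ereal B | B. Nge B F}"
 have N: "ereal B <= N \<longleftrightarrow> Nge B F" for B
 proof
  assume h: "ereal B <= N"
  show "Nge B F"
  proof (rule Nge_less)
   fix B' assume "B' < B"
   then have "ereal B' < ereal B" by simp
   then have "ereal B' < N" using h by (rule less_le_trans)
   then obtain C where "ereal B' < ereal C" "Nge C F" unfolding N_def less_Sup_iff by auto
   then show "Nge B' F" using Nge_mono by simp
  qed
 qed (auto simp: N_def intro: Sup_upper)
 have lim: "(%n. tensor_val C1 w1 C2 w2 (T n)) \<longlonglongrightarrow> N" if T: "tensor_approx v C1 w1 C2 w2 T F" for T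
 proof -
  have alg: "!!n. T n : alg_tensor C1 C2" using T unfolding tensor_approx_def by auto
  \<comment> \<open>Once T n is within B of F, the ultrametric inequality makes the bound B
    equivalent for both.\<close>
  have ev: "eventually (%n. Nge B F \<longleftrightarrow> ereal B <= tensor_val C1 w1 C2 w2 (T n)) sequentially" for B
  proof -
   obtain M where M: "\<forall>n\<ge>M. Nge B (%z. F z - T n z)" using approx_Nge[OF T] by blast
   have "Nge B F \<longleftrightarrow> Nge B (T n)" if "n >= M" for n
    using M that Nge_diff[of B F "%z. F z - T n z"] Nge_add[of B "T n" "%z. F z - T n z"] by auto
   then show ?thesis unfolding eventually_sequentially tensor_val_iff[OF alg] by blast
  qed
  show ?thesis
  proof (rule order_tendstoI)
   fix a assume "a < N"
   then obtain B where B: "a < ereal B" "ereal B < N" by (metis ereal_dense2)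
   then have "Nge B F" using N[of B] by (simp add: less_imp_le)
   then show "eventually (%n. a < tensor_val C1 w1 C2 w2 (T n)) sequentially"
    using ev[of B] B(1) by (auto elim!: eventually_mono)
  next
   fix a assume "N < a"
   then obtain B where B: "N < ereal B" "ereal B < a" by (metis ereal_dense2)
   then have "~ Nge B F" using N by (simp add: not_le[symmetric] del: not_le)
   then show "eventually (%n. tensor_val C1 w1 C2 w2 (T n) < a) sequentially"
    using ev[of B] B(2) by (auto elim!: eventually_mono)
  qed
 qed
 obtain T where T: "tensor_approx v C1 w1 C2 w2 T F" using F unfolding completed_tensor_def by blast
 have "completed_tensor_val v C1 w1 C2 w2 F = N" unfolding completed_tensor_val_def
 proof (rule the_equality)
  show "\<exists>T. tensor_approx v C1 w1 C2 w2 T F & (%n. tensor_val C1 w1 C2 w2 (T n)) \<longlonglongrightarrow> N"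
   using T lim by blast
  show "c = N" if "\<exists>T. tensor_approx v C1 w1 C2 w2 T F & (%n. tensor_val C1 w1 C2 w2 (T n)) \<longlonglongrightarrow> c" for c
   using that lim LIMSEQ_unique by blast
 qed
 then show ?thesis using N by simp
qed

text \<open>One factor is truncated at a time, f g - f' g' = (f - f') g + f' (g - g'); the level for
  g is chosen after a bound for the truncated f' is known.\<close>

lemma alg_approx_level:
 assumes F: "F : alg_tensor C1 C2"
 shows "\<exists>D L. Nge B (%z. F z - D z) & (\<forall>x\<in>carrier H1. \<forall>y\<in>carrier H2. \<forall>h\<in>ppow p H1 L. \<forall>k\<in>ppow p H2 L.
  D (x \<otimes>\<^bsub>H1\<^esub> h, y \<otimes>\<^bsub>H2\<^esub> k) = D (x, y))"
proof -
 obtain n f g where fg: "\<forall>i<n. f i : C1 & g i : C2" "F = tensor_sum n f g"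
  using F unfolding alg_tensor_def by blast
 have "\<exists>q. TR B (%(x, y). f i x * g i y - A.trunc (fst q) (f i) x * B.trunc (snd q) (g i) y)" if i: "i < n" for i
 proof -
  obtain b where b: "ereal b <= w2 (g i)" using B.Cr_bounded fg i by blast
  obtain L where L: "ereal (B - b) <= w1 (%x. f i x - A.trunc L (f i) x)" using A.Cr_val_diff_trunc fg i by blast
  obtain c where c: "ereal c <= w1 (A.trunc L (f i))" using A.Cr_bounded A.trunc_Cr by blast
  obtain M where M: "ereal (B - c) <= w2 (%x. g i x - B.trunc M (g i) x)" using B.Cr_val_diff_trunc fg i by blast
  have "ereal (B - b) + ereal b <= w1 (%x. f i x - A.trunc L (f i) x) + w2 (g i)" using L b by (rule add_mono)
  then have 1: "TR B (%(x, y). (f i x - A.trunc L (f i) x) * g i y)"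
   using fg i by (intro TR_single A.Cr_diff A.trunc_Cr) auto
  have "ereal c + ereal (B - c) <= w1 (A.trunc L (f i)) + w2 (%x. g i x - B.trunc M (g i) x)"
   using c M by (rule add_mono)
  then have 2: "TR B (%(x, y). A.trunc L (f i) x * (g i y - B.trunc M (g i) y))"
   using fg i by (intro TR_single B.Cr_diff A.trunc_Cr B.trunc_Cr) auto
  have "TR B (%(x, y). f i x * g i y - A.trunc L (f i) x * B.trunc M (g i) y)"
   using TR_add[OF 1 2] by (simp add: case_prod_beta' algebra_simps)
  then show ?thesis by (intro exI[of _ "(L, M)"]) simp
 qed
 then have "\<forall>i. \<exists>q. i < n --> TR B (%(x, y). f i x * g i y - A.trunc (fst q) (f i) x * B.trunc (snd q) (g i) y)"
  by blast
 from choice[OF this] obtain L where L: "!!i. i < n ==>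
   TR B (%(x, y). f i x * g i y - A.trunc (fst (L i)) (f i) x * B.trunc (snd (L i)) (g i) y)" by blast
 define D where "D = (%(x, y). \<Sum>i<n. A.trunc (fst (L i)) (f i) x * B.trunc (snd (L i)) (g i) y)"
 have "TR B (%z. \<Sum>i<n. (%(x, y). f i x * g i y - A.trunc (fst (L i)) (f i) x * B.trunc (snd (L i)) (g i) y) z)"
  by (rule TR_sum) (use L in auto)
 moreover have "(%z. \<Sum>i<n. (%(x, y). f i x * g i y - A.trunc (fst (L i)) (f i) x * B.trunc (snd (L i)) (g i) y) z)
   = (%z. F z - D z)" by (auto simp: fg D_def tensor_sum_def sum_subtractf)
 ultimately have N: "Nge B (%z. F z - D z)" using TR_Nge by simp
 define M where "M = Max (insert 0 ((%i. max (fst (L i)) (snd (L i))) ` {..<n}))"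
 have LM: "fst (L i) <= M" "snd (L i) <= M" if "i < n" for i
 proof -
  have "max (fst (L i)) (snd (L i)) <= M" unfolding M_def by (rule Max_ge) (use that in auto)
  then show "fst (L i) <= M" "snd (L i) <= M" by auto
 qed
 have "D (x \<otimes>\<^bsub>H1\<^esub> h, y \<otimes>\<^bsub>H2\<^esub> k) = D (x, y)"
  if "x : carrier H1" "y : carrier H2" "h : ppow p H1 M" "k : ppow p H2 M" for x y h k
 proof -
  have "A.trunc (fst (L i)) (f i) (x \<otimes>\<^bsub>H1\<^esub> h) * B.trunc (snd (L i)) (g i) (y \<otimes>\<^bsub>H2\<^esub> k) =
    A.trunc (fst (L i)) (f i) x * B.trunc (snd (L i)) (g i) y" if i: "i < n" for i
   using A.trunc_level[OF \<open>x : carrier H1\<close> A.K_mono[OF LM(1)[OF i] \<open>h : ppow p H1 M\<close>]]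
    B.trunc_level[OF \<open>y : carrier H2\<close> B.K_mono[OF LM(2)[OF i] \<open>k : ppow p H2 M\<close>]] by simp
  then show ?thesis by (simp add: D_def)
 qed
 then show ?thesis using N by blast
qed

text \<open>A function constant at level L in x is the sum, over representatives c of the finitely
  many cosets, of \<open>ind L c\<close> times its section at c.\<close>

lemma section_alg:
 assumes out: "!!z. z \<notin> carrier H1 \<times> carrier H2 ==> F z = 0"
  and lev: "!!x h y. x : carrier H1 ==> h : ppow p H1 L ==> y : carrier H2 ==> F (x \<otimes>\<^bsub>H1\<^esub> h, y) = F (x, y)"
  and sec: "!!c. c : carrier H1 ==> (%y. F (c, y)) : C2"
 shows "F : alg_tensor C1 C2"
proof -
 have "TR B (%(x, y). A.ind L c x * F (c, y))" if "c : carrier H1" "ereal B <= w1 (A.ind L c) + w2 (%y. F (c, y))" for c B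
  using that sec A.ind_Cr by (intro TR_single) auto
 moreover have "\<exists>B. ereal B <= w1 (A.ind L c) + w2 (%y. F (c, y))" if c: "c : carrier H1" for c
 proof -
  obtain b where "ereal b <= w2 (%y. F (c, y))" using B.Cr_bounded sec[OF c] by blast
  then have "ereal (- (r * real (L - 1))) + ereal b <= w1 (A.ind L c) + w2 (%y. F (c, y))"
   by (intro add_mono A.ind_val)
  then show ?thesis by auto
 qed
 ultimately have *: "\<forall>c. \<exists>B. c : carrier H1 --> TR B (%(x, y). A.ind L c x * F (c, y))" by blast
 from choice[OF *] obtain b where
  b: "!!c. c : carrier H1 ==> TR (b c) (%(x, y). A.ind L c x * F (c, y))" by blast
 define B where "B = Min (insert 0 (b ` A.rep L ` carrier H1))"
 have "TR B (%(x, y). A.ind L c x * F (c, y))" if c: "c : A.rep L ` carrier H1" for c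
 proof -
  have "B <= b c" unfolding B_def using c A.rep_finite by (intro Min_le) auto
  then have "ereal B <= ereal (b c)" by simp
  moreover have "TR (b c) (%(x, y). A.ind L c x * F (c, y))" using b c by auto
  ultimately show ?thesis unfolding TR_def using order_trans by blast
 qed
 then have "TR B (%z. \<Sum>c\<in>A.rep L ` carrier H1. (%(x, y). A.ind L c x * F (c, y)) z)"
  using A.rep_finite by (intro TR_sum) auto
 moreover have "(%z. \<Sum>c\<in>A.rep L ` carrier H1. (%(x, y). A.ind L c x * F (c, y)) z) = F"
 proof
  fix z :: "'x \<times> 'y"
  obtain x y where z: "z = (x, y)" by force
  show "(\<Sum>c\<in>A.rep L ` carrier H1. (%(x, y). A.ind L c x * F (c, y)) z) = F z"
  proof (cases "x : carrier H1")
   case x: True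
   then have "(\<Sum>c\<in>A.rep L ` carrier H1. (%(x, y). A.ind L c x * F (c, y)) z) = F (A.rep L x, y)"
    using A.sum_ind[OF x, of L "%c. F (c, y)"] z by simp
   also have "\<dots> = F z"
   proof (cases "y : carrier H2")
    case True
    then show ?thesis using A.rep_ex[OF x, of L] lev[OF x] z by auto
   qed (use out z in auto)
   finally show ?thesis .
  next
   case False
   then show ?thesis using z out by (simp add: A.ind_def)
  qed
 qed
 ultimately show ?thesis using TR_alg by simp
qed

end

section \<open>Compact groups with a basis of open subgroups\<close>

text \<open>The inverse limit enters the functional analysis through this interface: subgroups
  \<open>U n\<close> whose cosets define the topology, linearly ordered so that finitely many levels
  have a common refinement.\<close>

locale level_group = comm_group G
 for G :: "'g monoid" (structure) +
 fixes T :: "'g topology" and U :: "nat => 'g set"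
 assumes U_sub: "subgroup (U n) G" and U_anti: "m <= n ==> U n \<subseteq> U m"
  and openin_iff: "openin T S \<longleftrightarrow> S \<subseteq> carrier G & (\<forall>x\<in>S. \<exists>n. \<forall>u\<in>U n. x \<otimes> u : S)"
  and compact: "compact_space T"
begin

lemma U_carrier: "u : U n ==> u : carrier G" using subgroup.subset[OF U_sub] by blast

lemma topspace_T: "topspace T = carrier G"
proof
 show "topspace T \<subseteq> carrier G" using openin_topspace[of T] unfolding openin_iff by blast
 have "openin T (carrier G)" unfolding openin_iff using U_carrier by auto
 then show "carrier G \<subseteq> topspace T" by (rule openin_subset)
qed

lemma coset_openin:
 assumes V: "subgroup V G" "U n \<subseteq> V" and x: "x : carrier G"
 shows "openin T ((%k. x \<otimes> k) ` V)"
proof -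
 have Vc: "V \<subseteq> carrier G" using V subgroup.subset by blast
 have "\<exists>n. \<forall>u\<in>U n. y \<otimes> u : (%k. x \<otimes> k) ` V" if y: "y : (%k. x \<otimes> k) ` V" for y
 proof (intro exI[of _ n] ballI)
  fix u assume u: "u : U n"
  obtain k where k: "k : V" "y = x \<otimes> k" using y by blast
  then have "y \<otimes> u = x \<otimes> (k \<otimes> u)" using x Vc u U_carrier by (auto simp: m_assoc)
  moreover have "k \<otimes> u : V" using subgroup.m_closed[OF V(1) k(1)] u V by blast
  ultimately show "y \<otimes> u : (%k. x \<otimes> k) ` V" by blast
 qed
 then show ?thesis unfolding openin_iff using x Vc by auto
qed

lemma finite_subcover:
 assumes op: "!!x. x : carrier G ==> openin T (W x)" and mem: "!!x. x : carrier G ==> x : W x"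
 shows "\<exists>X. finite X & X \<subseteq> carrier G & carrier G \<subseteq> (\<Union>x\<in>X. W x)"
proof -
 have "topspace T \<subseteq> \<Union>(W ` carrier G)" using mem topspace_T by auto
 then have "\<exists>\<F>. finite \<F> & \<F> \<subseteq> W ` carrier G & topspace T \<subseteq> \<Union>\<F>"
  using compact op unfolding compact_space_def compactin_def by (metis imageE)
 then obtain \<F> where "finite \<F>" "\<F> \<subseteq> W ` carrier G" "carrier G \<subseteq> \<Union>\<F>"
  using topspace_T by auto
 moreover obtain X where "X \<subseteq> carrier G" "finite X" "\<F> = W ` X"
  using finite_subset_image[OF \<open>finite \<F>\<close> \<open>\<F> \<subseteq> W ` carrier G\<close>] by blast
 ultimately show ?thesis by blast
qed

lemma finite_index:
 assumes V: "subgroup V G" "U n \<subseteq> V"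
 shows "\<exists>X. finite X & X \<subseteq> carrier G & (\<forall>x\<in>carrier G. \<exists>a\<in>X. \<exists>k\<in>V. x = a \<otimes> k)"
proof -
 have "\<exists>X. finite X & X \<subseteq> carrier G & carrier G \<subseteq> (\<Union>x\<in>X. (%k. x \<otimes> k) ` V)"
 proof (rule finite_subcover)
  fix x assume x: "x : carrier G"
  show "openin T ((%k. x \<otimes> k) ` V)" by (rule coset_openin[OF V x])
  show "x : (%k. x \<otimes> k) ` V" using x subgroup.one_closed[OF V(1)] by (intro image_eqI[of _ _ \<one>]) auto
 qed
 then obtain X where X: "finite X" "X \<subseteq> carrier G" "carrier G \<subseteq> (\<Union>x\<in>X. (%k. x \<otimes> k) ` V)" by (elim exE conjE)
 have "\<exists>a\<in>X. \<exists>k\<in>V. x = a \<otimes> k" if "x : carrier G" for x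
  using subsetD[OF X(3) that] by auto
 then show ?thesis using X by (intro exI[of _ X]) simp
qed

lemma LC_I:
 assumes "!!x. x \<notin> carrier G ==> ph x = 0"
  and "!!x. x : carrier G ==> \<exists>n. \<forall>u\<in>U n. ph (x \<otimes> u) = ph x"
 shows "ph : LC T" unfolding LC_def topspace_T
proof (intro CollectI conjI allI impI ballI)
 fix x assume x: "x : carrier G"
 then obtain n where n: "\<forall>u\<in>U n. ph (x \<otimes> u) = ph x" using assms(2) by blast
 show "\<exists>V. openin T V & x : V & (\<forall>y\<in>V. ph y = ph x)"
  using coset_openin[OF U_sub order.refl x, of n] n x subgroup.one_closed[OF U_sub[of n]]
  by (intro exI[of _ "(%k. x \<otimes> k) ` U n"]) (auto intro!: image_eqI[of _ _ \<one>])
qed (use assms in auto)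

lemma LC_outside: "ph : LC T ==> x \<notin> carrier G ==> ph x = 0" unfolding LC_def topspace_T by blast

text \<open>Finitely many cosets of constancy, each at its own level, cover G by compactness. For N
  the largest level among them, translation by \<open>U N\<close> stays inside the coset in which a
  point lies.\<close>

lemma LC_uniform:
 assumes "ph : LC T"
 shows "\<exists>n. \<forall>x\<in>carrier G. \<forall>u\<in>U n. ph (x \<otimes> u) = ph x"
proof -
 have "\<exists>n. \<forall>u\<in>U n. ph (x \<otimes> u) = ph x" if x: "x : carrier G" for x
 proof -
  obtain V where V: "openin T V" "x : V" "\<forall>y\<in>V. ph y = ph x"
   using assms x unfolding LC_def topspace_T by blast
  then show ?thesis unfolding openin_iff by blast
 qed
 then have "\<forall>x. \<exists>n. x : carrier G --> (\<forall>u\<in>U n. ph (x \<otimes> u) = ph x)" by blast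
 from choice[OF this] obtain n where n: "!!x u. x : carrier G ==> u : U (n x) ==> ph (x \<otimes> u) = ph x" by blast
 have "\<exists>X. finite X & X \<subseteq> carrier G & carrier G \<subseteq> (\<Union>x\<in>X. (%k. x \<otimes> k) ` U (n x))"
 proof (rule finite_subcover)
  fix x assume x: "x : carrier G"
  show "openin T ((%k. x \<otimes> k) ` U (n x))" by (rule coset_openin[OF U_sub order.refl x])
  show "x : (%k. x \<otimes> k) ` U (n x)"
   using x subgroup.one_closed[OF U_sub] by (intro image_eqI[of _ _ \<one>]) auto
 qed
 then obtain X where X: "finite X" "X \<subseteq> carrier G" "carrier G \<subseteq> (\<Union>x\<in>X. (%k. x \<otimes> k) ` U (n x))"
  by blast
 define N where "N = Max (insert 0 (n ` X))"
 have nN: "n x <= N" if "x : X" for x unfolding N_def by (rule Max_ge) (use X that in auto)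
 have "ph (y \<otimes> u) = ph y" if y: "y : carrier G" and u: "u : U N" for y u
 proof -
  obtain x k where x: "x : X" "k : U (n x)" "y = x \<otimes> k" using X y by blast
  have u': "u : U (n x)" using U_anti[OF nN[OF x(1)]] u by blast
  have xc: "x : carrier G" using x X by blast
  have "y \<otimes> u = x \<otimes> (k \<otimes> u)" using x xc u U_carrier by (simp add: m_assoc)
  moreover have "k \<otimes> u : U (n x)" using subgroup.m_closed[OF U_sub x(2) u'] .
  ultimately show ?thesis using n[OF xc] x by simp
 qed
 then show ?thesis by blast
qed

lemma LC_add: assumes "ph : LC T" "\<psi> : LC T" shows "(%x. ph x + \<psi> x :: 'e::monoid_add) : LC T"
proof (rule LC_I)
 obtain m n where *: "\<forall>x\<in>carrier G. \<forall>u\<in>U m. ph (x \<otimes> u) = ph x" "\<forall>x\<in>carrier G. \<forall>u\<in>U n. \<psi> (x \<otimes> u) = \<psi> x"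
  using LC_uniform assms by meson
 fix x assume "x : carrier G"
 moreover have "U (max m n) \<subseteq> U m \<inter> U n" using U_anti[of m "max m n"] U_anti[of n "max m n"] by simp
 ultimately have "ph (x \<otimes> u) + \<psi> (x \<otimes> u) = ph x + \<psi> x" if "u : U (max m n)" for u
  using * that by (simp add: subset_iff)
 then show "\<exists>n. \<forall>u\<in>U n. ph (x \<otimes> u) + \<psi> (x \<otimes> u) = ph x + \<psi> x" by blast
qed (simp add: LC_outside[OF assms(1)] LC_outside[OF assms(2)])

lemma LC_scale: assumes "ph : LC T" shows "(%x. c * ph x :: 'e::mult_zero) : LC T"
proof (rule LC_I)
 obtain m where "\<forall>x\<in>carrier G. \<forall>u\<in>U m. ph (x \<otimes> u) = ph x"
  using LC_uniform assms by meson
 then show "\<exists>n. \<forall>u\<in>U n. c * ph (x \<otimes> u) = c * ph x" if "x : carrier G" for x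
  using that by (intro exI[of _ m]) simp
qed (simp add: LC_outside[OF assms])

lemma LC_zero: "(%x. 0) : LC T" by (rule LC_I) auto

lemma LC_sum: "finite I ==> (!!i. i : I ==> ph i : LC T) ==> (%x. \<Sum>i\<in>I. ph i x :: 'e::comm_monoid_add) : LC T"
 by (induction I rule: finite_induct) (auto intro: LC_zero LC_add)

lemma subgroup_comm_group: assumes "subgroup H G" shows "comm_group (G\<lparr>carrier := H\<rparr>)"
proof (rule group.group_comm_groupI)
 show "group (G\<lparr>carrier := H\<rparr>)" by (rule subgroup_imp_group[OF assms])
 show "x \<otimes>\<^bsub>G\<lparr>carrier := H\<rparr>\<^esub> y = y \<otimes>\<^bsub>G\<lparr>carrier := H\<rparr>\<^esub> x"
  if "x : carrier (G\<lparr>carrier := H\<rparr>)" "y : carrier (G\<lparr>carrier := H\<rparr>)" for x y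
  using that subgroup.subset[OF assms] m_comm by auto
qed

lemma ppow_subgroup: "ppow p (G\<lparr>carrier := H\<rparr>) m = (%h. h [^] (p ^ m)) ` H"
 unfolding ppow_def by (simp add: nat_pow_consistent[symmetric])

text \<open>H may fail to be open, as for the factors H1 and H2, so it is the trace of
  \<open>U n\<close> on H that is compared with the p^m-th powers.\<close>

lemma zp_filtered_subgroup:
 assumes v: "valued_field v" and H: "subgroup H G" and r: "r >= 0"
  and op: "!!m. \<exists>n. U n \<inter> H \<subseteq> ppow p (G\<lparr>carrier := H\<rparr>) m"
 shows "zp_filtered v (G\<lparr>carrier := H\<rparr>) p (subtopology T H) r"
proof -
 interpret valued_field v by (rule v)
 interpret H: comm_group "G\<lparr>carrier := H\<rparr>" by (rule subgroup_comm_group[OF H])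
 let ?K = "%m. ppow p (G\<lparr>carrier := H\<rparr>) m"
 have Hc: "H \<subseteq> carrier G" using subgroup.subset[OF H] .
 have "h [^] n : H" if "h : H" for h and n :: nat
  using H.nat_pow_closed[of h n] that by (simp add: nat_pow_consistent[symmetric])
 then have KH: "?K m \<subseteq> H" for m unfolding ppow_subgroup by (simp add: image_subset_iff)
 have Kmult: "k \<otimes> l : ?K m" if kl: "k : ?K m" "l : ?K m" for k l m
 proof -
  obtain a b where ab: "a : H" "b : H" "k = a [^] (p ^ m)" "l = b [^] (p ^ m)"
   using kl unfolding ppow_subgroup by blast
  moreover have "(a \<otimes> b) [^] (p ^ m) = a [^] (p ^ m) \<otimes> b [^] (p ^ m)"
   using ab Hc by (intro nat_pow_distrib) blast+
  ultimately have "k \<otimes> l = (a \<otimes> b) [^] (p ^ m)" by simp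
  then show ?thesis unfolding ppow_subgroup using subgroup.m_closed[OF H] ab by blast
 qed
 show ?thesis
 proof
  show "topspace (subtopology T H) = carrier (G\<lparr>carrier := H\<rparr>)" using Hc by (auto simp: topspace_T)
 next
  fix x m assume "x : carrier (G\<lparr>carrier := H\<rparr>)"
  then have x: "x : H" by simp
  obtain n where n: "U n \<inter> H \<subseteq> ?K m" using op by blast
  let ?S = "(%k. x \<otimes> k) ` ?K m"
  \<comment> \<open>Thickening S by \<open>U n\<close> gives an open set of G; it meets H in S
    alone, because two points of H that differ by \<open>U n\<close> differ by a p^m-th
    power.\<close>
  let ?O = "\<Union>y\<in>?S. (%u. y \<otimes> u) ` U n"
  have Sc: "?S \<subseteq> H" using x KH subgroup.m_closed[OF H] by blast
  have "openin T ?O" by (rule openin_clauses(3)) (use Sc Hc coset_openin[OF U_sub order.refl] in blast)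
  moreover have "?S = ?O \<inter> H"
  proof
   have "y : (%u. y \<otimes> u) ` U n" if "y : H" for y
    using that Hc subgroup.one_closed[OF U_sub] by (intro image_eqI[of _ _ \<one>]) auto
   then show "?S \<subseteq> ?O \<inter> H" using Sc by blast
   show "?O \<inter> H \<subseteq> ?S"
   proof
    fix z assume z: "z : ?O \<inter> H"
    then obtain k u where ku: "k : ?K m" "u : U n" "z = x \<otimes> k \<otimes> u" by blast
    have c: "x : carrier G" "k : H" "k : carrier G" "u : carrier G" "z : H" using x Hc KH ku U_carrier z by blast+
    have "inv (x \<otimes> k) \<otimes> z = u"
     using ku(3) c m_assoc[of "inv (x \<otimes> k)" "x \<otimes> k" u] by simp
    moreover have "inv (x \<otimes> k) \<otimes> z : H"
     using subgroup.m_closed[OF H] subgroup.m_inv_closed[OF H] x c by blast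
    ultimately have "u : ?K m" using n ku by blast
    then have "k \<otimes> u : ?K m" using Kmult ku by blast
    moreover have "z = x \<otimes> (k \<otimes> u)" using ku c by (simp add: m_assoc)
    ultimately show "z : ?S" by blast
   qed
  qed
  ultimately show "openin (subtopology T H) ((%k. x \<otimes>\<^bsub>G\<lparr>carrier := H\<rparr>\<^esub> k) ` ?K m)"
   unfolding openin_subtopology by auto
 next
  fix m
  obtain n where n: "U n \<inter> H \<subseteq> ?K m" using op by blast
  obtain X where X: "finite X" "X \<subseteq> carrier G" "\<forall>x\<in>carrier G. \<exists>a\<in>X. \<exists>k\<in>U n. x = a \<otimes> k"
   using finite_index[OF U_sub order.refl, of n] by (elim exE conjE)
  \<comment> \<open>Representatives of G modulo \<open>U n\<close> need not lie in H; those whose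
    coset meets H are moved into H.\<close>
  define h where "h a = (SOME y. y : H & (\<exists>k\<in>U n. y = a \<otimes> k))" for a
  let ?Y = "{a : X. \<exists>y. y : H & (\<exists>k\<in>U n. y = a \<otimes> k)}"
  have h: "h a : H" "\<exists>k\<in>U n. h a = a \<otimes> k" if "a : ?Y" for a
   using someI_ex[of "%y. y : H & (\<exists>k\<in>U n. y = a \<otimes> k)"] that unfolding h_def by auto
  have "\<exists>a\<in>h ` ?Y. \<exists>k\<in>?K m. x = a \<otimes> k" if x: "x : H" for x
  proof -
   obtain a k where ak: "a : X" "k : U n" "x = a \<otimes> k" using X(3) x Hc by (meson subsetD)
   then have a: "a : ?Y" using x by blast
   obtain l where l: "l : U n" "h a = a \<otimes> l" using h[OF a] by blast
   have c: "a : carrier G" "k : carrier G" "l : carrier G" using ak X l U_carrier by blast+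
   have *: "inv (h a) \<otimes> x = inv l \<otimes> k"
    using c ak(3) l(2) m_assoc[of "inv a" a k] by (simp add: inv_mult_group m_assoc)
   have "inv l \<otimes> k : U n" using subgroup.m_closed[OF U_sub] subgroup.m_inv_closed[OF U_sub] l ak by blast
   moreover have "inv (h a) \<otimes> x : H"
    using subgroup.m_closed[OF H] subgroup.m_inv_closed[OF H] h[OF a] x by blast
   ultimately have "inv (h a) \<otimes> x : ?K m" using n * by auto
   moreover have "x = h a \<otimes> (inv (h a) \<otimes> x)"
    using h(1)[OF a] x Hc m_assoc[of "h a" "inv (h a)" x] by (simp add: subset_iff)
   ultimately show ?thesis using a by blast
  qed
  moreover have "finite (h ` ?Y)" using X(1) by simp
  moreover have "h ` ?Y \<subseteq> H" using h(1) by blast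
  ultimately show "\<exists>X. finite X & X \<subseteq> carrier (G\<lparr>carrier := H\<rparr>) &
   (\<forall>x\<in>carrier (G\<lparr>carrier := H\<rparr>). \<exists>a\<in>X. \<exists>k\<in>?K m. x = a \<otimes>\<^bsub>G\<lparr>carrier := H\<rparr>\<^esub> k)"
   by (intro exI[of _ "h ` ?Y"]) simp
 qed (rule r)
qed

end

section \<open>Functionals on locally constant functions\<close>

text \<open>\<open>U_in_A\<close> takes independent levels m and n: the products of p^m-th powers of
  H1 with p^n-th powers of H2 contain neighbourhoods of the unit. Together with the opposite
  inclusions this makes the double filtration compatible with the topology.\<close>

locale two_filtrations = level_group G T U + valued_field v
 for G :: "'g monoid" (structure) and T :: "'g topology" and U :: "nat => 'g set"
  and v :: "'e::field => ereal" +
 fixes p :: nat and H1 H2 :: "'g set" and r s :: real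
 assumes H1: "subgroup H1 G" and H2: "subgroup H2 G" and H12: "H1 \<inter> H2 = {\<one>}"
  and r_nonneg: "r >= 0" and s_nonneg: "s >= 0"
  and A1_in_U: "\<exists>m. ppow p (G\<lparr>carrier := H1\<rparr>) m \<subseteq> U n"
  and A2_in_U: "\<exists>m. ppow p (G\<lparr>carrier := H2\<rparr>) m \<subseteq> U n"
  and U_in_A: "\<exists>N. \<forall>x\<in>U N. \<exists>a\<in>ppow p (G\<lparr>carrier := H1\<rparr>) m. \<exists>b\<in>ppow p (G\<lparr>carrier := H2\<rparr>) n. x = a \<otimes> b"
begin

abbreviation "A1 m \<equiv> ppow p (G\<lparr>carrier := H1\<rparr>) m"
abbreviation "A2 m \<equiv> ppow p (G\<lparr>carrier := H2\<rparr>) m"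

lemma ppow_sub: "subgroup H G ==> k : ppow p (G\<lparr>carrier := H\<rparr>) m ==> k : H"
proof -
 assume H: "subgroup H G" and k: "k : ppow p (G\<lparr>carrier := H\<rparr>) m"
 interpret H: group "G\<lparr>carrier := H\<rparr>" by (rule subgroup_imp_group[OF H])
 show "k : H" using k H.nat_pow_closed unfolding ppow_def by auto
qed

lemma H1_c: "x : H1 ==> x : carrier G" and H2_c: "x : H2 ==> x : carrier G"
 using subgroup.subset[OF H1] subgroup.subset[OF H2] by auto

lemma A1_H1: "x : A1 m ==> x : H1" and A2_H2: "x : A2 m ==> x : H2" using ppow_sub[OF H1] ppow_sub[OF H2] by auto

lemma A1_c: "x : A1 m ==> x : carrier G" and A2_c: "x : A2 m ==> x : carrier G" using A1_H1 A2_H2 H1_c H2_c by blast+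

lemma H_unique:
 assumes "h : H1" "h' : H1" "k : H2" "k' : H2" "h \<otimes> k = h' \<otimes> k'"
 shows "h = h'" "k = k'"
proof -
 have c: "h : carrier G" "h' : carrier G" "k : carrier G" "k' : carrier G" using assms H1_c H2_c by auto
 have 1: "inv h' \<otimes> (h' \<otimes> k') = k'" using c m_assoc[of "inv h'" h' k'] by simp
 have "(inv h' \<otimes> h) \<otimes> k = k'" using assms(5) 1 c by (simp add: m_assoc)
 then have "inv h' \<otimes> h = k' \<otimes> inv k" using c by (metis inv_closed inv_solve_right m_closed)
 moreover have "inv h' \<otimes> h : H1" using assms H1 by (meson subgroup.m_closed subgroup.m_inv_closed)
 moreover have "k' \<otimes> inv k : H2" using assms H2 by (meson subgroup.m_closed subgroup.m_inv_closed)
 ultimately have "inv h' \<otimes> h : H1 \<inter> H2" by simp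
 then have e: "inv h' \<otimes> h = \<one>" unfolding H12 by simp
 then show "h = h'" using c by (metis inv_closed inv_equality inv_inv)
 then show "k = k'" using assms(5) c by simp
qed

text \<open>Decompositions along H1 and H2 are unique, so an element of H1 has trivial second
  component.\<close>

lemma U_H1: "\<exists>N. U N \<inter> H1 \<subseteq> A1 m"
proof -
 obtain N where N: "\<forall>x\<in>U N. \<exists>a\<in>A1 m. \<exists>b\<in>A2 0. x = a \<otimes> b" using U_in_A[of m 0] by (elim exE)
 have "x : A1 m" if "x : U N" "x : H1" for x
 proof -
  obtain a b where ab: "a : A1 m" "b : A2 0" "x = a \<otimes> b" using N \<open>x : U N\<close> by blast
  have "x \<otimes> \<one> = a \<otimes> b" using ab H1_c \<open>x : H1\<close> by simp
  then have "x = a" using H_unique(1)[of x a \<one> b] \<open>x : H1\<close> A1_H1 A2_H2 ab subgroup.one_closed[OF H2] by blast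
  then show ?thesis using ab by simp
 qed
 then show ?thesis by blast
qed

lemma U_H2: "\<exists>N. U N \<inter> H2 \<subseteq> A2 m"
proof -
 obtain N where N: "\<forall>x\<in>U N. \<exists>a\<in>A1 0. \<exists>b\<in>A2 m. x = a \<otimes> b" using U_in_A[of 0 m] by (elim exE)
 have "x : A2 m" if "x : U N" "x : H2" for x
 proof -
  obtain a b where ab: "a : A1 0" "b : A2 m" "x = a \<otimes> b" using N \<open>x : U N\<close> by blast
  have "\<one> \<otimes> x = a \<otimes> b" using ab H2_c \<open>x : H2\<close> by simp
  then have "x = b" using H_unique(2)[of \<one> a x b] \<open>x : H2\<close> A1_H1 A2_H2 ab subgroup.one_closed[OF H1] by blast
  then show ?thesis using ab by simp
 qed
 then show ?thesis by blast
qed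

sublocale P: zp_filtered_pair v "G\<lparr>carrier := H1\<rparr>" "G\<lparr>carrier := H2\<rparr>" p
 "subtopology T H1" "subtopology T H2" r s
 by (intro zp_filtered_pair.intro zp_filtered_subgroup H1 H2 r_nonneg s_nonneg U_H1 U_H2)
  (rule valued_field_axioms)+

definition pb :: "'g => ('g => 'e) => 'g \<times> 'g => 'e" where
 "pb a f = pullback G (H1 \<times> H2) (%(h1, h2). h1 \<otimes> h2) a f"

lemma pb_apply: "x : H1 ==> y : H2 ==> pb a f (x, y) = f (a \<otimes> (x \<otimes> y))"
 by (simp add: pb_def pullback_def)

lemma pb_out: "z \<notin> H1 \<times> H2 ==> pb a f z = 0" by (simp add: pb_def pullback_def)

lemma pb_add: "pb a (%x. f x + g x) = (%z. pb a f z + pb a g z)"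
 and pb_diff: "pb a (%x. f x - g x) = (%z. pb a f z - pb a g z)"
 and pb_scale: "pb a (%x. c * f x) = (%z. c * pb a f z)" by (auto simp: pb_def pullback_def)

abbreviation "CT \<equiv> completed_tensor v P.C1 P.w1 P.C2 P.w2"

lemma CrsG_iff: "f : CrsG p v G T H1 H2 r s \<longleftrightarrow>
  (\<forall>x. x \<notin> carrier G --> f x = 0) & (\<forall>a\<in>carrier G. pb a f : CT)"
 unfolding CrsG_def glued_def pb_def by simp

text \<open>The condition \<open>Nge\<close> on all pullbacks, freed of pullbacks: as a runs through
  G, so does a h k, and tests can be taken at arbitrary points of G.\<close>

definition GN :: "real => ('g => 'e) => bool" where
 "GN B f \<longleftrightarrow> (\<forall>x\<in>carrier G. \<forall>m n. \<forall>h\<in>A1 m. \<forall>k\<in>A2 n. vge B (f x) &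
  vge (B + r * real m) (f (x \<otimes> h) - f x) & vge (B + s * real n) (f (x \<otimes> k) - f x) &
  vge (B + r * real m + s * real n) (f (x \<otimes> h \<otimes> k) - f (x \<otimes> h) - (f (x \<otimes> k) - f x)))"

lemma Nge_iff: "P.Nge B F \<longleftrightarrow> (\<forall>x\<in>H1. \<forall>y\<in>H2. \<forall>m n. \<forall>h\<in>A1 m. \<forall>k\<in>A2 n. vge B (F (x, y)) &
  vge (B + r * real m) (F (x \<otimes> h, y) - F (x, y)) & vge (B + s * real n) (F (x, y \<otimes> k) - F (x, y)) &
  vge (B + r * real m + s * real n) (F (x \<otimes> h, y \<otimes> k) - F (x \<otimes> h, y) - (F (x, y \<otimes> k) - F (x, y))))"
  (is "?L \<longleftrightarrow> ?R")
proof
 assume L: ?L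
 have t: "vge (B + twt r a + twt s b) (P.tev2 a b F)"
  if "a : tests p (G\<lparr>carrier := H1\<rparr>)" "b : tests p (G\<lparr>carrier := H2\<rparr>)" for a b
  using L that unfolding P.Nge_def by blast
 show ?R
 proof (intro ballI allI conjI)
  fix x y m n h k assume "x : H1" "y : H2" "h : A1 m" "k : A2 n"
  then have a: "Point x : tests p (G\<lparr>carrier := H1\<rparr>)" "Diff m (x \<otimes> h) x : tests p (G\<lparr>carrier := H1\<rparr>)"
   and b: "Point y : tests p (G\<lparr>carrier := H2\<rparr>)" "Diff n (y \<otimes> k) y : tests p (G\<lparr>carrier := H2\<rparr>)"
   unfolding tests_def by auto
  show "vge B (F (x, y))" using t[OF a(1) b(1)] by (simp add: P.tev2_def)
  show "vge (B + r * real m) (F (x \<otimes> h, y) - F (x, y))" using t[OF a(2) b(1)] by (simp add: P.tev2_def)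
  show "vge (B + s * real n) (F (x, y \<otimes> k) - F (x, y))" using t[OF a(1) b(2)] by (simp add: P.tev2_def)
  show "vge (B + r * real m + s * real n) (F (x \<otimes> h, y \<otimes> k) - F (x \<otimes> h, y) - (F (x, y \<otimes> k) - F (x, y)))"
   using t[OF a(2) b(2)] by (simp add: P.tev2_def)
 qed
next
 assume R: ?R
 have o: "\<one> : A1 0" "\<one> : A2 0" using P.A.K_one[of 0] P.B.K_one[of 0] by simp_all
 show ?L unfolding P.Nge_def
 proof (intro ballI)
  fix a b assume ab: "a : tests p (G\<lparr>carrier := H1\<rparr>)" "b : tests p (G\<lparr>carrier := H2\<rparr>)"
  consider (PP) x y where "a = Point x" "x : H1" "b = Point y" "y : H2"
   | (DP) m x h y where "a = Diff m (x \<otimes> h) x" "x : H1" "h : A1 m" "b = Point y" "y : H2"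
   | (PD) x n y k where "a = Point x" "x : H1" "b = Diff n (y \<otimes> k) y" "y : H2" "k : A2 n"
   | (DD) m x h n y k where "a = Diff m (x \<otimes> h) x" "x : H1" "h : A1 m" "b = Diff n (y \<otimes> k) y" "y : H2" "k : A2 n"
   using ab unfolding tests_def by auto
  then show "vge (B + twt r a + twt s b) (P.tev2 a b F)"
  proof cases
   case PP
   then have "vge B (F (x, y))" using R o by blast
   then show ?thesis using PP by (simp add: P.tev2_def)
  next
   case DP
   then have "vge (B + r * real m) (F (x \<otimes> h, y) - F (x, y))" using R o by blast
   then show ?thesis using DP by (simp add: P.tev2_def)
  next
   case PD
   then have "vge (B + s * real n) (F (x, y \<otimes> k) - F (x, y))" using R o by blast
   then show ?thesis using PD by (simp add: P.tev2_def)
  next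
   case DD
   then have "vge (B + r * real m + s * real n) (F (x \<otimes> h, y \<otimes> k) - F (x \<otimes> h, y) - (F (x, y \<otimes> k) - F (x, y)))"
    using R by blast
   then show ?thesis using DD by (simp add: P.tev2_def)
  qed
 qed
qed

lemma H1_mult: "x : H1 ==> h : A1 m ==> x \<otimes> h : H1" and H2_mult: "y : H2 ==> k : A2 m ==> y \<otimes> k : H2"
 using subgroup.m_closed[OF H1] A1_H1 subgroup.m_closed[OF H2] A2_H2 by blast+

lemma pb_shift:
 assumes "a : carrier G" "x : H1" "y : H2" "h : A1 m" "k : A2 n"
 shows "pb a f (x \<otimes> h, y) = f (a \<otimes> (x \<otimes> y) \<otimes> h)" "pb a f (x, y \<otimes> k) = f (a \<otimes> (x \<otimes> y) \<otimes> k)"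
  "pb a f (x \<otimes> h, y \<otimes> k) = f (a \<otimes> (x \<otimes> y) \<otimes> h \<otimes> k)"
proof -
 have c: "x : carrier G" "y : carrier G" "h : carrier G" "k : carrier G" using assms H1_c H2_c A1_c A2_c by auto
 have "a \<otimes> ((x \<otimes> h) \<otimes> y) = a \<otimes> (x \<otimes> y) \<otimes> h" "a \<otimes> (x \<otimes> (y \<otimes> k)) = a \<otimes> (x \<otimes> y) \<otimes> k"
  "a \<otimes> ((x \<otimes> h) \<otimes> (y \<otimes> k)) = a \<otimes> (x \<otimes> y) \<otimes> h \<otimes> k"
  using assms(1) c by (simp_all add: m_ac)
 then show "pb a f (x \<otimes> h, y) = f (a \<otimes> (x \<otimes> y) \<otimes> h)" "pb a f (x, y \<otimes> k) = f (a \<otimes> (x \<otimes> y) \<otimes> k)"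
  "pb a f (x \<otimes> h, y \<otimes> k) = f (a \<otimes> (x \<otimes> y) \<otimes> h \<otimes> k)"
  using assms H1_mult H2_mult pb_apply by auto
qed

lemma Nge_pb: assumes "GN B f" "a : carrier G" shows "P.Nge B (pb a f)" unfolding Nge_iff
proof (intro ballI allI)
 fix x y m n h k assume h: "x : H1" "y : H2" "h : A1 m" "k : A2 n"
 have z: "a \<otimes> (x \<otimes> y) : carrier G" using assms h H1_c H2_c by simp
 show "vge B (pb a f (x, y)) & vge (B + r * real m) (pb a f (x \<otimes> h, y) - pb a f (x, y)) &
  vge (B + s * real n) (pb a f (x, y \<otimes> k) - pb a f (x, y)) &
  vge (B + r * real m + s * real n) (pb a f (x \<otimes> h, y \<otimes> k) - pb a f (x \<otimes> h, y) - (pb a f (x, y \<otimes> k) - pb a f (x, y)))"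
  using assms(1)[unfolded GN_def, rule_format, OF z h(3,4)]
  by (simp add: pb_shift[OF assms(2) h] pb_apply[OF h(1,2)])
qed

lemma GN_iff: "GN B f \<longleftrightarrow> (\<forall>a\<in>carrier G. P.Nge B (pb a f))"
proof
 assume R: "\<forall>a\<in>carrier G. P.Nge B (pb a f)"
 show "GN B f" unfolding GN_def
 proof (intro ballI allI)
  fix x m n h k assume h: "x : carrier G" "h : A1 m" "k : A2 n"
  have o: "\<one> : H1" "\<one> : H2" using subgroup.one_closed[OF H1] subgroup.one_closed[OF H2] by auto
  have "P.Nge B (pb x f)" using R h by blast
  from this[unfolded Nge_iff, rule_format, OF o h(2,3)]
  show "vge B (f x) &
  vge (B + r * real m) (f (x \<otimes> h) - f x) & vge (B + s * real n) (f (x \<otimes> k) - f x) &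
  vge (B + r * real m + s * real n) (f (x \<otimes> h \<otimes> k) - f (x \<otimes> h) - (f (x \<otimes> k) - f x))"
   unfolding pb_shift[OF h(1) o h(2,3)] pb_apply[OF o] using h by simp
 qed
qed (use Nge_pb in blast)

lemma CrsG_val_iff: assumes "f : CrsG p v G T H1 H2 r s"
 shows "ereal B <= CrsG_val p v G T H1 H2 r s f \<longleftrightarrow> GN B f"
proof -
 have "ereal B <= CrsG_val p v G T H1 H2 r s f \<longleftrightarrow>
   (\<forall>a\<in>carrier G. ereal B <= completed_tensor_val v P.C1 P.w1 P.C2 P.w2 (pb a f))"
  unfolding CrsG_val_def glued_val_def le_INF_iff pb_def by simp
 also have "\<dots> \<longleftrightarrow> (\<forall>a\<in>carrier G. P.Nge B (pb a f))"
  using assms P.completed_val_iff unfolding CrsG_iff by blast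
 finally show ?thesis unfolding GN_iff .
qed

lemma GN_add: "GN B f ==> GN B g ==> GN B (%x. f x + g x)" unfolding GN_iff pb_add using P.Nge_add by blast

lemma GN_scale: "GN B f ==> vge D c ==> GN (B + D) (%x. c * f x)" unfolding GN_iff pb_scale using P.Nge_scale by blast

lemma GN_minus: assumes "GN B (%x. f x - g x)" shows "GN B (%x. g x - f x)"
proof -
 have "vge 0 (-1)" using vge_one_0 by simp
 from GN_scale[OF assms this] show ?thesis by simp
qed

lemma CT_out: assumes "F : CT" "z \<notin> H1 \<times> H2" shows "F z = 0"
proof -
 have "z \<notin> carrier (G\<lparr>carrier := H1\<rparr>) \<times> carrier (G\<lparr>carrier := H2\<rparr>)" using assms(2) by simp
 then show ?thesis using assms(1) unfolding P.completed_iff by blast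
qed

lemma CT_add: assumes "F : CT" "F' : CT" shows "(%z. F z + F' z) : CT" unfolding P.completed_iff
proof (intro conjI allI impI)
 fix B
 obtain D where D: "D : alg_tensor P.C1 P.C2" "P.Nge B (%z. F z - D z)"
  using assms(1) unfolding P.completed_iff by blast
 obtain D' where D': "D' : alg_tensor P.C1 P.C2" "P.Nge B (%z. F' z - D' z)"
  using assms(2) unfolding P.completed_iff by blast
 have z: "(%z. 0) : alg_tensor P.C1 P.C2" using P.TR_alg[OF P.TR_zero] .
 have "(%z. D z - (0 - D' z)) : alg_tensor P.C1 P.C2" by (intro P.alg_diff z D D')
 moreover have "P.Nge B (%z. (F z - D z) + (F' z - D' z))" using D D' by (intro P.Nge_add)
 ultimately show "\<exists>D\<in>alg_tensor P.C1 P.C2. P.Nge B (%z. F z + F' z - D z)"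
  by (intro bexI[of _ "%z. D z - (0 - D' z)"]) (simp_all add: algebra_simps)
qed (use CT_out[OF assms(1)] CT_out[OF assms(2)] in simp)

lemma CT_scale: assumes "F : CT" shows "(%z. c * F z) : CT" unfolding P.completed_iff
proof (intro conjI allI impI)
 fix B
 obtain E where E: "vge E c" using vge_ex by blast
 obtain D where D: "D : alg_tensor P.C1 P.C2" "P.Nge (B - E) (%z. F z - D z)"
  using assms(1) unfolding P.completed_iff by blast
 obtain n f g where fg: "\<forall>i<n. f i : P.C1 & g i : P.C2" "D = tensor_sum n f g"
  using D unfolding alg_tensor_def by blast
 have "(%z. c * D z) = tensor_sum n (%i x. c * f i x) g"
  by (auto simp: fg tensor_sum_def sum_distrib_left algebra_simps)
 moreover have "\<forall>i<n. (%x. c * f i x) : P.C1 & g i : P.C2" using fg P.A.Cr_scale by blast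
 ultimately have "(%z. c * D z) : alg_tensor P.C1 P.C2" unfolding alg_tensor_def by blast
 moreover have "P.Nge (B - E + E) (%z. c * (F z - D z))" using D E by (intro P.Nge_scale)
 ultimately show "\<exists>D\<in>alg_tensor P.C1 P.C2. P.Nge B (%z. c * F z - D z)"
  by (intro bexI[of _ "%z. c * D z"]) (simp_all add: algebra_simps)
qed (use CT_out[OF assms] in simp)

lemma CrsG_add: "f : CrsG p v G T H1 H2 r s ==> g : CrsG p v G T H1 H2 r s ==>
  (%x. f x + g x) : CrsG p v G T H1 H2 r s" unfolding CrsG_iff pb_add using CT_add by simp

lemma CrsG_scale: "f : CrsG p v G T H1 H2 r s ==> (%x. c * f x) : CrsG p v G T H1 H2 r s"
 unfolding CrsG_iff pb_scale using CT_scale by simp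

lemma CrsG_diff: "f : CrsG p v G T H1 H2 r s ==> g : CrsG p v G T H1 H2 r s ==>
  (%x. f x - g x) : CrsG p v G T H1 H2 r s" using CrsG_add[OF _ CrsG_scale[of g "-1"], of f] by simp

lemma CrsG_I:
 assumes out: "!!x. x \<notin> carrier G ==> f x = 0"
  and appr: "!!a B. a : carrier G ==> \<exists>D\<in>alg_tensor P.C1 P.C2. P.Nge B (%z. pb a f z - D z)"
 shows "f : CrsG p v G T H1 H2 r s" unfolding CrsG_iff P.completed_iff using out appr pb_out by simp

text \<open>A level of constancy in each variable makes every pullback an algebraic tensor, via
  \<open>section_alg\<close>.\<close>

lemma LC_CrsG: assumes "ph : LC T" shows "ph : CrsG p v G T H1 H2 r s"
proof (rule CrsG_I)
 show "ph x = 0" if "x \<notin> carrier G" for x using LC_outside[OF assms that] .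
 obtain n where n: "\<forall>x\<in>carrier G. \<forall>u\<in>U n. ph (x \<otimes> u) = ph x" using LC_uniform[OF assms] by blast
 obtain m1 where m1: "A1 m1 \<subseteq> U n" using A1_in_U by blast
 obtain m2 where m2: "A2 m2 \<subseteq> U n" using A2_in_U by blast
 fix a B assume a: "a : carrier G"
 have "pb a ph : alg_tensor P.C1 P.C2"
 proof (rule P.section_alg[where L = m1])
  show "pb a ph z = 0" if "z \<notin> carrier (G\<lparr>carrier := H1\<rparr>) \<times> carrier (G\<lparr>carrier := H2\<rparr>)" for z
   using that pb_out by simp
  show "pb a ph (x \<otimes>\<^bsub>G\<lparr>carrier := H1\<rparr>\<^esub> h, y) = pb a ph (x, y)"
   if "x : carrier (G\<lparr>carrier := H1\<rparr>)" "h : A1 m1" "y : carrier (G\<lparr>carrier := H2\<rparr>)" for x h y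
  proof -
   have h: "x : H1" "y : H2" "a \<otimes> (x \<otimes> y) : carrier G" "h : U n" using that a H1_c H2_c m1 by auto
   then show ?thesis using pb_shift(1)[OF a h(1,2) that(2) P.B.K_one[of 0]] pb_apply n by simp
  qed
  show "(%y. pb a ph (c, y)) : P.C2" if c: "c : carrier (G\<lparr>carrier := H1\<rparr>)" for c
  proof (rule P.B.level_in_Cr[where M = m2])
   show "pb a ph (c, y) = 0" if "y \<notin> carrier (G\<lparr>carrier := H2\<rparr>)" for y
    using that pb_out by simp
   show "pb a ph (c, y \<otimes>\<^bsub>G\<lparr>carrier := H2\<rparr>\<^esub> k) = pb a ph (c, y)"
    if "y : carrier (G\<lparr>carrier := H2\<rparr>)" "k : A2 m2" for y k
   proof -
    have h: "c : H1" "y : H2" "a \<otimes> (c \<otimes> y) : carrier G" "k : U n"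
     using that c a H1_c H2_c m2 by auto
    then show ?thesis using pb_shift(2)[OF a h(1,2) P.A.K_one[of 0] that(2)] pb_apply n by simp
   qed
  qed
 qed
 then show "\<exists>D\<in>alg_tensor P.C1 P.C2. P.Nge B (%z. pb a ph z - D z)"
 proof (rule bexI[rotated])
  show "P.Nge B (%z. pb a ph z - pb a ph z)" by (simp add: P.Nge_def P.tev2_def tev_zero)
 qed
qed

text \<open>A representative of the coset of x modulo H1 H2, chosen from the coset as a set.
  \<open>coords\<close> records the position of x relative to it, unique because H1 and H2 meet
  trivially.\<close>

definition rho :: "'g => 'g" where
 "rho x = (SOME y. \<exists>h\<in>H1. \<exists>k\<in>H2. y = x \<otimes> (h \<otimes> k))"

definition coords :: "'g => 'g \<times> 'g" where
 "coords x = (SOME z. fst z : H1 & snd z : H2 & x = rho x \<otimes> (fst z \<otimes> snd z))"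

definition "c1 x = fst (coords x)"
definition "c2 x = snd (coords x)"

lemma rho_ex: assumes "x : carrier G" shows "\<exists>h\<in>H1. \<exists>k\<in>H2. rho x = x \<otimes> (h \<otimes> k)"
proof -
 have "\<exists>h\<in>H1. \<exists>k\<in>H2. x = x \<otimes> (h \<otimes> k)"
  using assms subgroup.one_closed[OF H1] subgroup.one_closed[OF H2] by (intro bexI[of _ \<one>]) auto
 then show ?thesis unfolding rho_def by (rule someI)
qed

lemma rho_closed: "x : carrier G ==> rho x : carrier G" using rho_ex[of x] H1_c H2_c by auto

lemma coords_props: assumes x: "x : carrier G"
 shows "c1 x : H1" "c2 x : H2" "x = rho x \<otimes> (c1 x \<otimes> c2 x)"
proof -
 obtain h k where hk: "h : H1" "k : H2" "rho x = x \<otimes> (h \<otimes> k)" using rho_ex[OF x] by blast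
 have c: "h : carrier G" "k : carrier G" using hk H1_c H2_c by auto
 have "x = rho x \<otimes> (inv h \<otimes> inv k)"
  using hk(3) c x m_assoc[of x "h \<otimes> k" "inv (h \<otimes> k)"] r_inv[of "h \<otimes> k"]
  by (simp add: inv_mult del: r_inv)
 then have "\<exists>z. fst z : H1 & snd z : H2 & x = rho x \<otimes> (fst z \<otimes> snd z)"
  using subgroup.m_inv_closed[OF H1 hk(1)] subgroup.m_inv_closed[OF H2 hk(2)]
  by (intro exI[of _ "(inv h, inv k)"]) simp
 from someI_ex[OF this] show "c1 x : H1" "c2 x : H2" "x = rho x \<otimes> (c1 x \<otimes> c2 x)"
  unfolding c1_def c2_def coords_def by blast+
qed

lemma rho_shift: assumes x: "x : carrier G" and h: "h : H1" and k: "k : H2"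
 shows "rho (x \<otimes> (h \<otimes> k)) = rho x"
proof -
 have c: "h : carrier G" "k : carrier G" using h k H1_c H2_c by auto
 have "(\<exists>h'\<in>H1. \<exists>k'\<in>H2. y = (x \<otimes> (h \<otimes> k)) \<otimes> (h' \<otimes> k')) \<longleftrightarrow> (\<exists>h'\<in>H1. \<exists>k'\<in>H2. y = x \<otimes> (h' \<otimes> k'))" (is "?L \<longleftrightarrow> ?R") for y
 proof
  assume ?L
  then obtain h' k' where *: "h' : H1" "k' : H2" "y = (x \<otimes> (h \<otimes> k)) \<otimes> (h' \<otimes> k')" by blast
  have "h' : carrier G" "k' : carrier G" using * H1_c H2_c by auto
  then have "y = x \<otimes> ((h \<otimes> h') \<otimes> (k \<otimes> k'))" using * c x by (simp add: m_ac)
  then show ?R using subgroup.m_closed[OF H1 h *(1)] subgroup.m_closed[OF H2 k *(2)] by blast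
 next
  assume ?R
  then obtain h' k' where *: "h' : H1" "k' : H2" "y = x \<otimes> (h' \<otimes> k')" by blast
  have c': "h' : carrier G" "k' : carrier G" using * H1_c H2_c by auto
  have "h \<otimes> (inv h \<otimes> h') = h'" "k \<otimes> (inv k \<otimes> k') = k'"
   using c c' m_assoc[of h "inv h" h'] m_assoc[of k "inv k" k'] by simp_all
  moreover have "(x \<otimes> (h \<otimes> k)) \<otimes> ((inv h \<otimes> h') \<otimes> (inv k \<otimes> k'))
    = x \<otimes> ((h \<otimes> (inv h \<otimes> h')) \<otimes> (k \<otimes> (inv k \<otimes> k')))"
   using c c' x by (simp add: m_ac)
  ultimately have "y = (x \<otimes> (h \<otimes> k)) \<otimes> ((inv h \<otimes> h') \<otimes> (inv k \<otimes> k'))" using * by simp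
  moreover have "inv h \<otimes> h' : H1" "inv k \<otimes> k' : H2"
   using * h k H1 H2 by (meson subgroup.m_closed subgroup.m_inv_closed)+
  ultimately show ?L by blast
 qed
 then show ?thesis unfolding rho_def by simp
qed

lemma coords_shift: assumes x: "x : carrier G" and h: "h : H1" and k: "k : H2"
 shows "c1 (x \<otimes> (h \<otimes> k)) = c1 x \<otimes> h" "c2 (x \<otimes> (h \<otimes> k)) = c2 x \<otimes> k"
proof -
 have c: "h : carrier G" "k : carrier G" using h k H1_c H2_c by auto
 let ?y = "x \<otimes> (h \<otimes> k)"
 have y: "?y : carrier G" using x c by simp
 note X = coords_props[OF x] and Y = coords_props[OF y]
 have cc: "c1 x : carrier G" "c2 x : carrier G" "c1 ?y : carrier G" "c2 ?y : carrier G" "rho x : carrier G"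
  using X(1,2) Y(1,2) H1_c H2_c rho_closed[OF x] by auto
 have "rho x \<otimes> (c1 ?y \<otimes> c2 ?y) = ?y" using Y(3) rho_shift[OF x h k] by simp
 also have "\<dots> = (rho x \<otimes> (c1 x \<otimes> c2 x)) \<otimes> (h \<otimes> k)" using X(3) by simp
 also have "\<dots> = rho x \<otimes> ((c1 x \<otimes> h) \<otimes> (c2 x \<otimes> k))" using cc c by (simp add: m_ac)
 finally have "c1 ?y \<otimes> c2 ?y = (c1 x \<otimes> h) \<otimes> (c2 x \<otimes> k)" using cc c by simp
 then show "c1 ?y = c1 x \<otimes> h" "c2 ?y = c2 x \<otimes> k"
  using H_unique[of "c1 ?y" "c1 x \<otimes> h" "c2 ?y" "c2 x \<otimes> k"] X Y h k
   subgroup.m_closed[OF H1] subgroup.m_closed[OF H2] by auto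
qed

text \<open>Approximants of the pullbacks at the chosen representatives are glued along coordinates.
  Their levels may vary from coset to coset, since local constancy is a condition near each
  point.\<close>

lemma LC_dense_CrsG:
 assumes f: "f : CrsG p v G T H1 H2 r s"
 shows "\<exists>ph\<in>LC T. GN B (%x. f x - ph x)"
proof -
 have "\<exists>q. P.Nge B (%z. pb a f z - fst q z) & (\<forall>x\<in>H1. \<forall>y\<in>H2. \<forall>h\<in>A1 (snd q). \<forall>k\<in>A2 (snd q).
  fst q (x \<otimes> h, y \<otimes> k) = fst q (x, y))" if a: "a : carrier G" for a
 proof -
  obtain D where D: "D : alg_tensor P.C1 P.C2" "P.Nge B (%z. pb a f z - D z)"
   using f a unfolding CrsG_iff P.completed_iff by blast
  obtain D' L where D': "P.Nge B (%z. D z - D' z)"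
   "\<forall>x\<in>H1. \<forall>y\<in>H2. \<forall>h\<in>A1 L. \<forall>k\<in>A2 L. D' (x \<otimes> h, y \<otimes> k) = D' (x, y)"
   using P.alg_approx_level[OF D(1), of B] by auto
  have "P.Nge B (%z. (pb a f z - D z) + (D z - D' z))" using D D' by (intro P.Nge_add)
  then show ?thesis using D' by (intro exI[of _ "(D', L)"]) simp
 qed
 then have "\<forall>a. \<exists>q. a : carrier G --> P.Nge B (%z. pb a f z - fst q z) & (\<forall>x\<in>H1. \<forall>y\<in>H2.
   \<forall>h\<in>A1 (snd q). \<forall>k\<in>A2 (snd q). fst q (x \<otimes> h, y \<otimes> k) = fst q (x, y))" by blast
 from choice[OF this] obtain q where
  q: "!!a. a : carrier G ==> P.Nge B (%z. pb a f z - fst (q a) z)"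
   "!!a x y h k. a : carrier G ==> x : H1 ==> y : H2 ==> h : A1 (snd (q a)) ==> k : A2 (snd (q a)) ==>
    fst (q a) (x \<otimes> h, y \<otimes> k) = fst (q a) (x, y)" by blast
 define ph where "ph x = (if x : carrier G then fst (q (rho x)) (c1 x, c2 x) else 0)" for x
 have sh: "ph (x \<otimes> (h \<otimes> k)) = fst (q (rho x)) (c1 x \<otimes> h, c2 x \<otimes> k)"
  if "x : carrier G" "h : H1" "k : H2" for x h k using that rho_shift coords_shift H1_c H2_c by (simp add: ph_def)
 have "ph : LC T"
 proof (rule LC_I)
  show "ph x = 0" if "x \<notin> carrier G" for x using that by (simp add: ph_def)
  fix x assume x: "x : carrier G"
  let ?L = "snd (q (rho x))"
  obtain n where n: "\<forall>u\<in>U n. \<exists>a\<in>A1 ?L. \<exists>b\<in>A2 ?L. u = a \<otimes> b" using U_in_A[of ?L ?L] by (elim exE)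
  have "ph (x \<otimes> u) = ph x" if u: "u : U n" for u
  proof -
   obtain a b where ab: "a : A1 ?L" "b : A2 ?L" "u = a \<otimes> b" using n u by blast
   have "ph (x \<otimes> u) = fst (q (rho x)) (c1 x \<otimes> a, c2 x \<otimes> b)"
    unfolding ab(3) by (rule sh[OF x A1_H1[OF ab(1)] A2_H2[OF ab(2)]])
   also have "\<dots> = fst (q (rho x)) (c1 x, c2 x)"
    by (rule q(2)[OF rho_closed[OF x] coords_props(1,2)[OF x] ab(1,2)])
   finally show ?thesis using x by (simp add: ph_def)
  qed
  then show "\<exists>n. \<forall>u\<in>U n. ph (x \<otimes> u) = ph x" by blast
 qed
 moreover have "GN B (%x. f x - ph x)" unfolding GN_def
 proof (intro ballI allI)
  fix x m n h k assume x: "x : carrier G" and hk: "h : A1 m" "k : A2 n"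
  let ?a = "rho x"
  let ?E = "%z. pb ?a f z - fst (q ?a) z"
  have a: "?a : carrier G" using rho_closed[OF x] .
  have o: "\<one> : H1" "\<one> : H2" using subgroup.one_closed[OF H1] subgroup.one_closed[OF H2] by auto
  have hk': "h : H1" "k : H2" using hk A1_H1 A2_H2 by auto
  have hc: "h : carrier G" "k : carrier G" using hk' H1_c H2_c by auto
  note X = coords_props[OF x]
  have cc: "c1 x : carrier G" "c2 x : carrier G" using X H1_c H2_c by auto
  have f1: "f x = pb ?a f (c1 x, c2 x)" using pb_apply[OF X(1,2)] X(3) by simp
  have f2: "f (x \<otimes> h) = pb ?a f (c1 x \<otimes> h, c2 x)" "f (x \<otimes> k) = pb ?a f (c1 x, c2 x \<otimes> k)"
   "f (x \<otimes> h \<otimes> k) = pb ?a f (c1 x \<otimes> h, c2 x \<otimes> k)"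
   using pb_shift[OF a X(1,2) hk, of f] X(3) by simp_all
  have p1: "ph x = fst (q ?a) (c1 x, c2 x)" using x by (simp add: ph_def)
  have p2: "ph (x \<otimes> h) = fst (q ?a) (c1 x \<otimes> h, c2 x)" "ph (x \<otimes> k) = fst (q ?a) (c1 x, c2 x \<otimes> k)"
   "ph (x \<otimes> h \<otimes> k) = fst (q ?a) (c1 x \<otimes> h, c2 x \<otimes> k)"
   using sh[OF x hk'(1) o(2)] sh[OF x o(1) hk'(2)] sh[OF x hk'] x hc cc by (simp_all add: m_assoc)
  have E: "f x - ph x = ?E (c1 x, c2 x)" "f (x \<otimes> h) - ph (x \<otimes> h) = ?E (c1 x \<otimes> h, c2 x)"
   "f (x \<otimes> k) - ph (x \<otimes> k) = ?E (c1 x, c2 x \<otimes> k)"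
   "f (x \<otimes> h \<otimes> k) - ph (x \<otimes> h \<otimes> k) = ?E (c1 x \<otimes> h, c2 x \<otimes> k)"
   unfolding f1 p1 f2 p2 by (rule refl)+
  show "vge B (f x - ph x) & vge (B + r * real m) (f (x \<otimes> h) - ph (x \<otimes> h) - (f x - ph x)) &
   vge (B + s * real n) (f (x \<otimes> k) - ph (x \<otimes> k) - (f x - ph x)) &
   vge (B + r * real m + s * real n) (f (x \<otimes> h \<otimes> k) - ph (x \<otimes> h \<otimes> k) - (f (x \<otimes> h) - ph (x \<otimes> h)) -
    (f (x \<otimes> k) - ph (x \<otimes> k) - (f x - ph x)))"
   unfolding E by (rule q(1)[OF a, unfolded Nge_iff, rule_format, OF X(1,2) hk])
 qed
 ultimately show ?thesis by blast
qed

end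

section \<open>Functionals with values in V\<close>

lemma linear_on_sum:
 assumes lin: "linear_on C smul L" and vs: "vector_space smul"
  and add: "!!f g. f : C ==> g : C ==> (%x. f x + g x) : C"
  and scale: "!!c f. f : C ==> (%x. c * f x) : C" and zero: "(%x. 0) : C"
  and fin: "finite I" and f: "!!i. i : I ==> f i : C"
 shows "L (%x. \<Sum>i\<in>I. c i * f i x) = (\<Sum>i\<in>I. smul (c i) (L (f i)))"
proof -
 interpret vector_space smul by (rule vs)
 have Ladd: "L (%x. f x + g x) = L f + L g" if "f : C" "g : C" for f g
  using lin that unfolding linear_on_def by blast
 have Lscale: "L (%x. c * f x) = smul c (L f)" if "f : C" for c f using lin that unfolding linear_on_def by blast
 have L0: "L (%x. 0) = 0" using Ladd[OF zero zero] by simp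
 have "(%x. \<Sum>i\<in>I. c i * f i x) : C & L (%x. \<Sum>i\<in>I. c i * f i x) = (\<Sum>i\<in>I. smul (c i) (L (f i)))"
  using fin f
 proof (induction I rule: finite_induct)
  case (insert i I)
  then have 1: "(%x. c i * f i x) : C" using scale by blast
  have 2: "(%x. \<Sum>i\<in>I. c i * f i x) : C" "L (%x. \<Sum>i\<in>I. c i * f i x) = (\<Sum>i\<in>I. smul (c i) (L (f i)))"
   using insert by auto
  have "L (%x. c i * f i x + (\<Sum>i\<in>I. c i * f i x)) = L (%x. c i * f i x) + L (%x. \<Sum>i\<in>I. c i * f i x)"
   by (rule Ladd[OF 1 2(1)])
  moreover have "L (%x. c i * f i x) = smul (c i) (L (f i))" using Lscale insert by blast
  ultimately show ?case using insert(1,2) 2 add[OF 1 2(1)] by simp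
 qed (use L0 zero in simp)
 then show ?thesis by blast
qed

text \<open>In a basis of V the comparison reduces to \<open>cont_dual_dense_eq\<close> for each
  coordinate, whatever representations as sums of tensors the two sides have.\<close>

lemma dual_tensor_dense_eq:
 fixes smul :: "'e::field => 'v::ab_group_add => 'v"
 assumes v: "valued_field v" and fd: "finite_dimensional_vector_space smul Bs"
  and SC: "S \<subseteq> C"
  and w_minus: "!!B f ph. f : C ==> ph : S ==> ereal B <= w (%x. f x - ph x) ==> ereal B <= w (%x. ph x - f x)"
  and dense: "!!f B. f : C ==> \<exists>ph\<in>S. ereal B <= w (%x. f x - ph x)"
  and \<Psi>: "\<Psi> : dual_tensor (cont_dual v C w) smul" "\<Psi>' : dual_tensor (cont_dual v C w) smul"
  and eq: "!!ph. ph : S ==> \<Psi> ph = \<Psi>' ph"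
 shows "\<Psi> = \<Psi>'"
proof
 fix f
 interpret valued_field v by (rule v)
 interpret V: finite_dimensional_vector_space smul Bs by (rule fd)
 obtain n \<mu> x where 1: "\<Psi> = (%ph. \<Sum>i<(n::nat). smul (\<mu> i ph) (x i))" "\<forall>i<n. \<mu> i : cont_dual v C w"
  using \<Psi>(1) unfolding dual_tensor_def by (elim CollectE exE conjE)
 obtain m \<nu> y where 2: "\<Psi>' = (%ph. \<Sum>i<(m::nat). smul (\<nu> i ph) (y i))" "\<forall>i<m. \<nu> i : cont_dual v C w"
  using \<Psi>(2) unfolding dual_tensor_def by (elim CollectE exE conjE)
 let ?R = "%z b. V.representation Bs z b"
 have sp: "z : V.span Bs" for z using V.span_Basis by simp
 have R1: "?R (\<Psi> ph) b = (\<Sum>i<n. ?R (x i) b * \<mu> i ph)" for ph b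
  unfolding 1 by (simp add: V.representation_sum[OF V.independent_Basis sp]
    V.representation_scale[OF V.independent_Basis sp] mult.commute)
 have R2: "?R (\<Psi>' ph) b = (\<Sum>i<m. ?R (y i) b * \<nu> i ph)" for ph b
  unfolding 2 by (simp add: V.representation_sum[OF V.independent_Basis sp]
    V.representation_scale[OF V.independent_Basis sp] mult.commute)
 have "?R (\<Psi> f) b = ?R (\<Psi>' f) b" for b unfolding R1 R2
 proof (rule cont_dual_dense_eq[OF SC w_minus dense])
  show "(\<Sum>i<n. ?R (x i) b * \<mu> i ph) = (\<Sum>i<m. ?R (y i) b * \<nu> i ph)" if "ph : S" for ph
   using eq[OF that] R1[of ph b] R2[of ph b] by simp
 qed (use 1 2 in auto)
 then have "(\<Sum>b\<in>Bs. smul (?R (\<Psi> f) b) b) = (\<Sum>b\<in>Bs. smul (?R (\<Psi>' f) b) b)" by simp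
 then show "\<Psi> f = \<Psi>' f"
  using V.sum_representation_eq[OF V.independent_Basis sp V.finite_Basis order.refl] by simp
qed

lemma dual_tensor_from_coordinates:
 fixes smul :: "'e::field => 'v::ab_group_add => 'v"
 assumes fd: "finite_dimensional_vector_space smul Bs"
  and \<mu>: "!!b. b : Bs ==> \<mu> b : D"
  and eq: "!!b ph. b : Bs ==> ph : S ==> \<mu> b ph = module.representation smul Bs (L ph) b"
 shows "\<exists>\<Psi>\<in>dual_tensor D smul. \<forall>ph\<in>S. \<Psi> ph = L ph"
proof -
 interpret V: finite_dimensional_vector_space smul Bs by (rule fd)
 obtain e where e: "bij_betw e {0..<card Bs} Bs" using ex_bij_betw_nat_finite[OF V.finite_Basis] by blast
 define \<Psi> where "\<Psi> = (%ph. \<Sum>i<card Bs. smul (\<mu> (e i) ph) (e i))"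
 have "e i : Bs" if "i < card Bs" for i using e that by (auto simp: bij_betw_def)
 then have "\<Psi> : dual_tensor D smul" unfolding dual_tensor_def \<Psi>_def using \<mu>
  by (intro CollectI exI[of _ "card Bs"] exI[of _ "%i. \<mu> (e i)"] exI[of _ e]) simp
 moreover have "\<Psi> ph = L ph" if p: "ph : S" for ph
 proof -
  have "\<Psi> ph = (\<Sum>b\<in>Bs. smul (\<mu> b ph) b)"
   unfolding \<Psi>_def using sum.reindex_bij_betw[OF e, of "%b. smul (\<mu> b ph) b"]
   by (simp add: lessThan_atLeast0)
  also have "\<dots> = (\<Sum>b\<in>Bs. smul (V.representation Bs (L ph) b) b)" using eq p by simp
  also have "\<dots> = L ph" by (rule V.sum_representation_eq[OF V.independent_Basis _ V.finite_Basis order.refl])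
    (simp add: V.span_Basis)
  finally show ?thesis .
 qed
 ultimately show ?thesis by blast
qed

context two_filtrations begin

lemma finite_image:
 assumes "!!x a b. x : carrier G ==> a : A1 m ==> b : A2 n ==> F (x \<otimes> (a \<otimes> b)) = F x"
 shows "finite (F ` carrier G)"
proof -
 obtain N where N: "\<forall>u\<in>U N. \<exists>a\<in>A1 m. \<exists>b\<in>A2 n. u = a \<otimes> b" using U_in_A[of m n] by (elim exE)
 obtain X where X: "finite X" "X \<subseteq> carrier G" "\<forall>x\<in>carrier G. \<exists>a\<in>X. \<exists>k\<in>U N. x = a \<otimes> k"
  using finite_index[OF U_sub order.refl, of N] by (elim exE conjE)
 have "F ` carrier G \<subseteq> F ` X"
 proof
  fix y assume "y : F ` carrier G"
  then obtain x where x: "x : carrier G" "y = F x" by blast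
  obtain a u where au: "a : X" "u : U N" "x = a \<otimes> u" using X(3) x(1) by (meson bexE)
  obtain a' b' where "a' : A1 m" "b' : A2 n" "u = a' \<otimes> b'" using N au(2) by (meson bexE)
  then have "y = F a" using assms[of a a' b'] x au X(2) by auto
  then show "y : F ` X" using au by blast
 qed
 then show ?thesis using X finite_subset by blast
qed

text \<open>A canonical point of the coset of x modulo p^m-th powers of H1 and p^n-th powers of H2;
  its fibres are exactly these cosets.\<close>

definition sig :: "nat => nat => 'g => 'g" where
 "sig m n x = rho x \<otimes> (P.A.rep m (c1 x) \<otimes> P.B.rep n (c2 x))"

lemma sig_shift:
 assumes "x : carrier G" "a : A1 m" "b : A2 n"
 shows "rho (x \<otimes> (a \<otimes> b)) = rho x" "P.A.rep m (c1 (x \<otimes> (a \<otimes> b))) = P.A.rep m (c1 x)"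
  "P.B.rep n (c2 (x \<otimes> (a \<otimes> b))) = P.B.rep n (c2 x)" "sig m n (x \<otimes> (a \<otimes> b)) = sig m n x"
proof -
 have ab: "a : H1" "b : H2" using assms A1_H1 A2_H2 by auto
 show 1: "rho (x \<otimes> (a \<otimes> b)) = rho x" by (rule rho_shift[OF assms(1) ab])
 show 2: "P.A.rep m (c1 (x \<otimes> (a \<otimes> b))) = P.A.rep m (c1 x)"
  using coords_shift(1)[OF assms(1) ab] P.A.rep_mult[of "c1 x" a m] coords_props(1)[OF assms(1)] assms(2) by simp
 show 3: "P.B.rep n (c2 (x \<otimes> (a \<otimes> b))) = P.B.rep n (c2 x)"
  using coords_shift(2)[OF assms(1) ab] P.B.rep_mult[of "c2 x" b n] coords_props(2)[OF assms(1)] assms(3) by simp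
 show "sig m n (x \<otimes> (a \<otimes> b)) = sig m n x" unfolding sig_def 1 2 3 ..
qed

lemma sig_ex: assumes x: "x : carrier G" shows "\<exists>a\<in>A1 m. \<exists>b\<in>A2 n. sig m n x = x \<otimes> (a \<otimes> b)"
proof -
 note X = coords_props[OF x]
 obtain a where a: "a : A1 m" "P.A.rep m (c1 x) = c1 x \<otimes> a" using P.A.rep_ex[of "c1 x" m] X by auto
 obtain b where b: "b : A2 n" "P.B.rep n (c2 x) = c2 x \<otimes> b" using P.B.rep_ex[of "c2 x" n] X by auto
 have c: "c1 x : carrier G" "c2 x : carrier G" "rho x : carrier G" "a : carrier G" "b : carrier G"
  using X H1_c H2_c rho_closed[OF x] a b A1_c A2_c by auto
 have "sig m n x = (rho x \<otimes> (c1 x \<otimes> c2 x)) \<otimes> (a \<otimes> b)"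
  unfolding sig_def a(2) b(2) using c by (simp add: m_ac)
 then show ?thesis using a b X(3) by auto
qed

lemma sig_class: assumes x: "x : carrier G"
 shows "{y : carrier G. sig m n y = sig m n x} = {x \<otimes> (a \<otimes> b) | a b. a : A1 m & b : A2 n}"
proof (intro Set.set_eqI iffI)
 fix y assume "y : {y : carrier G. sig m n y = sig m n x}"
 then have y: "y : carrier G" "sig m n y = sig m n x" by auto
 obtain a b where ab: "a : A1 m" "b : A2 n" "sig m n x = x \<otimes> (a \<otimes> b)" using sig_ex[OF x] by blast
 obtain a' b' where ab': "a' : A1 m" "b' : A2 n" "sig m n y = y \<otimes> (a' \<otimes> b')" using sig_ex[OF y(1)] by blast
 have c: "a : carrier G" "b : carrier G" "a' : carrier G" "b' : carrier G" using ab ab' A1_c A2_c by auto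
 have "y = y \<otimes> (a' \<otimes> b') \<otimes> (inv (a' \<otimes> b'))" using y c m_assoc[of y "a' \<otimes> b'" "inv (a' \<otimes> b')"] by simp
 also have "\<dots> = x \<otimes> (a \<otimes> b) \<otimes> (inv (a' \<otimes> b'))" using ab(3) ab'(3) y(2) by simp
 also have "\<dots> = x \<otimes> ((a \<otimes> inv a') \<otimes> (b \<otimes> inv b'))" using x c by (simp add: inv_mult m_ac)
 finally have "y = x \<otimes> ((a \<otimes> inv a') \<otimes> (b \<otimes> inv b'))" .
 moreover have "a \<otimes> inv a' : A1 m" using P.A.K_mult[OF ab(1) P.A.K_inv[OF ab'(1)]]
   m_inv_consistent[OF H1 A1_H1[OF ab'(1)]] by simp
 moreover have "b \<otimes> inv b' : A2 n" using P.B.K_mult[OF ab(2) P.B.K_inv[OF ab'(2)]]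
   m_inv_consistent[OF H2 A2_H2[OF ab'(2)]] by simp
 ultimately show "y : {x \<otimes> (a \<otimes> b) | a b. a : A1 m & b : A2 n}" by blast
next
 fix y assume "y : {x \<otimes> (a \<otimes> b) | a b. a : A1 m & b : A2 n}"
 then obtain a b where ab: "a : A1 m" "b : A2 n" "y = x \<otimes> (a \<otimes> b)" by blast
 have "a : carrier G" "b : carrier G" using ab A1_c A2_c by auto
 then show "y : {y : carrier G. sig m n y = sig m n x}" using ab x sig_shift(4)[OF x ab(1,2)] by simp
qed

lemma LC_coset: assumes x: "x : carrier G"
 shows "(indicator {x \<otimes> (a \<otimes> b) | a b. a : A1 m & b : A2 n} :: 'g => 'e) : LC T"
 unfolding sig_class[OF x, symmetric]
proof (rule LC_I)
 fix y assume y: "y : carrier G"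
 obtain N where N: "\<forall>u\<in>U N. \<exists>a\<in>A1 m. \<exists>b\<in>A2 n. u = a \<otimes> b" using U_in_A[of m n] by (elim exE)
 have "(indicator {y : carrier G. sig m n y = sig m n x} (y \<otimes> u) :: 'e) = indicator {y : carrier G. sig m n y = sig m n x} y"
  if "u : U N" for u
 proof -
  obtain a b where "a : A1 m" "b : A2 n" "u = a \<otimes> b" using N \<open>u : U N\<close> by (meson bexE)
  then show ?thesis using sig_shift(4)[OF y] y U_carrier[OF \<open>u : U N\<close>] by (simp add: indicator_def)
 qed
 then show "\<exists>N. \<forall>u\<in>U N. (indicator {y : carrier G. sig m n y = sig m n x} (y \<otimes> u) :: 'e) =
  indicator {y : carrier G. sig m n y = sig m n x} y" by blast
qed simp

text \<open>A locally constant function is a sum of double differences: the \<open>(m, n)\<close>-th one is constant on the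
 cosets of \<open>A1 m \<otimes> A2 n\<close>, and its values make up for the growth of \<open>L\<close> at that level.\<close>

lemma LC_bounded:
 assumes lin: "linear_on (LC T) (*) L"
  and bnd: "!!x m n. x : carrier G ==>
   vge (- k - r * real m - s * real n) (L (indicator {x \<otimes> (a \<otimes> b) | a b. a : A1 m & b : A2 n}))"
  and ph: "ph : LC T" "GN B ph"
 shows "vge (B - (k + r + s)) (L ph)"
proof -
 have Lsum: "L (%x. \<Sum>i\<in>I. c i * f i x) = (\<Sum>i\<in>I. c i * L (f i))"
  if "finite I" "!!i. i : I ==> f i : LC T" for I :: "'z set" and c f
 proof -
  have "vector_space ((*) :: 'e => 'e => 'e)" by unfold_locales (auto simp: algebra_simps)
  from linear_on_sum[OF lin this LC_add LC_scale LC_zero that] show ?thesis .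
 qed
 \<comment> \<open>Evaluation at representatives of the two coordinates makes constancy on cosets
   automatic.\<close>
 define \<delta> where "\<delta> m n x = (if x : carrier G then
  P.A.dif m (%h. P.B.dif n (%k. pb (rho x) ph (h, k)) (P.B.rep n (c2 x))) (P.A.rep m (c1 x)) else 0)" for m n x
 have \<delta>_shift: "\<delta> m n (x \<otimes> (a \<otimes> b)) = \<delta> m n x" if "x : carrier G" "a : A1 m" "b : A2 n" for m n x a b
  using sig_shift[OF that] that A1_c A2_c by (simp add: \<delta>_def)
 have \<delta>_vge: "vge (B + r * real (m - 1) + s * real (n - 1)) (\<delta> m n x)" if x: "x : carrier G" for m n x
 proof -
  note X = coords_props[OF x]
  have r1: "P.A.rep m (c1 x) : carrier (G\<lparr>carrier := H1\<rparr>)" using P.A.rep_closed[of "c1 x" m] X by simp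
  have r2: "P.B.rep n (c2 x) : carrier (G\<lparr>carrier := H2\<rparr>)" using P.B.rep_closed[of "c2 x" n] X by simp
  obtain t1 where t1: "t1 : tests p (G\<lparr>carrier := H1\<rparr>)" "twt r t1 = r * real (m - 1)"
   "!!f. P.A.dif m f (P.A.rep m (c1 x)) = tev t1 f" using P.A.dif_tev[OF r1, of m] by blast
  obtain t2 where t2: "t2 : tests p (G\<lparr>carrier := H2\<rparr>)" "twt s t2 = s * real (n - 1)"
   "!!f. P.B.dif n f (P.B.rep n (c2 x)) = tev t2 f" using P.B.dif_tev[OF r2, of n] by blast
  have "\<delta> m n x = P.tev2 t1 t2 (pb (rho x) ph)" unfolding \<delta>_def P.tev2_def t1(3) t2(3) using x by simp
  moreover have "P.Nge B (pb (rho x) ph)" by (rule Nge_pb[OF ph(2) rho_closed[OF x]])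
  ultimately show ?thesis using t1 t2 unfolding P.Nge_def by metis
 qed
 have \<delta>_expand: "\<delta> m n y = (\<Sum>c\<in>sig m n ` carrier G. \<delta> m n c * indicator {x : carrier G. sig m n x = c} y)" for m n y
 proof (cases "y : carrier G")
  case True
  obtain a b where ab: "a : A1 m" "b : A2 n" "sig m n y = y \<otimes> (a \<otimes> b)" using sig_ex[OF True] by blast
  have "(\<Sum>c\<in>sig m n ` carrier G. \<delta> m n c * indicator {x : carrier G. sig m n x = c} y)
    = (\<Sum>c\<in>sig m n ` carrier G. if sig m n y = c then \<delta> m n c else 0)"
   using True by (intro sum.cong) (auto simp: indicator_def)
  also have "\<dots> = \<delta> m n (sig m n y)"
   using finite_image[of m n "sig m n"] sig_shift(4) True by (simp add: sum.delta)
  also have "\<dots> = \<delta> m n y" unfolding ab(3) by (rule \<delta>_shift[OF True ab(1,2)])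
  finally show ?thesis by simp
 next
  case False
  then show ?thesis by (simp add: \<delta>_def)
 qed
 have ind_LC: "(indicator {x : carrier G. sig m n x = c} :: 'g => 'e) : LC T" if c: "c : sig m n ` carrier G" for m n c
 proof -
  obtain y where y: "y : carrier G" "c = sig m n y" using c by blast
  show ?thesis unfolding y(2) sig_class[OF y(1)] by (rule LC_coset[OF y(1)])
 qed
 have fin: "finite (sig m n ` carrier G)" for m n by (rule finite_image[of m n]) (rule sig_shift(4))
 have \<delta>_LC: "\<delta> m n : LC T" for m n
 proof -
  have "(%y. \<Sum>c\<in>sig m n ` carrier G. \<delta> m n c * indicator {x : carrier G. sig m n x = c} y) : LC T"
   using fin ind_LC by (intro LC_sum LC_scale)
  then show ?thesis using \<delta>_expand[of m n] by (metis (no_types, lifting) ext)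
 qed
 have L\<delta>: "vge (B - (k + r + s)) (L (\<delta> m n))" for m n
 proof -
  have "\<delta> m n = (%y. \<Sum>c\<in>sig m n ` carrier G. \<delta> m n c * indicator {x : carrier G. sig m n x = c} y)"
   by (rule ext) (rule \<delta>_expand)
  then have "L (\<delta> m n) = L (%y. \<Sum>c\<in>sig m n ` carrier G. \<delta> m n c * indicator {x : carrier G. sig m n x = c} y)"
   by (rule arg_cong)
  also have "\<dots> = (\<Sum>c\<in>sig m n ` carrier G. \<delta> m n c * L (indicator {x : carrier G. sig m n x = c}))"
   by (rule Lsum[OF fin ind_LC])
  also have "vge (B - (k + r + s)) \<dots>"
  proof (rule vge_sum)
   fix c assume "c : sig m n ` carrier G"
   then obtain y where y: "y : carrier G" "c = sig m n y" by blast
   have c: "c : carrier G" using sig_ex[OF y(1), of m n] y A1_c A2_c by auto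
   have "vge (- k - r * real m - s * real n) (L (indicator {x : carrier G. sig m n x = c}))"
    unfolding y(2) sig_class[OF y(1)] by (rule bnd[OF y(1)])
   then have "vge ((B + r * real (m - 1) + s * real (n - 1)) + (- k - r * real m - s * real n))
     (\<delta> m n c * L (indicator {x : carrier G. sig m n x = c}))" by (intro vge_mult \<delta>_vge[OF c])
   \<comment> \<open>The increments gain weights at levels m - 1 and n - 1, while L loses at m and
     n. The gap is at most r + s, uniformly in the levels, and enters the constant.\<close>
   moreover have "r * real m <= r * real (m - 1) + r" "s * real n <= s * real (n - 1) + s"
    using r_nonneg s_nonneg by (cases m; cases n; simp add: algebra_simps)+
   then have "B - (k + r + s) <= (B + r * real (m - 1) + s * real (n - 1)) + (- k - r * real m - s * real n)"
    by simp
   ultimately show "vge (B - (k + r + s)) (\<delta> m n c * L (indicator {x : carrier G. sig m n x = c}))"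
    by (rule vge_mono)
  qed
  finally show ?thesis .
 qed
 obtain n0 where n0: "\<forall>x\<in>carrier G. \<forall>u\<in>U n0. ph (x \<otimes> u) = ph x" using LC_uniform[OF ph(1)] by blast
 obtain l1 where l1: "A1 l1 \<subseteq> U n0" using A1_in_U by blast
 obtain l2 where l2: "A2 l2 \<subseteq> U n0" using A2_in_U by blast
 \<comment> \<open>At levels \<open>l1\<close> and \<open>l2\<close> moving to representatives does
   not change ph, so the double telescoping sum is finite.\<close>
 have "ph x = (\<Sum>m\<le>l1. \<Sum>n\<le>l2. \<delta> m n x)" if x: "x : carrier G" for x
 proof -
  note X = coords_props[OF x]
  let ?F = "pb (rho x) ph"
  have y1: "c1 x : carrier (G\<lparr>carrier := H1\<rparr>)" and y2: "c2 x : carrier (G\<lparr>carrier := H2\<rparr>)" using X by auto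
  obtain a where a: "a : A1 l1" "P.A.rep l1 (c1 x) = c1 x \<otimes> a" using P.A.rep_ex[OF y1] by auto
  obtain b where b: "b : A2 l2" "P.B.rep l2 (c2 x) = c2 x \<otimes> b" using P.B.rep_ex[OF y2] by auto
  have "?F (P.A.rep l1 (c1 x), P.B.rep l2 (c2 x)) = ph (x \<otimes> a \<otimes> b)"
   unfolding a(2) b(2) using pb_shift(3)[OF rho_closed[OF x] X(1,2) a(1) b(1)] X(3) by simp
  also have "\<dots> = ph x"
  proof -
   have "a : carrier G" using a A1_c by auto
   then have "ph (x \<otimes> a \<otimes> b) = ph (x \<otimes> a)" using n0 l2 b x by (meson m_closed subsetD)
   then show ?thesis using n0 l1 a x by (metis subsetD)
  qed
  finally have "ph x = ?F (P.A.rep l1 (c1 x), P.B.rep l2 (c2 x))" by simp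
  also have "\<dots> = (\<Sum>m\<le>l1. P.A.dif m (%h. ?F (h, P.B.rep l2 (c2 x))) (P.A.rep m (c1 x)))"
   by (rule P.A.telescope[OF y1])
  also have "\<dots> = (\<Sum>m\<le>l1. P.A.dif m (%h. \<Sum>n\<le>l2. P.B.dif n (%k. ?F (h, k)) (P.B.rep n (c2 x))) (P.A.rep m (c1 x)))"
   by (subst P.B.telescope[OF y2, of _ l2]) (rule refl)
  also have "\<dots> = (\<Sum>m\<le>l1. \<Sum>n\<le>l2. \<delta> m n x)"
   using x unfolding \<delta>_def by (intro sum.cong refl) (simp add: P.A.dif_def sum_subtractf)
  finally show ?thesis .
 qed
 then have "ph x = (\<Sum>m\<le>l1. \<Sum>n\<le>l2. \<delta> m n x)" for x
  using LC_outside[OF ph(1), of x] by (cases "x : carrier G") (auto simp: \<delta>_def)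
 then have e: "ph = (%x. \<Sum>q\<in>{..l1} \<times> {..l2}. 1 * \<delta> (fst q) (snd q) x)"
  by (intro ext) (simp add: sum.cartesian_product case_prod_beta')
 have "L ph = (\<Sum>q\<in>{..l1} \<times> {..l2}. 1 * L (\<delta> (fst q) (snd q)))"
  by (subst e, rule Lsum) (auto intro: \<delta>_LC)
 then show ?thesis using L\<delta> by (auto intro: vge_sum)
qed

text \<open>Coordinates in a basis of V reduce existence to scalar functionals;
  \<open>LC_bounded\<close> supplies the constant k + r + s for each of them.\<close>

theorem extension_exists_unique:
 fixes smul :: "'e => 'v::ab_group_add => 'v"
 assumes complete: "vcomplete UNIV" and fd: "finite_dimensional_vector_space smul Bs"
  and lin: "linear_on (LC T) smul L"
  and bnd: "!!b x m n. b : Bs ==> x : carrier G ==>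
   vge (- k - r * real m - s * real n)
    (module.representation smul Bs (L (indicator {x \<otimes> (a \<otimes> b) | a b. a : A1 m & b : A2 n})) b)"
 shows "\<exists>!\<Psi>. \<Psi> : dual_tensor (DrsG p v G T H1 H2 r s) smul & (\<forall>ph\<in>LC T. \<Psi> ph = L ph)"
proof -
 interpret V: finite_dimensional_vector_space smul Bs by (rule fd)
 let ?C = "CrsG p v G T H1 H2 r s" and ?w = "CrsG_val p v G T H1 H2 r s"
 have sp: "z : V.span Bs" for z using V.span_Basis by simp
 have SC: "LC T \<subseteq> ?C" using LC_CrsG by blast
 have dense: "\<exists>ph\<in>LC T. ereal B <= ?w (%x. f x - ph x)" if f: "f : ?C" for f B
 proof -
  obtain ph where "ph : LC T" "GN B (%x. f x - ph x)" using LC_dense_CrsG[OF f] by blast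
  then show ?thesis using CrsG_val_iff[OF CrsG_diff[OF f LC_CrsG]] by blast
 qed
 have "\<exists>\<mu>\<in>cont_dual v ?C ?w. \<forall>ph\<in>LC T. \<mu> ph = V.representation Bs (L ph) b" if b: "b : Bs" for b
 proof (rule extend_functional[where k = "k + r + s", OF complete CrsG_add CrsG_scale _ _ SC LC_add LC_scale dense])
  show lin': "linear_on (LC T) (*) (%ph. V.representation Bs (L ph) b)" using lin unfolding linear_on_def
   by (simp add: V.representation_add[OF V.independent_Basis sp sp] V.representation_scale[OF V.independent_Basis sp])
  show "ereal B <= ?w (%x. f x + g x)" if "f : ?C" "g : ?C" "ereal B <= ?w f" "ereal B <= ?w g" for B f g
   using that CrsG_val_iff CrsG_add GN_add by simp
  show "ereal (B + D) <= ?w (%x. c * f x)" if "f : ?C" "ereal B <= ?w f" "vge D c" for B D c f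
   using that CrsG_val_iff CrsG_scale GN_scale by simp
  show "vge (B - (k + r + s)) (V.representation Bs (L ph) b)" if "ph : LC T" "ereal B <= ?w ph" for ph B
   by (rule LC_bounded[OF lin' bnd[OF b] that(1)]) (use that CrsG_val_iff[OF LC_CrsG] in auto)
 qed
 then have "\<forall>b. \<exists>\<mu>. b : Bs --> \<mu> : cont_dual v ?C ?w & (\<forall>ph\<in>LC T. \<mu> ph = V.representation Bs (L ph) b)"
  by blast
 from choice[OF this] obtain \<mu> where
  "!!b. b : Bs ==> \<mu> b : cont_dual v ?C ?w" "!!b ph. b : Bs ==> ph : LC T ==> \<mu> b ph = V.representation Bs (L ph) b"
  by blast
 from dual_tensor_from_coordinates[OF fd this]
 obtain \<Psi> where \<Psi>: "\<Psi> : dual_tensor (cont_dual v ?C ?w) smul" "\<forall>ph\<in>LC T. \<Psi> ph = L ph" by blast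
 have "\<Psi>' = \<Psi>" if "\<Psi>' : dual_tensor (cont_dual v ?C ?w) smul" "\<forall>ph\<in>LC T. \<Psi>' ph = L ph" for \<Psi>'
 proof (rule dual_tensor_dense_eq[OF valued_field_axioms fd SC _ dense that(1) \<Psi>(1)])
  show "ereal B <= ?w (%x. ph x - f x)" if "f : ?C" "ph : LC T" "ereal B <= ?w (%x. f x - ph x)" for B f ph
   using that CrsG_val_iff CrsG_diff LC_CrsG GN_minus by simp
 qed (use that \<Psi> in auto)
 then show ?thesis using \<Psi> unfolding DrsG_def by blast
qed

end

section \<open>Comparison with functions of order r + s\<close>

locale two_filtrations_open = two_filtrations +
 fixes H :: "'a set"
 assumes H: "subgroup H G"
  and U_in_K: "\<exists>n. U n \<subseteq> ppow p (G\<lparr>carrier := H\<rparr>) m"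
  and K_in_U: "\<exists>m. ppow p (G\<lparr>carrier := H\<rparr>) m \<subseteq> U n"
begin

abbreviation "K m \<equiv> ppow p (G\<lparr>carrier := H\<rparr>) m"
abbreviation "t \<equiv> r + s"
abbreviation "CG \<equiv> CrG p v G T H (r + s)"
abbreviation "wG \<equiv> CrG_val p v G H (r + s)"

lemma t_nonneg: "t >= 0" using r_nonneg s_nonneg by simp

sublocale Q: zp_filtered v "G\<lparr>carrier := H\<rparr>" p "subtopology T H" "r + s"
proof (rule zp_filtered_subgroup[OF valued_field_axioms H t_nonneg])
 show "\<exists>n. U n \<inter> H \<subseteq> K m" for m using U_in_K[of m] by blast
qed

lemma H_c: "x : H ==> x : carrier G" using subgroup.subset[OF H] by blast

lemma K_H: "x : K m ==> x : H" by (rule ppow_sub[OF H])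

lemma K_c: "x : K m ==> x : carrier G" using K_H H_c by blast

text \<open>H has finitely many cosets, so the levels obtained on each of them have a common bound
  and the modulus becomes uniform over G.\<close>

lemma CG_iff: "f : CG \<longleftrightarrow> (\<forall>x. x \<notin> carrier G --> f x = 0) &
 (\<forall>B. \<exists>M. \<forall>m\<ge>M. \<forall>x\<in>carrier G. \<forall>k\<in>K m. vge (B + t * real m) (f (x \<otimes> k) - f x))" (is "_ \<longleftrightarrow> ?O & ?R")
proof -
 have sh: "pullback G H (%h. h) a f (x \<otimes> k) - pullback G H (%h. h) a f x = f (a \<otimes> x \<otimes> k) - f (a \<otimes> x)"
  if "a : carrier G" "x : H" "k : K m" for a x k m
  using that K_H subgroup.m_closed[OF H] H_c K_c by (simp add: pullback_def m_assoc)
 have "f : CG \<longleftrightarrow> ?O & (\<forall>a\<in>carrier G. \<forall>B. \<exists>M. \<forall>m\<ge>M. \<forall>x\<in>H. \<forall>k\<in>K m.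
   vge (B + t * real m) (f (a \<otimes> x \<otimes> k) - f (a \<otimes> x)))"
 proof -
  have "pullback G H (%h. h) a f : Cr p v (G\<lparr>carrier := H\<rparr>) (subtopology T H) t \<longleftrightarrow>
   (\<forall>B. \<exists>M. \<forall>m\<ge>M. \<forall>x\<in>H. \<forall>k\<in>K m. vge (B + t * real m) (f (a \<otimes> x \<otimes> k) - f (a \<otimes> x)))"
   if a: "a : carrier G" for a unfolding Q.Cr_iff using sh[OF a] by (simp add: pullback_def)
  then show ?thesis unfolding CrG_def glued_def by simp
 qed
 also have "\<dots> \<longleftrightarrow> ?O & ?R"
 proof (rule conj_cong[OF refl], intro iffI allI ballI)
  fix B assume *: "\<forall>a\<in>carrier G. \<forall>B. \<exists>M. \<forall>m\<ge>M. \<forall>x\<in>H. \<forall>k\<in>K m.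
   vge (B + t * real m) (f (a \<otimes> x \<otimes> k) - f (a \<otimes> x))"
  have KH: "K 0 = H" using Q.K_zero by simp
  obtain N where N: "U N \<subseteq> H" using U_in_K[of 0] unfolding KH by (elim exE)
  obtain X where X: "finite X" "X \<subseteq> carrier G" "\<forall>x\<in>carrier G. \<exists>a\<in>X. \<exists>k\<in>H. x = a \<otimes> k"
   using finite_index[OF H N] by (elim exE conjE)
  have "\<forall>a. \<exists>M. a : carrier G --> (\<forall>m\<ge>M. \<forall>x\<in>H. \<forall>k\<in>K m. vge (B + t * real m) (f (a \<otimes> x \<otimes> k) - f (a \<otimes> x)))"
   using * by blast
  from choice[OF this] obtain M where M: "!!a m x k. a : carrier G ==> M a <= m ==> x : H ==> k : K m ==>
    vge (B + t * real m) (f (a \<otimes> x \<otimes> k) - f (a \<otimes> x))" by blast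
  have le: "M a <= Max (insert 0 (M ` X))" if "a : X" for a by (rule Max_ge) (use X that in auto)
  have "vge (B + t * real m) (f (x \<otimes> k) - f x)"
   if m: "m >= Max (insert 0 (M ` X))" and x: "x : carrier G" and k: "k : K m" for m x k
  proof -
   obtain a h where ah: "a : X" "h : H" "x = a \<otimes> h" using X(3) x by (meson bexE)
   have "M a <= m" using le[OF ah(1)] m by simp
   then show ?thesis unfolding ah(3) using M ah X(2) k by blast
  qed
  then show "\<exists>M. \<forall>m\<ge>M. \<forall>x\<in>carrier G. \<forall>k\<in>K m. vge (B + t * real m) (f (x \<otimes> k) - f x)" by blast
 next
  fix a B assume *: ?R and a: "a : carrier G"
  obtain M where M: "\<forall>m\<ge>M. \<forall>x\<in>carrier G. \<forall>k\<in>K m. vge (B + t * real m) (f (x \<otimes> k) - f x)" using * by blast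
  then show "\<exists>M. \<forall>m\<ge>M. \<forall>x\<in>H. \<forall>k\<in>K m. vge (B + t * real m) (f (a \<otimes> x \<otimes> k) - f (a \<otimes> x))"
   using a H_c by (intro exI[of _ M]) simp
 qed
 finally show ?thesis .
qed

lemma wG_iff: "ereal B <= wG f \<longleftrightarrow> (\<forall>x\<in>carrier G. vge B (f x)) &
 (\<forall>x\<in>carrier G. \<forall>m. \<forall>k\<in>K m. vge (B + t * real m) (f (x \<otimes> k) - f x))"
proof -
 let ?P = "%a. pullback G H (%h. h) a f"
 have "ereal B <= wG f \<longleftrightarrow> (\<forall>a\<in>carrier G. \<forall>t\<in>tests p (G\<lparr>carrier := H\<rparr>). vge (B + twt (r + s) t) (tev t (?P a)))"
  unfolding CrG_val_def glued_val_def le_INF_iff Q.Cr_val_iff ..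
 also have "\<dots> \<longleftrightarrow> (\<forall>x\<in>carrier G. vge B (f x)) &
 (\<forall>x\<in>carrier G. \<forall>m. \<forall>k\<in>K m. vge (B + t * real m) (f (x \<otimes> k) - f x))" (is "?L \<longleftrightarrow> ?R")
 proof
  assume L: ?L
  have o: "\<one> : H" using subgroup.one_closed[OF H] .
  show ?R
  proof (intro conjI ballI allI)
   fix x assume x: "x : carrier G"
   have "Point \<one> : tests p (G\<lparr>carrier := H\<rparr>)" unfolding tests_def using o by simp
   then have "vge (B + twt (r + s) (Point \<one> :: 'a test)) (tev (Point \<one>) (?P x))" using L x by blast
   then show "vge B (f x)" using x o by (simp add: pullback_def)
   fix m k assume k: "k : K m"
   have "Diff m (\<one> \<otimes>\<^bsub>G\<lparr>carrier := H\<rparr>\<^esub> k) \<one> : tests p (G\<lparr>carrier := H\<rparr>)"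
    unfolding tests_def using o k by (intro UnI2 CollectI exI[of _ m] exI[of _ \<one>] exI[of _ k]) simp
   then have "vge (B + twt (r + s) (Diff m (\<one> \<otimes>\<^bsub>G\<lparr>carrier := H\<rparr>\<^esub> k) \<one>)) (tev (Diff m (\<one> \<otimes>\<^bsub>G\<lparr>carrier := H\<rparr>\<^esub> k) \<one>) (?P x))"
    using L x by blast
   then show "vge (B + t * real m) (f (x \<otimes> k) - f x)" using x o k K_H K_c by (simp add: pullback_def)
  qed
 next
  assume R: ?R
  show ?L
  proof (intro ballI)
   fix a c assume a: "a : carrier G" and "c : tests p (G\<lparr>carrier := H\<rparr>)"
   then consider x where "c = Point x" "x : H"
    | m x k where "c = Diff m (x \<otimes> k) x" "x : H" "k : K m" unfolding tests_def by auto
   then show "vge (B + twt (r + s) c) (tev c (?P a))"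
   proof cases
    case 1
    then show ?thesis using R a H_c by (simp add: pullback_def)
   next
    case 2
    then have c: "x : carrier G" "k : carrier G" "k : H" "x \<otimes> k : H" using H_c K_c K_H subgroup.m_closed[OF H] by auto
    then have "vge (B + t * real m) (f (a \<otimes> x \<otimes> k) - f (a \<otimes> x))" using R a 2 by blast
    then show ?thesis using 2 a c by (simp add: pullback_def m_assoc)
   qed
  qed
 qed
 finally show ?thesis .
qed

lemma CG_add: assumes "f : CG" "g : CG" shows "(%x. f x + g x) : CG" unfolding CG_iff
proof (intro conjI allI impI)
 fix B
 obtain M where M: "\<forall>m\<ge>M. \<forall>x\<in>carrier G. \<forall>k\<in>K m. vge (B + t * real m) (f (x \<otimes> k) - f x)"
  using assms(1) unfolding CG_iff by blast
 obtain N where N: "\<forall>m\<ge>N. \<forall>x\<in>carrier G. \<forall>k\<in>K m. vge (B + t * real m) (g (x \<otimes> k) - g x)"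
  using assms(2) unfolding CG_iff by blast
 have "vge (B + t * real m) ((f (x \<otimes> k) - f x) + (g (x \<otimes> k) - g x))"
  if "m >= max M N" "x : carrier G" "k : K m" for m x k using that M N by (intro vge_add) auto
 then show "\<exists>M. \<forall>m\<ge>M. \<forall>x\<in>carrier G. \<forall>k\<in>K m. vge (B + t * real m) (f (x \<otimes> k) + g (x \<otimes> k) - (f x + g x))"
  by (intro exI[of _ "max M N"]) (simp add: algebra_simps)
qed (use assms in \<open>simp add: CG_iff\<close>)

lemma CG_scale: assumes "f : CG" shows "(%x. c * f x) : CG" unfolding CG_iff
proof (intro conjI allI impI)
 fix B
 obtain D where D: "vge D c" using vge_ex by blast
 obtain M where M: "\<forall>m\<ge>M. \<forall>x\<in>carrier G. \<forall>k\<in>K m. vge (B - D + t * real m) (f (x \<otimes> k) - f x)"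
  using assms unfolding CG_iff by blast
 have "vge (B + t * real m) (c * f (x \<otimes> k) - c * f x)"
  if "m >= M" "x : carrier G" "k : K m" for m x k
 proof -
  have "vge (D + (B - D + t * real m)) (c * (f (x \<otimes> k) - f x))" using M that D by (intro vge_mult) auto
  then show ?thesis by (simp add: algebra_simps)
 qed
 then show "\<exists>M. \<forall>m\<ge>M. \<forall>x\<in>carrier G. \<forall>k\<in>K m. vge (B + t * real m) (c * f (x \<otimes> k) - c * f x)"
  by blast
qed (use assms in \<open>simp add: CG_iff\<close>)

lemma LC_CG: assumes "ph : LC T" shows "ph : CG" unfolding CG_iff
proof (intro conjI allI impI)
 fix B
 obtain n where n: "\<forall>x\<in>carrier G. \<forall>u\<in>U n. ph (x \<otimes> u) = ph x" using LC_uniform[OF assms] by blast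
 obtain M where M: "K M \<subseteq> U n" using K_in_U by blast
 have "vge (B + t * real m) (ph (x \<otimes> k) - ph x)" if "m >= M" "x : carrier G" "k : K m" for m x k
  using n M Q.K_mono[OF that(1,3)] that(2) by (simp add: subset_iff)
 then show "\<exists>M. \<forall>m\<ge>M. \<forall>x\<in>carrier G. \<forall>k\<in>K m. vge (B + t * real m) (ph (x \<otimes> k) - ph x)" by blast
qed (use LC_outside[OF assms] in simp)

lemma K_subgroup: "subgroup (K m) G"
proof (rule subgroupI)
 show "K m \<subseteq> carrier G" using K_c by blast
 show "K m ~= {}" using Q.K_one by auto
 show "inv k : K m" if "k : K m" for k using Q.K_inv[OF that] m_inv_consistent[OF H K_H[OF that]] by simp
 show "k \<otimes> l : K m" if "k : K m" "l : K m" for k l using Q.K_mult[OF that] by simp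
qed

text \<open>The truncation of \<open>Cr_val_diff_trunc\<close>, carried out on cosets of p^M-th
  powers of H in all of G at once.\<close>

lemma LC_dense_CG:
 assumes f: "f : CG" shows "\<exists>ph\<in>LC T. ereal B <= wG (%x. f x - ph x)"
proof -
 obtain M where M: "\<forall>m\<ge>M. \<forall>x\<in>carrier G. \<forall>k\<in>K m. vge (B + t * real m) (f (x \<otimes> k) - f x)"
  using f unfolding CG_iff by blast
 define \<sigma> where "\<sigma> x = (SOME y. y : (%k. x \<otimes> k) ` K M)" for x
 have \<sigma>: "\<exists>k\<in>K M. \<sigma> x = x \<otimes> k" if "x : carrier G" for x
 proof -
  have "x : (%k. x \<otimes> k) ` K M" using that Q.K_one[of M] by (intro image_eqI[of _ _ \<one>]) auto
  then have "\<sigma> x : (%k. x \<otimes> k) ` K M" unfolding \<sigma>_def by (rule someI)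
  then show ?thesis by blast
 qed
 have \<sigma>_shift: "\<sigma> (x \<otimes> k) = \<sigma> x" if x: "x : carrier G" and k: "k : K M" for x k
 proof -
  have "(%l. (x \<otimes> k) \<otimes> l) ` K M = (%l. x \<otimes> l) ` K M"
  proof (intro Set.set_eqI iffI)
   fix z assume "z : (%l. (x \<otimes> k) \<otimes> l) ` K M"
   then obtain l where l: "l : K M" "z = (x \<otimes> k) \<otimes> l" by auto
   then have "z = x \<otimes> (k \<otimes> l)" using x k K_c by (simp add: m_assoc)
   then show "z : (%l. x \<otimes> l) ` K M" using subgroup.m_closed[OF K_subgroup k l(1)] by blast
  next
   fix z assume "z : (%l. x \<otimes> l) ` K M"
   then obtain l where l: "l : K M" "z = x \<otimes> l" by auto
   have c: "k : carrier G" "l : carrier G" using k l K_c by auto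
   then have "k \<otimes> (inv k \<otimes> l) = l" using m_assoc[of k "inv k" l] by simp
   then have "z = (x \<otimes> k) \<otimes> (inv k \<otimes> l)" using l c x m_assoc[of x k "inv k \<otimes> l"] by simp
   moreover have "inv k \<otimes> l : K M"
    by (intro subgroup.m_closed[OF K_subgroup] subgroup.m_inv_closed[OF K_subgroup] k l)
   ultimately show "z : (%l. (x \<otimes> k) \<otimes> l) ` K M" by blast
  qed
  then show ?thesis unfolding \<sigma>_def by simp
 qed
 define ph where "ph x = (if x : carrier G then f (\<sigma> x) else 0)" for x
 obtain n where n: "U n \<subseteq> K M" using U_in_K by blast
 have "ph : LC T"
 proof (rule LC_I)
  show "\<exists>n. \<forall>u\<in>U n. ph (x \<otimes> u) = ph x" if x: "x : carrier G" for x
  proof (intro exI[of _ n] ballI)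
   fix u assume "u : U n"
   then have "u : K M" using n by blast
   then show "ph (x \<otimes> u) = ph x" using \<sigma>_shift[OF x] x K_c by (simp add: ph_def)
  qed
 qed (simp add: ph_def)
 moreover have pt: "vge (B + t * real M) (f x - ph x)" if x: "x : carrier G" for x
 proof -
  obtain k where "k : K M" "\<sigma> x = x \<otimes> k" using \<sigma>[OF x] by blast
  then show ?thesis using M x vge_diff_commute by (simp add: ph_def)
 qed
 have "ereal B <= wG (%x. f x - ph x)" unfolding wG_iff
 proof (intro conjI ballI allI)
  have tM: "B <= B + t * real M" using t_nonneg by simp
  show "vge B (f x - ph x)" if "x : carrier G" for x using vge_mono[OF pt[OF that] tM] .
  fix x m k assume x: "x : carrier G" and k: "k : K m"
  show "vge (B + t * real m) (f (x \<otimes> k) - ph (x \<otimes> k) - (f x - ph x))"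
  proof (cases "m >= M")
   case True
   then have "k : K M" using Q.K_mono k by blast
   then have "ph (x \<otimes> k) = ph x" using \<sigma>_shift[OF x] x K_c by (simp add: ph_def)
   then show ?thesis using M x k True by simp
  next
   case False
   then have "B + t * real m <= B + t * real M" using t_nonneg by (intro add_left_mono mult_left_mono) auto
   moreover have "vge (B + t * real M) (f (x \<otimes> k) - ph (x \<otimes> k) - (f x - ph x))"
    by (rule vge_diff) (use pt x k K_c in auto)
   ultimately show ?thesis using vge_mono by blast
  qed
 qed
 ultimately show ?thesis by blast
qed

text \<open>Some p^c-th powers of H1 and H2 lie in H; raising to the power p^m then compares the
  filtrations, with a shift c independent of m.\<close>

lemma A_in_K: "\<exists>c. \<forall>m. A1 (m + c) \<subseteq> K m & A2 (m + c) \<subseteq> K m"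
proof -
 have KH: "K 0 = H" using Q.K_zero by simp
 obtain n where n: "U n \<subseteq> H" using U_in_K[of 0] KH by auto
 obtain c1 where c1: "A1 c1 \<subseteq> U n" using A1_in_U by blast
 obtain c2 where c2: "A2 c2 \<subseteq> U n" using A2_in_U by blast
 have pow: "ppow p (G\<lparr>carrier := H'\<rparr>) (m + c) \<subseteq> K m"
  if H': "subgroup H' G" and c: "ppow p (G\<lparr>carrier := H'\<rparr>) c \<subseteq> H" for H' c m
 proof
  fix a assume "a : ppow p (G\<lparr>carrier := H'\<rparr>) (m + c)"
  then obtain h where h: "h : H'" "a = h [^] (p ^ (m + c))" unfolding ppow_subgroup by blast
  have "h : carrier G" using h subgroup.subset[OF H'] by blast
  then have "a = (h [^] (p ^ c)) [^] (p ^ m)" using h by (simp add: nat_pow_pow power_add mult.commute)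
  moreover have "h [^] (p ^ c) : H" using c h unfolding ppow_subgroup by blast
  ultimately show "a : K m" unfolding ppow_subgroup by blast
 qed
 let ?c = "max c1 c2"
 have "A1 ?c \<subseteq> H" using P.A.K_mono[of c1 ?c] c1 n by auto
 moreover have "A2 ?c \<subseteq> H" using P.B.K_mono[of c2 ?c] c2 n by auto
 ultimately show ?thesis using pow[OF H1] pow[OF H2] by blast
qed

text \<open>A double difference is a difference of single differences in two ways. Using the
  variable of the larger level gives t times the maximum of m and n, which dominates r m + s n. The
  shift c of \<open>A_in_K\<close> costs t c.\<close>

lemma CG_GN: "\<exists>c. \<forall>f B. ereal B <= wG f --> GN (B - c) f"
proof -
 obtain c where c: "!!m. A1 (m + c) \<subseteq> K m" "!!m. A2 (m + c) \<subseteq> K m" using A_in_K by blast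
 have "GN (B - t * real c) f" if w: "ereal B <= wG f" for f B
 proof -
  let ?B = "B - t * real c"
  have f0: "vge B (f x)" if "x : carrier G" for x using w that unfolding wG_iff by blast
  have f1: "vge (B + t * real m) (f (x \<otimes> k) - f x)" if "x : carrier G" "k : K m" for x m k
   using w that unfolding wG_iff by blast
  have e: "vge (?B + t * real m) (f (x \<otimes> h) - f x)"
   if x: "x : carrier G" and h: "h : A1 m \<or> h : A2 m" for x m h
  proof (cases "m >= c")
   case True
   then have "h : K (m - c)" using c[of "m - c"] h by auto
   then have "vge (B + t * real (m - c)) (f (x \<otimes> h) - f x)" using f1 x by blast
   then show ?thesis using True by (simp add: of_nat_diff algebra_simps)
  next
   case False
   then have "t * real m <= t * real c" using t_nonneg by (intro mult_left_mono) auto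
   moreover have "h : carrier G" using h A1_c A2_c by blast
   then have "vge B (f (x \<otimes> h) - f x)" using f0 x vge_diff by simp
   ultimately show ?thesis by (auto intro: vge_mono)
  qed
  have rt: "r * real m <= t * real m" "s * real m <= t * real m" for m
   using r_nonneg s_nonneg by (auto intro!: mult_right_mono)
  show ?thesis unfolding GN_def
  proof (intro ballI allI conjI)
   fix x m n h k assume x: "x : carrier G" and h: "h : A1 m" and k: "k : A2 n"
   have hc: "h : carrier G" "k : carrier G" using h k A1_c A2_c by auto
   have "?B <= B" using t_nonneg by simp
   then show "vge ?B (f x)" using f0[OF x] vge_mono by blast
   have "?B + r * real m <= ?B + t * real m" using rt by simp
   moreover have "vge (?B + t * real m) (f (x \<otimes> h) - f x)" using e x h by blast
   ultimately show "vge (?B + r * real m) (f (x \<otimes> h) - f x)" using vge_mono by blast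
   have "?B + s * real n <= ?B + t * real n" using rt by simp
   moreover have "vge (?B + t * real n) (f (x \<otimes> k) - f x)" using e x k by blast
   ultimately show "vge (?B + s * real n) (f (x \<otimes> k) - f x)" using vge_mono by blast
   show "vge (?B + r * real m + s * real n) (f (x \<otimes> h \<otimes> k) - f (x \<otimes> h) - (f (x \<otimes> k) - f x))"
   proof (cases "m <= n")
    case True
    then have "r * real m <= r * real n" using r_nonneg by (intro mult_left_mono) auto
    then have "?B + r * real m + s * real n <= ?B + t * real n" by (simp add: algebra_simps)
    moreover have "vge (?B + t * real n) (f (x \<otimes> h \<otimes> k) - f (x \<otimes> h) - (f (x \<otimes> k) - f x))"
     by (rule vge_diff) (use e[of "x \<otimes> h" k n] e[of x k n] x k hc in auto)
    ultimately show ?thesis using vge_mono by blast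
   next
    case False
    then have "s * real n <= s * real m" using s_nonneg by (intro mult_left_mono) auto
    then have "?B + r * real m + s * real n <= ?B + t * real m" by (simp add: algebra_simps)
    moreover have "vge (?B + t * real m) ((f (x \<otimes> k \<otimes> h) - f (x \<otimes> k)) - (f (x \<otimes> h) - f x))"
     by (rule vge_diff) (use e[of "x \<otimes> k" h m] e[of x h m] x h hc in auto)
    moreover have "x \<otimes> k \<otimes> h = x \<otimes> h \<otimes> k" using x hc by (simp add: m_ac)
    moreover have "(f (x \<otimes> h \<otimes> k) - f (x \<otimes> k)) - (f (x \<otimes> h) - f x) = f (x \<otimes> h \<otimes> k) - f (x \<otimes> h) - (f (x \<otimes> k) - f x)"
     by simp
    ultimately have "vge (?B + t * real m) (f (x \<otimes> h \<otimes> k) - f (x \<otimes> h) - (f (x \<otimes> k) - f x))"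
     by simp
    then show ?thesis using \<open>?B + r * real m + s * real n <= ?B + t * real m\<close> by (rule vge_mono)
   qed
  qed
 qed
 then show ?thesis by blast
qed

lemma CG_modulus:
 assumes f: "f : CG"
 shows "\<exists>M. \<forall>m\<ge>M. \<forall>x\<in>carrier G. \<forall>h\<in>A1 m \<union> A2 m. vge (B + t * real m) (f (x \<otimes> h) - f x)"
proof -
 obtain c where c: "!!m. A1 (m + c) \<subseteq> K m" "!!m. A2 (m + c) \<subseteq> K m" using A_in_K by blast
 obtain M where M: "\<forall>m\<ge>M. \<forall>x\<in>carrier G. \<forall>k\<in>K m. vge (B + t * real c + t * real m) (f (x \<otimes> k) - f x)"
  using f unfolding CG_iff by blast
 have "vge (B + t * real m) (f (x \<otimes> h) - f x)" if m: "m >= M + c" and x: "x : carrier G" and h: "h : A1 m \<union> A2 m" for m x h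
 proof -
  have "h : K (m - c)" using c[of "m - c"] h m by auto
  moreover have "m - c >= M" using m by simp
  ultimately have "vge (B + t * real c + t * real (m - c)) (f (x \<otimes> h) - f x)" using M x by blast
  then show ?thesis using m by (simp add: of_nat_diff algebra_simps)
 qed
 then show ?thesis by blast
qed

text \<open>Freezing the first coordinate at a level L gives an algebraic tensor with sections of
  order s. The error has pointwise valuation at least B + t L, which pays for levels below L, and
  the modulus of f pays for those above.\<close>

lemma CG_CrsG:
 assumes f: "f : CG" shows "f : CrsG p v G T H1 H2 r s"
proof (rule CrsG_I)
 show "f x = 0" if "x \<notin> carrier G" for x using f that unfolding CG_iff by blast
 fix a B assume a: "a : carrier G"
 let ?F = "pb a f"
 obtain L where L: "!!m x h. m >= L ==> x : carrier G ==> h : A1 m \<union> A2 m ==> vge (B + t * real m) (f (x \<otimes> h) - f x)"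
  using CG_modulus[OF f, of B] by blast
 have aG: "a \<otimes> (x \<otimes> y) : carrier G" if "x : H1" "y : H2" for x y using a that H1_c H2_c by simp
 have o: "\<one> : A1 0" "\<one> : A2 0" using P.A.K_one[of 0] P.B.K_one[of 0] by simp_all
 have FA: "vge (B' + t * real m) (?F (x \<otimes> h, y) - ?F (x, y))"
  if "!!z. z : carrier G ==> vge (B' + t * real m) (f (z \<otimes> h) - f z)" "x : H1" "y : H2" "h : A1 m" for B' m x y h
  using that(1)[OF aG[OF that(2,3)]] pb_shift(1)[OF a that(2,3,4) o(2)] pb_apply[OF that(2,3)] by simp
 have FB: "vge (B' + t * real m) (?F (x, y \<otimes> k) - ?F (x, y))"
  if "!!z. z : carrier G ==> vge (B' + t * real m) (f (z \<otimes> k) - f z)" "x : H1" "y : H2" "k : A2 m" for B' m x y k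
  using that(1)[OF aG[OF that(2,3)]] pb_shift(2)[OF a that(2,3) o(1) that(4)] pb_apply[OF that(2,3)] by simp
 have rep1: "P.A.rep L x : H1" if "x : H1" for x using P.A.rep_closed[of x L] that by simp
 define D where "D = (%(x, y). if x : H1 & y : H2 then ?F (P.A.rep L x, y) else 0)"
 have "D : alg_tensor P.C1 P.C2"
 proof (rule P.section_alg[where L = L])
  show "D z = 0" if "z \<notin> carrier (G\<lparr>carrier := H1\<rparr>) \<times> carrier (G\<lparr>carrier := H2\<rparr>)" for z
   using that unfolding D_def by (cases z) auto
  show "D (x \<otimes>\<^bsub>G\<lparr>carrier := H1\<rparr>\<^esub> h, y) = D (x, y)"
   if "x : carrier (G\<lparr>carrier := H1\<rparr>)" "h : A1 L" "y : carrier (G\<lparr>carrier := H2\<rparr>)" for x h y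
   using that P.A.rep_mult[of x h L] H1_mult by (simp add: D_def)
  show "(%y. D (c, y)) : P.C2" if c: "c : carrier (G\<lparr>carrier := H1\<rparr>)" for c unfolding P.B.Cr_iff
  proof (intro conjI allI impI)
   fix B'
   obtain M where M: "\<forall>m\<ge>M. \<forall>x\<in>carrier G. \<forall>h\<in>A1 m \<union> A2 m. vge (B' + t * real m) (f (x \<otimes> h) - f x)"
    using CG_modulus[OF f, of B'] by blast
   have "vge (B' + s * real m) (D (c, y \<otimes> k) - D (c, y))" if m: "m >= M" and y: "y : H2" and k: "k : A2 m" for m y k
   proof -
    have "vge (B' + t * real m) (?F (P.A.rep L c, y \<otimes> k) - ?F (P.A.rep L c, y))"
     using M m y k c rep1 by (intro FB) auto
    moreover have "B' + s * real m <= B' + t * real m" using r_nonneg by (simp add: algebra_simps)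
    ultimately have "vge (B' + s * real m) (?F (P.A.rep L c, y \<otimes> k) - ?F (P.A.rep L c, y))" using vge_mono by blast
    then show ?thesis using c y H2_mult[OF y k] by (simp add: D_def)
   qed
   then show "\<exists>M. \<forall>m\<ge>M. \<forall>x\<in>carrier (G\<lparr>carrier := H2\<rparr>). \<forall>k\<in>A2 m.
    vge (B' + s * real m) (D (c, x \<otimes>\<^bsub>G\<lparr>carrier := H2\<rparr>\<^esub> k) - D (c, x))" by (intro exI[of _ M]) simp
  qed (simp add: D_def)
 qed
 moreover have "P.Nge B (%z. ?F z - D z)"
 proof -
  let ?R = "%x y. ?F (x, y) - D (x, y)"
  have D: "D (x, y) = ?F (P.A.rep L x, y)" if "x : H1" "y : H2" for x y using that by (simp add: D_def)
  have R1: "vge (B + t * real L) (?R x y)" if "x : H1" "y : H2" for x y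
  proof -
   obtain l where l: "l : A1 L" "P.A.rep L x = x \<otimes> l" using P.A.rep_ex[of x L] \<open>x : H1\<close> by auto
   have "vge (B + t * real L) (?F (x \<otimes> l, y) - ?F (x, y))" using that L l by (intro FA) auto
   then show ?thesis using l D that vge_diff_commute by simp
  qed
  have R2: "vge (B + t * real n) (?R x (y \<otimes> k) - ?R x y)" if "x : H1" "y : H2" "n >= L" "k : A2 n" for x y n k
  proof -
   have "vge (B + t * real n) ((?F (x, y \<otimes> k) - ?F (x, y)) - (?F (P.A.rep L x, y \<otimes> k) - ?F (P.A.rep L x, y)))"
    by (rule vge_diff) (use that L rep1 in \<open>auto intro!: FB\<close>)
   moreover have "(?F (x, y \<otimes> k) - ?F (x, y)) - (?F (P.A.rep L x, y \<otimes> k) - ?F (P.A.rep L x, y)) = ?R x (y \<otimes> k) - ?R x y"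
    using D[OF that(1,2)] D[OF that(1) H2_mult[OF that(2,4)]] by simp
   ultimately show ?thesis by simp
  qed
  have R3: "?R (x \<otimes> h) y - ?R x y = ?F (x \<otimes> h, y) - ?F (x, y)" if "x : H1" "y : H2" "m >= L" "h : A1 m" for x y m h
  proof -
   have "h : A1 L" using P.A.K_mono that by blast
   then have "P.A.rep L (x \<otimes> h) = P.A.rep L x" using P.A.rep_mult[of x h L] that by simp
   then show ?thesis using D[OF that(1,2)] D[OF H1_mult[OF that(1,4)] that(2)] by simp
  qed
  have tL: "t * real m <= t * real L" if "m <= L" for m using that t_nonneg by (intro mult_left_mono) auto
  have rs: "r * real m <= r * real n" "s * real m <= s * real n" if "m <= n" for m n
   using that r_nonneg s_nonneg by (auto intro!: mult_left_mono)
  have tL0: "0 <= t * real L" "0 <= r * real m" "0 <= s * real m" for m using t_nonneg r_nonneg s_nonneg by auto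
  show ?thesis unfolding Nge_iff
  proof (intro ballI allI conjI)
   fix x y m n h k assume x: "x : H1" and y: "y : H2" and h: "h : A1 m" and k: "k : A2 n"
   have xh: "x \<otimes> h : H1" and yk: "y \<otimes> k : H2" using x y h k H1_mult H2_mult by auto
   show "vge B (?R x y)" by (rule vge_mono[OF R1[OF x y]]) (use tL0 in simp)
   show "vge (B + r * real m) (?R (x \<otimes> h) y - ?R x y)"
   proof (cases "m >= L")
    case True
    have "vge (B + t * real m) (?F (x \<otimes> h, y) - ?F (x, y))" using x y h True L by (intro FA) auto
    then show ?thesis unfolding R3[OF x y True h] by (rule vge_mono) (use tL0 in \<open>simp add: algebra_simps\<close>)
   next
    case False
    have "vge (B + t * real L) (?R (x \<otimes> h) y - ?R x y)" by (rule vge_diff) (use R1 x y xh in auto)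
    then show ?thesis by (rule vge_mono) (use rs(1)[of m L] tL0(3)[of L] False in \<open>simp add: algebra_simps\<close>)
   qed
   show "vge (B + s * real n) (?R x (y \<otimes> k) - ?R x y)"
   proof (cases "n >= L")
    case True
    show ?thesis by (rule vge_mono[OF R2[OF x y True k]]) (use tL0 in \<open>simp add: algebra_simps\<close>)
   next
    case False
    have "vge (B + t * real L) (?R x (y \<otimes> k) - ?R x y)" by (rule vge_diff) (use R1 x y yk in auto)
    then show ?thesis by (rule vge_mono) (use rs(2)[of n L] tL0(2)[of L] False in \<open>simp add: algebra_simps\<close>)
   qed
   show "vge (B + r * real m + s * real n) (?R (x \<otimes> h) (y \<otimes> k) - ?R (x \<otimes> h) y - (?R x (y \<otimes> k) - ?R x y))"
   proof -
    \<comment> \<open>The larger of m and n, if it is at least L, decides in which variable the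
      double difference is split; below L the pointwise error is enough.\<close>
    consider "n >= L" "m <= n" | "m >= L" "n <= m" | "m <= L" "n <= L" by linarith
    then show ?thesis
    proof cases
     case 1
     have "vge (B + t * real n) (?R (x \<otimes> h) (y \<otimes> k) - ?R (x \<otimes> h) y - (?R x (y \<otimes> k) - ?R x y))"
      by (rule vge_diff[OF R2[OF xh y 1(1) k] R2[OF x y 1(1) k]])
     then show ?thesis by (rule vge_mono) (use rs(1)[OF 1(2)] in \<open>simp add: algebra_simps\<close>)
    next
     case 2
     have "vge (B + t * real m) ((?F (x \<otimes> h, y \<otimes> k) - ?F (x, y \<otimes> k)) - (?F (x \<otimes> h, y) - ?F (x, y)))"
      by (rule vge_diff) (use x y h yk 2 L in \<open>auto intro!: FA\<close>)
     then have "vge (B + t * real m) ((?R (x \<otimes> h) (y \<otimes> k) - ?R x (y \<otimes> k)) - (?R (x \<otimes> h) y - ?R x y))"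
      unfolding R3[OF x y 2(1) h] R3[OF x yk 2(1) h] .
     then have "vge (B + t * real m) (?R (x \<otimes> h) (y \<otimes> k) - ?R (x \<otimes> h) y - (?R x (y \<otimes> k) - ?R x y))"
      by (simp add: algebra_simps)
     then show ?thesis by (rule vge_mono) (use rs(2)[OF 2(2)] in \<open>simp add: algebra_simps\<close>)
    next
     case 3
     have "vge (B + t * real L) (?R (x \<otimes> h) (y \<otimes> k) - ?R (x \<otimes> h) y - (?R x (y \<otimes> k) - ?R x y))"
      by (rule vge_diff; rule vge_diff) (use R1 x y xh yk in auto)
     then show ?thesis by (rule vge_mono) (use rs(1)[OF 3(1)] rs(2)[OF 3(2)] in \<open>simp add: algebra_simps\<close>)
    qed
   qed
  qed
 qed
 ultimately show "\<exists>D\<in>alg_tensor P.C1 P.C2. P.Nge B (%z. ?F z - D z)" by blast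
qed

text \<open>The inclusion of the two function spaces loses a constant in valuation by
  \<open>CG_GN\<close>, hence is continuous.\<close>

lemma restrict_cont_dual:
 assumes \<mu>: "\<mu> : DrsG p v G T H1 H2 r s"
 shows "restrict_functional CG \<mu> : DrG p v G T H (r + s)" unfolding DrG_def cont_dual_def
proof (intro CollectI conjI allI impI)
 let ?C = "CrsG p v G T H1 H2 r s" and ?w = "CrsG_val p v G T H1 H2 r s"
 have lin: "linear_on ?C (*) \<mu>" and cont: "continuous_map (val_topology ?C ?w) (val_topology UNIV v) \<mu>"
  using \<mu> unfolding DrsG_def cont_dual_def by auto
 show "linear_on CG (*) (restrict_functional CG \<mu>)"
  using lin CG_add CG_scale CG_CrsG unfolding linear_on_def restrict_functional_def by simp
 show "restrict_functional CG \<mu> f = 0" if "f \<notin> CG" for f using that by (simp add: restrict_functional_def)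
 show "continuous_map (val_topology CG wG) (val_topology UNIV v) (restrict_functional CG \<mu>)"
  unfolding continuous_map_def topspace_val
 proof (intro conjI allI impI)
  fix V assume V: "openin (val_topology UNIV v) V"
  then have o: "openin (val_topology ?C ?w) {x : ?C. \<mu> x : V}"
   using cont unfolding continuous_map_def topspace_val by blast
  obtain c where c: "!!f B. ereal B <= wG f ==> GN (B - c) f" using CG_GN by blast
  show "openin (val_topology CG wG) {x : CG. restrict_functional CG \<mu> x : V}" unfolding openin_val_topology
  proof (intro conjI ballI)
   fix f assume "f : {x : CG. restrict_functional CG \<mu> x : V}"
   then have f: "f : CG" "f : ?C" "\<mu> f : V" using CG_CrsG by (auto simp: restrict_functional_def)
   then obtain B where B: "!!g. g : ?C ==> ereal B <= ?w (g - f) ==> \<mu> g : V"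
    using o unfolding openin_val_topology by blast
   have "\<mu> g : V" if g: "g : CG" "ereal (B + c) <= wG (g - f)" for g
   proof (rule B)
    show "g : ?C" using CG_CrsG g by blast
    then have "(%x. g x - f x) : ?C" using CrsG_diff f by blast
    moreover have "GN (B + c - c) (g - f)" using c g by blast
    ultimately show "ereal B <= ?w (g - f)" using CrsG_val_iff by (simp add: fun_diff_def)
   qed
   then show "\<exists>B. \<forall>g\<in>CG. ereal B <= wG (g - f) --> g : {x : CG. restrict_functional CG \<mu> x : V}"
    by (intro exI[of _ "B + c"]) (auto simp: restrict_functional_def)
  qed auto
 qed auto
qed

theorem restriction_unique:
 fixes smul :: "'b => 'v::ab_group_add => 'v"
 assumes fd: "finite_dimensional_vector_space smul Bs"
  and \<Psi>: "\<Psi> : dual_tensor (DrsG p v G T H1 H2 r s) smul" "\<forall>ph\<in>LC T. \<Psi> ph = L ph"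
 defines "D \<equiv> dual_tensor (DrG p v G T H (r + s)) smul"
 shows "restrict_functional CG \<Psi> : D"
  and "\<exists>!X. X : D & (\<forall>ph\<in>LC T. X ph = L ph)"
  and "restrict_functional CG \<Psi> = (THE X. X : D & (\<forall>ph\<in>LC T. X ph = L ph))"
proof -
 interpret V: finite_dimensional_vector_space smul Bs by (rule fd)
 obtain n \<mu> x where 1: "\<Psi> = (%ph. \<Sum>i<(n::nat). smul (\<mu> i ph) (x i))" "\<forall>i<n. \<mu> i : DrsG p v G T H1 H2 r s"
  using \<Psi>(1) unfolding dual_tensor_def by (elim CollectE exE conjE)
 have "restrict_functional CG \<Psi> = (%ph. \<Sum>i<n. smul (restrict_functional CG (\<mu> i) ph) (x i))"
  by (rule ext) (simp add: 1 restrict_functional_def)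
 then show D: "restrict_functional CG \<Psi> : D" unfolding D_def dual_tensor_def using 1 restrict_cont_dual
  by (intro CollectI exI[of _ n] exI[of _ "%i. restrict_functional CG (\<mu> i)"] exI[of _ x]) simp
 have R: "\<forall>ph\<in>LC T. restrict_functional CG \<Psi> ph = L ph"
  using \<Psi>(2) LC_CG by (simp add: restrict_functional_def)
 have U: "X = restrict_functional CG \<Psi>" if X: "X : D" "\<forall>ph\<in>LC T. X ph = L ph" for X
 proof (rule dual_tensor_dense_eq[OF valued_field_axioms fd _ _ LC_dense_CG])
  show "LC T \<subseteq> CG" using LC_CG by blast
  show "ereal B <= wG (%x. ph x - f x)" if "ereal B <= wG (%x. f x - ph x)" for B f ph
  proof -
   have *: "ph y - f y - (ph x - f x) = - (f y - ph y - (f x - ph x))" for x y by simp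
   show ?thesis using that vge_diff_commute unfolding wG_iff * vge_minus by blast
  qed
  show "X : dual_tensor (cont_dual v CG wG) smul" using X unfolding D_def DrG_def by simp
  show "restrict_functional CG \<Psi> : dual_tensor (cont_dual v CG wG) smul" using D unfolding D_def DrG_def by simp
 qed (use X R in auto)
 show ex1: "\<exists>!X. X : D & (\<forall>ph\<in>LC T. X ph = L ph)" using D R U by blast
 show "restrict_functional CG \<Psi> = (THE X. X : D & (\<forall>ph\<in>LC T. X ph = L ph))"
  using the1_equality[OF ex1] D R by simp
qed

end

section \<open>Imaginary quadratic fields\<close>

text \<open>Completing the square gives a generator with rational square D. Were D non-negative,
  sending it to a real square root would embed K in the reals. Multiplying by the denominator of D
  makes the square an integer.\<close>

lemma imaginary_quadratic_generator:
 assumes iq: "imaginary_quadratic TYPE('k::field_char_0)"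
 shows "\<exists>(w::'k) (d::int). d > 0 & w * w = - of_int d & (\<forall>x. \<exists>a b. x = of_rat a + of_rat b * w)"
proof -
 interpret V: vector_space "%(q::rat) (x::'k). of_rat q * x"
  by unfold_locales (auto simp: algebra_simps of_rat_add of_rat_mult)
 have dim: "V.dim (UNIV::'k set) = 2" using iq unfolding imaginary_quadratic_def by blast
 have span1: "x : V.span {1} \<longleftrightarrow> x : \<rat>" for x :: 'k
  unfolding V.span_singleton by (auto simp: Rats_def)
 have "\<exists>x::'k. x \<notin> \<rat>"
 proof (rule ccontr)
  assume "~ ?thesis"
  then have "V.span {1} = (UNIV::'k set)" using span1 by blast
  then have "V.dim (UNIV::'k set) <= card {1::'k}" by (intro V.dim_le_card) auto
  then show False using dim by simp
 qed
 then obtain x :: 'k where x: "x \<notin> \<rat>" by blast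
 have ind: "V.independent {x, 1}" using x span1 by (intro V.independent_insertI) (auto simp: V.dependent_def)
 have x1: "x ~= 1" using x by auto
 obtain t where t: "{x, 1} \<subseteq> t" "V.independent t" "UNIV \<subseteq> V.span t"
  by (rule V.maximal_independent_subset_extend[OF subset_UNIV ind]) blast
 have "card t = 2" using V.basis_card_eq_dim[of t UNIV] t dim by simp
 moreover from this have "finite t" by (metis card.infinite zero_neq_numeral)
 ultimately have "t = {x, 1}" using t(1) x1 card_subset_eq[of t "{x, 1}"] by simp
 then have sp: "V.span {x, 1} = (UNIV::'k set)" using t by auto
 have rep: "\<exists>a b. z = of_rat a + of_rat b * x" for z
 proof -
  have "z : V.span (insert x {1})" using sp by simp
  then obtain b where "z - of_rat b * x : V.span {1}" unfolding V.span_insert by blast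
  then obtain a where "z - of_rat b * x = of_rat a" using span1 by (auto elim: Rats_cases)
  then show ?thesis by (metis diff_add_cancel)
 qed
 obtain u e where ue: "x * x = of_rat u + of_rat e * x" using rep by blast
 define c where "c = e / 2"
 have ec: "e = c + c" by (simp add: c_def)
 define D where "D = u + c * c"
 define y where "y = x - of_rat c"
 have y2: "y * y = of_rat D" using ue by (simp add: y_def D_def ec of_rat_add of_rat_mult algebra_simps)
 have repy: "\<exists>a b. z = of_rat a + of_rat b * y" for z
 proof -
  obtain a b where "z = of_rat a + of_rat b * x" using rep by blast
  then have "z = of_rat (a + b * c) + of_rat b * y" by (simp add: y_def of_rat_add of_rat_mult algebra_simps)
  then show ?thesis by blast
 qed
 have ynr: "y \<notin> \<rat>"
 proof
  assume "y : \<rat>"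
  then have "y + of_rat c : \<rat>" by (intro Rats_add) auto
  then show False using x by (simp add: y_def)
 qed
 have uniq: "a = a' & b = b'" if "of_rat a + of_rat b * y = of_rat a' + of_rat b' * y" for a b a' b'
 proof -
  have "of_rat (b - b') * y = of_rat (a' - a)" using that by (simp add: of_rat_diff algebra_simps)
  then have "b = b'"
  proof (cases "b = b'")
   case False
   then have "y = of_rat ((a' - a) / (b - b'))"
    using \<open>of_rat (b - b') * y = of_rat (a' - a)\<close> by (simp add: of_rat_divide field_simps of_rat_diff)
   then show ?thesis using ynr by auto
  qed
  then show ?thesis using that by simp
 qed
 have "D < 0"
 proof (rule ccontr)
  assume "~ D < 0"
  \<comment> \<open>Coordinates in 1 and y are unique, so replacing y by q is a well-defined ring
    homomorphism into the reals, even if q is rational.\<close>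
  define q where "q = sqrt (real_of_rat D)"
  have q: "q * q = of_rat D" using \<open>~ D < 0\<close> unfolding q_def by simp
  define c1 where "c1 z = fst (SOME ab. z = of_rat (fst ab) + of_rat (snd ab) * y)" for z
  define c2 where "c2 z = snd (SOME ab. z = of_rat (fst ab) + of_rat (snd ab) * y)" for z
  have c: "z = of_rat (c1 z) + of_rat (c2 z) * y" for z
  proof -
   have "\<exists>ab. z = of_rat (fst ab) + of_rat (snd ab) * y" using repy[of z] by auto
   from someI_ex[OF this] show ?thesis unfolding c1_def c2_def .
  qed
  have c_eq: "c1 (of_rat a + of_rat b * y) = a" "c2 (of_rat a + of_rat b * y) = b" for a b
   using uniq c[of "of_rat a + of_rat b * y"] by metis+
  define \<sigma> :: "'k => real" where "\<sigma> z = of_rat (c1 z) + of_rat (c2 z) * q" for z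
  have \<sigma>: "\<sigma> (of_rat a + of_rat b * y) = of_rat a + of_rat b * q" for a b
   unfolding \<sigma>_def c_eq ..
  have "\<sigma> 1 = 1" using \<sigma>[of 1 0] by simp
  moreover have "\<sigma> (z + z') = \<sigma> z + \<sigma> z'" for z z'
  proof -
   have "z + z' = of_rat (c1 z + c1 z') + of_rat (c2 z + c2 z') * y"
    by (subst (1) c[of z], subst (1) c[of z']) (simp add: of_rat_add algebra_simps)
   then have "\<sigma> (z + z') = of_rat (c1 z + c1 z') + of_rat (c2 z + c2 z') * q" using \<sigma> by simp
   then show ?thesis by (simp add: \<sigma>_def of_rat_add algebra_simps)
  qed
  moreover have "\<sigma> (z * z') = \<sigma> z * \<sigma> z'" for z z'
  proof -
   have "z * z' = of_rat (c1 z * c1 z') + of_rat (c2 z * c2 z') * (y * y) + of_rat (c1 z * c2 z' + c2 z * c1 z') * y"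
    by (subst (1) c[of z], subst (1) c[of z']) (simp add: of_rat_add of_rat_mult algebra_simps)
   then have "z * z' = of_rat (c1 z * c1 z' + c2 z * c2 z' * D) + of_rat (c1 z * c2 z' + c2 z * c1 z') * y"
    by (simp add: y2 of_rat_add of_rat_mult)
   then have "\<sigma> (z * z') = of_rat (c1 z * c1 z' + c2 z * c2 z' * D) + of_rat (c1 z * c2 z' + c2 z * c1 z') * q"
    using \<sigma> by simp
   also have "\<dots> = of_rat (c1 z * c1 z') + of_rat (c2 z * c2 z') * (q * q) + of_rat (c1 z * c2 z' + c2 z * c1 z') * q"
    by (simp add: q of_rat_add of_rat_mult)
   finally show ?thesis by (simp add: \<sigma>_def of_rat_add of_rat_mult algebra_simps)
  qed
  ultimately show False using iq unfolding imaginary_quadratic_def by blast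
 qed
 obtain n m where nm: "quotient_of D = (n, m)" by force
 have m: "m > 0" using quotient_of_denom_pos[OF nm] .
 have D: "D = of_int n / of_int m" using quotient_of_div[OF nm] .
 have n: "n < 0" using \<open>D < 0\<close> m unfolding D by (simp add: field_simps)
 define w where "w = of_int m * y"
 have "w * w = of_int m * of_int m * (y * y)" by (simp add: w_def algebra_simps)
 also have "\<dots> = of_rat (of_int m * of_int m * D)" by (simp add: y2 of_rat_mult)
 also have "of_int m * of_int m * D = of_int (m * n)" using m by (simp add: D)
 finally have "w * w = - of_int (- (m * n))" by (simp add: of_rat_mult)
 moreover have "- (m * n) > 0" using m n by (simp add: mult_pos_neg)
 moreover have "\<exists>a b. z = of_rat a + of_rat b * w" for z
 proof -
  obtain a b where "z = of_rat a + of_rat b * y" using repy by blast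
  then have "z = of_rat a + of_rat (b / of_int m) * w" using m by (simp add: w_def of_rat_divide)
  then show ?thesis by blast
 qed
 ultimately show ?thesis by blast
qed

text \<open>d may have square factors and w need not generate the ring of integers, so integrality
  is later expressed by trace and norm and not by a basis.\<close>

locale imag_quad =
 fixes w :: "'k::field_char_0" and d :: int
 assumes d_pos: "d > 0" and w2: "w * w = - of_int d"
  and repr: "\<exists>a b. x = of_rat a + of_rat b * w"
begin

text \<open>Two expansions of one element would give (a' - a)^2 = - d (b - b')^2 among rationals,
  where the signs force both sides to vanish.\<close>

lemma coords_unique:
 assumes "of_rat a + of_rat b * w = of_rat a' + of_rat b' * w"
 shows "a = a'" "b = b'"
proof -
 have e: "of_rat (b - b') * w = of_rat (a' - a)" using assms by (simp add: of_rat_diff algebra_simps)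
 then have "(of_rat (b - b') * w) * (of_rat (b - b') * w) = of_rat (a' - a) * of_rat (a' - a)" by simp
 then have "of_rat ((b - b') * (b - b')) * (w * w) = of_rat ((a' - a) * (a' - a))"
  by (simp only: of_rat_mult mult_ac)
 then have "of_rat (- (of_int d * ((b - b') * (b - b')))) = (of_rat ((a' - a) * (a' - a)) :: 'k)"
  by (simp add: w2 of_rat_mult of_rat_minus mult_ac)
 then have "- (of_int d * ((b - b') * (b - b'))) = (a' - a) * (a' - a)" by (simp only: of_rat_eq_iff)
 moreover have "(a' - a) * (a' - a) >= 0" by simp
 moreover have "of_int d * ((b - b') * (b - b')) >= 0" using d_pos by simp
 ultimately have "of_int d * ((b - b') * (b - b')) = 0" by linarith
 then show "b = b'" using d_pos by simp
 then show "a = a'" using assms by simp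
qed

definition re :: "'k => rat" where "re x = (SOME a. \<exists>b. x = of_rat a + of_rat b * w)"
definition im :: "'k => rat" where "im x = (SOME b. x = of_rat (re x) + of_rat b * w)"

lemma re_im: "x = of_rat (re x) + of_rat (im x) * w"
proof -
 have "\<exists>b. x = of_rat (re x) + of_rat b * w" unfolding re_def by (rule someI_ex) (rule repr)
 then show ?thesis unfolding im_def by (rule someI_ex)
qed

lemma re_im_eq: "x = of_rat a + of_rat b * w ==> re x = a & im x = b" using coords_unique re_im[of x] by metis

lemma re_add: "re (x + y) = re x + re y" and im_add: "im (x + y) = im x + im y"
proof -
 have "x + y = of_rat (re x + re y) + of_rat (im x + im y) * w"
  by (subst re_im[of x], subst re_im[of y]) (simp add: of_rat_add algebra_simps)
 then show "re (x + y) = re x + re y" "im (x + y) = im x + im y" using re_im_eq by auto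
qed

lemma re_mult: "re (x * y) = re x * re y - of_int d * (im x * im y)"
 and im_mult: "im (x * y) = re x * im y + im x * re y"
proof -
 have "x * y = of_rat (re x * re y) + of_rat (im x * im y) * (w * w) + of_rat (re x * im y + im x * re y) * w"
  by (subst re_im[of x], subst re_im[of y]) (simp add: of_rat_add of_rat_mult algebra_simps)
 then have "x * y = of_rat (re x * re y - of_int d * (im x * im y)) + of_rat (re x * im y + im x * re y) * w"
  by (simp add: w2 of_rat_diff of_rat_mult)
 then show "re (x * y) = re x * re y - of_int d * (im x * im y)" "im (x * y) = re x * im y + im x * re y"
  using re_im_eq by auto
qed

lemma re_of_rat [simp]: "re (of_rat a) = a" and im_of_rat [simp]: "im (of_rat a) = 0"
 using re_im_eq[of "of_rat a" a 0] by auto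

lemma re_im_simps [simp]: "re 0 = 0" "im 0 = 0" "re 1 = 1" "im 1 = 0" "re (of_int n) = of_int n" "im (of_int n) = 0"
 "re w = 0" "im w = 1" "re (of_nat m) = of_nat m" "im (of_nat m) = 0"
 using re_of_rat[of 0] im_of_rat[of 0] re_of_rat[of 1] im_of_rat[of 1] re_of_rat[of "of_int n"] im_of_rat[of "of_int n"]
  re_im_eq[of w 0 1] re_of_rat[of "of_nat m"] im_of_rat[of "of_nat m"] by auto

lemma re_minus: "re (- x) = - re x" and im_minus: "im (- x) = - im x"
 using re_add[of x "- x"] im_add[of x "- x"] by auto

lemma re_diff: "re (x - y) = re x - re y" and im_diff: "im (x - y) = im x - im y"
 using re_add[of x "- y"] im_add[of x "- y"] re_minus[of y] im_minus[of y] by auto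

lemma eq_iff: "x = y \<longleftrightarrow> re x = re y & im x = im y" using re_im[of x] re_im[of y] by metis

definition cj :: "'k => 'k" where "cj x = of_rat (re x) - of_rat (im x) * w"

lemma re_cj [simp]: "re (cj x) = re x" and im_cj [simp]: "im (cj x) = - im x"
 using re_im_eq[of "cj x" "re x" "- im x"] by (auto simp: cj_def of_rat_minus)

lemma cj_add: "cj (x + y) = cj x + cj y" and cj_mult: "cj (x * y) = cj x * cj y" and cj_cj [simp]: "cj (cj x) = x"
 by (auto simp: eq_iff re_add im_add re_mult im_mult)

lemma cj_simps [simp]: "cj 0 = 0" "cj 1 = 1" "cj (of_int n) = of_int n" by (auto simp: eq_iff)

definition nrm :: "'k => rat" where "nrm x = re x * re x + of_int d * (im x * im x)"
definition tr :: "'k => rat" where "tr x = 2 * re x"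

lemma mult_cj: "x * cj x = of_rat (nrm x)" by (auto simp: eq_iff re_mult im_mult nrm_def)

lemma nrm_mult: "nrm (x * y) = nrm x * nrm y" by (simp add: nrm_def re_mult im_mult algebra_simps)

lemma nrm_nonneg: "nrm x >= 0" using d_pos by (simp add: nrm_def)

lemma nrm_eq_0 [simp]: "nrm x = 0 \<longleftrightarrow> x = 0"
proof
 assume *: "nrm x = 0"
 have "re x * re x >= 0" "of_int d * (im x * im x) >= 0" using d_pos by auto
 then have "re x * re x = 0" "of_int d * (im x * im x) = 0" using * unfolding nrm_def by linarith+
 then show "x = 0" using d_pos by (simp add: eq_iff)
qed (simp add: nrm_def)

lemma nrm_cj [simp]: "nrm (cj x) = nrm x" and tr_cj [simp]: "tr (cj x) = tr x" by (auto simp: nrm_def tr_def)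

lemma nrm_add: "nrm (x + y) = nrm x + nrm y + tr (x * cj y)"
 by (simp add: nrm_def tr_def re_add im_add re_mult algebra_simps)

lemma tr_add: "tr (x + y) = tr x + tr y" by (simp add: tr_def re_add)

lemma quad_eq: "x * x - of_rat (tr x) * x + of_rat (nrm x) = 0"
 by (auto simp: eq_iff re_add im_add re_diff im_diff re_mult im_mult tr_def nrm_def algebra_simps)

lemma nrm_of_int [simp]: "nrm (of_int n) = of_int (n * n)" and tr_of_int: "tr (of_int n) = of_int (2 * n)"
 by (auto simp: nrm_def tr_def)

text \<open>The elementary characterisation of algebraic integers in a quadratic field; closure
  under sums and products comes from \<open>tr_mult_cj_int\<close>.\<close>

definition integral :: "'k => bool" where "integral x \<longleftrightarrow> tr x : \<int> & nrm x : \<int>"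

lemma rat_square_int: fixes q :: rat assumes "q * q : \<int>" shows "q : \<int>"
proof -
 have "algebraic_int q"
 proof (rule algebraic_int.intros)
  show "lead_coeff [:- (q * q), 0, 1:] = 1" by simp
  show "\<forall>i. coeff [:- (q * q), 0, 1:] i : \<int>" using assms by (auto simp: coeff_pCons split: nat.splits)
  show "poly [:- (q * q), 0, 1:] q = 0" by simp
 qed
 moreover have "q : \<rat>" by (simp add: Rats_eq_range_nat_to_rat_surj surj_nat_to_rat_surj)
 ultimately show ?thesis by (intro rational_algebraic_int_is_int)
qed

text \<open>With \<open>A = tr x\<close>, \<open>N = nrm x\<close> and \<open>C = d (2 im x)(2 im y)\<close> one has
 \<open>C\<^sup>2 = (4 N - A\<^sup>2)(4 N' - A'\<^sup>2)\<close>, so \<open>C\<close> is an integer with the parity of \<open>A A'\<close>.\<close>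

lemma tr_mult_cj_int: assumes "integral x" "integral y" shows "tr (x * cj y) : \<int>"
proof -
 obtain A where A: "tr x = of_int A" using assms unfolding integral_def by (auto elim: Ints_cases)
 obtain A' where A': "tr y = of_int A'" using assms unfolding integral_def by (auto elim: Ints_cases)
 obtain N where N: "nrm x = of_int N" using assms unfolding integral_def by (auto elim: Ints_cases)
 obtain N' where N': "nrm y = of_int N'" using assms unfolding integral_def by (auto elim: Ints_cases)
 define C where "C = of_int d * ((2 * im x) * (2 * im y))"
 have 1: "of_int d * ((2 * im x) * (2 * im x)) = of_int (4 * N - A * A)"
  using A N[symmetric] by (simp add: nrm_def tr_def[symmetric] A[symmetric]) (simp add: tr_def algebra_simps)
 have 2: "of_int d * ((2 * im y) * (2 * im y)) = of_int (4 * N' - A' * A')"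
  using A' N'[symmetric] by (simp add: nrm_def tr_def[symmetric] A'[symmetric]) (simp add: tr_def algebra_simps)
 have "C * C = (of_int d * ((2 * im x) * (2 * im x))) * (of_int d * ((2 * im y) * (2 * im y)))"
  by (simp add: C_def algebra_simps)
 also have "\<dots> = of_int ((4 * N - A * A) * (4 * N' - A' * A'))" by (simp only: 1 2 of_int_mult)
 finally have CC: "C * C = of_int ((4 * N - A * A) * (4 * N' - A' * A'))" .
 have "C * C : \<int>" unfolding CC by (rule Ints_of_int)
 then have "C : \<int>" by (rule rat_square_int)
 then obtain c where c: "C = of_int c" by (auto elim: Ints_cases)
 have "c * c = (4 * N - A * A) * (4 * N' - A' * A')" using CC unfolding c of_int_mult[symmetric] of_int_eq_iff .
 then have "even (c * c) \<longleftrightarrow> even ((4 * N - A * A) * (4 * N' - A' * A'))" by (simp only:)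
 then have "even c \<longleftrightarrow> even (A * A')" by simp
 then have "even (A * A' + c)" by simp
 then obtain e where e: "A * A' + c = 2 * e" by (rule evenE)
 have "2 * tr (x * cj y) = tr x * tr y + C" by (simp add: tr_def re_mult C_def algebra_simps)
 also have "\<dots> = of_int (A * A' + c)" by (simp only: A A' c of_int_add of_int_mult)
 also have "\<dots> = of_int (2 * e)" unfolding e ..
 finally have "tr (x * cj y) = of_int e" by simp
 then show ?thesis by simp
qed

lemma integral_cj: "integral x ==> integral (cj x)" by (simp add: integral_def)

lemma integral_add: assumes "integral x" "integral y" shows "integral (x + y)"
 using assms tr_mult_cj_int[OF assms] unfolding integral_def nrm_add tr_add by (auto intro!: Ints_add)

lemma integral_mult: assumes "integral x" "integral y" shows "integral (x * y)"
 using assms tr_mult_cj_int[OF assms(1) integral_cj[OF assms(2)]]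
 unfolding integral_def nrm_mult by (auto intro!: Ints_mult)

lemma integral_of_int: "integral (of_int n)" by (simp add: integral_def tr_of_int)

lemma integral_w: "integral w" by (simp add: integral_def nrm_def tr_def)

lemma integral_minus: "integral x ==> integral (- x)" using integral_mult[OF integral_of_int[of "-1"]] by simp

lemma integral_imp_algebraic_int: assumes "integral x" shows "algebraic_int x"
proof (rule algebraic_int.intros)
 let ?p = "[:of_rat (nrm x), - of_rat (tr x), 1:] :: 'k poly"
 show "lead_coeff ?p = 1" by simp
 obtain a b where "tr x = of_int a" "nrm x = of_int b" using assms unfolding integral_def by (auto elim!: Ints_cases)
 then show "\<forall>i. coeff ?p i : \<int>" by (auto simp: coeff_pCons split: nat.splits)
 show "poly ?p x = 0" using quad_eq[of x] by (simp add: algebra_simps)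
qed

text \<open>Every power of the denominator of q divides c, so the denominator is 1.\<close>

lemma bounded_denominator_int:
 fixes q :: rat assumes c: "c ~= 0" and *: "!!n. of_int c * q ^ n : \<int>" shows "q : \<int>"
proof -
 obtain a b where ab: "quotient_of q = (a, b)" by force
 have b: "b > 0" and cop: "coprime a b" and q: "q = of_int a / of_int b"
  using quotient_of_denom_pos[OF ab] quotient_of_coprime[OF ab] quotient_of_div[OF ab] by auto
 have dv: "b ^ n dvd c" for n
 proof -
  obtain e where e: "of_int c * q ^ n = of_int e" using *[of n] by (auto elim: Ints_cases)
  then have "of_int (c * a ^ n) = (of_int (e * b ^ n) :: rat)" using b by (simp add: q power_divide field_simps)
  then have "c * a ^ n = e * b ^ n" by (simp only: of_int_eq_iff)
  then have "b ^ n dvd c * a ^ n" by simp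
  then show ?thesis using cop coprime_dvd_mult_left_iff[of "b ^ n" "a ^ n" c] by (simp add: coprime_commute)
 qed
 have "b = 1"
 proof (rule ccontr)
  assume "b ~= 1"
  then have "b >= 2" using b by simp
  then have "(2::int) ^ n <= b ^ n" for n by (intro power_mono) auto
  moreover have "b ^ n <= \<bar>c\<bar>" for n using dvd_imp_le_int[OF c dv[of n]] b by simp
  ultimately have "(2::int) ^ nat \<bar>c\<bar> <= \<bar>c\<bar>" using order_trans by blast
  moreover have "int n < 2 ^ n" for n by (metis of_nat_less_two_power)
  then have "\<bar>c\<bar> < 2 ^ nat \<bar>c\<bar>" by (metis abs_ge_zero int_nat_eq)
  ultimately show False by simp
 qed
 then show ?thesis using q by simp
qed

text \<open>A monic equation keeps M x^n in the lattice spanned by 1 and w for a fixed M. Norms of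
  lattice elements are integers, so the powers of nrm x have bounded denominators and nrm x is an
  integer. The same for x + 1 yields the trace as a difference of norms.\<close>

lemma algebraic_int_imp_integral: assumes "algebraic_int x" shows "integral x"
proof -
 obtain f where f: "lead_coeff f = 1" "\<forall>i. coeff f i : \<int>" "poly f x = 0"
  using assms by (auto elim: algebraic_int.cases)
 define L where "L = {z. re z : \<int> & im z : \<int>}"
 have L0: "0 : L" by (simp add: L_def)
 have Ladd: "y + z : L" if "y : L" "z : L" for y z using that by (auto simp: L_def re_add im_add)
 have Lint: "of_int n * z : L" if "z : L" for n z using that by (auto simp: L_def re_mult im_mult)
 have Lsum: "(\<Sum>i\<in>I. F i) : L" if "!!i. i : I ==> F i : L" for I :: "nat set" and F
  using that by (induction I rule: infinite_finite_induct) (auto intro: Ladd L0)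
 have den: "\<exists>m::int. m > 0 & of_int m * z : L" for z
 proof -
  obtain a b where ab: "quotient_of (re z) = (a, b)" by force
  obtain a' b' where ab': "quotient_of (im z) = (a', b')" by force
  have "re z = of_int a / of_int b" "b > 0" "im z = of_int a' / of_int b'" "b' > 0"
   using quotient_of_div[OF ab] quotient_of_denom_pos[OF ab] quotient_of_div[OF ab'] quotient_of_denom_pos[OF ab'] by auto
  then have "of_int (b * b') * re z = of_int (b' * a)" "of_int (b * b') * im z = of_int (b * a')" "b * b' > 0"
   by auto
  then have "of_int (b * b') * z : L" unfolding L_def by (simp only: mem_Collect_eq re_mult im_mult re_im_simps) simp
  then show ?thesis using \<open>b * b' > 0\<close> by blast
 qed
 have "\<exists>M::int. M > 0 & (\<forall>i<k. of_int M * x ^ i : L)" for k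
 proof (induction k)
  case (Suc k)
  then obtain M where M: "M > 0" "\<forall>i<k. of_int M * x ^ i : L" by auto
  obtain m where m: "m > 0" "of_int m * x ^ k : L" using den by blast
  have "of_int (m * M) * x ^ i : L" if "i < Suc k" for i
  proof (cases "i = k")
   case True
   then show ?thesis using Lint[OF m(2), of M] by (simp add: mult_ac)
  next
   case False
   then show ?thesis using Lint[of "of_int M * x ^ i" m] M that by (simp add: mult_ac)
  qed
  then show ?case using M m by (intro exI[of _ "m * M"]) auto
 qed (auto intro: exI[of _ 1])
 then obtain M where M: "M > 0" "!!i. i < degree f ==> of_int M * x ^ i : L" by blast
 have pw: "of_int M * x ^ n : L" for n
 proof (induction n rule: less_induct)
  case (less n)
  show ?case
  proof (cases "n < degree f")
   case False
   have "poly f x = (\<Sum>i<degree f. coeff f i * x ^ i) + x ^ degree f"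
    unfolding poly_altdef using f(1) by (simp add: lessThan_Suc_atMost[symmetric])
   then have "x ^ degree f = - (\<Sum>i<degree f. coeff f i * x ^ i)" using f(3) by (simp add: add_eq_0_iff2)
   then have "x ^ n = x ^ (n - degree f) * - (\<Sum>i<degree f. coeff f i * x ^ i)"
    using False by (metis add_diff_inverse_nat mult.commute power_add)
   then have "of_int M * x ^ n = (\<Sum>i<degree f. (- coeff f i) * (of_int M * x ^ (n - degree f + i)))"
    by (simp add: sum_distrib_left sum_negf power_add mult_ac)
   also have "\<dots> : L"
   proof (rule Lsum)
    fix i assume i: "i : {..<degree f}"
    obtain c where c: "coeff f i = of_int c" using f(2) by (auto elim: Ints_cases)
    have "of_int M * x ^ (n - degree f + i) : L" using less False i by simp
    from Lint[OF this, of "- c"] show "(- coeff f i) * (of_int M * x ^ (n - degree f + i)) : L" by (simp add: c)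
   qed
   finally show ?thesis .
  qed (use M in simp)
 qed
 \<comment> \<open>The powers of x + 1 stay in the same lattice by the binomial formula, so no
   second monic equation is required.\<close>
 have pw1: "of_int M * (x + 1) ^ n : L" for n
 proof -
  have "(x + 1) ^ n = (\<Sum>k\<le>n. of_int (int (n choose k)) * x ^ k)" by (simp add: binomial_ring)
  then have "of_int M * (x + 1) ^ n = (\<Sum>k\<le>n. of_int (int (n choose k)) * (of_int M * x ^ k))"
   by (simp add: sum_distrib_left mult_ac)
  also have "\<dots> : L" by (intro Lsum Lint pw)
  finally show ?thesis .
 qed
 have nL: "nrm z : \<int>" if "z : L" for z using that by (auto simp: L_def nrm_def)
 have nrm_pow: "nrm (y ^ n) = nrm y ^ n" for y n by (induction n) (auto simp: nrm_mult, simp add: nrm_def)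
 have key: "nrm y : \<int>" if "!!n. of_int M * y ^ n : L" for y
 proof (rule bounded_denominator_int)
  show "M * M ~= 0" using M by simp
  show "of_int (M * M) * nrm y ^ n : \<int>" for n using nL[OF that[of n]] by (simp add: nrm_mult nrm_pow)
 qed
 have "nrm x : \<int>" using key pw by blast
 moreover have "nrm (x + 1) : \<int>" using key pw1 by blast
 then have "nrm (x + 1) - nrm x - 1 : \<int>" using \<open>nrm x : \<int>\<close> by (intro Ints_diff) auto
 then have "tr x : \<int>" by (simp add: nrm_add) (simp add: nrm_def)
 ultimately show ?thesis by (simp add: integral_def)
qed

lemma carrier_OK: "carrier (OK :: 'k ring) = {x. integral x}"
 unfolding OK_def using integral_imp_algebraic_int algebraic_int_imp_integral by auto

end

section \<open>Fractional ideals\<close>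

lemma OK_simps [simp]: "mult (OK :: 'k::field_char_0 ring) = (*)" "one (OK :: 'k ring) = 1"
 "zero (OK :: 'k ring) = 0" "add (OK :: 'k ring) = (+)" by (auto simp: OK_def)

context imag_quad begin

lemma integral_01: "integral 0" "integral 1" using integral_of_int[of 0] integral_of_int[of 1] by auto

lemma integral_diff: "integral x ==> integral y ==> integral (x - y)"
 using integral_add[of x "- y"] integral_minus[of y] by simp

lemma cring_OK: "cring (OK :: 'k ring)"
proof (rule cringI)
 show "abelian_group (OK :: 'k ring)"
 proof (rule abelian_groupI)
  show "\<exists>y\<in>carrier OK. y \<oplus>\<^bsub>OK\<^esub> x = \<zero>\<^bsub>OK\<^esub>" if "x : carrier OK" for x :: 'k
   using that integral_minus by (intro bexI[of _ "- x"]) (auto simp: carrier_OK)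
 qed (auto simp: carrier_OK integral_add integral_01)
 show "comm_monoid (OK :: 'k ring)" by (rule comm_monoidI) (auto simp: carrier_OK integral_mult integral_01)
qed (auto simp: carrier_OK algebra_simps)

text \<open>O_K-submodules of K, the common frame of integral and fractional ideals, in which
  products of ideals obey their laws.\<close>

definition omod :: "'k set => bool" where
 "omod M \<longleftrightarrow> 0 : M & (\<forall>x\<in>M. \<forall>y\<in>M. x + y : M) & (\<forall>a x. integral a --> x : M --> a * x : M)"

lemma omodD: assumes "omod M" shows "0 : M" "x : M ==> y : M ==> x + y : M"
 "integral a ==> x : M ==> a * x : M" "x : M ==> - x : M" "x : M ==> y : M ==> x - y : M"
proof -
 show 1: "0 : M" "x : M ==> y : M ==> x + y : M" "integral a ==> x : M ==> a * x : M" for x y a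
  using assms unfolding omod_def by auto
 show m: "x : M ==> - x : M" for x using 1(3)[of "-1" x] integral_of_int[of "-1"] by simp
 show "x : M ==> y : M ==> x - y : M" using 1(2)[of x "- y"] m by simp
qed

definition idl :: "'k set => bool" where "idl I \<longleftrightarrow> omod I & (\<forall>x\<in>I. integral x)"

lemma ideal_iff: "ideal I (OK :: 'k ring) \<longleftrightarrow> idl I"
proof
 assume I: "ideal I (OK :: 'k ring)"
 interpret ideal I "OK :: 'k ring" by (rule I)
 have "0 : I" using additive_subgroup.zero_closed[OF is_additive_subgroup] by simp
 moreover have "x + y : I" if "x : I" "y : I" for x y 
  using additive_subgroup.a_closed[OF is_additive_subgroup that] by simp
 moreover have "a * x : I" if "integral a" "x : I" for a x
  using I_l_closed[OF that(2), of a] that by (simp add: carrier_OK)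
 moreover have "integral x" if "x : I" for x using a_subset that by (auto simp: carrier_OK)
 ultimately show "idl I" by (simp add: idl_def omod_def)
next
 assume I: "idl I"
 then have m: "omod I" and int: "!!x. x : I ==> integral x" unfolding idl_def by auto
 interpret cring "OK :: 'k ring" by (rule cring_OK)
 show "ideal I (OK :: 'k ring)"
 proof (rule idealI)
  show "ring (OK :: 'k ring)" by (rule ring_axioms)
  show "subgroup I (add_monoid (OK :: 'k ring))"
  proof (rule add.subgroupI)
   show "I \<subseteq> carrier OK" using int by (auto simp: carrier_OK)
   show "I ~= {}" using omodD(1)[OF m] by auto
   show "\<ominus>\<^bsub>OK\<^esub> a : I" if "a : I" for a
   proof -
    have "\<ominus>\<^bsub>OK\<^esub> a = - a" by (rule minus_equality) (use that int integral_minus in \<open>auto simp: carrier_OK\<close>)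
    then show ?thesis using omodD(4)[OF m that] by simp
   qed
   show "a \<oplus>\<^bsub>OK\<^esub> b : I" if "a : I" "b : I" for a b using omodD(2)[OF m that] by simp
  qed
  show "x \<otimes>\<^bsub>OK\<^esub> a : I" if "a : I" "x : carrier OK" for a x
   using omodD(3)[OF m] that by (simp add: carrier_OK)
  show "a \<otimes>\<^bsub>OK\<^esub> x : I" if "a : I" "x : carrier OK" for a x
   using omodD(3)[OF m, of x a] that by (simp add: carrier_OK mult.commute)
 qed
qed

abbreviation ip :: "'k set => 'k set => 'k set" (infixl "\<odot>" 75) where
 "I \<odot> J \<equiv> ideal_prod (OK :: 'k ring) I J"

abbreviation "ZK \<equiv> carrier (OK :: 'k ring)"

lemma ZK_iff: "x : ZK \<longleftrightarrow> integral x" by (simp add: carrier_OK)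

lemma ip_mem: "x : M ==> y : N ==> x * y : M \<odot> N" using ideal_prod.prod[of x M y N "OK :: 'k ring"] by simp

lemma ip_add: "x : M \<odot> N ==> y : M \<odot> N ==> x + y : M \<odot> N"
 using ideal_prod.sum[of x "OK :: 'k ring" M N y] by simp

lemma ip_le:
 assumes "!!x y. x : M ==> y : N ==> x * y : L" "!!x y. x : L ==> y : L ==> x + y : L"
 shows "M \<odot> N \<subseteq> L"
proof
 fix z assume "z : M \<odot> N"
 then show "z : L" by (induction rule: ideal_prod.induct) (use assms in auto)
qed

lemma ip_comm: "M \<odot> N = N \<odot> M"
proof -
 have "M \<odot> N \<subseteq> N \<odot> M" for M N
 proof (rule ip_le)
  show "x * y : N \<odot> M" if "x : M" "y : N" for x y using ip_mem[OF that(2,1)] by (simp add: mult.commute)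
 qed (rule ip_add)
 then show ?thesis by blast
qed

lemma ip_mono: "M \<subseteq> M' ==> N \<subseteq> N' ==> M \<odot> N \<subseteq> M' \<odot> N'"
 by (intro ip_le ip_add) (auto intro: ip_mem)

lemma ip_omod: assumes "omod M" "omod N" shows "omod (M \<odot> N)" unfolding omod_def
proof (intro conjI ballI allI impI)
 show "0 : M \<odot> N" using ip_mem[OF omodD(1)[OF assms(1)] omodD(1)[OF assms(2)]] by simp
 show "x + y : M \<odot> N" if "x : M \<odot> N" "y : M \<odot> N" for x y using ip_add that .
 fix a x assume a: "integral a" and x: "x : M \<odot> N"
 from x show "a * x : M \<odot> N"
 proof (induction rule: ideal_prod.induct)
  case (prod i j)
  then show ?case using ip_mem[OF omodD(3)[OF assms(1) a prod(1)] prod(2)] by (simp add: mult_ac)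
 next
  case (sum s1 s2)
  then show ?case using ip_add by (simp add: distrib_left)
 qed
qed

lemma ip_assoc: "(M \<odot> N) \<odot> L = M \<odot> (N \<odot> L)"
proof -
 have 1: "(M \<odot> N) \<odot> L \<subseteq> M \<odot> (N \<odot> L)" for M N L
 proof (rule ip_le)
  fix x y assume "x : M \<odot> N" and y: "y : L"
  then show "x * y : M \<odot> (N \<odot> L)"
  proof (induction rule: ideal_prod.induct)
   case (prod i j)
   then show ?case using ip_mem[OF prod(1) ip_mem[OF prod(2) y]] by (simp add: mult_ac)
  next
   case (sum s1 s2)
   then show ?case using ip_add y by (simp add: distrib_right)
  qed
 qed (rule ip_add)
 have "M \<odot> (N \<odot> L) = (L \<odot> N) \<odot> M" by (metis ip_comm)
 also have "\<dots> \<subseteq> L \<odot> (N \<odot> M)" by (rule 1)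
 also have "\<dots> = (M \<odot> N) \<odot> L" by (metis ip_comm)
 finally show ?thesis using 1[of M N L] by blast
qed

lemma ip_lcomm: "M \<odot> (N \<odot> L) = N \<odot> (M \<odot> L)" by (metis ip_assoc ip_comm)

lemmas ip_ac = ip_assoc ip_comm ip_lcomm

lemma omod_ZK: "omod ZK" by (simp add: omod_def carrier_OK integral_add integral_mult integral_01)

lemma idl_ZK: "idl ZK" unfolding idl_def using omod_ZK ZK_iff by auto

lemma ip_one: assumes "omod M" shows "ZK \<odot> M = M" "M \<odot> ZK = M"
proof -
 show "ZK \<odot> M = M"
 proof
  show "ZK \<odot> M \<subseteq> M" using assms by (intro ip_le) (auto simp: ZK_iff omodD)
  show "M \<subseteq> ZK \<odot> M" using ip_mem[of 1 ZK _ M] integral_01 ZK_iff by auto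
 qed
 then show "M \<odot> ZK = M" by (simp add: ip_comm)
qed

lemma ip_idl: assumes "idl I" "idl J" shows "idl (I \<odot> J)"
proof -
 have "I \<odot> J \<subseteq> ZK" using assms unfolding idl_def
  by (intro ip_le) (auto simp: ZK_iff integral_mult integral_add)
 then show ?thesis using assms ip_omod unfolding idl_def by (auto simp: ZK_iff)
qed

lemma ip_sub: assumes "idl I" "omod M" shows "I \<odot> M \<subseteq> M" "M \<odot> I \<subseteq> M"
proof -
 show "I \<odot> M \<subseteq> M" using assms unfolding idl_def by (intro ip_le) (auto simp: omodD)
 then show "M \<odot> I \<subseteq> M" by (simp add: ip_comm)
qed

definition pr :: "'k => 'k set" where "pr a = {x * a | x. integral x}"

lemma PIdl_eq: "PIdl\<^bsub>OK\<^esub> a = pr a" unfolding cgenideal_def pr_def by (auto simp: ZK_iff)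

lemma pr_omod: "omod (pr a)" unfolding omod_def pr_def
proof (intro conjI ballI allI impI)
 show "0 : {x * a |x. integral x}" using integral_01 by (intro CollectI exI[of _ 0]) auto
 fix x y assume "x : {x * a |x. integral x}" "y : {x * a |x. integral x}"
 then obtain u v where "integral u" "integral v" "x = u * a" "y = v * a" by auto
 then show "x + y : {x * a |x. integral x}"
  using integral_add by (intro CollectI exI[of _ "u + v"]) (auto simp: distrib_right)
next
 fix b x assume "integral b" "x : {x * a |x. integral x}"
 then obtain u where "integral u" "x = u * a" by auto
 then show "b * x : {x * a |x. integral x}"
  using integral_mult \<open>integral b\<close> by (intro CollectI exI[of _ "b * u"]) (auto simp: mult_ac)
qed

lemma pr_idl: "integral a ==> idl (pr a)" unfolding idl_def using pr_omod by (auto simp: pr_def integral_mult)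

lemma pr_self: "a : pr a" unfolding pr_def using integral_01 by (intro CollectI exI[of _ 1]) auto

lemma ip_pr: assumes "omod M" shows "pr a \<odot> M = (%x. a * x) ` M"
proof
 show "pr a \<odot> M \<subseteq> (%x. a * x) ` M"
 proof (rule ip_le)
  fix x y assume "x : pr a" "y : M"
  then obtain u where "integral u" "x = u * a" by (auto simp: pr_def)
  then have "x * y = a * (u * y)" "u * y : M" using omodD(3)[OF assms] \<open>y : M\<close> by auto
  then show "x * y : (%x. a * x) ` M" by blast
 next
  fix x y assume "x : (%x. a * x) ` M" "y : (%x. a * x) ` M"
  then obtain u v where "u : M" "v : M" "x = a * u" "y = a * v" by auto
  then have "x + y = a * (u + v)" "u + v : M" using omodD(2)[OF assms] by (auto simp: distrib_left)
  then show "x + y : (%x. a * x) ` M" by blast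
 qed
 show "(%x. a * x) ` M \<subseteq> pr a \<odot> M" using ip_mem[OF pr_self] by blast
qed

lemma ip_pr_pr: "pr a \<odot> pr b = pr (a * b)" unfolding ip_pr[OF pr_omod] by (auto simp: pr_def image_iff mult_ac) 

lemma pr_1: "pr 1 = ZK" by (auto simp: pr_def ZK_iff)

lemma integral_cases_nrm: assumes "integral x" obtains n :: int where "nrm x = of_int n" "n >= 0"
proof -
 obtain n where "nrm x = of_int n" using assms unfolding integral_def by (auto elim: Ints_cases)
 moreover then have "n >= 0" using nrm_nonneg[of x] by simp
 ultimately show thesis using that by blast
qed

lemma of_int_mem_dvd: assumes "omod M" "of_int m : M" "m dvd n" shows "of_int n : M"
proof -
 obtain k where "n = m * k" using assms(3) by blast
 then show ?thesis using omodD(3)[OF assms(1) integral_of_int[of k] assms(2)] by (simp add: mult.commute)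
qed

text \<open>\<open>I\<close> times its conjugate is generated by the greatest common divisor \<open>n\<close> of the norms of the elements
 of \<open>I\<close>: for \<open>x, y \<in> I\<close> the trace \<open>N(x + y) - N x - N y\<close> and the norm \<open>N x N y\<close> of \<open>x y'\<close>, with
 \<open>y'\<close> the conjugate of \<open>y\<close>, are divisible by \<open>n\<close> and \<open>n\<^sup>2\<close>.\<close>

lemma idl_invertible:
 assumes I: "idl I" and nz: "I ~= {0}"
 shows "\<exists>J n. idl J & J ~= {0} & n > 0 & I \<odot> J = pr (of_int n)"
proof -
 have m: "omod I" and int: "!!x. x : I ==> integral x" using I unfolding idl_def by auto
 define J where "J = cj ` I"
 have J: "idl J" unfolding idl_def omod_def
 proof (intro conjI ballI allI impI)
  show "0 : J" unfolding J_def using omodD(1)[OF m] by (intro image_eqI[of _ _ 0]) auto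
  show "x + y : J" if "x : J" "y : J" for x y
   using that omodD(2)[OF m] unfolding J_def by (auto simp: cj_add[symmetric])
  show "integral x" if "x : J" for x using that int integral_cj unfolding J_def by auto
  fix a x assume a: "integral a" and "x : J"
  then obtain y where y: "y : I" "x = cj y" unfolding J_def by auto
  have "cj a * y : I" using omodD(3)[OF m integral_cj[OF a] y(1)] .
  moreover have "a * x = cj (cj a * y)" by (simp add: y cj_mult)
  ultimately show "a * x : J" unfolding J_def by blast
 qed
 have mJ: "omod J" using J unfolding idl_def by auto
 have mIJ: "omod (I \<odot> J)" by (rule ip_omod[OF m mJ])
 have nrm_mem: "of_rat (nrm x) : I \<odot> J" if "x : I" for x
  using ip_mem[OF that, of "cj x" J] that unfolding mult_cj J_def by blast
 obtain x0 where x0: "x0 : I" "x0 ~= 0" using nz omodD(1)[OF m] by auto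
 define Q where "Q k \<longleftrightarrow> k > 0 & of_int (int k) : I \<odot> J" for k :: nat
 have "\<exists>k. Q k"
 proof -
  obtain a where a: "nrm x0 = of_int a" "a >= 0" using integral_cases_nrm[OF int[OF x0(1)]] .
  have "a ~= 0" using a x0 nrm_eq_0[of x0] by auto
  then have "Q (nat a)" unfolding Q_def using nrm_mem[OF x0(1)] a by simp
  then show ?thesis by blast
 qed
 \<comment> \<open>The least positive integer in the product; division with remainder shows that it
   divides every integer there, in particular all norms of elements of I.\<close>
 define n where "n = (LEAST k. Q k)"
 have n: "n > 0" "of_int (int n) : I \<odot> J" using LeastI_ex[OF \<open>\<exists>k. Q k\<close>] unfolding n_def Q_def by auto
 have dvd: "int n dvd a" if a: "of_int a : I \<odot> J" for a
 proof (rule ccontr)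
  assume nd: "~ int n dvd a"
  have "of_int (a mod int n) = of_int a - of_int (a div int n) * of_int (int n)"
   by (metis minus_div_mult_eq_mod of_int_diff of_int_mult)
  also have "\<dots> : I \<odot> J" by (intro omodD(5)[OF mIJ a] omodD(3)[OF mIJ integral_of_int n(2)])
  finally have "of_int (a mod int n) : I \<odot> J" .
  moreover have "a mod int n > 0" using nd n(1) by (metis dvd_eq_mod_eq_0 mod_pos_geq not_less of_nat_0_less_iff order_neq_le_trans pos_mod_sign)
  ultimately have "Q (nat (a mod int n))" unfolding Q_def by simp
  then have "n <= nat (a mod int n)" unfolding n_def by (rule Least_le)
  then show False using n(1) by (metis \<open>0 < a mod int n\<close> le_nat_iff less_le not_less of_nat_0_less_iff pos_mod_bound)
 qed
 have nrm_dvd: "\<exists>e. nrm x = of_int (int n * e)" if x: "x : I" for x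
 proof -
  obtain a where a: "nrm x = of_int a" using integral_cases_nrm[OF int[OF x]] by blast
  then have "int n dvd a" using dvd nrm_mem[OF x] by simp
  then show ?thesis using a by (metis dvdE)
 qed
 have "I \<odot> J = pr (of_int (int n))"
 proof
  show "pr (of_int (int n)) \<subseteq> I \<odot> J" unfolding pr_def using omodD(3)[OF mIJ _ n(2)] by blast
  show "I \<odot> J \<subseteq> pr (of_int (int n))"
  proof (rule ip_le)
   show "x + y : pr (of_int (int n))" if "x : pr (of_int (int n))" "y : pr (of_int (int n))" for x y
    using omodD(2)[OF pr_omod] that .
   fix x y' assume x: "x : I" and "y' : J"
   then obtain y where y: "y : I" "y' = cj y" unfolding J_def by auto
   obtain e1 where e1: "nrm x = of_int (int n * e1)" using nrm_dvd[OF x] by blast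
   obtain e2 where e2: "nrm y = of_int (int n * e2)" using nrm_dvd[OF y(1)] by blast
   obtain e3 where e3: "nrm (x + y) = of_int (int n * e3)" using nrm_dvd[OF omodD(2)[OF m x y(1)]] by blast
   \<comment> \<open>The quotient by n, integral because the divisibility of norms makes its trace
     and its norm integers.\<close>
   define z where "z = x * cj y * of_rat (1 / of_int (int n))"
   have nn: "of_int (int n) ~= (0::rat)" using n(1) by simp
   have "tr (x * cj y) = nrm (x + y) - nrm x - nrm y" by (simp add: nrm_add)
   also have "\<dots> = of_int (int n) * of_int (e3 - e1 - e2)" unfolding e1 e2 e3 by (simp add: algebra_simps)
   finally have "tr (x * cj y) = of_int (int n) * of_int (e3 - e1 - e2)" .
   moreover have "tr z = tr (x * cj y) * (1 / of_int (int n))"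
    unfolding z_def tr_def re_mult[of "x * cj y" "of_rat (1 / of_int (int n))"] re_of_rat im_of_rat by simp
   ultimately have "tr z = of_int (e3 - e1 - e2)" using nn by simp
   moreover have "nrm z = of_int (e1 * e2)"
   proof -
    have "nrm (of_rat (1 / of_int (int n))) = (1 / of_int (int n)) * (1 / of_int (int n))"
     unfolding nrm_def re_of_rat im_of_rat by simp
    then show ?thesis unfolding z_def nrm_mult nrm_cj e1 e2 using nn by (simp add: field_simps)
   qed
   ultimately have "integral z" unfolding integral_def by simp
   moreover have "x * y' = z * of_int (int n)"
   proof -
    have "of_rat (1 / of_int (int n)) * of_int (int n) = (1::'k)" using n(1) by (simp add: of_rat_divide)
    then show ?thesis unfolding z_def y(2) by (simp only: mult.assoc mult_1_right)
   qed
   ultimately show "x * y' : pr (of_int (int n))" unfolding pr_def by blast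
  qed
 qed
 moreover have "J ~= {0}"
 proof -
  have "cj x0 : J" "cj x0 ~= 0" using x0 unfolding J_def by (auto simp: eq_iff)
  then show ?thesis by auto
 qed
 ultimately show ?thesis using J n by (intro exI[of _ J] exI[of _ "int n"]) simp
qed

definition fid :: "'k set => bool" where
 "fid M \<longleftrightarrow> omod M & M ~= {0} & (\<exists>d. integral d & d ~= 0 & (\<forall>x\<in>M. integral (d * x)))"

lemma carrier_fractional: "carrier (fractional_ideals :: 'k set monoid) = {M. fid M}"
 unfolding fractional_ideals_def fid_def omod_def ZK_iff by (auto simp: ZK_iff)

lemma fractional_simps [simp]: "mult (fractional_ideals :: 'k set monoid) = ideal_prod OK"
 "one (fractional_ideals :: 'k set monoid) = ZK" by (auto simp: fractional_ideals_def)

lemma idl_fid: "idl I ==> I ~= {0} ==> fid I"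
 unfolding fid_def idl_def using integral_01 by (auto intro!: exI[of _ 1])

lemma pr_fid: "a ~= 0 ==> fid (pr a)"
proof -
 assume a: "a ~= 0"
 have "\<exists>m::int. m ~= 0 & integral (of_int m * a)"
 proof -
  obtain x y where xy: "quotient_of (re a) = (x, y)" by force
  obtain x' y' where xy': "quotient_of (im a) = (x', y')" by force
  have q: "re a = of_int x / of_int y" "y > 0" "im a = of_int x' / of_int y'" "y' > 0"
   using quotient_of_div[OF xy] quotient_of_denom_pos[OF xy] quotient_of_div[OF xy'] quotient_of_denom_pos[OF xy'] by auto
  have "of_int (y * y') * a = of_int (y' * x) + of_int (y * x') * w"
  proof -
   have "re (of_int (y * y') * a) = of_int (y' * x)" "im (of_int (y * y') * a) = of_int (y * x')"
    unfolding re_mult im_mult re_im_simps using q by simp_all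
   then show ?thesis unfolding eq_iff re_add im_add re_mult im_mult re_im_simps by simp
  qed
  then have "integral (of_int (y * y') * a)"
   by (simp only:) (intro integral_add integral_mult integral_of_int integral_w)
  then show ?thesis using q by (intro exI[of _ "y * y'"]) simp
 qed
 then obtain m :: int where m: "m ~= 0" "integral (of_int m * a)" by blast
 have "integral (of_int m * x)" if x: "x : pr a" for x
 proof -
  obtain u where "integral u" "x = u * a" using x by (auto simp: pr_def)
  then show ?thesis using integral_mult[OF \<open>integral u\<close> m(2)] by (simp add: mult_ac)
 qed
 then show "fid (pr a)" unfolding fid_def using pr_omod pr_self a m integral_of_int
  by (metis of_int_eq_0_iff singletonD)
qed

lemma fid_mult: assumes "fid M" "fid N" shows "fid (M \<odot> N)"
proof -
 obtain a where a: "integral a" "a ~= 0" "\<forall>x\<in>M. integral (a * x)" using assms unfolding fid_def by auto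
 obtain b where b: "integral b" "b ~= 0" "\<forall>x\<in>N. integral (b * x)" using assms unfolding fid_def by auto
 have mod: "omod M" "omod N" using assms unfolding fid_def by auto
 have "M \<odot> N \<subseteq> {z. integral (a * b * z)}"
 proof (rule ip_le)
  fix x y assume "x : M" "y : N"
  then have "integral ((a * x) * (b * y))" using a b integral_mult by blast
  then show "x * y : {z. integral (a * b * z)}" by (simp add: mult_ac)
 qed (auto simp: distrib_left integral_add)
 moreover have "M \<odot> N ~= {0}"
 proof -
  obtain x where x: "x : M" "x ~= 0" using assms(1) omodD(1)[OF mod(1)] unfolding fid_def by auto
  obtain y where y: "y : N" "y ~= 0" using assms(2) omodD(1)[OF mod(2)] unfolding fid_def by auto
  have "x * y ~= 0" using x y by simp
  then show ?thesis using ip_mem[OF x(1) y(1)] by (metis singletonD)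
 qed
 moreover have "integral (a * b)" "a * b ~= 0" using a b integral_mult by simp_all
 ultimately show ?thesis unfolding fid_def using ip_omod[OF mod] by blast
qed

text \<open>A common denominator a makes a M integral, and an ideal J with a M J principal then
  supplies the inverse.\<close>

lemma fid_inverse: assumes "fid M" shows "\<exists>N. fid N & N \<odot> M = ZK"
proof -
 obtain a where a: "integral a" "a ~= 0" "\<forall>x\<in>M. integral (a * x)" using assms unfolding fid_def by auto
 have mod: "omod M" using assms unfolding fid_def by auto
 let ?I = "pr a \<odot> M"
 have I: "fid ?I" by (rule fid_mult[OF pr_fid[OF a(2)] assms])
 have "idl ?I" using I a(3) unfolding idl_def fid_def ip_pr[OF mod] by auto
 moreover have "?I ~= {0}" using I unfolding fid_def by auto
 ultimately obtain J n where J: "idl J" "J ~= {0}" "n > 0" "?I \<odot> J = pr (of_int n)"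
  using idl_invertible by blast
 let ?N = "pr (1 / of_int n) \<odot> (pr a \<odot> J)"
 have "?N \<odot> M = pr (1 / of_int n) \<odot> (?I \<odot> J)" by (simp add: ip_ac)
 also have "\<dots> = pr 1" unfolding J(4) ip_pr_pr using J(3) by simp
 finally have "?N \<odot> M = ZK" by (simp add: pr_1)
 moreover have "fid ?N" using J a by (intro fid_mult pr_fid idl_fid) auto
 ultimately show ?thesis by blast
qed

lemma fractional_group: "comm_group (fractional_ideals :: 'k set monoid)"
proof (rule comm_groupI)
 show "\<one>\<^bsub>fractional_ideals\<^esub> : carrier (fractional_ideals :: 'k set monoid)"
  using pr_fid[of 1] by (simp add: carrier_fractional pr_1)
 show "\<one>\<^bsub>fractional_ideals\<^esub> \<otimes>\<^bsub>fractional_ideals\<^esub> x = x" if "x : carrier (fractional_ideals :: 'k set monoid)" for x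
  using that ip_one by (simp add: carrier_fractional fid_def)
 show "\<exists>y\<in>carrier fractional_ideals. y \<otimes>\<^bsub>fractional_ideals\<^esub> x = \<one>\<^bsub>fractional_ideals\<^esub>"
  if "x : carrier (fractional_ideals :: 'k set monoid)" for x
  using fid_inverse that by (auto simp: carrier_fractional)
 show "x \<otimes>\<^bsub>fractional_ideals\<^esub> y \<otimes>\<^bsub>fractional_ideals\<^esub> z = x \<otimes>\<^bsub>fractional_ideals\<^esub> (y \<otimes>\<^bsub>fractional_ideals\<^esub> z)"
  for x y z :: "'k set" by (simp add: ip_assoc)
 show "x \<otimes>\<^bsub>fractional_ideals\<^esub> y = y \<otimes>\<^bsub>fractional_ideals\<^esub> x" for x y :: "'k set"
  unfolding fractional_simps by (rule ip_comm)
qed (simp add: carrier_fractional fid_mult)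

lemma fid_cancel: assumes "fid M" "omod N" "omod L" "M \<odot> N = M \<odot> L" shows "N = L"
proof -
 obtain M' where M': "M' \<odot> M = ZK" using fid_inverse[OF assms(1)] by blast
 have "(M' \<odot> M) \<odot> N = (M' \<odot> M) \<odot> L" unfolding ip_assoc assms(4) ..
 then show ?thesis unfolding M' ip_one(1)[OF assms(2)] ip_one(1)[OF assms(3)] .
qed

text \<open>Coprimality as an explicit Bezout relation, from which products, inclusions and Chinese
  remainders follow by computation.\<close>

definition cop :: "'k set => 'k set => bool" where "cop I J \<longleftrightarrow> (\<exists>a\<in>I. \<exists>b\<in>J. a + b = 1)"

lemma coprime_iff: assumes "idl I" "idl J" shows "ideal_coprime I J \<longleftrightarrow> cop I J"
proof -
 have e: "I <+>\<^bsub>OK\<^esub> J = {a + b | a b. a : I & b : J}" unfolding set_add_def set_mult_def by auto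
 show ?thesis
 proof
  assume "ideal_coprime I J"
  then have "1 : I <+>\<^bsub>OK\<^esub> J" unfolding ideal_coprime_def using integral_01 ZK_iff by simp
  then show "cop I J" unfolding e cop_def by force
 next
  assume "cop I J"
  then obtain a b where ab: "a : I" "b : J" "a + b = 1" unfolding cop_def by blast
  have "x : I <+>\<^bsub>OK\<^esub> J" if "integral x" for x
  proof -
   have "x = x * a + x * b" using ab by (simp add: distrib_left[symmetric])
   moreover have "x * a : I" "x * b : J" using ab that assms omodD(3) unfolding idl_def by blast+
   ultimately show ?thesis unfolding e by blast
  qed
  moreover have "I <+>\<^bsub>OK\<^esub> J \<subseteq> ZK" unfolding e using assms integral_add unfolding idl_def by (auto simp: ZK_iff)
  ultimately show "ideal_coprime I J" unfolding ideal_coprime_def by (auto simp: ZK_iff)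
 qed
qed

lemma cop_sym: "cop I J \<longleftrightarrow> cop J I" unfolding cop_def by (metis add.commute)

lemma cop_mono: "cop I J ==> I \<subseteq> I' ==> J \<subseteq> J' ==> cop I' J'" unfolding cop_def by blast

lemma cop_mult: assumes "idl I" "idl J" "idl L" "cop I J" "cop I L" shows "cop I (J \<odot> L)"
proof -
 obtain a b where ab: "a : I" "b : J" "a + b = 1" using assms unfolding cop_def by blast
 obtain c e where ce: "c : I" "e : L" "c + e = 1" using assms unfolding cop_def by blast
 have I: "omod I" "!!x. x : I ==> integral x" "!!x. x : J ==> integral x" using assms unfolding idl_def by auto
 have "(a * c + a * e + b * c) + b * e = (a + b) * (c + e)" by (simp add: algebra_simps)
 then have "(a * c + a * e + b * c) + b * e = 1" using ab ce by simp
 moreover have "a * e : I"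
 proof -
  have "integral e" using ce assms unfolding idl_def by auto
  then show ?thesis using omodD(3)[OF I(1), of e a] ab by (simp add: mult.commute)
 qed
 then have "a * c + a * e + b * c : I" by (intro omodD(2)[OF I(1)]) (use ab ce I omodD(3)[OF I(1)] in auto)
 moreover have "b * e : J \<odot> L" using ip_mem ab ce by blast
 ultimately show ?thesis unfolding cop_def by blast
qed

lemma cop_inter: assumes "idl I" "idl J" "cop I J" "x : I" "x : J" shows "x : I \<odot> J"
proof -
 obtain a b where ab: "a : I" "b : J" "a + b = 1" using assms unfolding cop_def by blast
 have "x = a * x + x * b" using ab by (metis distrib_left mult.commute mult.right_neutral)
 moreover have "a * x : I \<odot> J" "x * b : I \<odot> J" using ip_mem ab assms by blast+
 ultimately show ?thesis using ip_add by metis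
qed

lemma chinese: assumes "idl I" "idl J" "cop I J" "integral x" "integral y"
 shows "\<exists>z. integral z & z - x : I & z - y : J"
proof -
 obtain a b where ab: "a : I" "b : J" "a + b = 1" using assms unfolding cop_def by blast
 have int: "integral a" "integral b" using ab assms unfolding idl_def by auto
 have "(x * b + y * a) - x = (y - x) * a" "(x * b + y * a) - y = (x - y) * b"
 proof -
  have b: "b = 1 - a" using ab(3) by (simp add: eq_diff_eq add.commute)
  show "(x * b + y * a) - x = (y - x) * a" "(x * b + y * a) - y = (x - y) * b"
   unfolding b by (simp_all add: algebra_simps)
 qed
 moreover have "(y - x) * a : I" "(x - y) * b : J"
  using omodD(3)[of I "y - x" a] omodD(3)[of J "x - y" b] integral_diff assms ab unfolding idl_def by auto
 moreover have "integral (x * b + y * a)" using int assms integral_add integral_mult by simp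
 ultimately show ?thesis by (intro exI[of _ "x * b + y * a"]) simp
qed

lemma im_int: assumes "integral x" shows "2 * of_int d * im x : \<int>"
proof -
 have "(2 * of_int d * im x) * (2 * of_int d * im x) = of_int d * (4 * nrm x - tr x * tr x)"
  by (simp add: nrm_def tr_def algebra_simps)
 also have "\<dots> : \<int>" using assms unfolding integral_def by (intro Ints_mult Ints_diff) auto
 finally show ?thesis by (rule rat_square_int)
qed

lemma finite_residues:
 assumes "n > (0::int)"
 shows "\<exists>S. finite S & (\<forall>x\<in>S. integral x) & (\<forall>x. integral x --> (\<exists>y\<in>S. x - y : pr (of_int n)))"
proof -
 \<comment> \<open>\<open>re\<close> is half the trace and \<open>im\<close> has denominator
   dividing 2 d, so congruence of the two integer invariants modulo 2 d n makes the difference n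
   times an element of Z + Z w.\<close>
 define q where "q = 2 * d * n"
 have q: "q > 0" using assms d_pos by (simp add: q_def)
 define c :: "'k => int \<times> int" where "c x = (\<lfloor>tr x\<rfloor> mod q, \<lfloor>2 * of_int d * im x\<rfloor> mod q)" for x
 have "c ` {x. integral x} \<subseteq> {0..<q} \<times> {0..<q}" using q by (auto simp: c_def)
 then have fin: "finite (c ` {x. integral x})" using finite_subset by blast
 define S where "S = (%i. SOME x. integral x & c x = i) ` (c ` {x. integral x})"
 have S: "integral (SOME y. integral y & c y = c x) & c (SOME y. integral y & c y = c x) = c x" if "integral x" for x
  by (rule someI[of _ x]) (use that in simp)
 have key: "x - y : pr (of_int n)" if x: "integral x" and y: "integral y" and c: "c x = c y" for x y
 proof -
  obtain a where a: "tr x = of_int a" using x unfolding integral_def by (auto elim: Ints_cases)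
  obtain a' where a': "tr y = of_int a'" using y unfolding integral_def by (auto elim: Ints_cases)
  obtain b where b: "2 * of_int d * im x = of_int b" using im_int[OF x] by (auto elim: Ints_cases)
  obtain b' where b': "2 * of_int d * im y = of_int b'" using im_int[OF y] by (auto elim: Ints_cases)
  have "a mod q = a' mod q" "b mod q = b' mod q" using c unfolding c_def a a' b b' by simp_all
  then obtain i j where ij: "a - a' = q * i" "b - b' = q * j" by (metis mod_eq_dvd_iff dvdE)
  have "of_int (a - a') = 2 * re (x - y)" using a a' by (simp add: tr_def re_diff)
  then have re: "re (x - y) = of_int (d * n * i)" unfolding ij q_def by simp
  have "of_int (b - b') = 2 * of_int d * im (x - y)" using b b' by (simp add: im_diff algebra_simps)
  then have im: "im (x - y) = of_int (n * j)" unfolding ij q_def using d_pos by simp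
  have "x - y = (of_int (d * i) + of_int j * w) * of_int n"
   unfolding eq_iff re im unfolding re_add im_add re_mult im_mult re_im_simps by (simp add: re_add im_add re_mult im_mult algebra_simps)
  moreover have "integral (of_int (d * i) + of_int j * w)"
   by (intro integral_add integral_mult integral_of_int integral_w)
  ultimately show ?thesis unfolding pr_def by blast
 qed
 have "\<exists>y\<in>S. x - y : pr (of_int n)" if x: "integral x" for x
 proof
  show "(SOME y. integral y & c y = c x) : S" unfolding S_def using x by blast
  show "x - (SOME y. integral y & c y = c x) : pr (of_int n)" using S[OF x] key[OF x] by metis
 qed
 moreover have "\<forall>x\<in>S. integral x" unfolding S_def using S by auto
 ultimately show ?thesis using fin unfolding S_def by blast
qed

lemma idl_contains_int: assumes "idl I" "I ~= {0}" shows "\<exists>n::int. n > 0 & of_int n : I"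
proof -
 obtain J n where J: "idl J" "n > 0" "I \<odot> J = pr (of_int n)" using idl_invertible[OF assms] by blast
 have "I \<odot> J \<subseteq> I" using ip_sub(2)[of J I] J assms unfolding idl_def by blast
 then show ?thesis using J pr_self by blast
qed

text \<open>Hurwitz' substitute for the Euclidean algorithm, by the pigeonhole principle applied to the
 fractional parts of the coordinates of \<open>0, \<gamma>, 2 \<gamma>, \<dots>\<close>.\<close>

lemma hurwitz: "\<exists>M::nat. \<forall>\<gamma>. \<exists>t \<omega>. 1 <= t & t <= M & integral \<omega> & nrm (of_nat t * \<gamma> - \<omega>) < 1"
proof -
 \<comment> \<open>Within a box of side 1/n the norm of a difference is below (1 + d)/n^2 =
   1/n.\<close>
 define n where "n = d + 1"
 have n: "n > 0" "n >= 2" using d_pos by (auto simp: n_def)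
 have "\<exists>t \<omega>. 1 <= t & t <= nat (n * n) & integral \<omega> & nrm (of_nat t * \<gamma> - \<omega>) < 1" for \<gamma>
 proof -
  define box where "box t = (\<lfloor>of_int n * frac (of_nat t * re \<gamma>)\<rfloor>, \<lfloor>of_int n * frac (of_nat t * im \<gamma>)\<rfloor>)" for t :: nat
  have fb: "0 <= \<lfloor>of_int n * frac (x::rat)\<rfloor> & \<lfloor>of_int n * frac x\<rfloor> < n" for x
  proof -
   have "0 <= of_int n * frac x" using n by simp
   moreover have "of_int n * frac x < of_int n * 1" using n frac_lt_1[of x] by (intro mult_strict_left_mono) auto
   ultimately show ?thesis by (simp add: floor_less_iff)
  qed
  have sub: "box ` {0..nat (n * n)} \<subseteq> {0..<n} \<times> {0..<n}" using fb by (auto simp: box_def)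
  have "card ({0..<n} \<times> {0..<n}) = nat n * nat n" by simp
  also have "\<dots> < card {0..nat (n * n)}" using n by (simp add: nat_mult_distrib)
  finally have "card (box ` {0..nat (n * n)}) < card {0..nat (n * n)}" using card_mono[OF _ sub] by fastforce
  then have "~ inj_on box {0..nat (n * n)}" using pigeonhole by blast
  then obtain t1 t2 where t12: "t1 : {0..nat (n * n)}" "t2 : {0..nat (n * n)}" "t1 < t2" "box t1 = box t2"
   unfolding inj_on_def by (metis linorder_neqE_nat)
  have close: "\<bar>frac x - frac y\<bar> * of_int n < 1" if "\<lfloor>of_int n * frac (x::rat)\<rfloor> = \<lfloor>of_int n * frac y\<rfloor>" for x y
  proof -
   have "\<bar>of_int n * frac x - of_int n * frac y\<bar> < 1" using that by linarith
   moreover have "of_int n * frac x - of_int n * frac y = (frac x - frac y) * of_int n" by (simp add: algebra_simps)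
   ultimately have "\<bar>(frac x - frac y) * of_int n\<bar> < 1" by (simp only:)
   then show ?thesis using n by (simp add: abs_mult)
  qed
  define m1 where "m1 = \<lfloor>of_nat t2 * re \<gamma>\<rfloor> - \<lfloor>of_nat t1 * re \<gamma>\<rfloor>"
  define m2 where "m2 = \<lfloor>of_nat t2 * im \<gamma>\<rfloor> - \<lfloor>of_nat t1 * im \<gamma>\<rfloor>"
  let ?z = "of_nat (t2 - t1) * \<gamma> - (of_int m1 + of_int m2 * w)"
  have rz: "re ?z = frac (of_nat t2 * re \<gamma>) - frac (of_nat t1 * re \<gamma>)"
   using t12(3) by (simp add: re_diff re_add re_mult m1_def frac_def of_nat_diff algebra_simps)
  have iz: "im ?z = frac (of_nat t2 * im \<gamma>) - frac (of_nat t1 * im \<gamma>)"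
   using t12(3) by (simp add: im_diff im_add im_mult m2_def frac_def of_nat_diff algebra_simps)
  have "\<bar>re ?z\<bar> * of_int n < 1" "\<bar>im ?z\<bar> * of_int n < 1"
   unfolding rz iz using close t12(4) unfolding box_def by auto
  have sq: "x * x * of_int (n * n) < 1" if "\<bar>x\<bar> * of_int n < 1" for x :: rat
  proof -
   have "(\<bar>x\<bar> * of_int n) * (\<bar>x\<bar> * of_int n) < 1 * 1"
    using that n by (intro mult_strict_mono) auto
   then show ?thesis by (simp add: mult_ac)
  qed
  have a: "re ?z * re ?z * of_int (n * n) < 1" "im ?z * im ?z * of_int (n * n) < 1"
   using sq \<open>\<bar>re ?z\<bar> * of_int n < 1\<close> \<open>\<bar>im ?z\<bar> * of_int n < 1\<close> by blast+
  have "of_int d * (im ?z * im ?z * of_int (n * n)) < of_int d * (1::rat)"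
   using a(2) d_pos by (intro mult_strict_left_mono) auto
  then have "nrm ?z * of_int (n * n) < 1 + of_int d" using a(1) unfolding nrm_def by (simp add: algebra_simps)
  also have "1 + of_int d = (of_int n :: rat)" by (simp add: n_def)
  also have "of_int n <= (of_int (n * n) :: rat)" using n by simp
  finally have "nrm ?z * of_int (n * n) < 1 * (of_int (n * n) :: rat)" by simp
  then have "nrm ?z < 1" using n mult_less_cancel_right_pos[of "of_int (n * n) :: rat" "nrm ?z" 1] by simp
  moreover have "integral (of_int m1 + of_int m2 * w)"
   by (intro integral_add integral_mult integral_of_int integral_w)
  moreover have "1 <= t2 - t1" "t2 - t1 <= nat (n * n)" using t12 by auto
  ultimately show ?thesis by blast
 qed
 then show ?thesis by blast
qed

text \<open>Let \<open>\<beta>\<close> have least norm among the non-zero elements of I. By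
  \<open>hurwitz\<close> some multiple t of \<open>\<alpha> / \<beta>\<close> differs from an
  integral element by norm below 1, and minimality makes t \<open>\<alpha>\<close> a multiple of
  \<open>\<beta>\<close>. Since t <= M, the factorial N works for all \<open>\<alpha>\<close>, and N
  / \<open>\<beta>\<close> scales I to an integral ideal containing N.\<close>

lemma class_representatives:
 "\<exists>N::int. N > 0 & (\<forall>I. idl I --> I ~= {0} --> (\<exists>\<gamma>. \<gamma> ~= 0 & idl (pr \<gamma> \<odot> I) & of_int N : pr \<gamma> \<odot> I))"
proof -
 obtain M :: nat where M: "!!\<gamma>. \<exists>t \<omega>. 1 <= t & t <= M & integral \<omega> & nrm (of_nat t * \<gamma> - \<omega>) < 1"
  using hurwitz by blast
 define N :: int where "N = fact M"
 have "\<exists>\<gamma>. \<gamma> ~= 0 & idl (pr \<gamma> \<odot> I) & of_int N : pr \<gamma> \<odot> I" if I: "idl I" "I ~= {0}" for I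
 proof -
  have m: "omod I" and int: "!!x. x : I ==> integral x" using I unfolding idl_def by auto
  define Q where "Q k \<longleftrightarrow> (\<exists>x\<in>I. x ~= 0 & nrm x = of_nat k)" for k :: nat
  obtain x0 where x0: "x0 : I" "x0 ~= 0" using I(2) omodD(1)[OF m] by auto
  have "\<exists>k. Q k"
  proof -
   obtain a where "nrm x0 = of_int a" "a >= 0" using integral_cases_nrm[OF int[OF x0(1)]] .
   then have "Q (nat a)" unfolding Q_def using x0 by auto
   then show ?thesis by blast
  qed
  from LeastI_ex[OF this] obtain \<beta> where \<beta>: "\<beta> : I" "\<beta> ~= 0" "nrm \<beta> = of_nat (LEAST k. Q k)"
   unfolding Q_def by blast
  have min: "x = 0" if x: "x : I" "nrm x < nrm \<beta>" for x
  proof (rule ccontr)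
   assume "x ~= 0"
   obtain a where a: "nrm x = of_int a" "a >= 0" using integral_cases_nrm[OF int[OF x(1)]] .
   then have "Q (nat a)" unfolding Q_def using x \<open>x ~= 0\<close> by auto
   then have "(LEAST k. Q k) <= nat a" by (rule Least_le)
   then have "nrm \<beta> <= nrm x" unfolding \<beta>(3) a using a(2)
    by (metis nat_0_le of_int_of_nat_eq of_nat_le_iff)
   then show False using x by simp
  qed
  have dv: "\<exists>u. integral u & of_int N * \<alpha> = u * \<beta>" if \<alpha>: "\<alpha> : I" for \<alpha>
  proof -
   obtain t \<omega> where t: "1 <= t" "t <= M" "integral \<omega>" "nrm (of_nat t * (\<alpha> / \<beta>) - \<omega>) < 1" using M by blast
   have "(of_nat t * (\<alpha> / \<beta>) - \<omega>) * \<beta> = of_nat t * \<alpha> - \<omega> * \<beta>" using \<beta> by (simp add: field_simps)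
   then have "nrm (of_nat t * \<alpha> - \<omega> * \<beta>) = nrm (of_nat t * (\<alpha> / \<beta>) - \<omega>) * nrm \<beta>"
    by (metis nrm_mult)
   also have "\<dots> < 1 * nrm \<beta>" using t(4) \<beta>(2) nrm_nonneg[of \<beta>] nrm_eq_0[of \<beta>]
    by (intro mult_strict_right_mono) (auto simp: order.strict_iff_order)
   finally have "nrm (of_nat t * \<alpha> - \<omega> * \<beta>) < nrm \<beta>" by simp
   moreover have "of_nat t * \<alpha> - \<omega> * \<beta> : I"
    using omodD(5)[OF m omodD(3)[OF m integral_of_int[of "int t"] \<alpha>] omodD(3)[OF m t(3) \<beta>(1)]] by simp
   ultimately have e: "of_nat t * \<alpha> = \<omega> * \<beta>" using min by fastforce
   have "int t dvd N" unfolding N_def using t(1,2) by (metis dvd_fact of_nat_dvd_iff of_nat_fact)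
   then obtain k where k: "N = int t * k" by blast
   have "of_int N * \<alpha> = (of_int k * \<omega>) * \<beta>" using e by (simp add: k mult_ac)
   then show ?thesis using integral_mult[OF integral_of_int t(3)] by blast
  qed
  let ?\<gamma> = "of_int N / \<beta>"
  have "N ~= 0" by (simp add: N_def)
  then have "?\<gamma> ~= 0" using \<beta> by simp
  moreover have "idl (pr ?\<gamma> \<odot> I)"
  proof -
   have "integral x" if "x : pr ?\<gamma> \<odot> I" for x
   proof -
    obtain \<alpha> where "\<alpha> : I" "x = ?\<gamma> * \<alpha>" using \<open>x : pr ?\<gamma> \<odot> I\<close> unfolding ip_pr[OF m] by blast
    then show ?thesis using dv[of \<alpha>] \<beta> by (auto simp: field_simps)
   qed
   then show ?thesis unfolding idl_def using ip_omod[OF pr_omod m] by blast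
  qed
  moreover have "of_int N : pr ?\<gamma> \<odot> I" unfolding ip_pr[OF m] using \<beta> by (intro image_eqI[of _ _ \<beta>]) auto
  ultimately show ?thesis by blast
 qed
 moreover have "N > 0" by (simp add: N_def)
 ultimately show ?thesis by blast
qed

text \<open>Such an ideal is a union of classes modulo N, so it is determined by the representatives
  that it contains.\<close>

lemma finite_idl_containing: assumes "N > (0::int)" shows "finite {J. idl J & of_int N : J}"
proof -
 obtain S where S: "finite S" "\<forall>x. integral x --> (\<exists>y\<in>S. x - y : pr (of_int N))"
  using finite_residues[OF assms] by blast
 have "inj_on (%J. J \<inter> S) {J. idl J & of_int N : J}"
 proof (rule inj_onI)
  have sub: "J \<subseteq> J'" if J: "idl J" "of_int N : J" and J': "idl J'" "of_int N : J'" and e: "J \<inter> S = J' \<inter> S" for J J'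
  proof
   fix x assume x: "x : J"
   have pN: "pr (of_int N) \<subseteq> J" "pr (of_int N) \<subseteq> J'"
    using J J' omodD(3) unfolding idl_def pr_def by blast+
   obtain y where y: "y : S" "x - y : pr (of_int N)" using S x J unfolding idl_def by blast
   have "x - (x - y) : J" using omodD(5) J x y pN unfolding idl_def by blast
   then have "y : J'" using e y by auto
   then have "(x - y) + y : J'" using omodD(2) J' y pN unfolding idl_def by blast
   then show "x : J'" by simp
  qed
  fix J J' assume "J : {J. idl J & of_int N : J}" "J' : {J. idl J & of_int N : J}" "J \<inter> S = J' \<inter> S"
  then show "J = J'" using sub[of J J'] sub[of J' J] by auto
 qed
 moreover have "(%J. J \<inter> S) ` {J. idl J & of_int N : J} \<subseteq> Pow S" by auto
 then have "finite ((%J. J \<inter> S) ` {J. idl J & of_int N : J})" using S(1) finite_subset by blast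
 ultimately show ?thesis using finite_imageD by blast
qed

end

section \<open>Ray class groups\<close>

lemma finite_image_factor:
 assumes "finite (h ` A)" "!!x y. x : A ==> y : A ==> h x = h y ==> g x = g y"
 shows "finite (g ` A)"
proof -
 have "g x = g (SOME y. y : A & h y = h x)" if x: "x : A" for x
 proof -
  have "(SOME y. y : A & h y = h x) : A & h (SOME y. y : A & h y = h x) = h x"
   by (rule someI[of _ x]) (use x in simp)
  then show ?thesis using assms(2)[OF x] by simp
 qed
 then have "g ` A \<subseteq> (%i. g (SOME y. y : A & h y = i)) ` (h ` A)" by auto
 then show ?thesis using assms(1) finite_surj by blast
qed

context imag_quad begin

lemma modulus_iff: "modulus I \<longleftrightarrow> idl I & I ~= {0}" unfolding modulus_def ideal_iff ..

abbreviation "FI \<equiv> (fractional_ideals :: 'k set monoid)"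

interpretation FI: comm_group FI by (rule fractional_group)

definition rid :: "'k set => 'k set set" where
 "rid f = {M. fid M & (\<exists>I J. idl I & I ~= {0} & idl J & J ~= {0} & cop I f & cop J f & M \<odot> J = I)}"

lemma ray_ideals_eq: assumes "idl f" shows "ray_ideals f = FI\<lparr>carrier := rid f\<rparr>"
proof -
 have "{M : carrier FI. \<exists>I J. modulus I & modulus J & ideal_coprime I f & ideal_coprime J f & M \<odot> J = I} = rid f"
  unfolding rid_def carrier_fractional modulus_iff using coprime_iff[OF _ assms] by auto
 then show ?thesis unfolding ray_ideals_def by simp
qed

lemma cop_mult': "idl I ==> idl J ==> idl L ==> cop J I ==> cop L I ==> cop (J \<odot> L) I"
 using cop_mult cop_sym by blast

lemma idl_mult_nz: assumes "idl I" "I ~= {0}" "idl J" "J ~= {0}" shows "I \<odot> J ~= {0}"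
 using fid_mult[OF idl_fid[OF assms(1,2)] idl_fid[OF assms(3,4)]] unfolding fid_def by blast

lemma ZK_nz: "ZK ~= {0}"
proof -
 have "1 : ZK" using integral_01 ZK_iff by blast
 then show ?thesis by (metis singletonD zero_neq_one)
qed

lemma rid_idl: assumes "idl f" "idl I" "I ~= {0}" "cop I f" shows "I : rid f"
proof -
 have "cop ZK f" unfolding cop_def
  using integral_01 ZK_iff omodD(1) assms(1) unfolding idl_def by (intro bexI[of _ 1] bexI[of _ 0]) auto
 moreover have "I \<odot> ZK = I" using assms(2) unfolding idl_def by (intro ip_one) auto
 ultimately show ?thesis unfolding rid_def using assms idl_fid idl_ZK ZK_nz by blast
qed

lemma rid_fid: "M : rid f ==> fid M" unfolding rid_def by blast

lemma rid_mult: assumes f: "idl f" and "M : rid f" "N : rid f" shows "M \<odot> N : rid f"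
proof -
 obtain I J where 1: "fid M" "idl I" "I ~= {0}" "idl J" "J ~= {0}" "cop I f" "cop J f" "M \<odot> J = I"
  using assms unfolding rid_def by blast
 obtain I' J' where 2: "fid N" "idl I'" "I' ~= {0}" "idl J'" "J' ~= {0}" "cop I' f" "cop J' f" "N \<odot> J' = I'"
  using assms unfolding rid_def by blast
 have "(M \<odot> N) \<odot> (J \<odot> J') = (M \<odot> J) \<odot> (N \<odot> J')" by (simp add: ip_ac)
 then have "(M \<odot> N) \<odot> (J \<odot> J') = I \<odot> I'" unfolding 1(8) 2(8) .
 moreover have "cop (I \<odot> I') f" "cop (J \<odot> J') f" using cop_mult' f 1 2 by blast+
 moreover have "idl (I \<odot> I')" "idl (J \<odot> J')" "I \<odot> I' ~= {0}" "J \<odot> J' ~= {0}" "fid (M \<odot> N)"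
  using 1 2 ip_idl idl_mult_nz fid_mult by auto
 ultimately show ?thesis unfolding rid_def by blast
qed

lemma rid_subgroup: assumes f: "idl f" shows "subgroup (rid f) FI"
proof (rule FI.subgroupI)
 show "rid f \<subseteq> carrier FI" using rid_fid by (auto simp: carrier_fractional)
 have "0 : f" using f omodD(1) unfolding idl_def by blast
 then have "cop ZK f" unfolding cop_def using integral_01 ZK_iff by (intro bexI[of _ 1] bexI[of _ 0]) auto
 then have "ZK : rid f" by (rule rid_idl[OF f idl_ZK ZK_nz])
 then show "rid f ~= {}" by blast
 show "a \<otimes>\<^bsub>FI\<^esub> b : rid f" if "a : rid f" "b : rid f" for a b using rid_mult[OF f that] by simp
 show "inv\<^bsub>FI\<^esub> M : rid f" if M: "M : rid f" for M
 proof -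
  obtain I J where 1: "fid M" "idl I" "I ~= {0}" "idl J" "J ~= {0}" "cop I f" "cop J f" "M \<odot> J = I"
   using M unfolding rid_def by blast
  have Mc: "M : carrier FI" using 1 by (simp add: carrier_fractional)
  have mJ: "omod J" using 1 unfolding idl_def by blast
  have "inv\<^bsub>FI\<^esub> M \<odot> I = (inv\<^bsub>FI\<^esub> M \<odot> M) \<odot> J" unfolding 1(8)[symmetric] by (simp add: ip_assoc)
  also have "inv\<^bsub>FI\<^esub> M \<odot> M = ZK" using FI.l_inv[OF Mc] by simp
  also have "ZK \<odot> J = J" by (rule ip_one(1)[OF mJ])
  finally have "inv\<^bsub>FI\<^esub> M \<odot> I = J" .
  moreover have "fid (inv\<^bsub>FI\<^esub> M)" using FI.inv_closed[OF Mc] by (simp add: carrier_fractional)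
  ultimately show ?thesis unfolding rid_def using 1 by blast
 qed
qed

lemma cop_pr: assumes f: "idl f" and a: "integral a" shows "cop (pr a) f \<longleftrightarrow> (\<exists>c. integral c & a * c - 1 : f)"
proof
 assume "cop (pr a) f"
 then obtain x y where xy: "x : pr a" "y : f" "x + y = 1" unfolding cop_def by blast
 then obtain c where "integral c" "x = c * a" unfolding pr_def by blast
 then have "a * c - 1 = - y" using xy(3) by (simp add: mult.commute algebra_simps eq_neg_iff_add_eq_0)
 then show "\<exists>c. integral c & a * c - 1 : f" using \<open>integral c\<close> xy(2) f omodD(4) unfolding idl_def by metis
next
 assume "\<exists>c. integral c & a * c - 1 : f"
 then obtain c where c: "integral c" "a * c - 1 : f" by blast
 then have "- (a * c - 1) : f" using f omodD(4) unfolding idl_def by blast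
 moreover have "c * a : pr a" using c unfolding pr_def by blast
 moreover have "c * a + - (a * c - 1) = 1" by (simp add: mult.commute)
 ultimately show "cop (pr a) f" unfolding cop_def by blast
qed

definition S :: "'k set => 'k set set" where
 "S f = {pr (a / b) | a b. integral a & integral b & a ~= 0 & b ~= 0 & cop (pr a) f & cop (pr b) f & a - b : f}"

lemma S_eq: assumes "idl f" shows "ray_principal f = S f"
 unfolding ray_principal_def S_def PIdl_eq ZK_iff using coprime_iff[OF pr_idl assms] by blast

lemma S_I: "integral a ==> integral b ==> a ~= 0 ==> b ~= 0 ==> cop (pr a) f ==> cop (pr b) f ==> a - b : f ==> pr (a / b) : S f"
 unfolding S_def by blast

lemma pr_nz: "a ~= 0 ==> pr a ~= {0}" using pr_self by (metis singletonD)

lemma S_rid: assumes f: "idl f" shows "S f \<subseteq> rid f"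
proof
 fix M assume "M : S f"
 then obtain a b where ab: "M = pr (a / b)" "integral a" "integral b" "a ~= 0" "b ~= 0" "cop (pr a) f" "cop (pr b) f"
  unfolding S_def by blast
 have "M \<odot> pr b = pr a" unfolding ab(1) ip_pr_pr using ab(5) by simp
 moreover have "fid M" unfolding ab(1) by (rule pr_fid) (use ab in simp)
 moreover have "idl (pr a)" "idl (pr b)" "pr a ~= {0}" "pr b ~= {0}" using ab pr_idl pr_nz by auto
 ultimately show "M : rid f" unfolding rid_def using ab(6,7) by blast
qed

lemma cop_pr_mult: assumes f: "idl f" and "integral a" "integral b" "cop (pr a) f" "cop (pr b) f" shows "cop (pr (a * b)) f"
 using cop_mult'[OF f pr_idl[OF assms(2)] pr_idl[OF assms(3)] assms(4,5)] unfolding ip_pr_pr .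

lemma S_subgroup: assumes f: "idl f" shows "subgroup (S f) FI"
proof (rule FI.subgroupI)
 have mf: "omod f" using f unfolding idl_def by blast
 show "S f \<subseteq> carrier FI" using S_rid[OF f] rid_fid by (auto simp: carrier_fractional)
 have "pr (1 / 1) : S f"
 proof (rule S_I)
  show "cop (pr 1) f"
   unfolding cop_pr[OF f integral_01(2)] using integral_01 omodD(1)[OF mf] by (intro exI[of _ 1]) simp
  then show "cop (pr 1) f" .
 qed (use integral_01 omodD(1)[OF mf] in simp_all)
 then show "S f ~= {}" by blast
 show "M \<otimes>\<^bsub>FI\<^esub> N : S f" if "M : S f" "N : S f" for M N
 proof -
  obtain a b where ab: "M = pr (a / b)" "integral a" "integral b" "a ~= 0" "b ~= 0" "cop (pr a) f" "cop (pr b) f" "a - b : f"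
   using \<open>M : S f\<close> unfolding S_def by blast
  obtain c e where ce: "N = pr (c / e)" "integral c" "integral e" "c ~= 0" "e ~= 0" "cop (pr c) f" "cop (pr e) f" "c - e : f"
   using \<open>N : S f\<close> unfolding S_def by blast
  have "a * c - b * e = a * (c - e) + e * (a - b)" by (simp add: algebra_simps)
  also have "\<dots> : f" using ab ce omodD(2,3)[OF mf] by blast
  finally have "pr ((a * c) / (b * e)) : S f" using ab ce cop_pr_mult[OF f] integral_mult by (intro S_I) auto
  then show ?thesis by (simp add: ab(1) ce(1) ip_pr_pr)
 qed
 show "inv\<^bsub>FI\<^esub> M : S f" if M: "M : S f" for M
 proof -
  obtain a b where ab: "M = pr (a / b)" "integral a" "integral b" "a ~= 0" "b ~= 0" "cop (pr a) f" "cop (pr b) f" "a - b : f"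
   using M unfolding S_def by blast
  have "- (a - b) : f" by (rule omodD(4)[OF mf ab(8)])
  then have "pr (b / a) : S f" using ab by (intro S_I) auto
  moreover have "inv\<^bsub>FI\<^esub> M = pr (b / a)"
  proof (rule FI.inv_equality)
   show "pr (b / a) \<otimes>\<^bsub>FI\<^esub> M = \<one>\<^bsub>FI\<^esub>" using ab by (simp add: ip_pr_pr pr_1)
  qed (use ab pr_fid in \<open>auto simp: carrier_fractional\<close>)
  ultimately show ?thesis by simp
 qed
qed

definition cls :: "'k set => 'k set => 'k set set" where "cls f M = S f #>\<^bsub>FI\<^esub> M"

lemma cls_mem: "N : cls f M \<longleftrightarrow> (\<exists>h\<in>S f. N = h \<odot> M)"
 unfolding cls_def r_coset_def by auto

abbreviation "Gr f \<equiv> ray_class_group f"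

lemma Gr_group: assumes f: "idl f" shows "comm_group (Gr f)"
proof -
 have c: "comm_group (FI\<lparr>carrier := rid f\<rparr>)"
 proof (rule group.group_comm_groupI)
  show "group (FI\<lparr>carrier := rid f\<rparr>)" by (rule FI.subgroup_imp_group[OF rid_subgroup[OF f]])
  show "x \<otimes>\<^bsub>FI\<lparr>carrier := rid f\<rparr>\<^esub> y = y \<otimes>\<^bsub>FI\<lparr>carrier := rid f\<rparr>\<^esub> x" for x y :: "'k set"
   using ip_comm[of x y] by simp
 qed
 have "subgroup (S f) (FI\<lparr>carrier := rid f\<rparr>)"
  by (rule FI.subgroup_incl[OF S_subgroup[OF f] rid_subgroup[OF f] S_rid[OF f]])
 then show ?thesis
  unfolding ray_class_group_def S_eq[OF f] ray_ideals_eq[OF f] by (rule comm_group.abelian_FactGroup[OF c])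
qed

lemma Gr_carrier: assumes f: "idl f" shows "carrier (Gr f) = cls f ` rid f"
 unfolding ray_class_group_def S_eq[OF f] ray_ideals_eq[OF f] FactGroup_def RCOSETS_def cls_def r_coset_def by auto

lemma Gr_one: assumes f: "idl f" shows "\<one>\<^bsub>Gr f\<^esub> = S f"
 unfolding ray_class_group_def S_eq[OF f] FactGroup_def by simp

lemma cls_ZK: assumes f: "idl f" shows "cls f ZK = S f"
proof -
 have "h \<odot> ZK = h" if "h : S f" for h using that S_rid[OF f] rid_fid ip_one(2) unfolding fid_def by blast
 then show ?thesis using cls_mem by auto
qed

lemma Gr_mult: assumes f: "idl f" and "M : rid f" "N : rid f"
 shows "cls f M \<otimes>\<^bsub>Gr f\<^esub> cls f N = cls f (M \<odot> N)"
proof -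
 have "cls f M \<otimes>\<^bsub>Gr f\<^esub> cls f N = cls f M <#>\<^bsub>FI\<^esub> cls f N"
  unfolding ray_class_group_def FactGroup_def ray_ideals_eq[OF f] by (simp add: set_mult_def)
 also have "\<dots> = cls f (M \<odot> N)"
 proof (intro Set.set_eqI iffI)
  fix x assume "x : cls f M <#>\<^bsub>FI\<^esub> cls f N"
  then obtain h h' where h: "h : S f" "h' : S f" "x = (h \<odot> M) \<odot> (h' \<odot> N)"
   unfolding set_mult_def cls_mem[symmetric] by (auto simp: cls_mem)
  then have "x = (h \<odot> h') \<odot> (M \<odot> N)" by (simp add: ip_ac)
  then show "x : cls f (M \<odot> N)" using subgroup.m_closed[OF S_subgroup[OF f] h(1,2)] cls_mem by auto
 next
  fix x assume "x : cls f (M \<odot> N)"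
  then obtain h where h: "h : S f" "x = h \<odot> (M \<odot> N)" using cls_mem by blast
  have o: "ZK : S f" using subgroup.one_closed[OF S_subgroup[OF f]] by simp
  have "x = (h \<odot> M) \<odot> (ZK \<odot> N)" using h(2) ip_one(1)[of N] rid_fid[OF assms(3)] unfolding fid_def by (simp add: ip_assoc)
  moreover have "h \<odot> M : cls f M" "ZK \<odot> N : cls f N" using h(1) o cls_mem by blast+
  ultimately show "x : cls f M <#>\<^bsub>FI\<^esub> cls f N" unfolding set_mult_def by auto
 qed
 finally show ?thesis .
qed

lemma cls_eq_iff: assumes f: "idl f" and M: "M : rid f" and N: "N : rid f"
 shows "cls f M = cls f N \<longleftrightarrow> (\<exists>h\<in>S f. M = h \<odot> N)"
proof
 assume "cls f M = cls f N"
 moreover have "M : cls f M"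
  using subgroup.one_closed[OF S_subgroup[OF f]] ip_one(1)[of M] rid_fid[OF M] cls_mem unfolding fid_def by force
 ultimately show "\<exists>h\<in>S f. M = h \<odot> N" using cls_mem by blast
next
 assume "\<exists>h\<in>S f. M = h \<odot> N"
 then obtain h where h: "h : S f" "M = h \<odot> N" by blast
 have hc: "h : carrier FI" using subgroup.subset[OF S_subgroup[OF f]] h by blast
 have sub: "h' \<odot> M : cls f N" if "h' : S f" for h'
  using subgroup.m_closed[OF S_subgroup[OF f] that h(1)] unfolding cls_mem h(2)
  by (intro bexI[of _ "h' \<odot> h"]) (simp_all add: ip_assoc)
 have "h' \<odot> N : cls f M" if h': "h' : S f" for h'
 proof -
  have "(h' \<otimes>\<^bsub>FI\<^esub> inv\<^bsub>FI\<^esub> h) \<odot> M = h' \<odot> ((inv\<^bsub>FI\<^esub> h \<otimes>\<^bsub>FI\<^esub> h) \<odot> N)" unfolding h(2) by (simp add: ip_assoc)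
  also have "\<dots> = h' \<odot> N" using FI.l_inv[OF hc] ip_one(1)[of N] rid_fid[OF N] unfolding fid_def by simp
  finally have "h' \<odot> N = (h' \<otimes>\<^bsub>FI\<^esub> inv\<^bsub>FI\<^esub> h) \<odot> M" by simp
  moreover have "h' \<otimes>\<^bsub>FI\<^esub> inv\<^bsub>FI\<^esub> h : S f"
   using subgroup.m_closed[OF S_subgroup[OF f] h' subgroup.m_inv_closed[OF S_subgroup[OF f] h(1)]] .
  ultimately show ?thesis using cls_mem by blast
 qed
 moreover have "cls f M \<subseteq> cls f N" using sub by (auto simp: cls_mem[of _ f M])
 ultimately show "cls f M = cls f N" by (auto simp: cls_mem[of _ f N])
qed

lemma ideal_dvd_iff: "ideal_dvd I J \<longleftrightarrow> (\<exists>L. idl L & J = I \<odot> L)"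
 unfolding ideal_dvd_def ideal_iff ..

lemma ideal_dvd_sub: assumes "idl f" "ideal_dvd f f'" shows "f' \<subseteq> f"
 using assms ip_sub(2) unfolding ideal_dvd_iff idl_def by blast

lemma rid_mono: assumes "f' \<subseteq> f" shows "rid f' \<subseteq> rid f"
 unfolding rid_def using cop_mono[OF _ order.refl assms] by blast

lemma S_mono: assumes "f' \<subseteq> f" shows "S f' \<subseteq> S f"
 unfolding S_def using cop_mono[OF _ order.refl assms] assms by blast

lemma ray_proj_cls: assumes f: "idl f" and f': "idl f'" and sub: "f' \<subseteq> f" and M: "M : rid f'"
 shows "ray_proj f (cls f' M) = cls f M"
proof (intro Set.set_eqI iffI)
 fix x assume "x : ray_proj f (cls f' M)"
 then obtain h h' where h: "h : S f" "h' : S f'" "x = h \<odot> (h' \<odot> M)"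
  unfolding ray_proj_def S_eq[OF f] set_mult_def by (auto simp: cls_mem)
 then have "x = (h \<odot> h') \<odot> M" "h \<odot> h' : S f"
  using subgroup.m_closed[OF S_subgroup[OF f] h(1), of h'] S_mono[OF sub] by (auto simp: ip_assoc)
 then show "x : cls f M" using cls_mem by blast
next
 fix x assume "x : cls f M"
 then obtain h where h: "h : S f" "x = h \<odot> M" using cls_mem by blast
 have o: "ZK : S f'" using subgroup.one_closed[OF S_subgroup[OF f']] by simp
 have "ZK \<odot> M = M" using ip_one(1) rid_fid[OF M] unfolding fid_def by blast
 then have "M : cls f' M" using o cls_mem by metis
 then show "x : ray_proj f (cls f' M)" unfolding ray_proj_def S_eq[OF f] set_mult_def using h by auto
qed

text \<open>Clearing denominators gives \<open>\<gamma>\<close> B = A with A and B integral and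
  prime to f. If \<open>\<beta>\<close> in B is 1 modulo f, then a =
  \<open>\<gamma> * \<beta>\<close> is invertible modulo f: for an element
  \<open>\<alpha> = \<gamma> * c\<close> of A that is 1 modulo f, the product a c equals
  \<open>\<alpha> * \<beta>\<close>.\<close>

lemma rid_ratio:
 assumes f: "idl f" and M: "M : rid f" and M': "M' : rid f" and \<gamma>: "\<gamma> ~= 0" "M = pr \<gamma> \<odot> M'"
 shows "\<exists>a b. integral a & integral b & a ~= 0 & b ~= 0 & cop (pr a) f & cop (pr b) f & \<gamma> = a / b"
proof -
 have mf: "omod f" using f unfolding idl_def by blast
 obtain I J where 1: "fid M" "idl I" "I ~= {0}" "idl J" "J ~= {0}" "cop I f" "cop J f" "M \<odot> J = I"
  using M unfolding rid_def by blast
 obtain I' J' where 2: "fid M'" "idl I'" "I' ~= {0}" "idl J'" "J' ~= {0}" "cop I' f" "cop J' f" "M' \<odot> J' = I'"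
  using M' unfolding rid_def by blast
 define A where "A = I \<odot> J'"
 define B where "B = I' \<odot> J"
 have A: "idl A" "cop A f" unfolding A_def using 1 2 ip_idl cop_mult'[OF f] by auto
 have B: "idl B" "cop B f" "B ~= {0}" unfolding B_def using 1 2 ip_idl cop_mult'[OF f] idl_mult_nz by auto
 have mB: "omod B" using B unfolding idl_def by blast
 have "pr \<gamma> \<odot> B = (pr \<gamma> \<odot> M') \<odot> J \<odot> J'" unfolding B_def 2(8)[symmetric] by (simp add: ip_ac)
 also have "\<dots> = A" unfolding \<gamma>(2)[symmetric] A_def 1(8) ..
 finally have AB: "(%x. \<gamma> * x) ` B = A" unfolding ip_pr[OF mB] .
 obtain \<alpha> ph where \<alpha>: "\<alpha> : A" "ph : f" "\<alpha> + ph = 1" using A unfolding cop_def by blast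
 have "\<exists>\<beta>\<in>B. \<beta> ~= 0 & 1 - \<beta> : f"
 proof -
  obtain \<beta> \<psi> where \<beta>: "\<beta> : B" "\<psi> : f" "\<beta> + \<psi> = 1" using B unfolding cop_def by blast
  then have b1: "1 - \<beta> : f" by (metis add_diff_cancel_left')
  show ?thesis
  \<comment> \<open>A denominator must be non-zero. If the element found is 0, then f contains 1 and
    any non-zero element of B is congruent to 1.\<close>
  proof (cases "\<beta> = 0")
   case True
   then have "1 : f" using \<beta> by simp
   obtain \<beta>' where b': "\<beta>' : B" "\<beta>' ~= 0" using B(3) omodD(1)[OF mB] by blast
   then have "integral (1 - \<beta>')" using B(1) integral_diff integral_01 unfolding idl_def by blast
   then have "1 - \<beta>' : f" using omodD(3)[OF mf _ \<open>1 : f\<close>] by simp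
   then show ?thesis using b' by blast
  qed (use b1 \<beta> in blast)
 qed
 then obtain \<beta> where \<beta>: "\<beta> : B" "\<beta> ~= 0" "1 - \<beta> : f" by blast
 obtain c where c: "c : B" "\<alpha> = \<gamma> * c" using \<alpha>(1) AB by blast
 define a where "a = \<gamma> * \<beta>"
 have aA: "a : A" unfolding a_def using AB \<beta> by blast
 have int: "integral a" "integral \<beta>" "integral c" "integral \<alpha>" using aA A(1) \<beta>(1) c(1) B(1) \<alpha>(1) unfolding idl_def by blast+
 have a1: "1 - \<alpha> : f" using \<alpha> by (metis add_diff_cancel_left')
 have "a * c - 1 = - ((1 - \<beta>) + \<beta> * (1 - \<alpha>))" unfolding a_def c(2) by (simp add: algebra_simps)
 also have "\<dots> : f" using omodD(2,3,4)[OF mf] \<beta>(3) a1 int by blast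
 finally have "cop (pr a) f" using cop_pr[OF f int(1)] int(3) by blast
 moreover have "\<beta> * 1 - 1 = - (1 - \<beta>)" by simp
 then have "\<beta> * 1 - 1 : f" using omodD(4)[OF mf \<beta>(3)] by simp
 then have "cop (pr \<beta>) f" using cop_pr[OF f int(2)] integral_01 by blast
 moreover have "a ~= 0" "\<gamma> = a / \<beta>" unfolding a_def using \<gamma> \<beta> by auto
 ultimately show ?thesis using int \<beta> by blast
qed

text \<open>A class is determined by an ideal from a finite list in the same ideal class, and by the
  residues modulo f of a numerator and a denominator prime to f that lead from a fixed base ideal to
  M.\<close>

lemma Gr_finite: assumes f: "idl f" and nz: "f ~= {0}" shows "finite (carrier (Gr f))"
proof -
 have mf: "omod f" using f unfolding idl_def by blast
 obtain N :: int where N: "N > 0"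
  "!!I. idl I ==> I ~= {0} ==> \<exists>\<gamma>. \<gamma> ~= 0 & idl (pr \<gamma> \<odot> I) & of_int N : pr \<gamma> \<odot> I"
  using class_representatives by blast
 define Fin where "Fin = {J. idl J & of_int N : J}"
 have finFin: "finite Fin" unfolding Fin_def by (rule finite_idl_containing[OF N(1)])
 have exC: "\<exists>C. C : Fin & (\<exists>\<gamma>. \<gamma> ~= 0 & C = pr \<gamma> \<odot> M)" if M: "M : rid f" for M
 proof -
  obtain I J where 1: "fid M" "idl I" "I ~= {0}" "idl J" "J ~= {0}" "M \<odot> J = I"
   using M unfolding rid_def by blast
  obtain J' n where J': "idl J'" "J' ~= {0}" "n > 0" "J \<odot> J' = pr (of_int n)" using idl_invertible[OF 1(4,5)] by blast
  have "idl (I \<odot> J')" "I \<odot> J' ~= {0}" using 1 J' ip_idl idl_mult_nz by auto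
  then obtain \<gamma> where \<gamma>: "\<gamma> ~= 0" "idl (pr \<gamma> \<odot> (I \<odot> J'))" "of_int N : pr \<gamma> \<odot> (I \<odot> J')" using N(2) by blast
  have "pr \<gamma> \<odot> (I \<odot> J') = (pr \<gamma> \<odot> (J \<odot> J')) \<odot> M" unfolding 1(6)[symmetric] by (simp add: ip_ac)
  also have "\<dots> = pr (\<gamma> * of_int n) \<odot> M" unfolding J'(4) ip_pr_pr ..
  finally show ?thesis using \<gamma> J'(3) unfolding Fin_def
   by (intro exI[of _ "pr \<gamma> \<odot> (I \<odot> J')"] conjI exI[of _ "\<gamma> * of_int n"]) auto
 qed
 define C where "C M = (SOME C. C : Fin & (\<exists>\<gamma>. \<gamma> ~= 0 & C = pr \<gamma> \<odot> M))" for M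
 have C: "C M : Fin" "\<exists>\<gamma>. \<gamma> ~= 0 & C M = pr \<gamma> \<odot> M" if "M : rid f" for M
  using someI_ex[OF exC[OF that]] unfolding C_def by auto
 \<comment> \<open>The base ideal is again prime to f and depends on M only through
   \<open>C M\<close>; the listed ideal itself may share factors with f.\<close>
 define bs where "bs c = (SOME M. M : rid f & C M = c)" for c
 have bs: "bs (C M) : rid f" "C (bs (C M)) = C M" if "M : rid f" for M
  using someI[of "%M'. M' : rid f & C M' = C M" M] that unfolding bs_def by auto
 have ratio: "\<exists>q. integral (fst q) & integral (snd q) & fst q ~= 0 & snd q ~= 0 & cop (pr (fst q)) f & cop (pr (snd q)) f &
  M = pr (fst q / snd q) \<odot> bs (C M)" if M: "M : rid f" for M
 proof -
  obtain \<gamma> where \<gamma>: "\<gamma> ~= 0" "C M = pr \<gamma> \<odot> M" using C(2)[OF M] by blast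
  obtain \<delta> where \<delta>: "\<delta> ~= 0" "C M = pr \<delta> \<odot> bs (C M)" using C(2)[OF bs(1)[OF M]] bs(2)[OF M] by auto
  have mM: "omod M" using rid_fid[OF M] unfolding fid_def by blast
  have "M = pr 1 \<odot> M" using ip_one(1)[OF mM] pr_1 by simp
  also have "pr 1 = pr (1 / \<gamma>) \<odot> pr \<gamma>" using \<gamma> by (simp add: ip_pr_pr)
  also have "(pr (1 / \<gamma>) \<odot> pr \<gamma>) \<odot> M = pr (1 / \<gamma>) \<odot> (pr \<delta> \<odot> bs (C M))" unfolding ip_assoc \<gamma>(2)[symmetric] \<delta>(2)[symmetric] ..
  also have "\<dots> = pr (\<delta> / \<gamma>) \<odot> bs (C M)" unfolding ip_assoc[symmetric] ip_pr_pr by simp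
  finally have e: "M = pr (\<delta> / \<gamma>) \<odot> bs (C M)" .
  have "\<delta> / \<gamma> ~= 0" using \<gamma> \<delta> by simp
  from rid_ratio[OF f M bs(1)[OF M] this e]
  obtain a b where "integral a" "integral b" "a ~= 0" "b ~= 0" "cop (pr a) f" "cop (pr b) f" "\<delta> / \<gamma> = a / b" by blast
  then show ?thesis using e by (intro exI[of _ "(a, b)"]) simp
 qed
 then have "\<forall>M. \<exists>q. M : rid f --> integral (fst q) & integral (snd q) & fst q ~= 0 & snd q ~= 0 &
  cop (pr (fst q)) f & cop (pr (snd q)) f & M = pr (fst q / snd q) \<odot> bs (C M)" by blast
 from choice[OF this] obtain q where q: "!!M. M : rid f ==> integral (fst (q M)) & integral (snd (q M)) &
   fst (q M) ~= 0 & snd (q M) ~= 0 & cop (pr (fst (q M))) f & cop (pr (snd (q M))) f &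
   M = pr (fst (q M) / snd (q M)) \<odot> bs (C M)" by blast
 obtain n :: int where n: "n > 0" "of_int n : f" using idl_contains_int[OF f nz] by blast
 obtain R where R: "finite R" "!!x. integral x ==> \<exists>y\<in>R. x - y : pr (of_int n)" using finite_residues[OF n(1)] by blast
 have prn: "pr (of_int n) \<subseteq> f" unfolding pr_def using omodD(3)[OF mf _ n(2)] by blast
 define res where "res x = (SOME y. y : R & x - y : f)" for x
 have res: "res x : R" "x - res x : f" if "integral x" for x
  using someI_ex[of "%y. y : R & x - y : f"] R(2)[OF that] prn unfolding res_def by blast+
 have res_eq: "x - y : f" if "integral x" "integral y" "res x = res y" for x y
  using omodD(5)[OF mf res(2)[OF that(1)] res(2)[OF that(2)]] that(3) by simp
 have "finite (cls f ` rid f)"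
 proof (rule finite_image_factor[where h = "%M. (C M, res (fst (q M)), res (snd (q M)))"])
  have "(%M. (C M, res (fst (q M)), res (snd (q M)))) ` rid f \<subseteq> Fin \<times> R \<times> R"
   using C(1) q res(1) by auto
  then show "finite ((%M. (C M, res (fst (q M)), res (snd (q M)))) ` rid f)"
   by (rule finite_subset) (intro finite_cartesian_product finFin R(1))
  fix M M' assume M: "M : rid f" and M': "M' : rid f"
   and e: "(C M, res (fst (q M)), res (snd (q M))) = (C M', res (fst (q M')), res (snd (q M')))"
  obtain a b where ab: "q M = (a, b)" by force
  obtain a' b' where ab': "q M' = (a', b')" by force
  have 1: "integral a" "integral b" "a ~= 0" "b ~= 0" "cop (pr a) f" "cop (pr b) f" "M = pr (a / b) \<odot> bs (C M)"
   using q[OF M] ab by auto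
  have 2: "integral a'" "integral b'" "a' ~= 0" "b' ~= 0" "cop (pr a') f" "cop (pr b') f" "M' = pr (a' / b') \<odot> bs (C M)"
   using q[OF M'] ab' e by auto
  have "a - a' : f" "b' - b : f" using res_eq 1 2 e ab ab' by auto
  then have "b' * (a - a') + a' * (b' - b) : f" using omodD(2,3)[OF mf] 2 by blast
  then have "a * b' - a' * b : f" by (simp add: algebra_simps)
  then have "pr ((a * b') / (a' * b)) : S f" using 1 2 cop_pr_mult[OF f] integral_mult by (intro S_I) auto
  moreover have "M = pr ((a * b') / (a' * b)) \<odot> M'"
  proof -
   have "pr ((a * b') / (a' * b)) \<odot> M' = pr ((a * b') / (a' * b) * (a' / b')) \<odot> bs (C M)"
    by (subst 2(7)) (simp only: ip_assoc[symmetric] ip_pr_pr)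
   also have "(a * b') / (a' * b) * (a' / b') = a / b" using 1 2 by simp
   finally show ?thesis using 1(7) by simp
  qed
  ultimately show "cls f M = cls f M'" using cls_eq_iff[OF f M M'] by blast
 qed
 then show ?thesis unfolding Gr_carrier[OF f] .
qed

end

section \<open>The inverse limit of the ray class groups\<close>

lemma ideal_power_simps:
 "ideal_power I 0 = carrier (OK :: 'k::field_char_0 ring)"
 "ideal_power I (Suc n) = ideal_prod OK (ideal_power I n) (I :: 'k set)"
 unfolding ideal_power_def by (simp_all add: ideals_set_def nat_pow_def)

locale split_quad = imag_quad w d for w :: "'k::field_char_0" and d :: int +
 fixes p :: nat and P Pb g :: "'k set"
 assumes p: "prime p" and split: "split_prime p P Pb" and g: "modulus g"
  and gp: "ideal_coprime g (PIdl\<^bsub>OK\<^esub> (of_nat p))"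
begin

lemma P_idl: "idl P" and Pb_idl: "idl Pb"
 using split primeideal.axioms(1) ideal_iff unfolding split_prime_def by blast+

lemma g_idl: "idl g" and g_nz: "g ~= {0}" using g modulus_iff by auto

lemma PPb: "P \<odot> Pb = pr (of_nat p)" using split unfolding split_prime_def PIdl_eq by simp

lemma omodI: "idl I ==> omod I" unfolding idl_def by blast

lemma integral_of_nat: "integral (of_nat n)" using integral_of_int[of "int n"] by simp

lemma cop_gp: "cop g (pr (of_nat p))"
 using gp coprime_iff[OF g_idl pr_idl[OF integral_of_nat]] unfolding PIdl_eq by blast

lemma prime_facts:
 assumes "Q = P \<or> Q = Pb"
 shows "idl Q" "pr (of_nat p) \<subseteq> Q" "1 \<notin> Q" "integral a ==> integral b ==> a * b : Q ==> a : Q \<or> b : Q"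
proof -
 have pi: "primeideal Q OK" using assms split unfolding split_prime_def by blast
 show i: "idl Q" using assms P_idl Pb_idl by blast
 show "pr (of_nat p) \<subseteq> Q"
  unfolding PPb[symmetric] using assms ip_sub(1)[OF P_idl omodI[OF Pb_idl]] ip_sub(2)[OF Pb_idl omodI[OF P_idl]] by blast
 show "1 \<notin> Q"
 proof
  assume "1 : Q"
  then have "x : Q" if "integral x" for x using omodD(3)[OF omodI[OF i] that] by fastforce
  then have "ZK = Q" using i ZK_iff unfolding idl_def by blast
  then show False using primeideal.I_notcarr[OF pi] by simp
 qed
 show "integral a ==> integral b ==> a * b : Q ==> a : Q \<or> b : Q"
  using primeideal.I_prime[OF pi, of a b] by (simp add: carrier_OK)
qed

lemma integral_power: "integral x ==> integral (x ^ n)" by (induction n) (auto simp: integral_01 integral_mult)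

text \<open>Powers of x take finitely many values modulo p, so two of them agree modulo Q; primality
  cancels the smaller one and leaves a power of x congruent to 1.\<close>

lemma inverse_mod:
 assumes Q: "Q = P \<or> Q = Pb" and x: "integral x" "x \<notin> Q"
 shows "\<exists>y. integral y & x * y - 1 : Q"
proof -
 note q = prime_facts[OF Q]
 have "int p > 0" using p prime_gt_0_nat by simp
 then obtain R where R: "finite R" "!!x. integral x ==> \<exists>y\<in>R. x - y : pr (of_int (int p))" using finite_residues by blast
 have "\<forall>i. \<exists>y. y : R & x ^ i - y : pr (of_nat p)" using R(2)[OF integral_power[OF x(1)]] by auto
 from choice[OF this] obtain \<rho> where \<rho>: "!!i. \<rho> i : R" "!!i. x ^ i - \<rho> i : pr (of_nat p)" by blast
 have "~ inj \<rho>"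
 proof
  assume "inj \<rho>"
  moreover have "finite (range \<rho>)" using \<rho>(1) R(1) by (meson finite_subset image_subsetI)
  ultimately show False using finite_imageD infinite_UNIV_nat by blast
 qed
 then obtain i j where ij: "i < j" "\<rho> i = \<rho> j" unfolding inj_def by (metis linorder_neqE_nat)
 have "(x ^ i - \<rho> i) - (x ^ j - \<rho> j) : pr (of_nat p)" by (rule omodD(5)[OF pr_omod \<rho>(2) \<rho>(2)])
 then have "x ^ i - x ^ j : Q" using ij q(2) by auto
 moreover have "x ^ i - x ^ j = x ^ i * (1 - x ^ (j - i))" using ij(1) by (simp add: algebra_simps power_add[symmetric])
 moreover have "x ^ i \<notin> Q"
 proof (induction i)
  case (Suc i)
  then show ?case using q(4)[OF x(1) integral_power[OF x(1)]] x(2) by auto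
 qed (use q(3) in simp)
 ultimately have "1 - x ^ (j - i) : Q" using q(4) integral_power[OF x(1)] integral_diff[OF integral_01(2)] by metis
 then have "- (1 - x ^ (j - i)) : Q" by (rule omodD(4)[OF omodI[OF q(1)]])
 moreover have "x ^ (j - i) = x * x ^ (j - i - 1)" using ij(1) by (metis Suc_diff_1 power_Suc zero_less_diff)
 ultimately have "x * x ^ (j - i - 1) - 1 : Q" by simp
 then show ?thesis using integral_power[OF x(1)] by blast
qed

text \<open>An element of one prime outside the other is invertible modulo that other one.\<close>

lemma cop_P_Pb: "cop P Pb"
proof -
 have *: "cop Q Q'" if Q: "Q = P \<or> Q = Pb" and Q': "Q' = P \<or> Q' = Pb" and x: "x : Q" "x \<notin> Q'" for Q Q' x
 proof -
  have ix: "integral x" using x prime_facts(1)[OF Q] unfolding idl_def by blast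
  obtain y where y: "integral y" "x * y - 1 : Q'" using inverse_mod[OF Q' ix x(2)] by blast
  have "y * x : Q" using omodD(3)[OF omodI[OF prime_facts(1)[OF Q]] y(1) x(1)] .
  moreover have "- (x * y - 1) : Q'" by (rule omodD(4)[OF omodI[OF prime_facts(1)[OF Q']] y(2)])
  moreover have "y * x + - (x * y - 1) = 1" by (simp add: mult.commute)
  ultimately show ?thesis unfolding cop_def by blast
 qed
 have "P ~= Pb" using split unfolding split_prime_def by blast
 then consider x where "x : P" "x \<notin> Pb" | x where "x : Pb" "x \<notin> P" by blast
 then show ?thesis using *[of P Pb] *[of Pb P] cop_sym by cases blast+
qed

text \<open>The situation is symmetric in the two primes, so each statement about P transfers to
  Pb.\<close>

lemma swap: "split_quad w d p Pb P g"
proof -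
 have "split_prime p Pb P" using split ip_comm unfolding split_prime_def by metis
 then show ?thesis using p g gp by unfold_locales
qed

lemma int_mem: assumes Q: "Q = P \<or> Q = Pb" shows "of_int m : Q \<longleftrightarrow> int p dvd m"
proof
 note q = prime_facts[OF Q]
 have pQ: "of_int (int p) : Q" using q(2) pr_self[of "of_nat p"] by auto
 show "of_int m : Q" if "int p dvd m" using of_int_mem_dvd[OF omodI[OF q(1)] pQ that] .
 assume m: "of_int m : Q"
 show "int p dvd m"
 proof (rule ccontr)
  assume "~ int p dvd m"
  then have "coprime (int p) m" using p by (simp add: prime_imp_coprime)
  then obtain u v where "u * int p + v * m = 1" by (metis bezout_int coprime_iff_gcd_eq_1)
  then have "of_int u * of_int (int p) + of_int v * of_int m = (1::'k)" by (metis of_int_1 of_int_add of_int_mult)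
  moreover have "of_int u * of_int (int p) + of_int v * of_int m : Q"
   by (intro omodD(2)[OF omodI[OF q(1)]] omodD(3)[OF omodI[OF q(1)] integral_of_int] pQ m)
  ultimately show False using q(3) by simp
 qed
qed

text \<open>Residue degree one: an integer \<open>y \<equiv> x\<close> modulo \<open>P\<close> that lies in \<open>Pb\<close> has norm divisible by \<open>p\<close>, so
 \<open>y (y - tr y)\<close> lies in \<open>P\<close>.\<close>

lemma int_residue: assumes x: "integral x" shows "\<exists>m. x - of_int m : P"
proof -
 note q = prime_facts[of P, OF disjI1[OF refl]] and q' = prime_facts[of Pb, OF disjI2[OF refl]]
 obtain y where y: "integral y" "y - x : P" "y - 0 : Pb"
  using chinese[OF P_idl Pb_idl cop_P_Pb x integral_01(1)] by blast
 obtain t where t: "tr y = of_int t" using y(1) unfolding integral_def by (auto elim: Ints_cases)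
 obtain n where n: "nrm y = of_int n" using integral_cases_nrm[OF y(1)] by blast
 have "cj y * y : Pb" using omodD(3)[OF omodI[OF Pb_idl] integral_cj[OF y(1)], of y] y(3) by simp
 then have "of_int n : Pb" using mult_cj[of y] n by (simp add: mult.commute)
 then have "int p dvd n" using int_mem[of Pb] by simp
 then have nP: "of_int n : P" using int_mem[of P] by simp
 have "y * (y - of_int t) = - of_int n" using quad_eq[of y] by (simp add: t n algebra_simps eq_neg_iff_add_eq_0)
 then have "y * (y - of_int t) : P" using omodD(4)[OF omodI[OF P_idl] nP] by simp
 then have "y : P \<or> y - of_int t : P" using q(4)[OF y(1)] integral_diff[OF y(1) integral_of_int] by blast
 then obtain m where m: "y - of_int m : P" by (metis diff_zero of_int_0)
 have "(y - of_int m) - (y - x) : P" by (rule omodD(5)[OF omodI[OF P_idl] m y(2)])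
 then show ?thesis by (intro exI[of _ m]) simp
qed

abbreviation "Pw n \<equiv> ideal_power P n"
abbreviation "Qw n \<equiv> ideal_power Pb n"

lemma P_nz: "P ~= {0}" and Pb_nz: "Pb ~= {0}"
proof -
 have "of_nat p : pr (of_nat p :: 'k)" by (rule pr_self)
 moreover have "of_nat p ~= (0::'k)" using p by (simp add: prime_gt_0_nat)
 ultimately show "P ~= {0}" "Pb ~= {0}" using prime_facts(2)[of P] prime_facts(2)[of Pb] by blast+
qed

lemma power_idl: "idl I ==> idl (ideal_power I n)" by (induction n) (auto simp: ideal_power_simps idl_ZK ip_idl)

lemma power_nz: "idl I ==> I ~= {0} ==> ideal_power I n ~= {0}"
 by (induction n) (auto simp: ideal_power_simps ZK_nz idl_mult_nz power_idl)

lemma ideal_power_add: "idl I ==> ideal_power I (m + n) = ideal_power I m \<odot> ideal_power I n"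
 by (induction n) (auto simp: ideal_power_simps ip_one(2)[OF omodI] power_idl ip_assoc)

lemmas Pw_idl = power_idl[OF P_idl] and Qw_idl = power_idl[OF Pb_idl]
lemmas Pw_nz = power_nz[OF P_idl P_nz] and Qw_nz = power_nz[OF Pb_idl Pb_nz]

lemma PQ_power: "Pw n \<odot> Qw n = pr (of_nat p ^ n)"
proof (induction n)
 case 0
 then show ?case by (simp add: ideal_power_simps ip_one(1)[OF omod_ZK] pr_1)
next
 case (Suc n)
 have "Pw (Suc n) \<odot> Qw (Suc n) = (Pw n \<odot> Qw n) \<odot> (P \<odot> Pb)" by (simp add: ideal_power_simps ip_ac)
 then show ?case by (simp only: Suc PPb ip_pr_pr) (simp add: mult.commute)
qed

lemma cop_power: assumes "idl I" "idl J" "cop I J" shows "cop I (ideal_power J n)"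
proof (induction n)
 case 0
 have "0 + (1::'k) = 1" by simp
 then show ?case unfolding cop_def using omodD(1)[OF omodI[OF assms(1)]] integral_01 ZK_iff
  by (metis ideal_power_simps(1))
next
 case (Suc n)
 then show ?case using cop_mult[OF assms(1) power_idl[OF assms(2)] assms(2) Suc assms(3)] by (simp add: ideal_power_simps)
qed

lemma cop_Pw_Qw: "cop (Pw m) (Qw n)"
 using cop_power[OF Qw_idl P_idl] cop_power[OF P_idl Pb_idl cop_P_Pb] cop_sym by blast

lemma cop_P_g: "cop P g" and cop_Pb_g: "cop Pb g"
 using cop_mono[OF cop_gp order.refl] prime_facts(2)[of P] prime_facts(2)[of Pb] cop_sym by blast+

lemma cop_Pw_g: "cop (Pw n) g" and cop_Qw_g: "cop (Qw n) g"
 using cop_power[OF g_idl P_idl] cop_power[OF g_idl Pb_idl] cop_P_g cop_Pb_g cop_sym by blast+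

lemma p_power_mem: "of_nat p ^ n : Pw n"
proof -
 have "of_nat p ^ n : Pw n \<odot> Qw n" unfolding PQ_power by (rule pr_self)
 then show ?thesis using ip_sub(2)[OF Qw_idl omodI[OF Pw_idl]] by blast
qed

text \<open>One p-adic digit at a time. For y in P^n split y = y a + y b with a in P and b in Pb^n:
  the first part lies in P^(n+1), the second is u p^n, where u may be replaced by an integer modulo
  P.\<close>

lemma int_residue_power: assumes x: "integral x" shows "\<exists>m. x - of_int m : Pw n"
proof (induction n)
 case 0
 then show ?case using x by (simp add: ideal_power_simps ZK_iff) (metis integral_diff integral_of_int)
next
 case (Suc n)
 note mo = omodI[OF Pw_idl]
 obtain m where m: "x - of_int m : Pw n" using Suc by blast
 let ?y = "x - of_int m"
 have iy: "integral ?y" using m Pw_idl unfolding idl_def by blast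
 obtain a b where ab: "a : P" "b : Qw n" "a + b = 1" using cop_power[OF P_idl Pb_idl cop_P_Pb] unfolding cop_def by blast
 have ya: "?y * a : Pw (Suc n)" unfolding ideal_power_simps by (rule ip_mem[OF m ab(1)])
 have "?y * b : pr (of_nat p ^ n)" unfolding PQ_power[symmetric] by (rule ip_mem[OF m ab(2)])
 then obtain u where u: "integral u" "?y * b = u * of_nat p ^ n" unfolding pr_def by blast
 obtain k where k: "u - of_int k : P" using int_residue[OF u(1)] by blast
 have "of_nat p ^ n * (u - of_int k) : Pw (Suc n)" unfolding ideal_power_simps by (rule ip_mem[OF p_power_mem k])
 with ya have "?y * a + of_nat p ^ n * (u - of_int k) : Pw (Suc n)" by (rule omodD(2)[OF mo])
 moreover have "?y * a + of_nat p ^ n * (u - of_int k) = x - of_int (m + int p ^ n * k)"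
 proof -
  have "?y = ?y * a + ?y * b" by (metis ab(3) distrib_left mult.right_neutral)
  then show ?thesis unfolding u(2) by (simp add: algebra_simps)
 qed
 ultimately show ?case by metis
qed

lemma ip_cancel_sub: assumes "fid M" "omod N" "omod L" "M \<odot> N \<subseteq> M \<odot> L" shows "N \<subseteq> L"
proof -
 obtain M' where M': "M' \<odot> M = ZK" using fid_inverse[OF assms(1)] by blast
 have "M' \<odot> (M \<odot> N) \<subseteq> M' \<odot> (M \<odot> L)" by (rule ip_mono[OF order.refl assms(4)])
 then show ?thesis unfolding ip_assoc[symmetric] M' ip_one(1)[OF assms(2)] ip_one(1)[OF assms(3)] .
qed

lemma Pw_fid: "fid (Pw n)" by (rule idl_fid[OF Pw_idl Pw_nz])

text \<open>Cancelling P^n leaves Pb^n k inside P, and Pb^n is prime to P.\<close>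

lemma int_mem_power: assumes "of_int m : Pw n" shows "int p ^ n dvd m" using assms
proof (induction n arbitrary: m)
 case (Suc n)
 have "of_int m : Pw n" using Suc.prems ip_sub(2)[OF P_idl omodI[OF Pw_idl]] unfolding ideal_power_simps by blast
 then obtain k where k: "m = int p ^ n * k" using Suc.IH by blast
 have "pr (of_nat p ^ n) \<odot> pr (of_int k) \<subseteq> Pw (Suc n)"
 proof -
  have "a * (of_nat p ^ n * of_int k) : Pw (Suc n)" if "integral a" for a
   using omodD(3)[OF omodI[OF Pw_idl] that Suc.prems] by (simp add: k)
  then show ?thesis unfolding ip_pr_pr unfolding pr_def by blast
 qed
 then have "Pw n \<odot> (Qw n \<odot> pr (of_int k)) \<subseteq> Pw n \<odot> P"
  unfolding PQ_power[symmetric] ideal_power_simps by (simp add: ip_assoc)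
 then have sub: "Qw n \<odot> pr (of_int k) \<subseteq> P"
  by (rule ip_cancel_sub[OF Pw_fid ip_omod[OF omodI[OF Qw_idl] pr_omod] omodI[OF P_idl]])
 obtain a b where ab: "a : P" "b : Qw n" "a + b = 1" using cop_power[OF P_idl Pb_idl cop_P_Pb] unfolding cop_def by blast
 have "b * of_int k : P" using sub ip_mem[OF ab(2) pr_self] by blast
 moreover have "of_int k * a : P" by (rule omodD(3)[OF omodI[OF P_idl] integral_of_int ab(1)])
 ultimately have "b * of_int k + of_int k * a : P" by (rule omodD(2)[OF omodI[OF P_idl]])
 moreover have "b * of_int k + of_int k * a = of_int k * (a + b)" by (simp add: algebra_simps)
 ultimately have "of_int k : P" using ab(3) by simp
 then have "int p dvd k" using int_mem[of P] by simp
 then show ?case unfolding k by (simp add: mult.commute)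
qed simp

lemma int_mem_power_iff: "of_int m : Pw n \<longleftrightarrow> int p ^ n dvd m"
 using int_mem_power of_int_mem_dvd[OF omodI[OF Pw_idl], of "int p ^ n" n m] p_power_mem by auto

text \<open>The diagonal levels F n n are cofinal among the moduli, while the off-diagonal ones
  separate the growth at the two primes.\<close>

definition F :: "nat => nat => 'k set" where "F i j = Pw i \<odot> (Qw j \<odot> g)"

lemma F_idl: "idl (F i j)" unfolding F_def by (intro ip_idl Pw_idl Qw_idl g_idl)

lemma F_nz: "F i j ~= {0}" unfolding F_def by (intro idl_mult_nz ip_idl Pw_idl Qw_idl g_idl Pw_nz Qw_nz g_nz)

lemma F_dvd: assumes "i <= i'" "j <= j'" shows "ideal_dvd (F i j) (F i' j')"
proof -
 obtain a b where "i' = i + a" "j' = j + b" using assms by (auto simp: le_iff_add)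
 then have "F i' j' = F i j \<odot> (Pw a \<odot> Qw b)"
  unfolding F_def by (simp add: ideal_power_add[OF P_idl] ideal_power_add[OF Pb_idl] ip_ac)
 then show ?thesis unfolding ideal_dvd_iff using ip_idl Pw_idl Qw_idl by blast
qed

lemma level_eq: "ideal_prod OK (ideal_power (PIdl\<^bsub>OK\<^esub> (of_nat p)) n) g = F n n"
proof -
 have "ideal_power (pr (of_nat p)) n = Pw n \<odot> Qw n"
 proof (induction n)
  case 0
  then show ?case by (simp add: ideal_power_simps ip_one(1)[OF omod_ZK])
 next
  case (Suc n)
  then show ?case unfolding ideal_power_simps PPb[symmetric] by (simp add: ip_ac)
 qed
 then show ?thesis unfolding F_def PIdl_eq by (simp add: ip_assoc)
qed

lemma moduli_iff: "f : moduli p g \<longleftrightarrow> idl f & f ~= {0} & (\<exists>n. ideal_dvd f (F n n))"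
 unfolding moduli_def modulus_iff level_eq by auto

lemma F_moduli: "F i j : moduli p g" unfolding moduli_iff using F_idl F_nz F_dvd[of i "max i j" j "max i j"] by auto

lemma ideal_dvd_trans: fixes a b c :: "'k set" assumes "ideal_dvd a b" "ideal_dvd b c" shows "ideal_dvd a c"
proof -
 obtain L L' where "idl L" "b = a \<odot> L" "idl L'" "c = b \<odot> L'" using assms unfolding ideal_dvd_iff by blast
 then show ?thesis unfolding ideal_dvd_iff by (intro exI[of _ "L \<odot> L'"]) (simp add: ip_idl ip_assoc)
qed

lemma cop_Pw_rest: "cop (Pw i) (Qw j \<odot> g)" by (rule cop_mult[OF Pw_idl Qw_idl g_idl cop_Pw_Qw cop_Pw_g])

text \<open>A higher power of P would, after cancellation, make P divide Pb^j g, which is prime to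
  P.\<close>

lemma val_F: "ideal_val P (F i j) = i" unfolding ideal_val_def
proof (rule Greatest_equality)
 show "ideal_dvd (Pw i) (F i j)" unfolding ideal_dvd_iff F_def using ip_idl Qw_idl g_idl by blast
 fix n assume "ideal_dvd (Pw n) (F i j)"
 then obtain L where L: "idl L" "F i j = Pw n \<odot> L" unfolding ideal_dvd_iff by blast
 show "n <= i"
 proof (rule ccontr)
  assume "~ n <= i"
  then have "n = i + Suc (n - i - 1)" by simp
  then obtain k where k: "n = i + Suc k" by blast
  have "Pw i \<odot> (Qw j \<odot> g) = (Pw i \<odot> (Pw k \<odot> P)) \<odot> L"
   using L(2) unfolding F_def k ideal_power_add[OF P_idl] ideal_power_simps .
  also have "\<dots> = Pw i \<odot> (P \<odot> (Pw k \<odot> L))" by (simp only: ip_ac)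
  finally have "Pw i \<odot> (Qw j \<odot> g) = Pw i \<odot> (P \<odot> (Pw k \<odot> L))" .
  then have "Qw j \<odot> g = P \<odot> (Pw k \<odot> L)"
   by (rule fid_cancel[OF Pw_fid omodI[OF ip_idl[OF Qw_idl g_idl]] omodI[OF ip_idl[OF P_idl ip_idl[OF Pw_idl L(1)]]]])
  then have "Qw j \<odot> g \<subseteq> P" using ip_sub(2)[OF ip_idl[OF Pw_idl L(1)] omodI[OF P_idl]] by simp
  moreover have "cop P (Qw j \<odot> g)"
   by (rule cop_mult[OF P_idl Qw_idl g_idl cop_power[OF P_idl Pb_idl cop_P_Pb] cop_P_g])
  ultimately obtain a b where "a : P" "b : P" "a + b = 1" unfolding cop_def by blast
  then have "1 : P" using omodD(2)[OF omodI[OF P_idl]] by metis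
  then show False using prime_facts(3)[of P] by blast
 qed
qed

abbreviation "RG \<equiv> ray_limit p g"
abbreviation "RT \<equiv> ray_limit_top p g"
abbreviation "Md \<equiv> moduli p g"
abbreviation "RC \<equiv> carrier RG"
abbreviation "pwr H \<equiv> ppow p (RG\<lparr>carrier := H\<rparr>)"
abbreviation rmul (infixl "\<cdot>" 70) where "x \<cdot> y \<equiv> x \<otimes>\<^bsub>RG\<^esub> y"

text \<open>Kernels of the projections to the diagonal levels; \<open>S f\<close> is the unit of the
  ray class group at level f.\<close>

definition U :: "nat => ('k set => 'k set set) set" where
 "U n = {x : RC. x (F n n) = S (F n n)}"

lemma moduli_idl: "f : Md ==> idl f" unfolding moduli_iff by blast

lemma RG_carrier: "x : RC \<longleftrightarrow> x : (\<Pi>\<^sub>E f\<in>Md. carrier (Gr f)) &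
 (\<forall>f\<in>Md. \<forall>f'\<in>Md. ideal_dvd f f' --> ray_proj f (x f') = x f)"
 unfolding ray_limit_def by simp

lemma RG_simps: "\<one>\<^bsub>RG\<^esub> = (\<lambda>f\<in>Md. \<one>\<^bsub>Gr f\<^esub>)" "x \<cdot> y = (\<lambda>f\<in>Md. x f \<otimes>\<^bsub>Gr f\<^esub> y f)"
 unfolding ray_limit_def by simp_all

lemma proj_closed:
 assumes "f : Md" "f' : Md" "ideal_dvd f f'" "c : carrier (Gr f')"
 shows "ray_proj f c : carrier (Gr f)"
  and "c' : carrier (Gr f') ==> ray_proj f (c \<otimes>\<^bsub>Gr f'\<^esub> c') = ray_proj f c \<otimes>\<^bsub>Gr f\<^esub> ray_proj f c'"
  and "f0 : Md ==> ideal_dvd f0 f ==> ray_proj f0 (ray_proj f c) = ray_proj f0 c"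
  and "ray_proj f \<one>\<^bsub>Gr f'\<^esub> = \<one>\<^bsub>Gr f\<^esub>"
proof -
 note i = moduli_idl[OF assms(1)] moduli_idl[OF assms(2)]
 note sub = ideal_dvd_sub[OF i(1) assms(3)]
 obtain M where M: "M : rid f'" "c = cls f' M" using assms(4) Gr_carrier[OF i(2)] by blast
 have M': "M : rid f" using rid_mono[OF sub] M by blast
 have pc: "ray_proj f (cls f' N) = cls f N" if "N : rid f'" for N by (rule ray_proj_cls[OF i sub that])
 show "ray_proj f c : carrier (Gr f)" using pc[OF M(1)] M' Gr_carrier[OF i(1)] M(2) by auto
 show "ray_proj f (c \<otimes>\<^bsub>Gr f'\<^esub> c') = ray_proj f c \<otimes>\<^bsub>Gr f\<^esub> ray_proj f c'" if c': "c' : carrier (Gr f')"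
 proof -
  obtain N where N: "N : rid f'" "c' = cls f' N" using c' Gr_carrier[OF i(2)] by blast
  have N': "N : rid f" using rid_mono[OF sub] N by blast
  show ?thesis unfolding M(2) N(2) Gr_mult[OF i(2) M(1) N(1)] pc[OF rid_mult[OF i(2) M(1) N(1)]] pc[OF M(1)] pc[OF N(1)]
   Gr_mult[OF i(1) M' N'] ..
 qed
 show "ray_proj f0 (ray_proj f c) = ray_proj f0 c" if f0: "f0 : Md" "ideal_dvd f0 f"
 proof -
  note i0 = moduli_idl[OF f0(1)]
  note sub0 = ideal_dvd_sub[OF i0 f0(2)]
  have s: "f' \<subseteq> f0" using sub sub0 by blast
  show ?thesis unfolding M(2) pc[OF M(1)] ray_proj_cls[OF i0 i(1) sub0 M'] ray_proj_cls[OF i0 i(2) s M(1)] ..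
 qed
 have "ZK : rid f'" using subgroup.one_closed[OF rid_subgroup[OF i(2)]] by simp
 then show "ray_proj f \<one>\<^bsub>Gr f'\<^esub> = \<one>\<^bsub>Gr f\<^esub>"
  unfolding Gr_one[OF i(1)] Gr_one[OF i(2)] cls_ZK[OF i(1), symmetric] cls_ZK[OF i(2), symmetric] by (rule pc)
qed

lemma Gr_comm: "f : Md ==> comm_group (Gr f)" using Gr_group moduli_idl by blast
lemma Gr_grp: "f : Md ==> group (Gr f)" using Gr_comm comm_group.axioms(2) by blast

lemma RG_comp: "x : RC ==> f : Md ==> x f : carrier (Gr f)" unfolding RG_carrier by blast

lemma RG_proj: "x : RC ==> f : Md ==> f' : Md ==> ideal_dvd f f' ==> ray_proj f (x f') = x f"
 unfolding RG_carrier by blast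

lemma RG_ext: "x : RC ==> y : RC ==> (!!f. f : Md ==> x f = y f) ==> x = y"
 unfolding RG_carrier by (auto intro: PiE_ext)

lemma RG_subgroup: "subgroup (RC) (product_group (Md) Gr)"
proof -
 interpret Pr: group "product_group (Md) (Gr :: 'k set => _)" by (rule product_group) (erule Gr_grp)
 show ?thesis
 proof (rule Pr.subgroupI)
  show "RC \<subseteq> carrier (product_group (Md) Gr)"
  proof
   fix x assume "x : RC"
   then show "x : carrier (product_group (Md) Gr)" unfolding carrier_product_group RG_carrier by (rule conjunct1)
  qed
  have o: "\<one>\<^bsub>Gr f\<^esub> : carrier (Gr f)" if "f : Md" for f
   using monoid.one_closed[OF group.is_monoid[OF Gr_grp[OF that]]] .
  have "ray_proj f \<one>\<^bsub>Gr f'\<^esub> = \<one>\<^bsub>Gr f\<^esub>" if h: "f : Md" "f' : Md" "ideal_dvd f f'" for f f'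
   by (rule proj_closed(4)[OF h o[OF h(2)]])
  then have "(\<lambda>f\<in>Md. \<one>\<^bsub>Gr f\<^esub>) : RC"
   unfolding RG_carrier using o by (intro conjI restrict_PiE_iff[THEN iffD2] ballI impI) simp_all
  then show "RC ~= {}" by blast
  show "a \<otimes>\<^bsub>product_group (Md) Gr\<^esub> b : RC" if "a : RC" "b : RC" for a b
  proof -
   have "a f \<otimes>\<^bsub>Gr f\<^esub> b f : carrier (Gr f)" if "f : Md" for f
    using RG_comp[OF \<open>a : _\<close> that] RG_comp[OF \<open>b : _\<close> that] monoid.m_closed[OF group.is_monoid[OF Gr_grp[OF that]]] by blast
   moreover have "ray_proj f (a f' \<otimes>\<^bsub>Gr f'\<^esub> b f') = a f \<otimes>\<^bsub>Gr f\<^esub> b f"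
    if h: "f : Md" "f' : Md" "ideal_dvd f f'" for f f'
    using proj_closed(2)[OF h RG_comp[OF \<open>a : _\<close> h(2)] RG_comp[OF \<open>b : _\<close> h(2)]]
     RG_proj[OF \<open>a : _\<close> h] RG_proj[OF \<open>b : _\<close> h] by simp
   ultimately show ?thesis unfolding RG_carrier by simp
  qed
  show "inv\<^bsub>product_group (Md) Gr\<^esub> a : RC" if a: "a : RC" for a
  proof -
   have e: "inv\<^bsub>product_group (Md) Gr\<^esub> a = (\<lambda>f\<in>Md. inv\<^bsub>Gr f\<^esub> (a f))"
    by (rule inv_product_group) (use a Gr_grp in \<open>auto simp: RG_carrier\<close>)
   have "inv\<^bsub>Gr f\<^esub> (a f) : carrier (Gr f)" if "f : Md" for f
    using RG_comp[OF a that] group.inv_closed[OF Gr_grp[OF that]] by blast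
   moreover have "ray_proj f (inv\<^bsub>Gr f'\<^esub> (a f')) = inv\<^bsub>Gr f\<^esub> (a f)"
    if h: "f : Md" "f' : Md" "ideal_dvd f f'" for f f'
   proof -
    interpret f: group "Gr f" by (rule Gr_grp[OF h(1)])
    interpret f': group "Gr f'" by (rule Gr_grp[OF h(2)])
    have c: "a f' : carrier (Gr f')" "a f : carrier (Gr f)" using RG_comp[OF a] h by auto
    have "ray_proj f (inv\<^bsub>Gr f'\<^esub> (a f')) \<otimes>\<^bsub>Gr f\<^esub> a f = ray_proj f (inv\<^bsub>Gr f'\<^esub> (a f') \<otimes>\<^bsub>Gr f'\<^esub> a f')"
     using proj_closed(2)[OF h f'.inv_closed[OF c(1)] c(1)] RG_proj[OF a h] by simp
    also have "\<dots> = \<one>\<^bsub>Gr f\<^esub>" using f'.l_inv[OF c(1)] proj_closed(4)[OF h c(1)] by simp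
    finally show ?thesis using f.inv_equality[OF _ c(2) proj_closed(1)[OF h f'.inv_closed[OF c(1)]]] by simp
   qed
   ultimately show ?thesis unfolding e RG_carrier by simp
  qed
 qed
qed

lemma RG_group: "comm_group RG"
proof -
 have e: "RG = product_group (Md) Gr\<lparr>carrier := RC\<rparr>" unfolding ray_limit_def by simp
 have "group RG" using group.subgroup_imp_group[OF product_group[OF Gr_grp] RG_subgroup] e by simp
 moreover have "x \<cdot> y = y \<cdot> x" if "x : RC" "y : RC" for x y
  unfolding RG_simps using RG_comp[OF that(1)] RG_comp[OF that(2)] Gr_comm
  by (intro restrict_ext) (meson comm_groupE(4))
 ultimately show ?thesis by (rule group.group_comm_groupI)
qed

lemma dvd_level: "f : Md ==> \<exists>n. \<forall>m\<ge>n. ideal_dvd f (F m m)"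
 using ideal_dvd_trans F_dvd unfolding moduli_iff by blast

lemma RG_mult_comp: "f : Md ==> (x \<cdot> y) f = x f \<otimes>\<^bsub>Gr f\<^esub> y f" unfolding RG_simps by simp

lemma level_determines:
 assumes "x : RC" "y : RC" "x (F n n) = y (F n n)" "f : Md" "ideal_dvd f (F n n)"
 shows "x f = y f"
 using RG_proj[OF assms(1,4) F_moduli assms(5)] RG_proj[OF assms(2,4) F_moduli assms(5)] assms(3) by simp

lemma U_coset:
 assumes x: "x : RC" and y: "y : RC"
 shows "x (F n n) = y (F n n) \<longleftrightarrow> (\<exists>u\<in>U n. y = x \<cdot> u)"
proof -
 interpret G: comm_group RG by (rule RG_group)
 interpret f: group "Gr (F n n)" by (rule Gr_grp[OF F_moduli])
 have o: "\<one>\<^bsub>Gr (F n n)\<^esub> = S (F n n)" by (rule Gr_one[OF F_idl])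
 have cx: "x (F n n) : carrier (Gr (F n n))" using RG_comp[OF x F_moduli] .
 show ?thesis
 proof
  assume e: "x (F n n) = y (F n n)"
  let ?u = "inv\<^bsub>RG\<^esub> x \<cdot> y"
  have "(inv\<^bsub>RG\<^esub> x \<cdot> x) (F n n) = (\<one>\<^bsub>RG\<^esub>) (F n n)" using G.l_inv[OF x] by simp
  then have "(inv\<^bsub>RG\<^esub> x) (F n n) \<otimes>\<^bsub>Gr (F n n)\<^esub> x (F n n) = S (F n n)"
   unfolding RG_mult_comp[OF F_moduli] using o F_moduli by (simp add: RG_simps)
  then have "?u : U n" unfolding U_def using x y e by (simp add: RG_mult_comp[OF F_moduli])
  moreover have "y = x \<cdot> ?u" using x y G.m_assoc[of x "inv\<^bsub>RG\<^esub> x" y] by simp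
  ultimately show "\<exists>u\<in>U n. y = x \<cdot> u" by blast
 next
  assume "\<exists>u\<in>U n. y = x \<cdot> u"
  then obtain u where "u : U n" "y = x \<cdot> u" by blast
  then show "x (F n n) = y (F n n)" using cx o f.r_one unfolding U_def by (simp add: RG_mult_comp[OF F_moduli])
 qed
qed

lemma U_subgroup: "subgroup (U n) RG"
proof -
 interpret G: comm_group RG by (rule RG_group)
 interpret f: group "Gr (F n n)" by (rule Gr_grp[OF F_moduli])
 have o: "\<one>\<^bsub>Gr (F n n)\<^esub> = S (F n n)" by (rule Gr_one[OF F_idl])
 show ?thesis
 proof (rule G.subgroupI)
  show "U n \<subseteq> RC" unfolding U_def by blast
  have "\<one>\<^bsub>RG\<^esub> : U n" unfolding U_def using o F_moduli G.one_closed by (simp add: RG_simps)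
  then show "U n ~= {}" by blast
  show "a \<cdot> b : U n" if "a : U n" "b : U n" for a b
   using that f.r_one[OF f.one_closed] unfolding U_def by (simp add: RG_mult_comp[OF F_moduli] o)
  show "inv\<^bsub>RG\<^esub> a : U n" if a: "a : U n" for a
  proof -
   have ac: "a : RC" "a (F n n) = \<one>\<^bsub>Gr (F n n)\<^esub>" using a o unfolding U_def by auto
   have "(inv\<^bsub>RG\<^esub> a \<cdot> a) (F n n) = (\<one>\<^bsub>RG\<^esub>) (F n n)" using G.l_inv[OF ac(1)] by simp
   then have "(inv\<^bsub>RG\<^esub> a) (F n n) \<otimes>\<^bsub>Gr (F n n)\<^esub> \<one>\<^bsub>Gr (F n n)\<^esub> = \<one>\<^bsub>Gr (F n n)\<^esub>"
    unfolding RG_mult_comp[OF F_moduli] ac(2) using F_moduli by (simp add: RG_simps)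
   then have "(inv\<^bsub>RG\<^esub> a) (F n n) = \<one>\<^bsub>Gr (F n n)\<^esub>" using f.r_one RG_comp[OF G.inv_closed[OF ac(1)] F_moduli] by metis
   then show ?thesis unfolding U_def using ac o by simp
  qed
 qed
qed

lemma U_anti: assumes "m <= n" shows "U n \<subseteq> U m"
proof
 fix u assume "u : U n"
 then have u: "u : RC" "u (F n n) = \<one>\<^bsub>Gr (F n n)\<^esub>" unfolding U_def using Gr_one[OF F_idl] by auto
 have d: "ideal_dvd (F m m) (F n n)" using F_dvd assms by blast
 have "u (F m m) = ray_proj (F m m) (u (F n n))" using RG_proj[OF u(1) F_moduli F_moduli d] by simp
 also have "\<dots> = \<one>\<^bsub>Gr (F m m)\<^esub>" unfolding u(2) using proj_closed(4)[OF F_moduli F_moduli d RG_comp[OF u(1) F_moduli]] .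
 finally show "u : U m" unfolding U_def using u Gr_one[OF F_idl] by simp
qed

abbreviation "PT \<equiv> product_topology (%f. discrete_topology (carrier (Gr f))) (Md)"

lemma fiber_open: assumes "f : Md" shows "openin PT {x : topspace PT. x f : V}"
proof -
 have "continuous_map PT (discrete_topology (carrier (Gr f))) (%x. x f)"
  using continuous_map_product_projection[OF assms, of "%f. discrete_topology (carrier (Gr f))"] by simp
 then have "openin PT {x : topspace PT. x f : V \<inter> carrier (Gr f)}"
  by (rule openin_continuous_map_preimage) simp
 moreover have "{x : topspace PT. x f : V \<inter> carrier (Gr f)} = {x : topspace PT. x f : V}"
  using assms by (auto simp: PiE_iff)
 ultimately show ?thesis by simp
qed

lemma RG_topspace: "RC \<subseteq> topspace PT"
 unfolding topspace_product_topology using RG_carrier by (simp add: subset_iff)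

text \<open>A basic open set of the product constrains finitely many moduli, and one diagonal level
  is divisible by all of them.\<close>

lemma RT_openin: "openin RT V \<longleftrightarrow> V \<subseteq> RC & (\<forall>x\<in>V. \<exists>n. \<forall>u\<in>U n. x \<cdot> u : V)"
proof
 interpret G: comm_group RG by (rule RG_group)
 assume "openin RT V"
 then obtain W where W: "openin PT W" "V = W \<inter> RC" unfolding ray_limit_top_def openin_subtopology by blast
 have "\<exists>n. \<forall>u\<in>U n. x \<cdot> u : V" if x: "x : V" for x
 proof -
  have xc: "x : RC" using x W by blast
  obtain Z where Z: "finite {f : Md. Z f ~= carrier (Gr f)}" "x : Pi\<^sub>E (Md) Z" "Pi\<^sub>E (Md) Z \<subseteq> W"
   using W(1) x W(2) unfolding openin_product_topology_alt by auto
  have "\<forall>f. \<exists>n. f : Md --> (\<forall>m\<ge>n. ideal_dvd f (F m m))" using dvd_level by blast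
  from choice[OF this] obtain N where N: "!!f m. f : Md ==> N f <= m ==> ideal_dvd f (F m m)" by blast
  define n where "n = Max (insert 0 (N ` {f : Md. Z f ~= carrier (Gr f)}))"
  have nN: "N f <= n" if "f : Md" "Z f ~= carrier (Gr f)" for f
   unfolding n_def by (rule Max_ge) (use Z(1) that in auto)
  have "x \<cdot> u : V" if u: "u : U n" for u
  proof -
   have uc: "u : RC" using u unfolding U_def by blast
   have c: "x \<cdot> u : RC" using xc uc by simp
   have e: "x (F n n) = (x \<cdot> u) (F n n)" using U_coset[OF xc c] u by blast
   have "(x \<cdot> u) f : Z f" if f: "f : Md" for f
   proof (cases "Z f = carrier (Gr f)")
    case True
    then show ?thesis using RG_comp[OF c f] by simp
   next
    case False
    have "x f = (x \<cdot> u) f" by (rule level_determines[OF xc c e f N[OF f nN[OF f False]]])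
    then show ?thesis using Z(2) f by (auto simp: PiE_iff)
   qed
   then have "x \<cdot> u : Pi\<^sub>E (Md) Z" using c unfolding RG_carrier by (auto simp: PiE_iff)
   then show ?thesis using Z(3) W(2) c by blast
  qed
  then show ?thesis by blast
 qed
 then show "V \<subseteq> RC & (\<forall>x\<in>V. \<exists>n. \<forall>u\<in>U n. x \<cdot> u : V)" using W(2) by blast
next
 assume V: "V \<subseteq> RC & (\<forall>x\<in>V. \<exists>n. \<forall>u\<in>U n. x \<cdot> u : V)"
 show "openin RT V"
 proof (subst openin_subopen, intro ballI)
  fix x assume x: "x : V"
  then obtain n where n: "\<forall>u\<in>U n. x \<cdot> u : V" using V by blast
  have xc: "x : RC" using x V by blast
  let ?W = "{y : topspace PT. y (F n n) : {x (F n n)}} \<inter> RC"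
  have "openin RT ?W" unfolding ray_limit_top_def openin_subtopology using fiber_open[OF F_moduli] by blast
  moreover have "x : ?W" using xc RG_topspace by auto
  moreover have "?W \<subseteq> V"
  proof
   fix y assume "y : ?W"
   then have y: "y : RC" "x (F n n) = y (F n n)" by auto
   then show "y : V" using U_coset[OF xc y(1)] n by blast
  qed
  ultimately show "\<exists>W. openin RT W & x : W & W \<subseteq> V" by blast
 qed
qed

text \<open>The limit is closed in a product of finite discrete groups: a failure of compatibility
  is visible in two coordinates and persists on a neighbourhood.\<close>

lemma RT_compact: "compact_space RT"
proof -
 have "finite (carrier (Gr f))" if "f : Md" for f using that Gr_finite unfolding moduli_iff by blast
 then have "compact_space PT" unfolding compact_space_product_topology by (simp add: compact_space_discrete_topology)
 moreover have "closedin PT (RC)" unfolding closedin_def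
 proof (intro conjI RG_topspace)
  show "openin PT (topspace PT - RC)"
  proof (subst openin_subopen, intro ballI)
   fix x assume x: "x : topspace PT - RC"
   then have "x : (\<Pi>\<^sub>E f\<in>Md. carrier (Gr f))" by simp
   with x have "~ (\<forall>f\<in>Md. \<forall>f'\<in>Md. ideal_dvd f f' --> ray_proj f (x f') = x f)"
    unfolding Diff_iff RG_carrier by simp
   then obtain f f' where f: "f : Md" "f' : Md" "ideal_dvd f f'" "ray_proj f (x f') ~= x f" by meson
   let ?W = "{y : topspace PT. y f : {x f}} \<inter> {y : topspace PT. y f' : {x f'}}"
   have "openin PT ?W" by (intro openin_Int fiber_open f)
   moreover have "x : ?W" using x by auto
   moreover have "?W \<subseteq> topspace PT - RC"
   proof
    fix y assume y: "y : ?W"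
    have "y \<notin> RC"
    proof
     assume "y : RC"
     then have "ray_proj f (y f') = y f" using RG_proj f by blast
     then show False using y f(4) by auto
    qed
    then show "y : topspace PT - RC" using y by blast
   qed
   ultimately show "\<exists>W. openin PT W & x : W & W \<subseteq> topspace PT - RC" by blast
  qed
 qed
 ultimately have "compactin PT (RC)" by (rule closedin_compact_space)
 then show ?thesis unfolding ray_limit_top_def compactin_subspace by blast
qed

end

section \<open>Powers of \<open>\<int>\<^sub>p\<close> as subgroups\<close>

lemma one_plus_power:
 fixes x :: int
 shows "\<exists>q. (1 + x) ^ n = 1 + int n * x + x\<^sup>2 * q"
proof (induction n)
 case (Suc n)
 then obtain q where "(1 + x) ^ n = 1 + int n * x + x\<^sup>2 * q" by blast
 then have "(1 + x) ^ Suc n = 1 + int (Suc n) * x + x\<^sup>2 * (int n + q + x * q)"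
  by (simp add: algebra_simps power2_eq_square)
 then show ?case by blast
qed simp

text \<open>In the p-th power of 1 + p^(j+2) u the terms beyond the linear one are divisible by
  p^(2j+4), which exceeds p^(j+3). Starting from p^2 gives this room for every p, including
  2.\<close>

lemma one_plus_square_power:
 assumes p: "prime p"
 shows "\<exists>u. ~ int p dvd u & (1 + (int p)\<^sup>2) ^ (p ^ j) = 1 + int p ^ (j + 2) * u"
proof (induction j)
 case 0
 have "~ int p dvd 1" using prime_gt_1_nat[OF p] by simp
 then show ?case by (intro exI[of _ 1]) (simp add: power2_eq_square)
next
 case (Suc j)
 then obtain u where u: "~ int p dvd u" "(1 + (int p)\<^sup>2) ^ (p ^ j) = 1 + int p ^ (j + 2) * u" by blast
 obtain q where q: "(1 + int p ^ (j + 2) * u) ^ p = 1 + int p * (int p ^ (j + 2) * u) + (int p ^ (j + 2) * u)\<^sup>2 * q"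
  using one_plus_power by blast
 have "(1 + (int p)\<^sup>2) ^ (p ^ Suc j) = ((1 + (int p)\<^sup>2) ^ (p ^ j)) ^ p"
  by (simp add: power_mult[symmetric] mult.commute)
 also have "\<dots> = 1 + int p ^ (Suc j + 2) * (u + int p * (int p ^ j * u\<^sup>2 * q))"
  unfolding u(2) q by (simp add: algebra_simps power2_eq_square power_add)
 finally have "(1 + (int p)\<^sup>2) ^ (p ^ Suc j) = 1 + int p ^ (Suc j + 2) * (u + int p * (int p ^ j * u\<^sup>2 * q))" .
 moreover have "~ int p dvd u + int p * (int p ^ j * u\<^sup>2 * q)" using u(1) by (simp add: dvd_add_left_iff)
 ultimately show ?case by blast
qed

text \<open>Successive approximation: when the power agrees with y to some precision, a further
  factor, congruent to 1 plus t u times the power of p of that precision, gains one digit for a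
  suitable t. Such factors are themselves powers of 1 + p^2 with exponent divisible by p^k, by
  \<open>one_plus_square_power\<close>.\<close>

lemma int_log:
 assumes p: "prime p" and y: "int p ^ (k + 2) dvd y - 1"
 shows "\<exists>e. int p ^ N dvd (1 + (int p)\<^sup>2) ^ (p ^ k * e) - y"
proof (cases "N <= k + 2")
 case True
 then have "int p ^ N dvd - (y - 1)" using y le_imp_power_dvd dvd_trans dvd_minus_iff by blast
 then show ?thesis by (intro exI[of _ 0]) simp
next
 case False
 have "\<exists>e. int p ^ (k + 2 + j) dvd (1 + (int p)\<^sup>2) ^ (p ^ k * e) - y" for j
 proof (induction j)
  case 0
  have "int p ^ (k + 2) dvd - (y - 1)" using y dvd_minus_iff by blast
  then show ?case by (intro exI[of _ 0]) simp
 next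
  case (Suc j)
  let ?N = "k + 2 + j"
  obtain e where "int p ^ ?N dvd (1 + (int p)\<^sup>2) ^ (p ^ k * e) - y" using Suc by blast
  then obtain q where q: "(1 + (int p)\<^sup>2) ^ (p ^ k * e) - y = int p ^ ?N * q" unfolding dvd_def by blast
  define z where "z = (1 + (int p)\<^sup>2) ^ (p ^ k * e)"
  obtain u where u: "~ int p dvd u" "(1 + (int p)\<^sup>2) ^ (p ^ (k + j)) = 1 + int p ^ (k + j + 2) * u"
   using one_plus_square_power[OF p] by blast
  have pr: "prime (int p)" using p by simp
  have "~ int p dvd 1 + (int p)\<^sup>2"
  proof
   assume "int p dvd 1 + (int p)\<^sup>2"
   then have "int p dvd 1" by (simp add: dvd_add_left_iff)
   then show False using prime_gt_1_nat[OF p] by simp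
  qed
  then have "~ int p dvd z" unfolding z_def using pr prime_dvd_power by blast
  then have "~ int p dvd u * z" using u(1) pr prime_dvd_mult_iff by blast
  then have "coprime (int p) (u * z)" by (rule prime_imp_coprime[OF pr])
  then obtain a b where ab: "a * int p + b * (u * z) = 1" by (metis bezout_int coprime_iff_gcd_eq_1)
  have ppos: "int p > 0" using p by (simp add: prime_gt_0_nat)
  \<comment> \<open>b inverts u z modulo p, so this digit solves q + t u z = 0 modulo p.\<close>
  define t where "t = nat ((- b * q) mod int p)"
  have "int t mod int p = (- b * q) mod int p" unfolding t_def using ppos by simp
  then have "int p dvd int t - (- b * q)" by (simp add: mod_eq_dvd_iff)
  then obtain c where c: "int t = - b * q + int p * c" by (metis add_diff_cancel_left' dvdE diff_add_cancel add.commute)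
  have "q + int t * (u * z) = q * (a * int p + b * (u * z)) + (- b * q + int p * c) * (u * z)" unfolding ab c by simp
  also have "\<dots> = int p * (q * a + c * (u * z))" by (simp add: algebra_simps)
  finally have d1: "q + int t * (u * z) = int p * (q * a + c * (u * z))" .
  obtain q' where q': "(1 + int p ^ ?N * u) ^ t = 1 + int t * (int p ^ ?N * u) + (int p ^ ?N * u)\<^sup>2 * q'"
   using one_plus_power by blast
  have N: "?N = Suc (k + 1 + j)" by simp
  have "(1 + (int p)\<^sup>2) ^ (p ^ k * (e + p ^ j * t)) = z * ((1 + (int p)\<^sup>2) ^ (p ^ (k + j))) ^ t"
   unfolding z_def by (simp add: power_add power_mult[symmetric] algebra_simps)
  also have "\<dots> = z * (1 + int p ^ ?N * u) ^ t" using u(2) by (simp add: add_ac)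
  also have "\<dots> = z + int p ^ ?N * (int t * (u * z)) + int p ^ ?N * (int p ^ ?N * (u\<^sup>2 * q' * z))"
   unfolding q' by (simp only: algebra_simps power2_eq_square)
  also have "\<dots> - y = int p ^ ?N * (q + int t * (u * z)) + int p ^ ?N * (int p ^ ?N * (u\<^sup>2 * q' * z))"
   using q unfolding z_def[symmetric] by (simp add: algebra_simps)
  also have "\<dots> = int p ^ ?N * int p * (q * a + c * (u * z) + int p ^ (k + 1 + j) * (u\<^sup>2 * q' * z))"
   unfolding d1 by (simp add: algebra_simps)
  finally have "int p ^ (k + 2 + Suc j) dvd (1 + (int p)\<^sup>2) ^ (p ^ k * (e + p ^ j * t)) - y" by simp
  then show ?case by blast
 qed
 moreover have "k + 2 + (N - (k + 2)) = N" using False by simp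
 ultimately show ?thesis by metis
qed

lemma Zp_carrier: assumes "prime p"
 shows "x : carrier (Zp p) \<longleftrightarrow> (\<forall>n. 0 <= x n & x n < int p ^ n & x (Suc n) mod int p ^ n = x n)"
 using assms prime_gt_0_nat[OF assms] unfolding Zp_def by (auto simp: carrier_integer_mod_group)

lemma Zp_mult: "x \<otimes>\<^bsub>Zp p\<^esub> y = (%n. (x n + y n) mod int p ^ n)"
 unfolding Zp_def by (simp add: restrict_def)

lemma Zp_one: "\<one>\<^bsub>Zp p\<^esub> = (%n. 0)" unfolding Zp_def by (simp add: restrict_def)

lemma Zp_mod: assumes p: "prime p" and x: "x : carrier (Zp p)" shows "n <= m ==> x m mod int p ^ n = x n"
proof (induction m)
 case 0
 have "0 <= x 0 & x 0 < int p ^ 0" using x Zp_carrier[OF p, of x] by blast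
 with 0 show ?case by simp
next
 case (Suc m)
 show ?case
 proof (cases "n = Suc m")
  case True
  have "0 <= x n & x n < int p ^ n" using x Zp_carrier[OF p, of x] by blast
  then show ?thesis unfolding True[symmetric] by (intro mod_pos_pos_trivial) auto
 next
  case False
  then have nm: "n <= m" using Suc.prems by simp
  have "x (Suc m) mod int p ^ n = (x (Suc m) mod int p ^ m) mod int p ^ n"
   using nm by (simp add: mod_mod_cancel le_imp_power_dvd)
  then show ?thesis using Suc.IH[OF nm] x Zp_carrier[OF p, of x] by simp
 qed
qed

lemma Zp_I: assumes p: "prime p" and "!!n. y (Suc n) mod int p ^ n = y n mod int p ^ n"
 shows "(%n. y n mod int p ^ n) : carrier (Zp p)"
proof -
 have "int p ^ n > 0" for n using p by (simp add: prime_gt_0_nat)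
 moreover have "y (Suc n) mod int p ^ Suc n mod int p ^ n = y n mod int p ^ n" for n
  using assms(2)[of n] by (simp add: mod_mod_cancel)
 ultimately show ?thesis unfolding Zp_carrier[OF p] by simp
qed

lemma Zp_comm_group: assumes p: "prime p" shows "comm_group (Zp p)"
proof (rule comm_groupI)
 note c = Zp_carrier[OF p]
 show "x \<otimes>\<^bsub>Zp p\<^esub> y : carrier (Zp p)" if "x : carrier (Zp p)" "y : carrier (Zp p)" for x y
  unfolding Zp_mult
 proof (rule Zp_I[OF p])
  fix n
  have "x (Suc n) mod int p ^ n = x n" "y (Suc n) mod int p ^ n = y n" using that c by blast+
  then show "(x (Suc n) + y (Suc n)) mod int p ^ n = (x n + y n) mod int p ^ n" by (metis mod_add_eq)
 qed
 show "\<one>\<^bsub>Zp p\<^esub> : carrier (Zp p)" using prime_gt_0_nat[OF p] unfolding c Zp_one by simp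
 show "x \<otimes>\<^bsub>Zp p\<^esub> y \<otimes>\<^bsub>Zp p\<^esub> z = x \<otimes>\<^bsub>Zp p\<^esub> (y \<otimes>\<^bsub>Zp p\<^esub> z)" for x y z
  unfolding Zp_mult by (simp add: mod_add_left_eq mod_add_right_eq add.assoc)
 show "x \<otimes>\<^bsub>Zp p\<^esub> y = y \<otimes>\<^bsub>Zp p\<^esub> x" for x y unfolding Zp_mult by (simp add: add.commute)
 show "\<one>\<^bsub>Zp p\<^esub> \<otimes>\<^bsub>Zp p\<^esub> x = x" if "x : carrier (Zp p)" for x
  using that c[of x] unfolding Zp_mult Zp_one by (intro ext) simp
 show "\<exists>y\<in>carrier (Zp p). y \<otimes>\<^bsub>Zp p\<^esub> x = \<one>\<^bsub>Zp p\<^esub>" if x: "x : carrier (Zp p)" for x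
 proof
  show "(%n. (- x n) mod int p ^ n) : carrier (Zp p)"
  proof (rule Zp_I[OF p])
   fix n
   have "x (Suc n) mod int p ^ n = x n mod int p ^ n" using x c[of x] by simp
   then show "(- x (Suc n)) mod int p ^ n = (- x n) mod int p ^ n" by (metis mod_minus_eq)
  qed
  show "(%n. (- x n) mod int p ^ n) \<otimes>\<^bsub>Zp p\<^esub> x = \<one>\<^bsub>Zp p\<^esub>"
   unfolding Zp_mult Zp_one by (simp add: mod_add_left_eq)
 qed
qed

lemma Zp_pow: assumes p: "prime p" shows "(x [^]\<^bsub>Zp p\<^esub> (k::nat)) n = (int k * x n) mod int p ^ n"
proof -
 interpret comm_group "Zp p" by (rule Zp_comm_group[OF p])
 show ?thesis
 proof (induction k)
  case 0
  then show ?case by (simp add: Zp_one)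
 next
  case (Suc k)
  have "(x [^]\<^bsub>Zp p\<^esub> Suc k) n = ((int k * x n) mod int p ^ n + x n) mod int p ^ n"
   by (simp add: Zp_mult Suc[symmetric])
  also have "\<dots> = (int (Suc k) * x n) mod int p ^ n"
   unfolding mod_add_left_eq by (simp add: distrib_right add.commute)
  finally show ?case .
 qed
qed

lemma ppow_Zp: assumes p: "prime p" shows "ppow p (Zp p) n = {x : carrier (Zp p). x n = 0}"
proof
 interpret comm_group "Zp p" by (rule Zp_comm_group[OF p])
 show "ppow p (Zp p) n \<subseteq> {x : carrier (Zp p). x n = 0}" unfolding ppow_def by (auto simp: Zp_pow[OF p])
 show "{x : carrier (Zp p). x n = 0} \<subseteq> ppow p (Zp p) n"
 proof
  fix x assume "x : {x : carrier (Zp p). x n = 0}"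
  then have x: "x : carrier (Zp p)" "x n = 0" by auto
  have pp: "int p ^ k > 0" for k using p by (simp add: prime_gt_0_nat)
  have d: "\<exists>y. x (n + j) = int p ^ n * y" for j
   using Zp_mod[OF p x(1), of n "n + j"] x(2) by (simp add: mod_eq_0_iff_dvd dvd_def)
  \<comment> \<open>The root is x shifted by n levels and divided by p^n.\<close>
  then obtain y where y: "!!j. x (n + j) = int p ^ n * y j" by metis
  have "y : carrier (Zp p)" unfolding Zp_carrier[OF p]
  proof (intro allI conjI)
   fix j
   have b: "0 <= x (n + j)" "x (n + j) < int p ^ (n + j)" "x (Suc (n + j)) mod int p ^ (n + j) = x (n + j)"
    using x(1) Zp_carrier[OF p, of x] by blast+
   show "0 <= y j" using b(1) pp[of n] unfolding y by (simp add: zero_le_mult_iff)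
   show "y j < int p ^ j" using b(2) pp[of n] unfolding y power_add by simp
   have e: "x (Suc (n + j)) = int p ^ n * y (Suc j)" using y[of "Suc j"] by simp
   have "(int p ^ n * y (Suc j)) mod (int p ^ n * int p ^ j) = int p ^ n * y j"
    using b(3) unfolding e y power_add .
   then have "int p ^ n * (y (Suc j) mod int p ^ j) = int p ^ n * y j" by (simp only: mult_mod_right)
   then show "y (Suc j) mod int p ^ j = y j" using pp[of n] by (metis mult_cancel_left less_irrefl)
  qed
  moreover have "y [^]\<^bsub>Zp p\<^esub> (p ^ n) = x"
  proof
   fix j
   have "(y [^]\<^bsub>Zp p\<^esub> (p ^ n)) j = x (n + j) mod int p ^ j" unfolding Zp_pow[OF p] y by simp
   then show "(y [^]\<^bsub>Zp p\<^esub> (p ^ n)) j = x j" using Zp_mod[OF p x(1), of j "n + j"] by simp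
  qed
  ultimately show "x : ppow p (Zp p) n" unfolding ppow_def by blast
 qed
qed

lemma Zp_top_nbhd: assumes p: "prime p" and V: "openin (Zp_top p) V" "\<one>\<^bsub>Zp p\<^esub> : V"
 shows "\<exists>n. \<forall>m\<ge>n. ppow p (Zp p) m \<subseteq> V"
proof -
 let ?X = "%n. discrete_topology (carrier (integer_mod_group (p ^ n)))"
 obtain W where W: "openin (product_topology ?X UNIV) W" "V = W \<inter> carrier (Zp p)"
  using V(1) unfolding Zp_top_def openin_subtopology by blast
 then have "\<one>\<^bsub>Zp p\<^esub> : W" using V(2) by blast
 with W(1)[unfolded openin_product_topology_alt] obtain Z where
  Z: "finite {i : UNIV. Z i ~= topspace (?X i)}" "\<one>\<^bsub>Zp p\<^esub> : Pi\<^sub>E UNIV Z" "Pi\<^sub>E UNIV Z \<subseteq> W" by meson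
 then obtain n where n: "!!i. i : {i : UNIV. Z i ~= topspace (?X i)} ==> i <= n" by (meson finite_nat_set_iff_bounded_le)
 have "x : V" if m: "m >= n" and x: "x : ppow p (Zp p) m" for x m
 proof -
  have x: "x : carrier (Zp p)" "x m = 0" using x ppow_Zp[OF p] by auto
  have "x i : Z i" for i
  proof (cases "Z i = topspace (?X i)")
   case True
   then show ?thesis using x(1) unfolding Zp_def by simp
  next
   case False
   then have "i <= m" using n[of i] m by simp
   then have "x i = 0" using Zp_mod[OF p x(1), of i m] x(2) by simp
   then show ?thesis using Z(2) by (simp add: Zp_one PiE_iff)
  qed
  then have "x : W" using Z(3) by (auto simp: PiE_iff)
  then show ?thesis using W x(1) by blast
 qed
 then show ?thesis by blast
qed

lemma topspace_Zp_top: "topspace (Zp_top p) = carrier (Zp p)" unfolding Zp_top_def Zp_def by auto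

lemma ppow_Zp_open: assumes p: "prime p" shows "openin (Zp_top p) (ppow p (Zp p) n)"
proof -
 let ?X = "%n. discrete_topology (carrier (integer_mod_group (p ^ n)))"
 have c: "continuous_map (Zp_top p) (?X n) (%x. x n)"
  unfolding Zp_top_def by (intro continuous_map_from_subtopology continuous_map_product_projection) simp
 have "openin (Zp_top p) {x : topspace (Zp_top p). x n : {0} \<inter> carrier (integer_mod_group (p ^ n))}"
  by (rule openin_continuous_map_preimage[OF c]) simp
 moreover have "{x : topspace (Zp_top p). x n : {0} \<inter> carrier (integer_mod_group (p ^ n))} = ppow p (Zp p) n"
  unfolding ppow_Zp[OF p] topspace_Zp_top using prime_gt_0_nat[OF p] by (auto simp: carrier_integer_mod_group)
 ultimately show ?thesis by simp
qed

lemma Zpd_group: assumes p: "prime p" shows "group (product_group I (%_. Zp p))"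
 by (rule product_group) (rule comm_group.axioms(2)[OF Zp_comm_group[OF p]])

lemma product_group_pow:
 assumes "group (product_group I G)" "i : I"
 shows "(x [^]\<^bsub>product_group I G\<^esub> (k::nat)) i = x i [^]\<^bsub>G i\<^esub> k"
 by (induction k) (use assms(2) in \<open>simp_all add: nat_pow_def\<close>)

lemma ppow_Zpd: assumes p: "prime p" 
 shows "ppow p (product_group I (%_. Zp p)) n = (\<Pi>\<^sub>E i\<in>I. ppow p (Zp p) n)"
proof
 let ?M = "product_group I (%_. Zp p)"
 interpret M: group ?M by (rule Zpd_group[OF p])
 show "ppow p ?M n \<subseteq> (\<Pi>\<^sub>E i\<in>I. ppow p (Zp p) n)"
 proof
  fix x assume "x : ppow p ?M n"
  then obtain y where y: "y : carrier ?M" "x = y [^]\<^bsub>?M\<^esub> (p ^ n)" unfolding ppow_def by blast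
  have "x : carrier ?M" unfolding y(2) by (rule M.nat_pow_closed[OF y(1)])
  moreover have "x i : ppow p (Zp p) n" if "i : I" for i
   unfolding y(2) product_group_pow[OF M.group_axioms that] ppow_def using y(1) that by (auto simp: PiE_iff)
  ultimately show "x : (\<Pi>\<^sub>E i\<in>I. ppow p (Zp p) n)" by (simp add: PiE_iff)
 qed
 show "(\<Pi>\<^sub>E i\<in>I. ppow p (Zp p) n) \<subseteq> ppow p ?M n"
 proof
  fix x assume x: "x : (\<Pi>\<^sub>E i\<in>I. ppow p (Zp p) n)"
  then have "\<forall>i\<in>I. \<exists>y. y : carrier (Zp p) & x i = y [^]\<^bsub>Zp p\<^esub> (p ^ n)" unfolding PiE_iff ppow_def by blast
  from bchoice[OF this] obtain y where y: "!!i. i : I ==> y i : carrier (Zp p) & x i = y i [^]\<^bsub>Zp p\<^esub> (p ^ n)" by blast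
  let ?y = "restrict y I"
  have yc: "?y : carrier ?M" using y by simp
  have "x = ?y [^]\<^bsub>?M\<^esub> (p ^ n)"
  proof (rule PiE_ext)
   show "x : (\<Pi>\<^sub>E i\<in>I. carrier (Zp p))" using x ppow_Zp[OF p] by (auto simp: PiE_iff)
   show "?y [^]\<^bsub>?M\<^esub> (p ^ n) : (\<Pi>\<^sub>E i\<in>I. carrier (Zp p))" using M.nat_pow_closed[OF yc] by simp
   show "x i = (?y [^]\<^bsub>?M\<^esub> (p ^ n)) i" if "i : I" for i
    unfolding product_group_pow[OF M.group_axioms that] using y[OF that] that by simp
  qed
  then show "x : ppow p ?M n" unfolding ppow_def using yc by blast
 qed
qed

lemma Zpd_nbhd: assumes p: "prime p" and I: "finite I"
  and V: "openin (product_topology (%_. Zp_top p) I) V" "\<one>\<^bsub>product_group I (%_. Zp p)\<^esub> : V"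
 shows "\<exists>n. ppow p (product_group I (%_. Zp p)) n \<subseteq> V"
proof -
 obtain Z where Z: "\<forall>i\<in>I. openin (Zp_top p) (Z i)" "\<one>\<^bsub>product_group I (%_. Zp p)\<^esub> : Pi\<^sub>E I Z" "Pi\<^sub>E I Z \<subseteq> V"
  using V(1)[unfolded openin_product_topology_alt] V(2) by meson
 have "\<forall>i\<in>I. \<exists>n. \<forall>m\<ge>n. ppow p (Zp p) m \<subseteq> Z i"
 proof
  fix i assume i: "i : I"
  then have "\<one>\<^bsub>Zp p\<^esub> : Z i" using Z(2) by (auto simp: PiE_iff)
  then show "\<exists>n. \<forall>m\<ge>n. ppow p (Zp p) m \<subseteq> Z i" using Zp_top_nbhd[OF p] Z(1) i by blast
 qed
 from bchoice[OF this] obtain N where N: "!!i m. i : I ==> N i <= m ==> ppow p (Zp p) m \<subseteq> Z i" by blast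
 define n where "n = Max (insert 0 (N ` I))"
 have "N i <= n" if "i : I" for i unfolding n_def by (rule Max_ge) (use I that in auto)
 then have "ppow p (Zp p) n \<subseteq> Z i" if "i : I" for i using N that by blast
 then have "ppow p (product_group I (%_. Zp p)) n \<subseteq> Pi\<^sub>E I Z" unfolding ppow_Zpd[OF p] by (rule PiE_mono)
 then show ?thesis using Z(3) by blast
qed

lemma ppow_iso:
 assumes "group M" "group A" "h : iso M A"
 shows "ppow p A n = h ` ppow p M n"
proof -
 interpret h: group_hom M A h using assms iso_imp_homomorphism by (intro group_hom.intro group_hom_axioms.intro) auto
 have "h ` carrier M = carrier A" using assms(3) unfolding iso_def bij_betw_def by blast
 then have "ppow p A n = (%a. a [^]\<^bsub>A\<^esub> (p ^ n)) ` (h ` carrier M)" unfolding ppow_def by simp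
 also have "\<dots> = (%x. h x [^]\<^bsub>A\<^esub> (p ^ n)) ` carrier M" by (rule image_image)
 also have "\<dots> = (%x. h (x [^]\<^bsub>M\<^esub> (p ^ n))) ` carrier M"
  by (rule image_cong) (simp_all add: h.hom_nat_pow)
 finally show ?thesis unfolding ppow_def image_image .
qed

context level_group begin

text \<open>The isomorphism carries p-power subgroups to p-power subgroups and the homeomorphism
  carries their topology, so both comparisons take place in Z_p^d. Openness of H is what turns
  relative openness in H into openness in G.\<close>

lemma Zp_subgroup_filtration:
 assumes p: "prime p" and H: "subgroup H G" and iso: "iso_Zp_power p d (G\<lparr>carrier := H\<rparr>) (subtopology T H)"
 shows "\<exists>m. ppow p (G\<lparr>carrier := H\<rparr>) m \<subseteq> U n"
  and "openin T H ==> \<exists>n. U n \<subseteq> ppow p (G\<lparr>carrier := H\<rparr>) m"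
proof -
 let ?A = "G\<lparr>carrier := H\<rparr>" and ?M = "product_group {..<d} (%_. Zp p)" and ?MT = "product_topology (%_. Zp_top p) {..<d}"
 interpret M: group ?M by (rule Zpd_group[OF p])
 interpret A: comm_group ?A by (rule subgroup_comm_group[OF H])
 obtain h where h: "h : iso ?M ?A" "homeomorphic_map ?MT (subtopology T H) h"
  using iso unfolding iso_Zp_power_def by blast
 interpret h: group_hom ?M ?A h
  using h(1) M.group_axioms A.group_axioms iso_imp_homomorphism by (intro group_hom.intro group_hom_axioms.intro) auto
 note pp = ppow_iso[OF M.group_axioms A.group_axioms h(1), of p]
 have h1: "h \<one>\<^bsub>?M\<^esub> = \<one>" using h.hom_one by simp
 have opU: "openin T (U n)"
  using U_sub[of n] subgroup.m_closed[OF U_sub[of n]] subgroup.subset[OF U_sub[of n]] unfolding openin_iff by blast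
 have top: "topspace ?MT = carrier ?M" by (simp add: topspace_Zp_top)
 show "\<exists>m. ppow p ?A m \<subseteq> U n"
 proof -
  have "openin (subtopology T H) (U n \<inter> H)" using opU unfolding openin_subtopology by blast
  then have "openin ?MT {x : topspace ?MT. h x : U n \<inter> H}"
   by (rule openin_continuous_map_preimage[OF homeomorphic_imp_continuous_map[OF h(2)]])
  moreover have "\<one>\<^bsub>?M\<^esub> : {x : topspace ?MT. h x : U n \<inter> H}"
   unfolding top using M.one_closed h1 subgroup.one_closed[OF U_sub] subgroup.one_closed[OF H] by simp
  ultimately obtain m where "ppow p ?M m \<subseteq> {x : topspace ?MT. h x : U n \<inter> H}"
   using Zpd_nbhd[OF p finite_lessThan] by blast
  then show ?thesis unfolding pp by blast
 qed
 show "\<exists>n. U n \<subseteq> ppow p ?A m" if op: "openin T H"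
 proof -
  have "openin ?MT (ppow p ?M m)"
   unfolding ppow_Zpd[OF p] openin_PiE[OF finite_lessThan] using ppow_Zp_open[OF p] by blast
  then have "openin (subtopology T H) (h ` ppow p ?M m)"
   using homeomorphic_imp_open_map[OF h(2)] unfolding open_map_def by blast
  then have "openin T (ppow p ?A m)" unfolding pp using openin_trans_full[OF _ op] by blast
  moreover have "\<one> : ppow p ?A m"
   unfolding ppow_subgroup by (rule image_eqI[of _ _ \<one>]) (simp_all add: subgroup.one_closed[OF H])
  ultimately obtain n where n: "\<forall>u\<in>U n. \<one> \<otimes> u : ppow p ?A m" unfolding openin_iff by blast
  have "U n \<subseteq> ppow p ?A m"
  proof
   fix u assume u: "u : U n"
   then show "u : ppow p ?A m" using n U_carrier[OF u] by force
  qed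
  then show ?thesis ..
 qed
qed

text \<open>It exhibits a product of p-power subgroups as a continuous image of H1 x H2, hence as a
  compact set.\<close>

lemma continuous_power_product:
 "continuous_map (prod_topology T T) T (%z. fst z [^] (k::nat) \<otimes> snd z [^] (l::nat))"
 unfolding continuous_map_def
proof (intro conjI allI impI)
 show "(%z. fst z [^] k \<otimes> snd z [^] l) : topspace (prod_topology T T) \<rightarrow> topspace T"
  by (auto simp: topspace_T)
 fix V assume V: "openin T V"
 show "openin (prod_topology T T) {z : topspace (prod_topology T T). fst z [^] k \<otimes> snd z [^] l : V}"
  unfolding openin_prod_topology_alt
 proof (intro allI impI)
  fix x y assume "(x, y) : {z : topspace (prod_topology T T). fst z [^] k \<otimes> snd z [^] l : V}"
  then have xy: "x : carrier G" "y : carrier G" "x [^] k \<otimes> y [^] l : V" by (auto simp: topspace_T)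
  then obtain n where n: "\<forall>u\<in>U n. x [^] k \<otimes> y [^] l \<otimes> u : V" using V unfolding openin_iff by blast
  have op: "openin T ((%u. a \<otimes> u) ` U n)" if a: "a : carrier G" for a unfolding openin_iff
  proof (intro conjI ballI)
   show "(%u. a \<otimes> u) ` U n \<subseteq> carrier G" using a U_carrier by auto
   fix z assume "z : (%u. a \<otimes> u) ` U n"
   then obtain u where u: "u : U n" "z = a \<otimes> u" by blast
   have "z \<otimes> u' : (%u. a \<otimes> u) ` U n" if u': "u' : U n" for u'
    unfolding u(2) using m_assoc[OF a U_carrier[OF u(1)] U_carrier[OF u']] subgroup.m_closed[OF U_sub u(1) u'] by simp
   then show "\<exists>n'. \<forall>u'\<in>U n'. z \<otimes> u' : (%u. a \<otimes> u) ` U n" by blast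
  qed
  have mem: "a : (%u. a \<otimes> u) ` U n" if a: "a : carrier G" for a
   by (rule image_eqI[of _ _ \<one>]) (simp_all add: a subgroup.one_closed[OF U_sub])
  have powU: "u [^] (j::nat) : U n" if "u : U n" for u j
   by (induction j) (use that subgroup.one_closed[OF U_sub] subgroup.m_closed[OF U_sub] in auto)
  have "(x \<otimes> u) [^] k \<otimes> (y \<otimes> u') [^] l : V" if uu: "u : U n" "u' : U n" for u u'
  proof -
   note c = U_carrier[OF uu(1)] U_carrier[OF uu(2)]
   have "(x \<otimes> u) [^] k \<otimes> (y \<otimes> u') [^] l = x [^] k \<otimes> y [^] l \<otimes> (u [^] k \<otimes> u' [^] l)"
    using xy(1,2) c by (simp add: nat_pow_distrib m_ac)
   then show ?thesis using n subgroup.m_closed[OF U_sub powU[OF uu(1)] powU[OF uu(2)]] by simp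
  qed
  then have "(%u. x \<otimes> u) ` U n \<times> (%u. y \<otimes> u) ` U n \<subseteq> {z : topspace (prod_topology T T). fst z [^] k \<otimes> snd z [^] l : V}"
   using xy(1,2) U_carrier by (auto simp: topspace_T)
  then show "\<exists>A B. openin T A & openin T B & x : A & y : B &
    A \<times> B \<subseteq> {z : topspace (prod_topology T T). fst z [^] k \<otimes> snd z [^] l : V}"
   using op[OF xy(1)] op[OF xy(2)] mem[OF xy(1)] mem[OF xy(2)] by blast
 qed
qed

text \<open>The product of two \<open>p\<close>-power subgroups of closed subgroups is compact, hence determined by its images at
 all levels.\<close>

lemma ppow_product_closed:
 assumes cl: "closedin T H1" "closedin T H2"
  and sep: "!!x. x : carrier G ==> (!!n. x : U n) ==> x = \<one>"
  and x: "x : carrier G"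
  and app: "!!N. \<exists>a\<in>ppow p (G\<lparr>carrier := H1\<rparr>) m. \<exists>b\<in>ppow p (G\<lparr>carrier := H2\<rparr>) n. \<exists>u\<in>U N. x = a \<otimes> b \<otimes> u"
 shows "\<exists>a\<in>ppow p (G\<lparr>carrier := H1\<rparr>) m. \<exists>b\<in>ppow p (G\<lparr>carrier := H2\<rparr>) n. x = a \<otimes> b"
proof (rule ccontr)
 assume no: "~ ?thesis"
 have Hc: "H1 \<subseteq> carrier G" "H2 \<subseteq> carrier G" using closedin_subset[OF cl(1)] closedin_subset[OF cl(2)] topspace_T by auto
 define f where "f = (%z. fst z [^] (p ^ m) \<otimes> snd z [^] (p ^ n))"
 define K where "K = f ` (H1 \<times> H2)"
 have K: "y : K \<longleftrightarrow> (\<exists>a\<in>ppow p (G\<lparr>carrier := H1\<rparr>) m. \<exists>b\<in>ppow p (G\<lparr>carrier := H2\<rparr>) n. y = a \<otimes> b)" for y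
 proof -
  have "y : K \<longleftrightarrow> (\<exists>a\<in>H1. \<exists>b\<in>H2. y = a [^] (p ^ m) \<otimes> b [^] (p ^ n))"
   unfolding K_def f_def by force
  then show ?thesis unfolding ppow_subgroup by blast
 qed
 have "compactin (prod_topology T T) (H1 \<times> H2)"
  unfolding compactin_Times using closedin_compact_space[OF compact] cl by blast
 then have comp: "compactin T K" unfolding K_def f_def by (rule image_compactin[OF _ continuous_power_product])
 have Kc: "K \<subseteq> carrier G" using compactin_subset_topspace[OF comp] topspace_T by simp
 \<comment> \<open>If x agreed with y modulo every \<open>U N\<close>, separation would place x in
   the compact set K.\<close>
 have sepn: "\<exists>N. \<forall>u\<in>U N. x ~= y \<otimes> u" if y: "y : K" for y
 proof (rule ccontr)
  assume "~ ?thesis"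
  then have *: "!!N. \<exists>u\<in>U N. x = y \<otimes> u" by blast
  have yc: "y : carrier G" using y Kc by blast
  have "inv y \<otimes> x : U N" for N
  proof -
   obtain u where u: "u : U N" "x = y \<otimes> u" using * by blast
   then have "inv y \<otimes> x = u" using yc U_carrier[OF u(1)] by (simp add: m_assoc[symmetric])
   then show ?thesis using u(1) by simp
  qed
  then have "inv y \<otimes> x = \<one>" using sep[of "inv y \<otimes> x"] yc x by simp
  then have "x = y" using yc x by (metis inv_closed inv_equality inv_inv m_comm)
  then show False using no y K by blast
 qed
 then obtain N where N: "!!y. y : K ==> \<forall>u\<in>U (N y). x ~= y \<otimes> u" by metis
 let ?C = "%y. (%u. y \<otimes> u) ` U (N y)"
 have opC: "openin T (?C y)" if y: "y : K" for y unfolding openin_iff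
 proof (intro conjI ballI)
  have a: "y : carrier G" using y Kc by blast
  show "?C y \<subseteq> carrier G" using a U_carrier by auto
  fix z assume "z : ?C y"
  then obtain u where u: "u : U (N y)" "z = y \<otimes> u" by blast
  have "z \<otimes> u' : ?C y" if u': "u' : U (N y)" for u'
   unfolding u(2) using m_assoc[OF a U_carrier[OF u(1)] U_carrier[OF u']] subgroup.m_closed[OF U_sub u(1) u'] by simp
  then show "\<exists>n'. \<forall>u'\<in>U n'. z \<otimes> u' : ?C y" by blast
 qed
 have memC: "y : ?C y" if y: "y : K" for y
  by (rule image_eqI[of _ _ \<one>]) (use y Kc subgroup.one_closed[OF U_sub] in auto)
 have "\<exists>\<F>. finite \<F> & \<F> \<subseteq> ?C ` K & K \<subseteq> \<Union>\<F>"
 proof (rule compactinD[OF comp])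
  show "openin T V" if V: "V : ?C ` K" for V
  proof -
   obtain y where "y : K" "V = ?C y" using V by (elim imageE)
   then show ?thesis using opC by simp
  qed
  show "K \<subseteq> \<Union> (?C ` K)"
  proof
   fix y assume "y : K"
   then show "y : \<Union> (?C ` K)" using memC by (intro UN_I)
  qed
 qed
 then obtain \<F> where \<F>: "finite \<F>" "\<F> \<subseteq> ?C ` K" "K \<subseteq> \<Union>\<F>" by (elim exE conjE)
 obtain Y where Y: "Y \<subseteq> K" "finite Y" "\<F> = ?C ` Y" using finite_subset_image[OF \<F>(1,2)] by (elim exE conjE)
 define M where "M = Max (insert 0 (N ` Y))"
 have M: "N y <= M" if "y : Y" for y unfolding M_def by (rule Max_ge) (use Y(2) that in auto)
 obtain z u where z: "z : K" "u : U M" "x = z \<otimes> u" using app[of M] K by blast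
 have "z : \<Union> (?C ` Y)" using \<F>(3) z(1) unfolding Y(3) by (rule subsetD)
 then obtain y where y: "y : Y" "z : ?C y" by (elim UN_E)
 then obtain u' where u': "u' : U (N y)" "z = y \<otimes> u'" by blast
 have uN: "u : U (N y)" using U_anti[OF M[OF y(1)]] z(2) by blast
 have "x = y \<otimes> (u' \<otimes> u)"
  unfolding z(3) u'(2) by (rule m_assoc[OF subsetD[OF Kc subsetD[OF Y(1) y(1)]] U_carrier[OF u'(1)] U_carrier[OF uN]])
 then show False using N[OF subsetD[OF Y(1) y(1)]] subgroup.m_closed[OF U_sub u'(1) uN] by simp
qed

end

section \<open>The local units in the ray class groups\<close>

context split_quad begin

lemma RG_level: "level_group RG RT U"
 by (intro level_group.intro level_group_axioms.intro) (rule RG_group U_subgroup RT_openin RT_compact | erule U_anti)+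

lemma U_separated: assumes x: "x : RC" and U: "!!n. x : U n" shows "x = \<one>\<^bsub>RG\<^esub>"
proof (rule RG_ext[OF x])
 interpret G: comm_group RG by (rule RG_group)
 show "\<one>\<^bsub>RG\<^esub> : RC" by (rule G.one_closed)
 fix f assume f: "f : Md"
 obtain n where n: "\<forall>m\<ge>n. ideal_dvd f (F m m)" using dvd_level[OF f] by blast
 have "x (F n n) = S (F n n)" "\<one>\<^bsub>RG\<^esub> (F n n) = S (F n n)"
  using U[of n] subgroup.one_closed[OF U_subgroup, of n] unfolding U_def by auto
 then show "x f = \<one>\<^bsub>RG\<^esub> f" using level_determines[OF x G.one_closed _ f, of n] n by simp
qed

lemma ppow_RG: assumes H: "subgroup H RG" 
 shows "a : pwr H m ==> a : RC"
  and "a : pwr H m ==> b : pwr H m ==> a \<cdot> b : pwr H m"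
proof -
 interpret G: level_group RG RT U by (rule RG_level)
 note Hc = subsetD[OF subgroup.subset[OF H]]
 show "a : pwr H m ==> a : RC" unfolding G.ppow_subgroup using Hc G.nat_pow_closed by blast
 assume "a : pwr H m" "b : pwr H m"
 then obtain x y where xy: "x : H" "y : H" "a = x [^]\<^bsub>RG\<^esub> (p ^ m)" "b = y [^]\<^bsub>RG\<^esub> (p ^ m)"
  unfolding G.ppow_subgroup by blast
 have "(x \<cdot> y) [^]\<^bsub>RG\<^esub> (p ^ m) = a \<cdot> b"
  unfolding xy(3,4) by (rule G.nat_pow_distrib[OF Hc[OF xy(1)] Hc[OF xy(2)]])
 moreover have "x \<cdot> y : H" by (rule subgroup.m_closed[OF H xy(1,2)])
 ultimately show "a \<cdot> b : pwr H m" unfolding G.ppow_subgroup by (metis image_eqI)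
qed

definition crs :: "nat => 'k => 'k set" where "crs n a = {y. y - a : Pw n}"

lemma Pw_add: "x : Pw n ==> y : Pw n ==> x + y : Pw n" by (rule omodD(2)[OF omodI[OF Pw_idl]])
lemma Pw_diff: "x : Pw n ==> y : Pw n ==> x - y : Pw n" by (rule omodD(5)[OF omodI[OF Pw_idl]])
lemma Pw_scale: "integral a ==> x : Pw n ==> a * x : Pw n" by (rule omodD(3)[OF omodI[OF Pw_idl]])
lemma crs_eq: assumes "a - b : Pw n" shows "crs n a = crs n b"
proof -
 have "y - b : Pw n" if "y - a : Pw n" for y using Pw_add[OF that assms] by simp
 moreover have "y - a : Pw n" if "y - b : Pw n" for y using Pw_diff[OF that assms] by simp
 ultimately show ?thesis unfolding crs_def by blast
qed

lemma crs_coset: "Pw n +>\<^bsub>OK\<^esub> a = crs n a"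
proof -
 have "(\<Union>h\<in>Pw n. {h + a}) = crs n a"
 proof (intro Set.set_eqI iffI)
  show "y : crs n a" if "y : (\<Union>h\<in>Pw n. {h + a})" for y using that unfolding crs_def by auto
  fix y assume "y : crs n a"
  then have "y - a : Pw n" unfolding crs_def by simp
  moreover have "y : {y - a + a}" by simp
  ultimately show "y : (\<Union>h\<in>Pw n. {h + a})" by (rule UN_I)
 qed
 then show ?thesis unfolding a_r_coset_def' by (simp add: OK_def)
qed

lemma crs_mult: assumes "integral a" "integral b"
 shows "crs n a \<otimes>\<^bsub>OK Quot Pw n\<^esub> crs n b = crs n (a * b)"
proof -
 have i: "ideal (Pw n) (OK :: 'k ring)" using Pw_idl ideal_iff by blast
 have "crs n a \<otimes>\<^bsub>OK Quot Pw n\<^esub> crs n b = rcoset_mult OK (Pw n) (Pw n +>\<^bsub>OK\<^esub> a) (Pw n +>\<^bsub>OK\<^esub> b)"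
  unfolding crs_coset FactRing_def by simp
 also have "\<dots> = Pw n +>\<^bsub>OK\<^esub> (a \<otimes>\<^bsub>OK\<^esub> b)"
  by (rule ideal.rcoset_mult_add[OF i]) (use assms carrier_OK in auto)
 finally show ?thesis unfolding crs_coset by (simp add: OK_def)
qed

lemma crs_one: "\<one>\<^bsub>OK Quot Pw n\<^esub> = crs n 1"
 unfolding crs_coset[symmetric] FactRing_def by (simp add: OK_def)

lemma crs_closed: "integral a ==> crs n a : carrier (OK Quot Pw n)"
 unfolding crs_coset[symmetric] FactRing_def A_RCOSETS_def' by (auto simp: carrier_OK)

lemma crs_unit: assumes "integral a" "integral b" "a * b - 1 : Pw n" shows "crs n a : Units (OK Quot Pw n)"
proof -
 have "crs n a \<otimes>\<^bsub>OK Quot Pw n\<^esub> crs n b = \<one>\<^bsub>OK Quot Pw n\<^esub>" "crs n b \<otimes>\<^bsub>OK Quot Pw n\<^esub> crs n a = \<one>\<^bsub>OK Quot Pw n\<^esub>"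
  unfolding crs_mult[OF assms(1,2)] crs_mult[OF assms(2,1)] crs_one using crs_eq[OF assms(3)] by (simp_all add: mult.commute)
 then show ?thesis unfolding Units_def using crs_closed[OF assms(1)] crs_closed[OF assms(2)] by blast
qed

text \<open>The powers of 1 + p^2 are rational integers, so \<open>int_log\<close> is available, and
  by \<open>\<Gamma>_mod\<close> they are p-adically continuous in the exponent.\<close>

definition \<Gamma> :: "nat => 'k" where "\<Gamma> k = of_int ((1 + (int p)\<^sup>2) ^ k)"

lemma \<Gamma>_int: "integral (\<Gamma> k)" unfolding \<Gamma>_def by (rule integral_of_int)

lemma \<Gamma>_add: "\<Gamma> (a + b) = \<Gamma> a * \<Gamma> b" unfolding \<Gamma>_def power_add by (rule of_int_mult)

lemma \<Gamma>_mod: "\<Gamma> a - \<Gamma> (a mod p ^ n) : Pw n"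
proof -
 define x where "x = (1 + (int p)\<^sup>2) ^ (p ^ n) - 1"
 obtain u where "(1 + (int p)\<^sup>2) ^ (p ^ n) = 1 + int p ^ (n + 2) * u" using one_plus_square_power[OF p] by blast
 then have "x = int p ^ n * ((int p)\<^sup>2 * u)" unfolding x_def by (simp add: power_add power2_eq_square)
 then have dx: "int p ^ n dvd x" by simp
 obtain q where q: "(1 + x) ^ (a div p ^ n) = 1 + int (a div p ^ n) * x + x\<^sup>2 * q" using one_plus_power by blast
 have "(1 + (int p)\<^sup>2) ^ a = (1 + (int p)\<^sup>2) ^ (a mod p ^ n + p ^ n * (a div p ^ n))" by simp
 also have "\<dots> = (1 + (int p)\<^sup>2) ^ (a mod p ^ n) * (1 + x) ^ (a div p ^ n)"
  unfolding power_add power_mult x_def by simp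
 finally have "(1 + (int p)\<^sup>2) ^ a - (1 + (int p)\<^sup>2) ^ (a mod p ^ n) =
   x * ((1 + (int p)\<^sup>2) ^ (a mod p ^ n) * (int (a div p ^ n) + x * q))"
  unfolding q by (simp add: algebra_simps power2_eq_square)
 with dx have "int p ^ n dvd (1 + (int p)\<^sup>2) ^ a - (1 + (int p)\<^sup>2) ^ (a mod p ^ n)" by simp
 then show ?thesis unfolding \<Gamma>_def of_int_diff[symmetric] int_mem_power_iff .
qed

lemma \<Gamma>_inverse: "\<Gamma> a * \<Gamma> ((p ^ n - 1) * a) - 1 : Pw n"
proof -
 have "p ^ n > 0" using p by (simp add: prime_gt_0_nat)
 then have "a + (p ^ n - 1) * a = p ^ n * a" by (cases "p ^ n") simp_all
 then have "\<Gamma> a * \<Gamma> ((p ^ n - 1) * a) = \<Gamma> (p ^ n * a)" unfolding \<Gamma>_add[symmetric] by simp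
 moreover have "\<Gamma> 0 = 1" unfolding \<Gamma>_def by simp
 ultimately show ?thesis using \<Gamma>_mod[of "p ^ n * a" n] by simp
qed

text \<open>The one-parameter subgroup x -> (1 + p^2)^x of the local units, for a p-adic integer x;
  its value modulo P^n is computed from x modulo p^n.\<close>

definition one_param :: "(nat => int) => nat => 'k set" where "one_param x n = crs n (\<Gamma> (nat (x n)))"

lemma crs_\<Gamma>_unit: "crs n (\<Gamma> a) : Units (OK Quot Pw n)"
 by (rule crs_unit[OF \<Gamma>_int \<Gamma>_int \<Gamma>_inverse])

lemma crs_\<Gamma>_mod: "crs n (\<Gamma> (a mod p ^ n)) = crs n (\<Gamma> a)" using crs_eq[OF \<Gamma>_mod] by simp

lemma one_param_carrier: assumes x: "x : carrier (Zp p)" shows "one_param x : carrier (local_units P)"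
proof -
 have "one_param x (Suc n) \<subseteq> one_param x n" for n
 proof -
  have b: "0 <= x (Suc n)" "x (Suc n) mod int p ^ n = x n" using x Zp_carrier[OF p, of x] by blast+
  have "int (nat (x (Suc n)) mod p ^ n) = x n" using b by (simp add: of_nat_mod)
  then have e: "nat (x n) = nat (x (Suc n)) mod p ^ n" by linarith
  have "Pw (Suc n) \<subseteq> Pw n" using ip_sub(2)[OF P_idl omodI[OF Pw_idl]] unfolding ideal_power_simps by blast
  then have "crs (Suc n) (\<Gamma> (nat (x (Suc n)))) \<subseteq> crs n (\<Gamma> (nat (x (Suc n))))" unfolding crs_def by blast
  then show ?thesis unfolding one_param_def e crs_\<Gamma>_mod .
 qed
 then show ?thesis unfolding local_units_def one_param_def using crs_\<Gamma>_unit by simp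
qed

lemma one_param_local: "one_param : local_one_param p (local_units P) (local_units_top P)"
proof -
 have p0: "ppow p (Zp p) 0 = carrier (Zp p)"
 proof -
  have "x 0 = 0" if "x : carrier (Zp p)" for x
  proof -
   have "0 <= x 0 & x 0 < int p ^ 0" using that Zp_carrier[OF p, of x] by blast
   then show ?thesis by simp
  qed
  then show ?thesis unfolding ppow_Zp[OF p] by blast
 qed
 have lm: "a \<otimes>\<^bsub>local_units P\<^esub> b = (%n. a n \<otimes>\<^bsub>OK Quot Pw n\<^esub> b n)" for a b
  unfolding local_units_def by (simp add: units_of_def restrict_def)
 have "one_param : hom (Zp p) (local_units P)"
 proof (rule homI)
  show "one_param x : carrier (local_units P)" if "x : carrier (Zp p)" for x by (rule one_param_carrier[OF that])
  fix x y assume xy: "x : carrier (Zp p)" "y : carrier (Zp p)"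
  show "one_param (x \<otimes>\<^bsub>Zp p\<^esub> y) = one_param x \<otimes>\<^bsub>local_units P\<^esub> one_param y"
   unfolding lm
  proof
   fix n
   have b: "0 <= x n" "0 <= y n" using xy Zp_carrier[OF p] by blast+
   have "int ((nat (x n) + nat (y n)) mod p ^ n) = (x n + y n) mod int p ^ n" using b by (simp add: of_nat_mod)
   then have "nat ((x n + y n) mod int p ^ n) = (nat (x n) + nat (y n)) mod p ^ n" by linarith
   then show "one_param (x \<otimes>\<^bsub>Zp p\<^esub> y) n = one_param x n \<otimes>\<^bsub>OK Quot Pw n\<^esub> one_param y n"
    unfolding one_param_def Zp_mult crs_mult[OF \<Gamma>_int \<Gamma>_int] by (simp add: crs_\<Gamma>_mod \<Gamma>_add)
  qed
 qed
 moreover have "continuous_map (Zp_top p) (local_units_top P) one_param"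
  unfolding local_units_top_def continuous_map_in_subtopology continuous_map_componentwise_UNIV
 proof (intro conjI allI)
  show "one_param : topspace (Zp_top p) \<rightarrow> carrier (local_units P)"
   using one_param_carrier by (simp add: topspace_Zp_top)
  fix k
  let ?X = "%n. discrete_topology (carrier (integer_mod_group (p ^ n)))"
  have c: "continuous_map (Zp_top p) (?X k) (%x. x k)"
   unfolding Zp_top_def by (intro continuous_map_from_subtopology continuous_map_product_projection) simp
  show "continuous_map (Zp_top p) (discrete_topology (Units (OK Quot Pw k))) (%x. one_param x k)"
   unfolding continuous_map_def
  proof (intro conjI allI impI)
   show "(%x. one_param x k) : topspace (Zp_top p) \<rightarrow> topspace (discrete_topology (Units (OK Quot Pw k)))"
    unfolding one_param_def using crs_\<Gamma>_unit by simp
   fix V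
   let ?A = "{a : carrier (integer_mod_group (p ^ k)). crs k (\<Gamma> (nat a)) : V}"
   have "openin (Zp_top p) {x : topspace (Zp_top p). x k : ?A}" by (rule openin_continuous_map_preimage[OF c]) simp
   moreover have "{x : topspace (Zp_top p). x k : ?A} = {x : topspace (Zp_top p). one_param x k : V}"
    unfolding one_param_def using c by (auto simp: continuous_map_def)
   ultimately show "openin (Zp_top p) {x : topspace (Zp_top p). one_param x k : V}" by simp
  qed
 qed
 moreover have "subtopology (Zp_top p) (carrier (Zp p)) = Zp_top p"
  using subtopology_topspace[of "Zp_top p"] unfolding topspace_Zp_top .
 ultimately show ?thesis unfolding local_one_param_def by (intro CollectI exI[of _ 0]) (simp add: p0)
qed

definition zemb :: "nat => nat => int" where "zemb k n = int k mod int p ^ n"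

lemma zemb_Zp: "zemb k : carrier (Zp p)"
proof -
 have "(%n. int k mod int p ^ n) : carrier (Zp p)" by (rule Zp_I[OF p]) simp
 then show ?thesis unfolding zemb_def[abs_def] .
qed

text \<open>The Lie algebra equality provides a homomorphism \<open>\<delta>\<close> into H with the
  same germ as the image of the curve of powers of 1 + p^2. Near 0 this image therefore lies in H,
  and its value at p^m times y is the p^m-th power of an element of H.\<close>

lemma lie_points:
 assumes H: "adapted_Zp_subgroup p g P H"
 shows "\<exists>n0. \<forall>m e. local_unit_map p g P (one_param (zemb (p ^ (n0 + m) * e))) : pwr H m"
proof -
 interpret G: level_group RG RT U by (rule RG_level)
 interpret Z: comm_group "Zp p" by (rule Zp_comm_group[OF p])
 have sg: "subgroup H RG" using H unfolding adapted_Zp_subgroup_def by blast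
 let ?A = "RG\<lparr>carrier := H\<rparr>" and ?rho = "local_unit_map p g P"
 interpret A: comm_group ?A by (rule G.subgroup_comm_group[OF sg])
 have "lie_algebra p ?A (subtopology RT H) = lie_image p (local_units P) (local_units_top P) ?rho"
  using H unfolding adapted_Zp_subgroup_def by blast
 moreover have "germ p (?rho \<circ> one_param) : lie_image p (local_units P) (local_units_top P) ?rho"
  unfolding lie_image_def using one_param_local by (rule imageI)
 ultimately have "germ p (?rho \<circ> one_param) : germ p ` local_one_param p ?A (subtopology RT H)"
  unfolding lie_algebra_def by simp
 then obtain \<delta> where \<delta>: "germ p (?rho \<circ> one_param) = germ p \<delta>" "\<delta> : local_one_param p ?A (subtopology RT H)"
  by (elim imageE)
 have "\<delta> : germ p \<delta>" unfolding germ_def by simp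
 then have "\<delta> : germ p (?rho \<circ> one_param)" unfolding \<delta>(1) .
 then obtain n2 where n2: "!!x. x : ppow p (Zp p) n2 ==> \<delta> x = ?rho (one_param x)" unfolding germ_def by auto
 obtain n1 where n1: "\<delta> : hom (Zp p\<lparr>carrier := ppow p (Zp p) n1\<rparr>) ?A" using \<delta>(2) unfolding local_one_param_def by blast
 have mem: "zemb (p ^ n * e) : ppow p (Zp p) n'" if "n' <= n" for n e n'
 proof -
  have "int p ^ n' dvd int (p ^ n * e)" using that by (simp add: le_imp_power_dvd dvd_mult2)
  then show ?thesis unfolding ppow_Zp[OF p] using zemb_Zp by (simp add: zemb_def)
 qed
 \<comment> \<open>Deep enough both for the domain of \<open>\<delta>\<close> and for its agreement
   with the curve.\<close>
 define n0 where "n0 = max n1 n2"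
 have "?rho (one_param (zemb (p ^ (n0 + m) * e))) : ppow p ?A m" for m e
 proof -
  let ?y = "zemb (p ^ n0 * e)" and ?x = "zemb (p ^ (n0 + m) * e)"
  have y1: "?y : ppow p (Zp p) n1" by (rule mem) (simp add: n0_def)
  have yc: "?y : carrier (Zp p)" by (rule zemb_Zp)
  have x2: "?x : ppow p (Zp p) n2" by (rule mem) (simp add: n0_def)
  have e: "int (p ^ (n0 + m) * e) = int (p ^ m) * int (p ^ n0 * e)" unfolding power_add by simp
  have xy: "?x = ?y [^]\<^bsub>Zp p\<^esub> (p ^ m)"
  proof
   fix n
   show "?x n = (?y [^]\<^bsub>Zp p\<^esub> (p ^ m)) n"
    unfolding Zp_pow[OF p] zemb_def e by (simp only: mod_mult_right_eq)
  qed
  have yk: "?y [^]\<^bsub>Zp p\<^esub> k : ppow p (Zp p) n1" for k :: nat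
   using y1 Z.nat_pow_closed[OF yc, of k] unfolding ppow_Zp[OF p] by (simp add: Zp_pow[OF p])
  have dH: "\<delta> ?y : H" using hom_in_carrier[OF n1, of ?y] y1 by simp
  \<comment> \<open>Exponents start at 1, so the value of \<open>\<delta>\<close> at the unit does
    not enter.\<close>
  have pw: "\<delta> (?y [^]\<^bsub>Zp p\<^esub> Suc k) = \<delta> ?y [^]\<^bsub>?A\<^esub> Suc k" for k
  proof (induction k)
   case 0
   have "?y [^]\<^bsub>Zp p\<^esub> Suc 0 = ?y" using yc by simp
   moreover have "\<delta> ?y [^]\<^bsub>?A\<^esub> Suc 0 = \<delta> ?y" using dH A.l_one[of "\<delta> ?y"] by simp
   ultimately show ?case by simp
  next
   case (Suc k)
   have "\<delta> (?y [^]\<^bsub>Zp p\<^esub> Suc k \<otimes>\<^bsub>Zp p\<^esub> ?y) = \<delta> (?y [^]\<^bsub>Zp p\<^esub> Suc k) \<otimes>\<^bsub>?A\<^esub> \<delta> ?y"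
    using hom_mult[OF n1, of "?y [^]\<^bsub>Zp p\<^esub> Suc k" ?y] yk[of "Suc k"] y1 by simp
   then show ?case unfolding Suc by (simp only: Z.nat_pow_Suc A.nat_pow_Suc)
  qed
  have "p ^ m = Suc (p ^ m - 1)" using p by (simp add: prime_gt_0_nat)
  then have "\<delta> ?x = \<delta> ?y [^]\<^bsub>?A\<^esub> (p ^ m)" unfolding xy using pw by metis
  then have "\<delta> ?x : ppow p ?A m" unfolding ppow_def using dH by simp
  then show ?thesis unfolding n2[OF x2] .
 qed
 then show ?thesis by blast
qed

lemma cop_pr_cong: assumes f: "idl f" and i: "integral a" "integral b" and c: "cop (pr a) f" and ab: "a - b : f"
 shows "cop (pr b) f"
proof -
 obtain c where c: "integral c" "a * c - 1 : f" using c cop_pr[OF f i(1)] by blast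
 have "(a * c - 1) - c * (a - b) : f" by (rule omodD(5)[OF omodI[OF f] c(2) omodD(3)[OF omodI[OF f] c(1) ab]])
 moreover have "(a * c - 1) - c * (a - b) = b * c - 1" by (simp add: algebra_simps)
 ultimately show ?thesis using cop_pr[OF f i(2)] c(1) by auto
qed

lemma pr_rid: "idl f ==> integral a ==> a ~= 0 ==> cop (pr a) f ==> pr a : rid f" by (rule rid_idl[OF _ pr_idl pr_nz])

lemma cls_pr_eq: assumes f: "idl f" and a: "integral a" "a ~= 0" and b: "integral b" "b ~= 0"
  and c: "cop (pr a) f" and ab: "a - b : f"
 shows "cls f (pr a) = cls f (pr b)"
proof -
 note c' = cop_pr_cong[OF f a(1) b(1) c ab]
 have "pr (a / b) : S f" by (rule S_I[OF a(1) b(1) a(2) b(2) c c' ab])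
 moreover have "pr a = pr (a / b) \<odot> pr b" unfolding ip_pr_pr using b(2) by simp
 ultimately show ?thesis using cls_eq_iff[OF f pr_rid[OF f a c] pr_rid[OF f b c']] by blast
qed

lemma PL_mem: assumes "x : Pw N" "x : Qw M \<odot> g" shows "x : F N M"
 unfolding F_def by (rule cop_inter[OF Pw_idl ip_idl[OF Qw_idl g_idl] cop_Pw_rest assms])

text \<open>The definite description is evaluated: cancelling P^N determines the complementary ideal
  L, and two admissible numbers are congruent modulo P^N and modulo L, hence modulo their product,
  so they define one class.\<close>

lemma local_unit_map_value:
 assumes z: "integral z" "z ~= 0" "z - \<Gamma> k : Pw N" "z - 1 : Qw N \<odot> g"
 shows "local_unit_map p g P (one_param (zemb k)) (F N N) = cls (F N N) (pr z)"
proof -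
 let ?f = "F N N" and ?L = "Qw N \<odot> g"
 have L: "idl ?L" by (rule ip_idl[OF Qw_idl g_idl])
 have u: "one_param (zemb k) N = crs N (\<Gamma> k)"
 proof -
  have "nat (zemb k N) = k mod p ^ N" unfolding zemb_def by (metis nat_int of_nat_mod of_nat_power)
  then show ?thesis unfolding one_param_def by (simp add: crs_\<Gamma>_mod)
 qed
 have cz: "cop (pr z) ?f"
 proof -
  let ?k = "(p ^ N - 1) * k"
  \<comment> \<open>An inverse of z modulo the level, glued from an inverse of
    \<open>\<Gamma> k\<close> at P and from 1 at the complement.\<close>
  obtain b where b: "integral b" "b - \<Gamma> ?k : Pw N" "b - 1 : ?L"
   using chinese[OF Pw_idl L cop_Pw_rest \<Gamma>_int integral_01(2)] by blast
  have "b * (z - \<Gamma> k) + \<Gamma> k * (b - \<Gamma> ?k) + (\<Gamma> k * \<Gamma> ?k - 1) : Pw N"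
   by (rule Pw_add[OF Pw_add[OF Pw_scale[OF b(1) z(3)] Pw_scale[OF \<Gamma>_int b(2)]] \<Gamma>_inverse])
  then have 1: "z * b - 1 : Pw N" by (simp add: algebra_simps)
  have "b * (z - 1) + (b - 1) : ?L" by (rule omodD(2)[OF omodI[OF L] omodD(3)[OF omodI[OF L] b(1) z(4)] b(3)])
  then have "z * b - 1 : ?L" by (simp add: algebra_simps)
  then show ?thesis using cop_pr[OF F_idl z(1)] PL_mem[OF 1] b(1) by blast
 qed
 have cl: "ray_principal ?f #>\<^bsub>ray_ideals ?f\<^esub> (PIdl\<^bsub>OK\<^esub> a) = cls ?f (pr a)" for a
  unfolding cls_def S_eq[OF F_idl] ray_ideals_eq[OF F_idl] r_coset_def PIdl_eq by simp
 have "(THE c. \<exists>L \<alpha>. ideal L OK & ?f = ideal_prod OK (ideal_power P (ideal_val P ?f)) L &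
  \<alpha> : carrier OK & \<alpha> ~= 0 & \<alpha> : one_param (zemb k) (ideal_val P ?f) & \<alpha> - 1 : L &
  c = ray_principal ?f #>\<^bsub>ray_ideals ?f\<^esub> (PIdl\<^bsub>OK\<^esub> \<alpha>)) = cls ?f (pr z)"
  unfolding val_F u cl
 proof (rule the_equality)
  show "\<exists>L \<alpha>. ideal L OK & ?f = ideal_prod OK (Pw N) L & \<alpha> : carrier OK & \<alpha> ~= 0 & \<alpha> : crs N (\<Gamma> k) &
    \<alpha> - 1 : L & cls ?f (pr z) = cls ?f (pr \<alpha>)"
   using L z by (intro exI[of _ ?L] exI[of _ z]) (simp add: ideal_iff F_def carrier_OK crs_def)
  fix c assume "\<exists>L \<alpha>. ideal L OK & ?f = ideal_prod OK (Pw N) L & \<alpha> : carrier OK & \<alpha> ~= 0 &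
    \<alpha> : crs N (\<Gamma> k) & \<alpha> - 1 : L & c = cls ?f (pr \<alpha>)"
  then obtain L a where a: "idl L" "Pw N \<odot> ?L = Pw N \<odot> L" "integral a" "a ~= 0" "a - \<Gamma> k : Pw N" "a - 1 : L" "c = cls ?f (pr a)"
   unfolding ideal_iff F_def carrier_OK crs_def by auto
  have LL: "?L = L" by (rule fid_cancel[OF Pw_fid omodI[OF L] omodI[OF a(1)] a(2)])
  have 1: "z - a : Pw N" using Pw_diff[OF z(3) a(5)] by simp
  have "(z - 1) - (a - 1) : ?L" by (rule omodD(5)[OF omodI[OF L] z(4)]) (use a(6) LL in simp)
  then have "z - a : ?f" using PL_mem[OF 1] by simp
  then show "c = cls ?f (pr z)" unfolding a(7) using cls_pr_eq[OF F_idl z(1,2) a(3,4) cz] by simp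
 qed
 then show ?thesis unfolding local_unit_map_def using F_moduli by simp
qed

lemma Pw_anti: assumes "m <= n" shows "Pw n \<subseteq> Pw m"
proof -
 obtain k where "n = m + k" using assms by (auto simp: le_iff_add)
 then show ?thesis using ideal_power_add[OF P_idl, of m k] ip_sub(2)[OF Pw_idl[of k] omodI[OF Pw_idl[of m]]] by simp
qed

text \<open>z is replaced first by a rational integer y, by residue degree one, and then by a power
  of 1 + p^2. Of the constant n0 + 2, the 2 is the starting precision of \<open>int_log\<close> and
  n0 comes from the germs in \<open>lie_points\<close>.\<close>

lemma lie_approx:
 assumes H: "adapted_Zp_subgroup p g P H"
 shows "\<exists>c. \<forall>m N z. integral z --> z ~= 0 --> z - 1 : Pw (m + c) --> z - 1 : Qw N \<odot> g -->
  (\<exists>a\<in>pwr H m. a (Pw N \<odot> (Qw N \<odot> g)) = cls (Pw N \<odot> (Qw N \<odot> g)) (pr z))"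
proof -
 obtain n0 where n0: "!!m e. local_unit_map p g P (one_param (zemb (p ^ (n0 + m) * e))) : pwr H m"
  using lie_points[OF H] by blast
 have "\<exists>a\<in>pwr H m. a (Pw N \<odot> (Qw N \<odot> g)) = cls (Pw N \<odot> (Qw N \<odot> g)) (pr z)"
  if z: "integral z" "z ~= 0" "z - 1 : Pw (m + (n0 + 2))" "z - 1 : Qw N \<odot> g" for m N z
 proof -
  \<comment> \<open>The precision serves two purposes: the class at level N, and the congruence of y
    to 1 that \<open>int_log\<close> starts from.\<close>
  let ?M = "max N (m + (n0 + 2))"
  obtain y where y: "z - of_int y : Pw ?M" using int_residue_power[OF z(1)] by blast
  have yN: "z - of_int y : Pw N" and ym: "z - of_int y : Pw (m + (n0 + 2))" using y Pw_anti[of N ?M] Pw_anti[of "m + (n0 + 2)" ?M] by (simp_all only: max.cobounded1 max.cobounded2 subset_iff)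
  have "(z - 1) - (z - of_int y) : Pw (m + (n0 + 2))" by (rule Pw_diff[OF z(3) ym])
  then have "of_int (y - 1) : Pw (m + (n0 + 2))" by simp
  then have "int p ^ (n0 + m + 2) dvd y - 1" unfolding int_mem_power_iff by (simp add: add_ac)
  then obtain e where e: "int p ^ N dvd (1 + (int p)\<^sup>2) ^ (p ^ (n0 + m) * e) - y" using int_log[OF p] by blast
  then have "of_int ((1 + (int p)\<^sup>2) ^ (p ^ (n0 + m) * e) - y) : Pw N" unfolding int_mem_power_iff .
  then have "\<Gamma> (p ^ (n0 + m) * e) - of_int y : Pw N" unfolding \<Gamma>_def of_int_diff .
  with yN have "(z - of_int y) - (\<Gamma> (p ^ (n0 + m) * e) - of_int y) : Pw N" by (rule Pw_diff)
  then have "z - \<Gamma> (p ^ (n0 + m) * e) : Pw N" by simp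
  from local_unit_map_value[OF z(1,2) this z(4)] show ?thesis unfolding F_def using n0 by blast
 qed
 then show ?thesis by blast
qed

text \<open>At each level an element of the kernel is the class of a number y close to 1 at both
  primes. The Chinese remainder theorem splits y into z1, which carries its part at P, and z2, which
  carries its part at Pb; \<open>lie_approx\<close> places each in its filtration, and closedness of
  the product of filtrations handles all levels together.\<close>

lemma kernel_product:
 assumes H1: "adapted_Zp_subgroup p g P H1" and H2: "adapted_Zp_subgroup p g Pb H2"
 shows "\<exists>c. \<forall>m n x. x : RC --> x (F (m + c) (n + c)) = S (F (m + c) (n + c)) -->
  (\<exists>a\<in>pwr H1 m. \<exists>b\<in>pwr H2 n. x = a \<cdot> b)"
proof -
 interpret G: comm_group RG by (rule RG_group)
 have sg: "subgroup H1 RG" "subgroup H2 RG" and cl: "closedin RT H1" "closedin RT H2"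
  using H1 H2 unfolding adapted_Zp_subgroup_def by blast+
 have sF: "Qw N \<odot> (Pw M \<odot> g) = F M N" for M N unfolding F_def by (rule ip_lcomm)
 have sF': "Pw M \<odot> (Qw N \<odot> g) = F M N" for M N unfolding F_def ..
 obtain c1 where "\<forall>m N z. integral z --> z ~= 0 --> z - 1 : Pw (m + c1) --> z - 1 : Qw N \<odot> g -->
  (\<exists>a\<in>pwr H1 m. a (F N N) = cls (F N N) (pr z))" using lie_approx[OF H1, unfolded sF'] by (elim exE)
 then have c1: "!!m N z. integral z ==> z ~= 0 ==> z - 1 : Pw (m + c1) ==> z - 1 : Qw N \<odot> g ==>
  \<exists>a\<in>pwr H1 m. a (F N N) = cls (F N N) (pr z)" by simp
 obtain c2 where "\<forall>m N z. integral z --> z ~= 0 --> z - 1 : Qw (m + c2) --> z - 1 : Pw N \<odot> g -->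
  (\<exists>a\<in>pwr H2 m. a (F N N) = cls (F N N) (pr z))"
  using split_quad.lie_approx[OF swap H2, unfolded sF] by (elim exE)
 then have c2: "!!m N z. integral z ==> z ~= 0 ==> z - 1 : Qw (m + c2) ==> z - 1 : Pw N \<odot> g ==>
  \<exists>a\<in>pwr H2 m. a (F N N) = cls (F N N) (pr z)" by simp
 note Qw_anti = split_quad.Pw_anti[OF swap]
 \<comment> \<open>The successor makes both exponents in \<open>F (m + c) (n + c)\<close> positive,
   so that P and Pb divide it and coprimality to it extends to all higher levels.\<close>
 define c where "c = Suc (max c1 c2)"
 have cle: "c1 <= c" "c2 <= c" unfolding c_def by auto
 have "\<exists>a\<in>pwr H1 m. \<exists>b\<in>pwr H2 n. x = a \<cdot> b"
  if x: "x : RC" and x0: "x (F (m + c) (n + c)) = S (F (m + c) (n + c))" for m n x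
 proof (rule level_group.ppow_product_closed[OF RG_level cl U_separated x])
  fix N
  let ?fa = "F (m + c) (n + c)"
  define N0 where "N0 = max N (max (m + c) (n + c))"
  let ?f = "F N0 N0"
  have le: "N <= N0" "m + c <= N0" "n + c <= N0" "1 <= N0" unfolding N0_def c_def by auto
  have d: "ideal_dvd ?fa ?f" using F_dvd le by blast
  have sub: "?f \<subseteq> ?fa" by (rule ideal_dvd_sub[OF F_idl d])
  obtain M where M: "M : rid ?f" "x ?f = cls ?f M" using RG_comp[OF x F_moduli] Gr_carrier[OF F_idl] by blast
  have "cls ?fa M = S ?fa"
   using RG_proj[OF x F_moduli F_moduli d] x0 ray_proj_cls[OF F_idl F_idl sub M(1)] M(2) by simp
  moreover have "ZK : rid ?fa" using subgroup.one_closed[OF rid_subgroup[OF F_idl]] by simp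
  moreover have M0: "M : rid ?fa" using rid_mono[OF sub] M(1) by blast
  ultimately obtain h where h: "h : S ?fa" "M = h \<odot> ZK"
   using cls_eq_iff[OF F_idl M0] cls_ZK[OF F_idl] by metis
  then have "M : S ?fa" using ip_one(2) S_rid[OF F_idl] rid_fid unfolding fid_def by (metis subsetD)
  then obtain a b where ab: "M = pr (a / b)" "integral a" "integral b" "a ~= 0" "b ~= 0"
    "cop (pr a) ?fa" "cop (pr b) ?fa" "a - b : ?fa" unfolding S_def by blast
  have cf: "cop I ?f" if I: "idl I" "cop I ?fa" for I
  proof -
   have s: "?fa \<subseteq> P" "?fa \<subseteq> Pb" "?fa \<subseteq> g"
   proof -
    have "1 <= m + c" "1 <= n + c" unfolding c_def by auto
    then have "Pw (m + c) \<subseteq> Pw 1" "Qw (n + c) \<subseteq> Qw 1" using Pw_anti Qw_anti by simp_all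
    moreover have "Pw 1 = P" "Qw 1 = Pb"
     using ip_one(1)[OF omodI[OF P_idl]] ip_one(1)[OF omodI[OF Pb_idl]] by (simp_all add: ideal_power_simps)
    moreover have "?fa \<subseteq> Pw (m + c)" "?fa \<subseteq> Qw (n + c) \<odot> g"
     unfolding F_def using ip_sub(2)[OF ip_idl[OF Qw_idl g_idl] omodI[OF Pw_idl]] ip_sub(1)[OF Pw_idl omodI[OF ip_idl[OF Qw_idl g_idl]]] by blast+
    moreover have "Qw (n + c) \<odot> g \<subseteq> Qw (n + c)" "Qw (n + c) \<odot> g \<subseteq> g"
     using ip_sub(2)[OF g_idl omodI[OF Qw_idl]] ip_sub(1)[OF Qw_idl omodI[OF g_idl]] by blast+
    ultimately show "?fa \<subseteq> P" "?fa \<subseteq> Pb" "?fa \<subseteq> g" by blast+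
   qed
   have "cop I P" "cop I Pb" "cop I g" using cop_mono[OF I(2) order.refl] s by blast+
   then show ?thesis unfolding F_def
    using cop_mult[OF I(1) Pw_idl ip_idl[OF Qw_idl g_idl] cop_power[OF I(1) P_idl] cop_mult[OF I(1) Qw_idl g_idl cop_power[OF I(1) Pb_idl]]] by blast
  qed
  have ca: "cop (pr a) ?f" and cb: "cop (pr b) ?f" using cf[OF pr_idl] ab by blast+
  obtain b' where b': "integral b'" "b * b' - 1 : ?f" using cb cop_pr[OF F_idl ab(3)] by blast
  have mf: "omod ?f" "omod ?fa" using omodI[OF F_idl] by blast+
  \<comment> \<open>An integral number congruent to a / b modulo \<open>?f\<close>, in place of the
    fraction.\<close>
  define y where "y = a * b'"
  have iy: "integral y" unfolding y_def by (rule integral_mult[OF ab(2) b'(1)])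
  have "b' * (a - b) + (b * b' - 1) : ?fa"
   using omodD(2)[OF mf(2) omodD(3)[OF mf(2) b'(1) ab(8)]] b'(2) sub by blast
  then have y1: "y - 1 : ?fa" unfolding y_def by (simp add: algebra_simps)
  have "a * (b * b' - 1) : ?f" by (rule omodD(3)[OF mf(1) ab(2) b'(2)])
  then have yb: "y * b - a : ?f" unfolding y_def by (simp add: algebra_simps)
  have L: "idl (Qw k \<odot> g)" "idl (Pw k \<odot> g)" for k using ip_idl Qw_idl Pw_idl g_idl by blast+
  have f0P: "?fa \<subseteq> Pw (m + c)" "?fa \<subseteq> Qw (n + c)" "?fa \<subseteq> g"
  proof -
   show "?fa \<subseteq> Pw (m + c)" unfolding F_def by (rule ip_sub(2)[OF L(1) omodI[OF Pw_idl]])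
   have 1: "?fa \<subseteq> Qw (n + c) \<odot> g" unfolding F_def by (rule ip_sub(1)[OF Pw_idl omodI[OF L(1)]])
   show "?fa \<subseteq> Qw (n + c)" by (rule order_trans[OF 1 ip_sub(2)[OF g_idl omodI[OF Qw_idl]]])
   show "?fa \<subseteq> g" by (rule order_trans[OF 1 ip_sub(1)[OF Qw_idl omodI[OF g_idl]]])
  qed
  have nz: "z ~= 0" if "z - 1 : Q" "Q \<subseteq> P \<or> Q \<subseteq> Pb" for z Q
  proof
   assume "z = 0"
   then have "- 1 : P \<or> - 1 : Pb" using that by auto
   then have "1 : P \<or> 1 : Pb" using omodD(4)[OF omodI[OF P_idl], of "- 1"] omodD(4)[OF omodI[OF Pb_idl], of "- 1"] by auto
   then show False using prime_facts(3) by blast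
  qed
  have PwP: "Pw k \<subseteq> P" and QwP: "Qw k \<subseteq> Pb" if "1 <= k" for k
  proof -
   have "Pw 1 = P" "Qw 1 = Pb"
    using ip_one(1)[OF omodI[OF P_idl]] ip_one(1)[OF omodI[OF Pb_idl]] by (simp_all add: ideal_power_simps)
   then show "Pw k \<subseteq> P" "Qw k \<subseteq> Pb" using Pw_anti[OF that] Qw_anti[OF that] by simp_all
  qed
  obtain z1 where z1: "integral z1" "z1 - y : Pw N0" "z1 - 1 : Qw N0 \<odot> g"
   using chinese[OF Pw_idl L(1) cop_Pw_rest iy integral_01(2)] by blast
  obtain z2 where z2: "integral z2" "z2 - y : Qw N0" "z2 - 1 : Pw N0 \<odot> g"
   using chinese[OF Qw_idl L(2) split_quad.cop_Pw_rest[OF swap] iy integral_01(2)] by blast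
  have z1L: "z1 - 1 : Qw N0" "z1 - 1 : g"
   using z1(3) ip_sub(2)[OF g_idl omodI[OF Qw_idl]] ip_sub(1)[OF Qw_idl omodI[OF g_idl]] by blast+
  have z2L: "z2 - 1 : Pw N0" "z2 - 1 : g"
   using z2(3) ip_sub(2)[OF g_idl omodI[OF Pw_idl]] ip_sub(1)[OF Pw_idl omodI[OF g_idl]] by blast+
  have nz1: "z1 ~= 0" by (rule nz[OF z1L(1)]) (use QwP[OF le(4)] in blast)
  have nz2: "z2 ~= 0" by (rule nz[OF z2L(1)]) (use PwP[OF le(4)] in blast)
  have "(z1 - y) + (y - 1) : Pw (m + c)"
   using Pw_add[of "z1 - y" "m + c" "y - 1"] z1(2) Pw_anti[OF le(2)] f0P(1) y1 by blast
  then have "z1 - 1 : Pw (m + c1)" using Pw_anti[of "m + c1" "m + c"] cle by auto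
  then obtain \<alpha> where \<alpha>: "\<alpha> : pwr H1 m" "\<alpha> ?f = cls ?f (pr z1)"
   using c1[OF z1(1) nz1 _ z1(3)] by blast
  have "(z2 - y) + (y - 1) : Qw (n + c)"
   using omodD(2)[OF omodI[OF Qw_idl], of "z2 - y" "n + c" "y - 1"] z2(2) Qw_anti[OF le(3)] f0P(2) y1 by blast
  then have "z2 - 1 : Qw (n + c2)" using Qw_anti[of "n + c2" "n + c"] cle by auto
  then obtain \<beta> where \<beta>: "\<beta> : pwr H2 n" "\<beta> ?f = cls ?f (pr z2)"
   using c2[OF z2(1) nz2 _ z2(3)] by blast
  have i12: "integral (z1 * z2)" by (rule integral_mult[OF z1(1) z2(1)])
  have "z1 * (z2 - 1) + (z1 - y) : Pw N0" by (rule Pw_add[OF Pw_scale[OF z1(1) z2L(1)] z1(2)])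
  then have e1: "z1 * z2 - y : Pw N0" by (simp add: algebra_simps)
  have "z2 * (z1 - 1) + (z2 - y) : Qw N0"
   by (rule omodD(2)[OF omodI[OF Qw_idl] omodD(3)[OF omodI[OF Qw_idl] z2(1) z1L(1)] z2(2)])
  then have e2: "z1 * z2 - y : Qw N0" by (simp add: algebra_simps)
  have "z1 * (z2 - 1) + (z1 - 1) - (y - 1) : g"
   by (rule omodD(5)[OF omodI[OF g_idl] omodD(2)[OF omodI[OF g_idl] omodD(3)[OF omodI[OF g_idl] z1(1) z2L(2)] z1L(2)]])
    (use f0P(3) y1 in blast)
  then have e3: "z1 * z2 - y : g" by (simp add: algebra_simps)
  \<comment> \<open>The congruences at P, at Pb and at g combine, the three factors being pairwise
    coprime.\<close>
  have zy: "z1 * z2 - y : ?f" by (rule PL_mem[OF e1 cop_inter[OF Qw_idl g_idl cop_Qw_g e2 e3]])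
  have "b * (z1 * z2 - y) + (y * b - a) : ?f" by (rule omodD(2)[OF mf(1) omodD(3)[OF mf(1) ab(3) zy] yb])
  then have zb: "z1 * z2 * b - a : ?f" by (simp add: algebra_simps)
  then have "- (z1 * z2 * b - a) : ?f" by (rule omodD(4)[OF mf(1)])
  then have az: "a - z1 * z2 * b : ?f" by simp
  have i12b: "integral (z1 * z2 * b)" by (rule integral_mult[OF i12 ab(3)])
  have c12b: "cop (pr (z1 * z2 * b)) ?f" by (rule cop_pr_cong[OF F_idl ab(2) i12b ca az])
  have cc: "cop (pr z1) ?f" "cop (pr z2) ?f" "cop (pr (z1 * z2)) ?f"
  proof -
   obtain e where e: "integral e" "z1 * z2 * b * e - 1 : ?f" using c12b cop_pr[OF F_idl i12b] by blast
   have "z1 * (z2 * b * e) - 1 : ?f" "z2 * (z1 * b * e) - 1 : ?f" "z1 * z2 * (b * e) - 1 : ?f" using e(2) by (simp_all add: mult_ac)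
   then show "cop (pr z1) ?f" "cop (pr z2) ?f" "cop (pr (z1 * z2)) ?f"
    using cop_pr[OF F_idl] z1(1) z2(1) i12 ab(3) e(1) integral_mult by metis+
  qed
  have "(\<alpha> \<cdot> \<beta>) ?f = cls ?f (pr (z1 * z2))"
   unfolding RG_mult_comp[OF F_moduli] \<alpha>(2) \<beta>(2)
    Gr_mult[OF F_idl pr_rid[OF F_idl z1(1) nz1 cc(1)] pr_rid[OF F_idl z2(1) nz2 cc(2)]] ip_pr_pr ..
  also have "\<dots> = cls ?f M"
  proof -
   have nz12: "z1 * z2 ~= 0" "z1 * z2 * b ~= 0" using nz1 nz2 ab(5) by auto
   have "pr (a / (z1 * z2 * b)) : S ?f" by (rule S_I[OF ab(2) i12b ab(4) nz12(2) ca c12b az])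
   moreover have "M = pr (a / (z1 * z2 * b)) \<odot> pr (z1 * z2)"
    unfolding ab(1) ip_pr_pr using nz12 ab(5) by (simp add: field_simps)
   ultimately show ?thesis using cls_eq_iff[OF F_idl M(1) pr_rid[OF F_idl i12 nz12(1) cc(3)]] by metis
  qed
  finally have e: "(\<alpha> \<cdot> \<beta>) ?f = x ?f" unfolding M(2) .
  have "\<alpha> \<cdot> \<beta> : RC" using ppow_RG(1)[OF sg(1) \<alpha>(1)] ppow_RG(1)[OF sg(2) \<beta>(1)] by simp
  then obtain u where "u : U N0" "x = \<alpha> \<cdot> \<beta> \<cdot> u" using U_coset[OF _ x] e by blast
  then show "\<exists>a\<in>pwr H1 m. \<exists>b\<in>pwr H2 n. \<exists>u\<in>U N. x = a \<cdot> b \<cdot> u"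
   using \<alpha>(1) \<beta>(1) U_anti[OF le(1)] by blast
 qed
 then show ?thesis by blast
qed

end

section \<open>Ray class distributions\<close>

context split_quad begin

lemma Gr_fin: "f : Md ==> finite (carrier (Gr f))" using Gr_finite unfolding moduli_iff by blast

lemma PT_compact: "compact_space PT"
 unfolding compact_space_product_topology using Gr_fin by (simp add: compact_space_discrete_topology)

lemma topspace_PT: "topspace PT = (\<Pi>\<^sub>E f\<in>Md. carrier (Gr f))" by simp

text \<open>A class at level \<open>f\<close> all of whose fibres at higher levels are non-empty lifts to the limit, by
 compactness. So surjectivity of the transition maps is not needed: a class that does not lift has
 an empty fibre, and distribution relations make its coefficient vanish.\<close>

lemma lift_or_empty_fibre:
 assumes f: "f : Md" and c: "c : carrier (Gr f)" and no: "!!x. x : RC ==> x f ~= c"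
 shows "\<exists>m. ideal_dvd f (F m m) & {c' : carrier (Gr (F m m)). ray_proj f c' = c} = {}"
proof (rule ccontr)
 assume neg: "~ ?thesis"
 obtain n0 where n0: "!!m. m >= n0 ==> ideal_dvd f (F m m)" using dvd_level[OF f] by blast
 have ne: "\<exists>c'. c' : carrier (Gr (F (n0 + N) (n0 + N))) & ray_proj f c' = c" for N
  using neg n0[of "n0 + N"] by auto
 \<comment> \<open>Compatibility is imposed only among moduli dividing one diagonal level. This is a
   closed condition, and the projections of a single class at that level meet it.\<close>
 define R where "R x N \<longleftrightarrow> (\<forall>f'\<in>Md. \<forall>f''\<in>Md. ideal_dvd f'' (F (n0 + N) (n0 + N)) -->
   ideal_dvd f' f'' --> ray_proj f' (x f'') = x f')" for x N
 define C where "C N = {x : topspace PT. x f = c & R x N}" for N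
 have "(\<Inter>N. C N) ~= {}"
 proof (rule compact_space_imp_nest[OF PT_compact])
  show "closedin PT (C N)" for N unfolding closedin_def
  proof (intro conjI)
   show "C N \<subseteq> topspace PT" unfolding C_def by blast
   show "openin PT (topspace PT - C N)"
   proof (subst openin_subopen, intro ballI)
    fix x assume "x : topspace PT - C N"
    then have x: "x : topspace PT" "x \<notin> C N" by blast+
    show "\<exists>W. openin PT W & x : W & W \<subseteq> topspace PT - C N"
    proof (cases "x f = c")
     case False
     let ?W = "{y : topspace PT. y f : {x f}}"
     have "?W \<subseteq> topspace PT - C N" using False unfolding C_def by blast
     then show ?thesis using fiber_open[OF f, of "{x f}"] x(1) by (intro exI[of _ ?W]) simp
    next
     case True
     then have "~ R x N" using x unfolding C_def by blast
     then obtain f' f'' where ff: "f' : Md" "f'' : Md" "ideal_dvd f'' (F (n0 + N) (n0 + N))"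
       "ideal_dvd f' f''" "ray_proj f' (x f'') ~= x f'" unfolding R_def by meson
     let ?W = "{y : topspace PT. y f' : {x f'}} \<inter> {y : topspace PT. y f'' : {x f''}}"
     have "openin PT ?W" by (intro openin_Int fiber_open ff)
     moreover have "?W \<subseteq> topspace PT - C N"
     proof
      fix y assume y: "y : ?W"
      have "~ R y N"
      proof
       assume "R y N"
       then have "ray_proj f' (y f'') = y f'" using ff unfolding R_def by meson
       then show False using y ff(5) by simp
      qed
      then show "y : topspace PT - C N" using y unfolding C_def by blast
     qed
     ultimately show ?thesis using x(1) by (intro exI[of _ ?W]) simp
    qed
   qed
  qed
  show "C N ~= {}" for N
  proof -
   let ?F = "F (n0 + N) (n0 + N)"
   obtain c' where c': "c' : carrier (Gr ?F)" "ray_proj f c' = c" using ne by blast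
   \<comment> \<open>Moduli that do not divide the level receive the unit as a default, since
     \<open>R x N\<close> says nothing about them.\<close>
   define x where "x = (\<lambda>f'\<in>Md. if ideal_dvd f' ?F then ray_proj f' c' else \<one>\<^bsub>Gr f'\<^esub>)"
   have "x f' : carrier (Gr f')" if f': "f' : Md" for f'
    using proj_closed(1)[OF f' F_moduli _ c'(1)] monoid.one_closed[OF group.is_monoid[OF Gr_grp[OF f']]] f'
    unfolding x_def by simp
   then have "x : topspace PT" unfolding topspace_PT by (simp add: PiE_iff x_def)
   moreover have "x f = c" unfolding x_def using f n0[of "n0 + N"] c'(2) by simp
   moreover have "R x N" unfolding R_def
   proof (intro ballI impI)
    fix f' f'' assume ff: "f' : Md" "f'' : Md" "ideal_dvd f'' ?F" "ideal_dvd f' f''"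
    have "ideal_dvd f' ?F" by (rule ideal_dvd_trans[OF ff(4,3)])
    then show "ray_proj f' (x f'') = x f'"
     unfolding x_def using ff proj_closed(3)[OF ff(2) F_moduli ff(3) c'(1) ff(1,4)] by simp
   qed
   ultimately have "x : C N" unfolding C_def by blast
   then show ?thesis by blast
  qed
  show "decseq C" unfolding decseq_def
  proof (intro allI impI subsetI)
   fix N N' x assume N: "N <= N'" and x: "x : C N'"
   have d: "ideal_dvd (F (n0 + N) (n0 + N)) (F (n0 + N') (n0 + N'))" by (rule F_dvd) (use N in auto)
   have "R x N" unfolding R_def
   proof (intro ballI impI)
    fix f' f'' assume ff: "f' : Md" "f'' : Md" "ideal_dvd f'' (F (n0 + N) (n0 + N))" "ideal_dvd f' f''"
    have "R x N'" using x unfolding C_def by blast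
    then show "ray_proj f' (x f'') = x f'" unfolding R_def using ff ideal_dvd_trans[OF ff(3) d] by meson
   qed
   then show "x : C N" using x unfolding C_def by blast
  qed
 qed
 then obtain x where x: "!!N. x : C N" by blast
 have "x : RC" unfolding RG_carrier
 proof (intro conjI ballI impI)
  show "x : (\<Pi>\<^sub>E f\<in>Md. carrier (Gr f))" using x[of 0] unfolding C_def topspace_PT by blast
  fix f' f'' assume ff: "f' : Md" "f'' : Md" "ideal_dvd f' f''"
  obtain n where n: "\<forall>m\<ge>n. ideal_dvd f'' (F m m)" using dvd_level[OF ff(2)] by blast
  have "R x n" using x[of n] unfolding C_def by blast
  moreover have "ideal_dvd f'' (F (n0 + n) (n0 + n))" using n by simp
  ultimately show "ray_proj f' (x f'') = x f'" unfolding R_def using ff by meson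
 qed
 moreover have "x f = c" using x[of 0] unfolding C_def by blast
 ultimately show False using no by blast
qed

text \<open>The classes that lift to the limit; sums over a level are restricted to them, so that
  every term has a point of the limit attached.\<close>

definition Im :: "nat => 'k set set set" where "Im n = (%x. x (F n n)) ` RC"
definition lift :: "nat => 'k set set => 'k set => 'k set set" where
 "lift n c = (SOME x. x : RC & x (F n n) = c)"
definition unif :: "nat => (('k set => 'k set set) => 'e) => bool" where
 "unif n ph \<longleftrightarrow> (\<forall>x\<in>RC. \<forall>y\<in>RC. x (F n n) = y (F n n) --> ph x = ph y)"

lemma lift: assumes "c : Im n" shows "lift n c : RC" "lift n c (F n n) = c"
proof -
 have "\<exists>x. x : RC & x (F n n) = c" using assms unfolding Im_def by blast
 from someI_ex[OF this] show "lift n c : RC" "lift n c (F n n) = c" unfolding lift_def by auto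
qed

lemma Im_carrier: "Im n \<subseteq> carrier (Gr (F n n))" unfolding Im_def using RG_comp[OF _ F_moduli] by blast
lemma Im_finite: "finite (Im n)" by (rule finite_subset[OF Im_carrier Gr_fin[OF F_moduli]])

lemma unif_D: "unif n ph ==> x : RC ==> y : RC ==> x (F n n) = y (F n n) ==> ph x = ph y" unfolding unif_def by blast

lemma unif_mono: assumes "unif n ph" "n <= m" shows "unif m ph" unfolding unif_def
proof (intro ballI impI)
 fix x y assume xy: "x : RC" "y : RC" "x (F m m) = y (F m m)"
 have "x (F n n) = y (F n n)" by (rule level_determines[OF xy F_moduli F_dvd[OF assms(2,2)]])
 then show "ph x = ph y" by (rule unif_D[OF assms(1) xy(1,2)])
qed

lemma LC_unif: assumes "ph : LC RT" shows "\<exists>n. unif n ph"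
proof -
 obtain n where n: "\<forall>x\<in>RC. \<forall>u\<in>U n. ph (x \<cdot> u) = ph x"
  using level_group.LC_uniform[OF RG_level assms] by blast
 have "ph x = ph y" if xy: "x : RC" "y : RC" "x (F n n) = y (F n n)" for x y
 proof -
  obtain u where "u : U n" "y = x \<cdot> u" using U_coset[OF xy(1,2)] xy(3) by blast
  then show ?thesis using n xy(1) by simp
 qed
 then show ?thesis unfolding unif_def by blast
qed

lemma fibre_LC:
 assumes f: "f : Md"
 shows "(indicator {x : RC. x f = c} :: _ => 'e::field) : LC RT"
  and "ideal_dvd f (F n n) ==> unif n (indicator {x : RC. x f = c} :: _ => 'e)"
proof -
 have *: "unif n (indicator {x : RC. x f = c} :: _ => 'e)" if d: "ideal_dvd f (F n n)" for n unfolding unif_def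
 proof (intro ballI impI)
  fix x y assume xy: "x : RC" "y : RC" "x (F n n) = y (F n n)"
  have "x f = y f" by (rule level_determines[OF xy f d])
  then show "(indicator {x : RC. x f = c} x :: 'e) = indicator {x : RC. x f = c} y"
   using xy(1,2) by (simp add: indicator_def)
 qed
 then show "ideal_dvd f (F n n) ==> unif n (indicator {x : RC. x f = c} :: _ => 'e)" .
 interpret G: comm_group RG by (rule RG_group)
 obtain n where n: "\<forall>m\<ge>n. ideal_dvd f (F m m)" using dvd_level[OF f] by blast
 show "(indicator {x : RC. x f = c} :: _ => 'e) : LC RT"
 proof (rule level_group.LC_I[OF RG_level])
  show "(indicator {x : RC. x f = c} x :: 'e) = 0" if "x \<notin> RC" for x using that by (simp add: indicator_def)
  fix x assume x: "x : RC"
  have "(indicator {x : RC. x f = c} (x \<cdot> u) :: 'e) = indicator {x : RC. x f = c} x" if u: "u : U n" for u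
  proof -
   have xu: "x \<cdot> u : RC" using x u unfolding U_def by simp
   have "x (F n n) = (x \<cdot> u) (F n n)" using U_coset[OF x xu] u by blast
   from unif_D[OF *[of n] x xu this] n show ?thesis by simp
  qed
  then show "\<exists>n. \<forall>u\<in>U n. (indicator {x : RC. x f = c} (x \<cdot> u) :: 'e) = indicator {x : RC. x f = c} x" by blast
 qed
qed

end

locale ray_distribution = split_quad w d p P Pb g + valued_field v + vector_space smul
 for w :: "'k::field_char_0" and d :: int and p :: nat and P Pb g :: "'k set"
  and v :: "'e::field_char_0 => ereal" and smul :: "'e => 'v::ab_group_add => 'v" +
 fixes \<alpha> \<alpha>b :: 'e and \<Theta> :: "'k set => 'k set set => 'v"
 assumes rcd: "ray_class_distribution p P Pb g v smul \<alpha> \<alpha>b \<Theta>"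
begin

text \<open>A class outside \<open>Im m\<close> has an empty fibre at some higher level by
  \<open>lift_or_empty_fibre\<close>, and the relation between these levels makes its coefficient an
  empty sum.\<close>

lemma distribution_relation:
 assumes f: "f : Md" and c: "c : carrier (Gr f)" and d: "ideal_dvd f (F m m)"
 shows "\<Theta> f c = (\<Sum>c'\<in>{c' : Im m. ray_proj f c' = c}. \<Theta> (F m m) c')"
proof -
 have rel: "\<Theta> f c = (\<Sum>c'\<in>{c' : carrier (Gr f'). ray_proj f c' = c}. \<Theta> f' c')"
  if "f : Md" "f' : Md" "ideal_dvd f f'" "c : carrier (Gr f)" for f f' c
  using rcd that unfolding ray_class_distribution_def by meson
 have zero: "\<Theta> (F m m) c' = 0" if c': "c' : carrier (Gr (F m m))" "c' \<notin> Im m" for c'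
 proof -
  have "\<exists>k. ideal_dvd (F m m) (F k k) & {a : carrier (Gr (F k k)). ray_proj (F m m) a = c'} = {}"
   by (rule lift_or_empty_fibre[OF F_moduli c'(1)]) (use c'(2) in \<open>auto simp: Im_def\<close>)
  then obtain k where
   k: "ideal_dvd (F m m) (F k k)" "{a : carrier (Gr (F k k)). ray_proj (F m m) a = c'} = {}" by blast
  show ?thesis unfolding rel[OF F_moduli F_moduli k(1) c'(1)] k(2) by simp
 qed
 have "\<Theta> f c = (\<Sum>c'\<in>{c' : carrier (Gr (F m m)). ray_proj f c' = c}. \<Theta> (F m m) c')"
  by (rule rel[OF f F_moduli d c])
 also have "\<dots> = (\<Sum>c'\<in>{c' : Im m. ray_proj f c' = c}. \<Theta> (F m m) c')"
 proof (rule sum.mono_neutral_right)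
  show "finite {c' : carrier (Gr (F m m)). ray_proj f c' = c}" using Gr_fin[OF F_moduli] by simp
  show "{c' : Im m. ray_proj f c' = c} \<subseteq> {c' : carrier (Gr (F m m)). ray_proj f c' = c}" using Im_carrier by blast
  show "\<forall>i\<in>{c' : carrier (Gr (F m m)). ray_proj f c' = c} - {c' : Im m. ray_proj f c' = c}. \<Theta> (F m m) i = 0"
  proof
   fix i assume "i : {c' : carrier (Gr (F m m)). ray_proj f c' = c} - {c' : Im m. ray_proj f c' = c}"
   then have "i : carrier (Gr (F m m))" "i \<notin> Im m" by blast+
   then show "\<Theta> (F m m) i = 0" by (rule zero)
  qed
 qed
 finally show ?thesis .
qed

definition lsum :: "nat => (('k set => 'k set set) => 'e) => 'v" where
 "lsum n ph = (\<Sum>c\<in>Im n. smul (ph (lift n c)) (\<Theta> (F n n) c))"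

text \<open>Finite additivity: the coefficient at level n is the sum over its fibre at level m,
  where ph takes one value.\<close>

lemma lsum_mono: assumes u: "unif n ph" and nm: "n <= m" shows "lsum n ph = lsum m ph"
proof -
 have d: "ideal_dvd (F n n) (F m m)" by (rule F_dvd[OF nm nm])
 have pl: "ray_proj (F n n) c' = lift m c' (F n n)" if "c' : Im m" for c'
  using RG_proj[OF lift(1)[OF that] F_moduli F_moduli d] lift(2)[OF that] by simp
 have im: "ray_proj (F n n) ` Im m \<subseteq> Im n" using pl lift(1) unfolding Im_def[of n] by auto
 have "smul (ph (lift n c)) (\<Theta> (F n n) c) = (\<Sum>c'\<in>{c' : Im m. ray_proj (F n n) c' = c}. smul (ph (lift m c')) (\<Theta> (F m m) c'))"
  if c: "c : Im n" for c
 proof -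
  have cc: "c : carrier (Gr (F n n))" using Im_carrier c by blast
  have "ph (lift n c) = ph (lift m c')" if c': "c' : Im m" "ray_proj (F n n) c' = c" for c'
   by (rule unif_D[OF u lift(1)[OF c] lift(1)[OF c'(1)]]) (simp add: lift(2)[OF c] pl[OF c'(1), symmetric] c'(2))
  then show ?thesis unfolding distribution_relation[OF F_moduli cc d] scale_sum_right by (intro sum.cong) auto
 qed
 then have "lsum n ph = (\<Sum>c\<in>Im n. \<Sum>c'\<in>{c' : Im m. ray_proj (F n n) c' = c}. smul (ph (lift m c')) (\<Theta> (F m m) c'))"
  unfolding lsum_def by (rule sum.cong[OF refl])
 also have "\<dots> = lsum m ph" unfolding lsum_def by (rule sum.group[OF Im_finite Im_finite im])
 finally show ?thesis .
qed

lemma lsum_indicator: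
 assumes f: "f : Md" and c: "c : carrier (Gr f)" and d: "ideal_dvd f (F n n)"
 shows "lsum n (indicator {x : RC. x f = c}) = \<Theta> f c"
proof -
 have "smul (indicator {x : RC. x f = c} (lift n c')) (\<Theta> (F n n) c') =
   (if ray_proj f c' = c then \<Theta> (F n n) c' else 0)" if c': "c' : Im n" for c'
  using RG_proj[OF lift(1)[OF c'] f F_moduli d] lift[OF c'] by (auto simp: indicator_def)
 then have "lsum n (indicator {x : RC. x f = c}) = (\<Sum>c'\<in>Im n. if ray_proj f c' = c then \<Theta> (F n n) c' else 0)"
  unfolding lsum_def by (rule sum.cong[OF refl])
 also have "\<dots> = (\<Sum>c'\<in>{c' : Im n. ray_proj f c' = c}. \<Theta> (F n n) c')" by (rule sum.inter_filter[symmetric, OF Im_finite])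
 finally show ?thesis unfolding distribution_relation[OF f c d] .
qed

abbreviation "Lc \<equiv> lc_functional p g smul \<Theta>"

text \<open>The definite description denotes the sum \<open>lsum\<close> at any level through which
  a function factors. Uniqueness holds because indicators of fibres span the locally constant
  functions.\<close>

lemma lc_functional_props:
 shows "linear_on (LC RT) smul Lc"
  and "f : Md ==> c : carrier (Gr f) ==> Lc (indicator {x : RC. x f = c}) = \<Theta> f c"
proof -
 interpret G: level_group RG RT U by (rule RG_level)
 define L where "L ph = (if ph : LC RT then lsum (SOME n. unif n ph) ph else 0)" for ph
 have L: "L ph = lsum n ph" if ph: "ph : LC RT" "unif n ph" for ph n
 proof -
  let ?m = "SOME n. unif n ph"
  have m: "unif ?m ph" by (rule someI[of "%n. unif n ph", OF ph(2)])
  have "lsum ?m ph = lsum (max ?m n) ph" by (rule lsum_mono[OF m]) simp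
  also have "\<dots> = lsum n ph" by (rule lsum_mono[OF ph(2), symmetric]) simp
  finally show ?thesis unfolding L_def using ph(1) by simp
 qed
 define Q where "Q L \<longleftrightarrow> linear_on (LC RT) smul L & (\<forall>ph. ph \<notin> LC RT --> L ph = 0) &
  (\<forall>f\<in>Md. \<forall>c\<in>carrier (Gr f). L (indicator {x : RC. x f = c}) = \<Theta> f c)" for L
 have lin: "linear_on (LC RT) smul L" unfolding linear_on_def
 proof (intro conjI ballI allI)
  fix f h :: "('k set => 'k set set) => 'e" assume fh: "f : LC RT" "h : LC RT"
  obtain a b where "unif a f" "unif b h" using LC_unif fh by blast
  then have u: "unif (max a b) f" "unif (max a b) h" using unif_mono max.cobounded1 max.cobounded2 by blast+
  then have "unif (max a b) (%x. f x + h x)" unfolding unif_def by metis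
  from L[OF G.LC_add[OF fh] this] L[OF fh(1) u(1)] L[OF fh(2) u(2)]
  show "L (%x. f x + h x) = L f + L h" by (simp add: lsum_def scale_left_distrib sum.distrib)
 next
  fix c and f :: "('k set => 'k set set) => 'e" assume f: "f : LC RT"
  obtain a where u: "unif a f" using LC_unif f by blast
  then have "unif a (%x. c * f x)" unfolding unif_def by metis
  from L[OF G.LC_scale[OF f] this] L[OF f u]
  show "L (%x. c * f x) = smul c (L f)" by (simp add: lsum_def scale_sum_right)
 qed
 have QL: "Q L" unfolding Q_def
 proof (intro conjI lin allI impI ballI)
  show "L ph = 0" if "ph \<notin> LC RT" for ph using that unfolding L_def by simp
  fix f c assume f: "f : Md" "c : carrier (Gr f)"
  obtain n where "\<forall>m\<ge>n. ideal_dvd f (F m m)" using dvd_level[OF f(1)] by blast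
  then have d: "ideal_dvd f (F n n)" by simp
  show "L (indicator {x : RC. x f = c}) = \<Theta> f c"
   unfolding L[OF fibre_LC(1)[OF f(1)] fibre_LC(2)[OF f(1) d]] by (rule lsum_indicator[OF f d])
 qed
 have val: "L' ph = (\<Sum>c\<in>Im n. smul (ph (lift n c)) (\<Theta> (F n n) c))"
  if Q: "Q L'" and ph: "ph : LC RT" "unif n ph" for L' ph n
 proof -
  let ?I = "%c. indicator {x : RC. x (F n n) = c} :: _ => 'e"
  have e: "ph = (%x. \<Sum>c\<in>Im n. ph (lift n c) * ?I c x)"
  proof
   fix x
   show "ph x = (\<Sum>c\<in>Im n. ph (lift n c) * ?I c x)"
   proof (cases "x : RC")
    case True
    have xi: "x (F n n) : Im n" unfolding Im_def using True by blast
    have "(\<Sum>c\<in>Im n. ph (lift n c) * ?I c x) = (\<Sum>c\<in>Im n. if x (F n n) = c then ph (lift n c) else 0)"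
     by (rule sum.cong) (use True in \<open>auto simp: indicator_def\<close>)
    also have "\<dots> = ph (lift n (x (F n n)))" using xi by (simp add: sum.delta' Im_finite)
    also have "\<dots> = ph x" by (rule unif_D[OF ph(2) lift(1)[OF xi] True lift(2)[OF xi]])
    finally show ?thesis by simp
   next
    case False
    then show ?thesis using G.LC_outside[OF ph(1) False] by simp
   qed
  qed
  have "L' (%x. \<Sum>c\<in>Im n. ph (lift n c) * ?I c x) = (\<Sum>c\<in>Im n. smul (ph (lift n c)) (L' (?I c)))"
  proof (rule linear_on_sum[OF _ vector_space_axioms G.LC_add G.LC_scale G.LC_zero Im_finite])
   show "linear_on (LC RT) smul L'" using Q unfolding Q_def by blast
   show "?I c : LC RT" for c by (rule fibre_LC(1)[OF F_moduli])
  qed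
  also have "\<dots> = (\<Sum>c\<in>Im n. smul (ph (lift n c)) (\<Theta> (F n n) c))"
  proof (rule sum.cong[OF refl])
   fix c assume "c : Im n"
   then have "c : carrier (Gr (F n n))" using Im_carrier by blast
   then have "L' (?I c) = \<Theta> (F n n) c" using Q F_moduli unfolding Q_def by blast
   then show "smul (ph (lift n c)) (L' (?I c)) = smul (ph (lift n c)) (\<Theta> (F n n) c)" by simp
  qed
  finally show ?thesis using e by simp
 qed
 have uniq: "L' = L" if Q: "Q L'" for L'
 proof
  fix ph
  show "L' ph = L ph"
  proof (cases "ph : LC RT")
   case True
   obtain n where n: "unif n ph" using LC_unif[OF True] by blast
   show ?thesis unfolding val[OF Q True n] val[OF QL True n] ..
  next
   case False
   then show ?thesis using Q QL unfolding Q_def by simp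
  qed
 qed
 have "Lc = (THE L. Q L)" unfolding lc_functional_def Q_def ..
 also have "\<dots> = L" by (rule the_equality[of Q, OF QL uniq])
 finally have "Q Lc" using QL by simp
 then show "linear_on (LC RT) smul Lc"
  and "f : Md ==> c : carrier (Gr f) ==> Lc (indicator {x : RC. x f = c}) = \<Theta> f c" unfolding Q_def by blast+
qed

text \<open>A lattice has finitely many generators with coefficients in the valuation ring, so
  coordinates of its elements have a common lower bound. The inverse of the growth factor at F i j
  has valuation - r i - s j.\<close>

lemma growth:
 assumes fd: "finite_dimensional_vector_space smul Bs" and v\<alpha>: "v \<alpha> = ereal r" "v \<alpha>b = ereal s"
 shows "\<exists>k. \<forall>i j. \<forall>c\<in>carrier (Gr (F i j)). \<forall>b\<in>Bs.
  vge (- k - r * real i - s * real j) (representation Bs (\<Theta> (F i j) c) b)"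
proof -
 interpret V: finite_dimensional_vector_space smul Bs by (rule fd)
 obtain \<Lambda> where \<Lambda>: "OE_lattice v smul \<Lambda>" and \<Theta>: "!!f c. f : Md ==> c : carrier (Gr f) ==>
   \<exists>y\<in>\<Lambda>. \<Theta> f c = smul (inverse (\<alpha> ^ ideal_val P f * \<alpha>b ^ ideal_val Pb f)) y"
  using rcd unfolding ray_class_distribution_def by blast
 obtain X where X: "finite X" "\<Lambda> = {\<Sum>b\<in>X. smul (c b) b | c. \<forall>b\<in>X. c b : OE v}"
  using \<Lambda> unfolding OE_lattice_def by blast
 have sp: "y : span Bs" for y using V.span_Basis by simp
 obtain k where k: "\<forall>z\<in>X \<times> Bs. vge k (representation Bs (fst z) (snd z))"
  using vge_ex_finite[OF finite_cartesian_product[OF X(1) V.finite_Basis], of "%z. representation Bs (fst z) (snd z)"] by blast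
 have rep: "vge k (representation Bs y b)" if y: "y : \<Lambda>" and b: "b : Bs" for y b
 proof -
  obtain c where c: "y = (\<Sum>b\<in>X. smul (c b) b)" "\<forall>b\<in>X. c b : OE v" using y X(2) by blast
  have "representation Bs y b = (\<Sum>z\<in>X. c z * representation Bs z b)"
   unfolding c(1) by (simp add: representation_sum[OF V.independent_Basis sp] representation_scale[OF V.independent_Basis sp])
  moreover have "vge k (c z * representation Bs z b)" if z: "z : X" for z
  proof -
   have "vge 0 (c z)" using c(2) z unfolding OE_def vge_def zero_ereal_def by simp
   moreover have "vge k (representation Bs z b)" using k z b by auto
   ultimately have "vge (0 + k) (c z * representation Bs z b)" by (rule vge_mult)
   then show ?thesis by simp
  qed
  ultimately show ?thesis using vge_sum[of X k "%z. c z * representation Bs z b"] by metis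
 qed
 \<comment> \<open>The lattice bound k appears with the opposite sign, because the statement
   subtracts its constant.\<close>
 have "vge (- (- k) - r * real i - s * real j) (representation Bs (\<Theta> (F i j) c) b)"
  if c: "c : carrier (Gr (F i j))" and b: "b : Bs" for i j c b
 proof -
  have vb: "ideal_val Pb (F i j) = j"
  proof -
   have "F i j = split_quad.F Pb P g j i" unfolding split_quad.F_def[OF swap] F_def by (rule ip_lcomm)
   then show ?thesis using split_quad.val_F[OF swap, of j i] by simp
  qed
  obtain y where y: "y : \<Lambda>" "\<Theta> (F i j) c = smul (inverse (\<alpha> ^ i * \<alpha>b ^ j)) y"
   using \<Theta>[OF F_moduli c] unfolding val_F vb by blast
  have nz: "\<alpha> ~= 0" "\<alpha>b ~= 0" using rcd unfolding ray_class_distribution_def by blast+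
  have "v (\<alpha> ^ i * \<alpha>b ^ j) = ereal (r * real i + s * real j)"
   unfolding v_mult using v_power[OF v\<alpha>(1), of i] v_power[OF v\<alpha>(2), of j] by (simp add: mult.commute)
  then have "v (inverse (\<alpha> ^ i * \<alpha>b ^ j)) = ereal (- (r * real i + s * real j))" by (rule v_inverse)
  then have "vge (- (r * real i + s * real j)) (inverse (\<alpha> ^ i * \<alpha>b ^ j))" unfolding vge_def by simp
  then have "vge (- (r * real i + s * real j) + k) (inverse (\<alpha> ^ i * \<alpha>b ^ j) * representation Bs y b)"
   by (rule vge_mult[OF _ rep[OF y(1) b]])
  moreover have "- (r * real i + s * real j) + k = - (- k) - r * real i - s * real j" by simp
  ultimately show ?thesis unfolding y(2) representation_scale[OF V.independent_Basis sp] by (simp only:)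
 qed
 then show ?thesis by blast
qed

text \<open>A set saturated for the projection to level f is the disjoint union of its
  fibres.\<close>

lemma coset_sum:
 assumes f: "f : Md" and X: "X \<subseteq> RC"
  and inv: "!!x y. x : X ==> y : RC ==> y f = x f ==> y : X"
 shows "Lc (indicator X) = (\<Sum>c\<in>(%x. x f) ` X. \<Theta> f c)"
proof -
 interpret G: level_group RG RT U by (rule RG_level)
 let ?D = "(%x. x f) ` X" and ?I = "%c. indicator {x : RC. x f = c} :: _ => 'e"
 have Dc: "?D \<subseteq> carrier (Gr f)" using RG_comp[OF _ f] X by blast
 have fin: "finite ?D" by (rule finite_subset[OF Dc Gr_fin[OF f]])
 have e: "(indicator X :: _ => 'e) = (%x. \<Sum>c\<in>?D. 1 * ?I c x)"
 proof
  fix x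
  have "(\<Sum>c\<in>?D. 1 * ?I c x) = (\<Sum>c\<in>?D. if x f = c then (if x : RC then 1 else 0) else 0)"
   by (rule sum.cong) (auto simp: indicator_def)
  also have "\<dots> = (if x f : ?D then (if x : RC then 1 else 0) else 0)" by (simp add: sum.delta' fin)
  also have "\<dots> = indicator X x"
  proof (cases "x : X")
   case True
   then show ?thesis using X by auto
  next
   case False
   then have "~ (x f : ?D & x : RC)" using inv by blast
   then show ?thesis using False by auto
  qed
  finally show "(indicator X x :: 'e) = (\<Sum>c\<in>?D. 1 * ?I c x)" by simp
 qed
 have "Lc (%x. \<Sum>c\<in>?D. 1 * ?I c x) = (\<Sum>c\<in>?D. smul 1 (Lc (?I c)))"
  by (rule linear_on_sum[OF lc_functional_props(1) vector_space_axioms G.LC_add G.LC_scale G.LC_zero fin fibre_LC(1)[OF f]])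
 also have "\<dots> = (\<Sum>c\<in>?D. \<Theta> f c)"
 proof (rule sum.cong[OF refl])
  fix c assume "c : ?D"
  then have "c : carrier (Gr f)" using Dc by blast
  from lc_functional_props(2)[OF f this] show "smul 1 (Lc (?I c)) = \<Theta> f c" by simp
 qed
 finally show ?thesis unfolding e .
qed

end

context ray_distribution begin

text \<open>Two points with the same image at f differ by the kernel, which \<open>ker\<close>
  places in the product of the p-power subgroups.\<close>

lemma kernel_coset:
 assumes ker: "!!x. x : RC ==> x f = S f ==>
   \<exists>a\<in>pwr H1 m. \<exists>b\<in>pwr H2 n. x = a \<cdot> b"
  and f: "f : Md" and H: "subgroup H1 RG" "subgroup H2 RG" and x: "x : RC"
 defines "X \<equiv> {x \<cdot> (a \<cdot> b) | a b. a : pwr H1 m & b : pwr H2 n}"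
 shows "X \<subseteq> RC" and "x' : X ==> y : RC ==> y f = x' f ==> y : X"
proof -
 interpret G: comm_group RG by (rule RG_group)
 show Xc: "X \<subseteq> RC" unfolding X_def using ppow_RG(1)[OF H(1)] ppow_RG(1)[OF H(2)] x by auto
 assume x': "x' : X" and y: "y : RC" and e: "y f = x' f"
 obtain a b where ab: "a : pwr H1 m" "b : pwr H2 n"
   "x' = x \<cdot> (a \<cdot> b)" using x' unfolding X_def by blast
 have xc: "x' : RC" using x' Xc by blast
 let ?u = "inv\<^bsub>RG\<^esub> x' \<cdot> y"
 have uc: "?u : RC" using xc y by simp
 have "?u f = (inv\<^bsub>RG\<^esub> x' \<cdot> x') f" unfolding RG_mult_comp[OF f] e ..
 also have "\<dots> = S f" unfolding G.l_inv[OF xc] RG_simps(1) using f Gr_one[OF moduli_idl[OF f]] by simp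
 finally obtain a' b' where a': "a' : pwr H1 m" "b' : pwr H2 n"
   "?u = a' \<cdot> b'" using ker[OF uc] by blast
 have c: "a : RC" "b : RC" "a' : RC" "b' : RC" using ppow_RG(1)[OF H(1)] ppow_RG(1)[OF H(2)] ab a' by blast+
 have "y = x' \<cdot> ?u" using xc y by (simp add: G.m_assoc[symmetric])
 also have "\<dots> = x' \<cdot> (a' \<cdot> b')" unfolding a'(3) ..
 also have "\<dots> = x \<cdot> ((a \<cdot> a') \<cdot> (b \<cdot> b'))"
  unfolding ab(3) using x c by (simp add: G.m_ac)
 finally show "y : X" unfolding X_def using ppow_RG(2)[OF H(1) ab(1) a'(1)] ppow_RG(2)[OF H(2) ab(2) a'(2)] by blast
qed

lemma adapted_pair_filtrations:
 assumes ap: "adapted_pair p g P Pb H1 H2" and "r >= 0" "s >= 0"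
 shows "two_filtrations RG RT U v p H1 H2 r s"
proof -
 have H: "adapted_Zp_subgroup p g P H1" "adapted_Zp_subgroup p g Pb H2" and i: "H1 \<inter> H2 = {\<one>\<^bsub>RG\<^esub>}"
  using ap unfolding adapted_pair_def by blast+
 have sg: "subgroup H1 RG" "subgroup H2 RG"
  and iso: "iso_Zp_power p 1 (RG\<lparr>carrier := H1\<rparr>) (subtopology RT H1)" "iso_Zp_power p 1 (RG\<lparr>carrier := H2\<rparr>) (subtopology RT H2)"
  using H unfolding adapted_Zp_subgroup_def by blast+
 interpret G: comm_group RG by (rule RG_group)
 obtain c where c: "!!m n x. x : RC ==> x (F (m + c) (n + c)) = S (F (m + c) (n + c)) ==>
  \<exists>a\<in>pwr H1 m. \<exists>b\<in>pwr H2 n. x = a \<cdot> b" using kernel_product[OF H] by blast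
 have UA: "\<exists>N. \<forall>x\<in>U N. \<exists>a\<in>pwr H1 m. \<exists>b\<in>pwr H2 n. x = a \<cdot> b" for m n
 proof (intro exI ballI)
  \<comment> \<open>Triviality at the diagonal level \<open>?N\<close> implies triviality at
    \<open>F (m + c) (n + c)\<close>, which divides it.\<close>
  let ?N = "max (m + c) (n + c)"
  fix x assume "x : U ?N"
  then have x: "x : RC" "x (F ?N ?N) = S (F ?N ?N)" unfolding U_def by auto
  have o: "\<one>\<^bsub>RG\<^esub> (F i j) = S (F i j)" for i j unfolding RG_simps(1) using F_moduli[of i j] Gr_one[OF F_idl] by simp
  have "x (F (m + c) (n + c)) = \<one>\<^bsub>RG\<^esub> (F (m + c) (n + c))"
   by (rule level_determines[OF x(1) G.one_closed _ F_moduli F_dvd]) (use x(2) o in auto)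
  then show "\<exists>a\<in>pwr H1 m. \<exists>b\<in>pwr H2 n. x = a \<cdot> b" unfolding o by (rule c[OF x(1)])
 qed
 note Z = level_group.Zp_subgroup_filtration(1)[OF RG_level p]
 show ?thesis
  by (intro two_filtrations.intro two_filtrations_axioms.intro RG_level valued_field_axioms sg i assms(2,3) UA
    Z[OF sg(1) iso(1)] Z[OF sg(2) iso(2)])
qed

text \<open>The number of fibres making up a coset is immaterial in the ultrametric setting; only
  the shift by c costs, namely (r + s) c, independently of m and n.\<close>

lemma coset_bound:
 assumes ap: "adapted_pair p g P Pb H1 H2" and fd: "finite_dimensional_vector_space smul Bs"
  and v\<alpha>: "v \<alpha> = ereal r" "v \<alpha>b = ereal s"
 shows "\<exists>k. \<forall>b\<in>Bs. \<forall>x\<in>RC. \<forall>m n. vge (- k - r * real m - s * real n)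
  (representation Bs (Lc (indicator {x \<cdot> (a \<cdot> b) | a b.
   a : pwr H1 m & b : pwr H2 n})) b)"
proof -
 interpret V: finite_dimensional_vector_space smul Bs by (rule fd)
 have sp: "y : span Bs" for y using V.span_Basis by simp
 have H: "adapted_Zp_subgroup p g P H1" "adapted_Zp_subgroup p g Pb H2" using ap unfolding adapted_pair_def by blast+
 have sg: "subgroup H1 RG" "subgroup H2 RG" using H unfolding adapted_Zp_subgroup_def by blast+
 obtain c where c: "!!m n x. x : RC ==> x (F (m + c) (n + c)) = S (F (m + c) (n + c)) ==>
  \<exists>a\<in>pwr H1 m. \<exists>b\<in>pwr H2 n. x = a \<cdot> b" using kernel_product[OF H] by blast
 obtain k where k: "!!i j q b. q : carrier (Gr (F i j)) ==> b : Bs ==>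
  vge (- k - r * real i - s * real j) (representation Bs (\<Theta> (F i j) q) b)" using growth[OF fd v\<alpha>] by blast
 have "vge (- (k + (r + s) * real c) - r * real m - s * real n)
  (representation Bs (Lc (indicator {x \<cdot> (a \<cdot> b) | a b.
   a : pwr H1 m & b : pwr H2 n})) b)"
  if b: "b : Bs" and x: "x : RC" for b x m n
 proof -
  let ?f = "F (m + c) (n + c)"
  define X where "X = {x \<cdot> (a \<cdot> b) | a b. a : pwr H1 m & b : pwr H2 n}"
  note kc = kernel_coset[of ?f H1 m H2 n x, OF c F_moduli sg x, folded X_def]
  have e: "Lc (indicator X) = (\<Sum>q\<in>(%x. x ?f) ` X. \<Theta> ?f q)" by (rule coset_sum[OF F_moduli kc])
  have "representation Bs (Lc (indicator X)) b = (\<Sum>q\<in>(%x. x ?f) ` X. representation Bs (\<Theta> ?f q) b)"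
   unfolding e by (simp add: representation_sum[OF V.independent_Basis sp])
  moreover have "vge (- k - r * real (m + c) - s * real (n + c)) (\<Sum>q\<in>(%x. x ?f) ` X. representation Bs (\<Theta> ?f q) b)"
  proof (rule vge_sum)
   fix q assume "q : (%x. x ?f) ` X"
   then have "q : carrier (Gr ?f)" using kc(1) RG_comp[OF _ F_moduli] by blast
   then show "vge (- k - r * real (m + c) - s * real (n + c)) (representation Bs (\<Theta> ?f q) b)" by (rule k[OF _ b])
  qed
  moreover have "- k - r * real (m + c) - s * real (n + c) = - (k + (r + s) * real c) - r * real m - s * real n"
   by (simp add: algebra_simps)
  ultimately show ?thesis unfolding X_def[symmetric] by (simp only:)
 qed
 then show ?thesis by blast
qed

end

theorem theorem3p11:
 fixes p :: nat
  and P Pb g :: "'k::field_char_0 set"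
  and v :: "'e::field_char_0 \<Rightarrow> ereal"
  and smul :: "'e \<Rightarrow> 'v::ab_group_add \<Rightarrow> 'v"
  and \<alpha> \<alpha>b :: 'e
  and \<Theta> :: "'k set \<Rightarrow> 'k set set \<Rightarrow> 'v"
  and r s :: real
  and H1 H2 :: "('k set \<Rightarrow> 'k set set) set"
 assumes "imaginary_quadratic TYPE('k)"
  and "prime p" and "split_prime p P Pb"
  and "modulus g" and "ideal_coprime g (PIdl\<^bsub>OK\<^esub> (of_nat p))"
  and "finite_ext_Qp p v"
  and "\<exists>B. finite_dimensional_vector_space smul B"
  and "ray_class_distribution p P Pb g v smul \<alpha> \<alpha>b \<Theta>"
  and "v \<alpha> = ereal r" and "v \<alpha>b = ereal s"
  and "r < 1" and "s < 1"
  and "adapted_pair p g P Pb H1 H2"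
 shows
  "(\<exists>!\<Theta>'. \<Theta>' \<in> dual_tensor (DrsG p v (ray_limit p g) (ray_limit_top p g) H1 H2 r s) smul \<and>
      restricts_to p g smul \<Theta>' \<Theta>) \<and>
  (r + s < 1 \<longrightarrow>
   (\<forall>\<Theta>' H.
     \<Theta>' \<in> dual_tensor (DrsG p v (ray_limit p g) (ray_limit_top p g) H1 H2 r s) smul \<and>
     restricts_to p g smul \<Theta>' \<Theta> \<and>
     open_Zp_subgroup p (ray_limit p g) (ray_limit_top p g) H \<longrightarrow>
     (let D = dual_tensor (DrG p v (ray_limit p g) (ray_limit_top p g) H (r + s)) smul;
       \<Theta>'' = restrict_functional (CrG p v (ray_limit p g) (ray_limit_top p g) H (r + s)) \<Theta>'
     in \<Theta>'' \<in> D \<and>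
       (\<exists>!\<Psi>. \<Psi> \<in> D \<and> restricts_to p g smul \<Psi> \<Theta>) \<and>
       \<Theta>'' = (THE \<Psi>. \<Psi> \<in> D \<and> restricts_to p g smul \<Psi> \<Theta>))))"
proof -
 obtain w :: 'k and d :: int where wd: "d > 0" "w * w = - of_int d" "\<forall>x. \<exists>a b. x = of_rat a + of_rat b * w"
  using imaginary_quadratic_generator[OF assms(1)] by (elim exE conjE)
 obtain Bs where fd: "finite_dimensional_vector_space smul Bs" using assms(7) by (elim exE)
 have vs: "vector_space smul" using fd by (rule finite_dimensional_vector_space.axioms(1))
 have vf: "valued_field v" using assms(6) unfolding finite_ext_Qp_def valued_field_def by (elim conjE)
 interpret ray_distribution w d p P Pb g v smul \<alpha> \<alpha>b \<Theta>
  by (intro ray_distribution.intro ray_distribution_axioms.intro split_quad.intro split_quad_axioms.intro imag_quad.intro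
    vs vf wd(1,2) wd(3)[rule_format] assms(2,3,4,5,8))
 \<comment> \<open>The growth parameters lie in the valuation ring.\<close>
 have "r >= 0" "s >= 0" using assms(8-10) unfolding ray_class_distribution_def OE_def by (auto simp: zero_ereal_def)
 then have tf: "two_filtrations RG RT U v p H1 H2 r s" by (rule adapted_pair_filtrations[OF assms(13)])
 obtain k where k: "\<forall>b\<in>Bs. \<forall>x\<in>RC. \<forall>m n. vge (- k - r * real m - s * real n)
  (representation Bs (Lc (indicator {x \<cdot> (a \<cdot> b) | a b.
   a : pwr H1 m & b : pwr H2 n})) b)" using coset_bound[OF assms(13) fd assms(9,10)] by (elim exE)
 have 1: "\<exists>!\<Psi>. \<Psi> : dual_tensor (DrsG p v RG RT H1 H2 r s) smul & (\<forall>ph\<in>LC RT. \<Psi> ph = Lc ph)"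
  by (rule two_filtrations.extension_exists_unique[OF tf finite_ext_complete[OF assms(6)] fd lc_functional_props(1)])
   (rule k[rule_format])
 have 2: "restrict_functional (CrG p v RG RT H (r + s)) \<Psi> : dual_tensor (DrG p v RG RT H (r + s)) smul"
   "\<exists>!X. X : dual_tensor (DrG p v RG RT H (r + s)) smul & (\<forall>ph\<in>LC RT. X ph = Lc ph)"
   "restrict_functional (CrG p v RG RT H (r + s)) \<Psi> =
    (THE X. X : dual_tensor (DrG p v RG RT H (r + s)) smul & (\<forall>ph\<in>LC RT. X ph = Lc ph))"
  if \<Psi>: "\<Psi> : dual_tensor (DrsG p v RG RT H1 H2 r s) smul" "\<forall>ph\<in>LC RT. \<Psi> ph = Lc ph"
   and H: "open_Zp_subgroup p RG RT H" for \<Psi> H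
 proof -
  obtain d where H': "subgroup H RG" "openin RT H" "iso_Zp_power p d (RG\<lparr>carrier := H\<rparr>) (subtopology RT H)"
   using H unfolding open_Zp_subgroup_def by (elim conjE exE)
  \<comment> \<open>The subgroup H that defines the order r + s is arbitrary and unrelated to H1 and
    H2; the filtrations are compared through \<open>U\<close>.\<close>
  note Z = level_group.Zp_subgroup_filtration[OF RG_level p H'(1,3)]
  have "two_filtrations_open RG RT U v p H1 H2 r s H"
   by (intro two_filtrations_open.intro two_filtrations_open_axioms.intro tf H'(1) Z(1) Z(2)[OF H'(2)])
  from two_filtrations_open.restriction_unique[OF this fd \<Psi>]
  show "restrict_functional (CrG p v RG RT H (r + s)) \<Psi> : dual_tensor (DrG p v RG RT H (r + s)) smul"
   "\<exists>!X. X : dual_tensor (DrG p v RG RT H (r + s)) smul & (\<forall>ph\<in>LC RT. X ph = Lc ph)"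
   "restrict_functional (CrG p v RG RT H (r + s)) \<Psi> =
    (THE X. X : dual_tensor (DrG p v RG RT H (r + s)) smul & (\<forall>ph\<in>LC RT. X ph = Lc ph))" .
 qed
 show ?thesis unfolding restricts_to_def Let_def 
  by (intro conjI allI impI) (rule 1 | (elim conjE, rule 2, assumption, assumption, assumption))+
qed

end
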